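(* Let $\gamma>1$, $N\in\{1,2,3\}$, $T>0$, and let the initial data satisfy $$\varrho^0\in C^1(\Omega),\ \varrho^0>0,\quad \mathbf m^0\in C^1(\Omega;\mathbb R^N),\quad E^0\in C^1(\Omega),\quad p^0=(\gamma-1)\Big(E^0-\tfrac12\tfrac{|\mathbf m^0|^2}{\varrho^0}\Big)>0 .$$ Suppose that the approximate solutions $\mathbf U_h=[\varrho_h,\mathbf m_h,E_h]$, $h>0$, on $[0,T]$ of the complete Euler system, constructed by the local or by the global Lax--Friedrichs scheme with these initial data, generate (as a Young measure) a dissipative measure-valued (DMV) solution with initial condition $\mathcal V_{0,x}=\delta_{[\varrho^0(x),\mathbf m^0(x),E^0(x)]}$. In addition, let the complete Euler system possess the unique strong (continuously differentiable) solution $\mathbf U=[\varrho,\mathbf m,E]$ on $[0,T]\times\Omega$ emanating from the initial data $[\varrho^0,\mathbf m^0,E^0]$. Then $$\mathbf U_h\to\mathbf U\ \text{ strongly in } L^1\big((0,T)\times\Omega;\mathbb R^{N+2}\big)\quad\text{as }h\to0 .$$ More precisely, $$\varrho_h\to\varrho\ \text{ weakly-( * ) in } L^\infty(0,T;L^\gamma(\Omega))\ \text{ and strongly in } L^1((0,T)\times\Omega),$$ $$\mathbf m_h\to\mathbf m\ \text{ weakly-( * ) in } L^\infty(0,T;L^{2\gamma/(\gamma+1)}(\Omega;\mathbb R^N))\ \text{ and strongly in } L^1((0,T)\times\Omega;\mathbb R^N),$$ $$E_h\to E\ \text{ weakly-( * ) in } L^\infty(0,T;L^1(\Omega))\ \text{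 and strongly in } L^1((0,T)\times\Omega).$$
   Context: **Domain and mesh.** $\Omega=([0,1]|_{\{0,1\}})^N$ is the flat torus (periodic boundary conditions). $\mathcal T_h$ is the uniform periodic partition of $\Omega$ into cubes $K$ of side $h$ ($1/h$ an integer). $\mathbf e_s$, $s=1,\dots,N$, are the unit basis vectors and $K\pm h\mathbf e_s$ the neighbouring cells of $K$ (indices taken periodically); $\mathcal N(K)$ is the set of all neighbours of $K$. $X(\mathcal T_h)$ is the space of functions constant on each cell, $g_K$ is the value of $g_h\in X(\mathcal T_h)$ on $K$, and $(\Pi_h\phi)_K=h^{-N}\int_K\phi\,dx$. The discrete divergence is $(\widetilde{\mathrm{div}}_h\,\mathbf g_h)_K=\sum_{s=1}^N\frac{g^s_{K+h\mathbf e_s}-g^s_{K-h\mathbf e_s}}{2h}$, where for matrix-valued arguments $g^s$ is the $s$-th column. **Weak-( * ) convergence** in $L^\infty(0,T;L^1(\Omega))$ is understood by viewing $L^\infty(0,T;L^1(\Omega))\subset L^\infty_{\mathrm{weak}( * )}(0,T;\mathcal M(\Omega))$, i.e. testing against $L^1(0,T;C(\Omega))$. **Complete Euler system** (conservative variables density $\varrho$, momentum $\mathbf m$, total energy $E$): $$\partial_t\varrho+\mathrm{div}\,\mathbf m=0,\quad \partial_t\mathbf m+\mathrm{div}\Big(\frac{\mathbf m\otimes\mathbf m}{\varrho}\Big)+\nabla p=0,\quad \partial_tE+\mathrm{div}\Big[(E+p)\frac{\mathbf m}{\varrho}\Big]=0,\quad p=(\gamma-1)\Big(E-\frac12\frac{|\mathbf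 m|^2}{\varrho}\Big).$$ **Schemes.** For $t>0$ and all $K\in\mathcal T_h$, $$\frac{d}{dt}\varrho_K+(\widetilde{\mathrm{div}}_h\mathbf m_h)_K-\frac1h\sum_{L\in\mathcal N(K)}\lambda_{K|L}(\varrho_L-\varrho_K)=0,$$ $$\frac{d}{dt}\mathbf m_K+\Big(\widetilde{\mathrm{div}}_h\Big(\frac{\mathbf m_h\otimes\mathbf m_h}{\varrho_h}+p_h\mathbb I\Big)\Big)_K-\frac1h\sum_{L\in\mathcal N(K)}\lambda_{K|L}(\mathbf m_L-\mathbf m_K)=0,$$ $$\frac{d}{dt}E_K+\Big(\widetilde{\mathrm{div}}_h\Big(\frac{\mathbf m_h}{\varrho_h}(E_h+p_h)\Big)\Big)_K-\frac1h\sum_{L\in\mathcal N(K)}\lambda_{K|L}(E_L-E_K)=0,$$ with $p_h=(\gamma-1)(E_h-\frac12|\mathbf m_h|^2/\varrho_h)$ and initial values $(\varrho_K,\mathbf m_K,E_K)(0)=((\Pi_h\varrho^0)_K,(\Pi_h\mathbf m^0)_K,(\Pi_hE^0)_K)$. Put $\lambda(\mathbf U_K)=|\mathbf u_K|+c_K$, $\mathbf u_K=\mathbf m_K/\varrho_K$, $c_K=\sqrt{\gamma p_K/\varrho_K}$ (largest modulus of the characteristic speeds). *Local* scheme: $\lambda_{K|L}=\max(\lambda(\mathbf U_K),\lambda(\mathbf U_L))$. *Global* scheme: $\lambda_{K|L}=\lambda=\max_{K\in\mathcal T_h}\lambda(\mathbf U_K)$ for all faces. Everything depends on $t$. A numerical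 solution on $[0,T]$ is understood to exist on $[0,T]$ with $\varrho_h(t)>0$. **Young measure.** $\{\mathbf U_h\}$ generates $\mathcal V_{t,x}$ if $g(\mathbf U_h)\to\langle\mathcal V_{t,x};g\rangle$ weakly in $L^1((0,T)\times\Omega)$ for every $g\in C_c(\mathcal F)$; here $\langle\mathcal V_{t,x};g\rangle=\int_{\mathcal F}g\,d\mathcal V_{t,x}$, and $\mathcal P$ denotes Borel probability measures. **DMV solution of the complete Euler system.** Let $\mathcal F=\{[\varrho,\mathbf m,E]:\varrho\ge0,\mathbf m\in\mathbb R^N,E\ge0\}$. A family $\{\mathcal V_{t,x}\}_{t\in(0,T),x\in\Omega}$ of probability measures on $\mathcal F$ is a DMV solution with initial condition $\mathcal V_{0,x}\in\mathcal P(\mathcal F)$ if (all expressions being tacitly integrable on $(0,T)\times\Omega$): 1. $(t,x)\mapsto\mathcal V_{t,x}$ is weakly-( * ) measurable from $(0,T)\times\Omega$ into $\mathcal P(\mathcal F)$; 2. $\int_0^T\!\int_\Omega[\langle\mathcal V_{t,x};\varrho\rangle\partial_t\varphi+\langle\mathcal V_{t,x};\mathbf m\rangle\cdot\nabla\varphi]\,dx\,dt=-\int_\Omega\langle\mathcal V_{0,x};\varrho\rangle\varphi(0,\cdot)\,dx$ for all $\varphi\in C^1_c([0,T)\times\Omega)$; 3. there is a signed matrix-valued measure $\mu_C$ on $[0,T]\times\Omega$ such that for all $\boldsymbol\varphi\in C^1_c([0,T)\times\Omega;\mathbb R^N)$ $$\int_0^T\!\!\int_\Omega\Big[\langle\mathcal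 V_{t,x};\mathbf m\rangle\cdot\partial_t\boldsymbol\varphi+\Big\langle\mathcal V_{t,x};\frac{\mathbf m\otimes\mathbf m}{\varrho}\Big\rangle:\nabla\boldsymbol\varphi+(\gamma-1)\Big\langle\mathcal V_{t,x};E-\frac12\frac{|\mathbf m|^2}{\varrho}\Big\rangle\mathrm{div}\boldsymbol\varphi\Big]dx\,dt=-\int_\Omega\langle\mathcal V_{0,x};\mathbf m\rangle\cdot\boldsymbol\varphi(0,\cdot)\,dx+\int_0^T\!\!\int_\Omega\nabla\boldsymbol\varphi:d\mu_C;$$ 4. $\int_\Omega\langle\mathcal V_{\tau,x};E\rangle dx\le\int_\Omega\langle\mathcal V_{0,x};E\rangle dx$ for a.a. $\tau\in(0,T)$; 5. for every increasing concave $\chi:\mathbb R\to\mathbb R$ with $\chi\le\overline\chi$ for some constant $\overline\chi$, with $\mathcal S_\chi(\varrho,\mathbf m,E)=\chi\Big(\frac1{\gamma-1}\log\Big((\gamma-1)\frac{E-\frac12|\mathbf m|^2/\varrho}{\varrho^\gamma}\Big)\Big)$, and every $\varphi\in C^1_c([0,T)\times\Omega)$, $\varphi\ge0$, $$\int_0^T\!\!\int_\Omega[\langle\mathcal V_{t,x};\varrho\mathcal S_\chi\rangle\partial_t\varphi+\langle\mathcal V_{t,x};\mathcal S_\chi\mathbf m\rangle\cdot\nabla\varphi]\,dx\,dt\le-\int_\Omega\langle\mathcal V_{0,x};\varrho\mathcal S_\chi\rangle\varphi(0,\cdot)\,dx;$$ 6. $\int_0^\tau\!\int_\Omega d|\mu_C|\le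 c(N,\gamma)\int_0^\tau\!\int_\Omega[\langle\mathcal V_{0,x};E\rangle-\langle\mathcal V_{t,x};E\rangle]\,dx\,dt$ for all $0\le\tau<T$. *)

theory Defs
  imports "HOL-Probability.Probability"
begin

section \<open>The flat torus\<close>

text \<open>
  The torus is represented by the half-open unit cube, which meets every class of
  \<open>\<real>\<^sup>N\<close> modulo \<open>\<int>\<^sup>N\<close> exactly once; integrals over the torus and Borel measures on it are taken
  there. Functions whose regularity matters are periodic functions on all of \<open>\<real>\<^sup>N\<close>.
\<close>

definition torus :: "(real^'n) set" where
  "torus = {x. \<forall>i. 0 \<le> x$i \<and> x$i < 1}"

definition periodic :: "(real^'n \<Rightarrow> 'b) \<Rightarrow> bool" where
  "periodic f \<longleftrightarrow> (\<forall>x s. f (x + axis s 1) = f x)"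

definition C1_on :: "'a set \<Rightarrow> ('a::real_normed_vector \<Rightarrow> 'b::real_normed_vector) \<Rightarrow> bool" where
  "C1_on S f \<longleftrightarrow> (\<exists>f'. (\<forall>z\<in>S. (f has_derivative blinfun_apply (f' z)) (at z within S)) \<and>
                     continuous_on S f')"

definition C1_torus :: "(real^'n \<Rightarrow> 'b::real_normed_vector) \<Rightarrow> bool" where
  "C1_torus f \<longleftrightarrow> periodic f \<and> C1_on UNIV f"

definition pd :: "'n \<Rightarrow> (real^'n \<Rightarrow> 'b::real_normed_vector) \<Rightarrow> real^'n \<Rightarrow> 'b" where
  "pd s f x = frechet_derivative f (at x) (axis s 1)"

definition grad :: "(real^'n \<Rightarrow> real) \<Rightarrow> real^'n \<Rightarrow> real^'n" where
  "grad f x = (\<chi> s. pd s f x)"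

definition jac :: "(real^'n \<Rightarrow> real^'n) \<Rightarrow> real^'n \<Rightarrow> real^'n^'n" where
  "jac f x = (\<chi> i j. pd j (\<lambda>y. f y $ i) x)"

definition divergence :: "(real^'n \<Rightarrow> real^'n) \<Rightarrow> real^'n \<Rightarrow> real" where
  "divergence f x = (\<Sum>s\<in>UNIV. pd s (\<lambda>y. f y $ s) x)"

definition mat_divergence :: "(real^'n \<Rightarrow> real^'n^'n) \<Rightarrow> real^'n \<Rightarrow> real^'n" where
  "mat_divergence f x = (\<Sum>s\<in>UNIV. pd s (\<lambda>y. column s (f y)) x)"


section \<open>States and fluxes\<close>

type_synonym 'n state = "real \<times> (real^'n) \<times> real"

definition dens :: "'n::finite state \<Rightarrow> real" where "dens U = fst U"
definition mom :: "'n::finite state \<Rightarrow> real^'n" where "mom U = fst (snd U)"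
definition ener :: "'n::finite state \<Rightarrow> real" where "ener U = snd (snd U)"

definition outer :: "real^'n \<Rightarrow> real^'n \<Rightarrow> real^'n^'n" where
  "outer a b = (\<chi> i j. a$i * b$j)"

definition velocity :: "'n::finite state \<Rightarrow> real^'n" where
  "velocity U = mom U /\<^sub>R dens U"

definition internal_energy :: "'n::finite state \<Rightarrow> real" where
  "internal_energy U = ener U - (norm (mom U))\<^sup>2 / dens U / 2"

definition pressure :: "real \<Rightarrow> 'n::finite state \<Rightarrow> real" where
  "pressure \<gamma> U = (\<gamma> - 1) * internal_energy U"

definition convective_flux :: "'n::finite state \<Rightarrow> real^'n^'n" where
  "convective_flux U = outer (mom U) (mom U) /\<^sub>R dens U"

definition energy_flux :: "real \<Rightarrow> 'n::finite state \<Rightarrow> real^'n" where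
  "energy_flux \<gamma> U = (ener U + pressure \<gamma> U) *\<^sub>R velocity U"

definition max_char_speed :: "real \<Rightarrow> 'n::finite state \<Rightarrow> real" where
  "max_char_speed \<gamma> U = norm (velocity U) + sqrt (\<gamma> * pressure \<gamma> U / dens U)"

definition S_eta :: "real \<Rightarrow> (real \<Rightarrow> real) \<Rightarrow> 'n::finite state \<Rightarrow> real" where
  "S_eta \<gamma> \<eta> U = \<eta> (1 / (\<gamma> - 1) * ln ((\<gamma> - 1) * internal_energy U / dens U powr \<gamma>))"

definition state_space :: "'n::finite state set" where
  "state_space = {U. 0 \<le> dens U \<and> 0 \<le> ener U}"


section \<open>Lax--Friedrichs schemes\<close>

definition mesh_sizes :: "real set" where
  "mesh_sizes = {h. 0 < h \<and> 1 / h \<in> \<nat>}"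

abbreviation h_to_0 :: "real filter" where
  "h_to_0 \<equiv> at 0 within mesh_sizes"

text \<open>A cell is addressed by the integer vector \<open>K\<close> for which \<open>h K\<close> is its lower corner.\<close>

type_synonym 'n cell = "int^'n"

definition cells :: "real \<Rightarrow> 'n::finite cell set" where
  "cells h = {K. \<forall>i. 0 \<le> K$i \<and> K$i < \<lfloor>1 / h\<rfloor>}"

definition cell_cube :: "real \<Rightarrow> 'n::finite cell \<Rightarrow> (real^'n) set" where
  "cell_cube h K = {x. \<forall>i. h * of_int (K$i) \<le> x$i \<and> x$i < h * (of_int (K$i) + 1)}"

definition cell_of :: "real \<Rightarrow> real^'n \<Rightarrow> 'n::finite cell" where
  "cell_of h x = (\<chi> i. \<lfloor>x$i / h\<rfloor> mod \<lfloor>1 / h\<rfloor>)"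

definition grid_fun :: "real \<Rightarrow> ('n::finite cell \<Rightarrow> 'b) \<Rightarrow> real^'n \<Rightarrow> 'b" where
  "grid_fun h g x = g (cell_of h x)"

definition approx :: "(real \<Rightarrow> real \<Rightarrow> 'n::finite cell \<Rightarrow> 'b) \<Rightarrow> real \<Rightarrow> real \<Rightarrow> real^'n \<Rightarrow> 'b" where
  "approx Uh h t = grid_fun h (Uh h t)"

definition next_cell :: "real \<Rightarrow> 'n \<Rightarrow> 'n::finite cell \<Rightarrow> 'n::finite cell" where
  "next_cell h s K = (\<chi> i. (K$i + axis s 1 $ i) mod \<lfloor>1 / h\<rfloor>)"

definition prev_cell :: "real \<Rightarrow> 'n \<Rightarrow> 'n::finite cell \<Rightarrow> 'n::finite cell" where
  "prev_cell h s K = (\<chi> i. (K$i - axis s 1 $ i) mod \<lfloor>1 / h\<rfloor>)"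

definition neighbours :: "real \<Rightarrow> 'n::finite cell \<Rightarrow> 'n::finite cell set" where
  "neighbours h K = range (\<lambda>s. next_cell h s K) \<union> range (\<lambda>s. prev_cell h s K)"

definition cell_average ::
  "real \<Rightarrow> (real^'n \<Rightarrow> 'b::{banach, second_countable_topology}) \<Rightarrow> 'n::finite cell \<Rightarrow> 'b" where
  "cell_average h f K = (1 / h ^ CARD('n)) *\<^sub>R (LINT x:cell_cube h K|lborel. f x)"

definition div_h :: "real \<Rightarrow> ('n::finite cell \<Rightarrow> real^'n) \<Rightarrow> 'n::finite cell \<Rightarrow> real" where
  "div_h h g K = (\<Sum>s\<in>UNIV. (g (next_cell h s K) $ s - g (prev_cell h s K) $ s) / (2 * h))"

definition mat_div_h :: "real \<Rightarrow> ('n::finite cell \<Rightarrow> real^'n^'n) \<Rightarrow> 'n::finite cell \<Rightarrow> real^'n" where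
  "mat_div_h h g K =
     (\<Sum>s\<in>UNIV. (column s (g (next_cell h s K)) - column s (g (prev_cell h s K))) /\<^sub>R (2 * h))"

definition diffusion_h ::
  "real \<Rightarrow> ('n::finite cell \<Rightarrow> 'n::finite cell \<Rightarrow> real) \<Rightarrow> ('n::finite cell \<Rightarrow> 'b::real_vector) \<Rightarrow> 'n::finite cell \<Rightarrow> 'b" where
  "diffusion_h h lam g K = (1 / h) *\<^sub>R (\<Sum>L\<in>neighbours h K. lam K L *\<^sub>R (g L - g K))"

datatype lf_variant = Local | Global

fun face_speed ::
  "lf_variant \<Rightarrow> real \<Rightarrow> real \<Rightarrow> ('n::finite cell \<Rightarrow> 'n::finite state) \<Rightarrow> 'n::finite cell \<Rightarrow> 'n::finite cell \<Rightarrow> real" where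
  "face_speed Local \<gamma> h U K L = max (max_char_speed \<gamma> (U K)) (max_char_speed \<gamma> (U L))"
| "face_speed Global \<gamma> h U K L = Max ((\<lambda>J. max_char_speed \<gamma> (U J)) ` cells h)"

text \<open>
  Only positivity of the density is required of a numerical solution. Positivity of the pressure,
  under which the square root in \<^const>\<open>max_char_speed\<close> is the sound speed, is a consequence of
  the scheme for data of positive pressure.
\<close>

definition lax_friedrichs_solution ::
  "lf_variant \<Rightarrow> real \<Rightarrow> real \<Rightarrow> real \<Rightarrow> (real^'n \<Rightarrow> real) \<Rightarrow> (real^'n \<Rightarrow> real^'n) \<Rightarrow> (real^'n \<Rightarrow> real) \<Rightarrow>
   (real \<Rightarrow> 'n::finite cell \<Rightarrow> 'n::finite state) \<Rightarrow> bool" where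
  "lax_friedrichs_solution variant \<gamma> T h \<rho>0 m0 E0 U \<longleftrightarrow>
     (\<forall>K\<in>cells h. continuous_on {0..T} (\<lambda>t. U t K)) \<and>
     (\<forall>t\<in>{0..T}. \<forall>K\<in>cells h. 0 < dens (U t K)) \<and>
     (\<forall>K\<in>cells h. U 0 K = (cell_average h \<rho>0 K, cell_average h m0 K, cell_average h E0 K)) \<and>
     (\<forall>t\<in>{0<..<T}. \<forall>K\<in>cells h.
        let lam = face_speed variant \<gamma> h (U t) in
        ((\<lambda>t. dens (U t K)) has_vector_derivative
           - div_h h (\<lambda>L. mom (U t L)) K
           + diffusion_h h lam (\<lambda>L. dens (U t L)) K) (at t) \<and>
        ((\<lambda>t. mom (U t K)) has_vector_derivative
           - mat_div_h h (\<lambda>L. convective_flux (U t L) + mat (pressure \<gamma> (U t L))) K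
           + diffusion_h h lam (\<lambda>L. mom (U t L)) K) (at t) \<and>
        ((\<lambda>t. ener (U t K)) has_vector_derivative
           - div_h h (\<lambda>L. energy_flux \<gamma> (U t L)) K
           + diffusion_h h lam (\<lambda>L. ener (U t L)) K) (at t))"


section \<open>Strong solutions\<close>

text \<open>
  Positivity of the density is part of the definition because the fluxes divide by it; time
  derivatives are one-sided at \<open>0\<close> and \<open>T\<close>.
\<close>

definition strong_solution ::
  "real \<Rightarrow> real \<Rightarrow> (real^'n \<Rightarrow> real) \<Rightarrow> (real^'n \<Rightarrow> real^'n) \<Rightarrow> (real^'n \<Rightarrow> real) \<Rightarrow>
   (real \<Rightarrow> real^'n \<Rightarrow> real) \<Rightarrow> (real \<Rightarrow> real^'n \<Rightarrow> real^'n) \<Rightarrow> (real \<Rightarrow> real^'n \<Rightarrow> real) \<Rightarrow> bool" where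
  "strong_solution \<gamma> T \<rho>0 m0 E0 \<rho> m E \<longleftrightarrow>
     C1_on ({0..T} \<times> UNIV) (\<lambda>(t, x). \<rho> t x) \<and> (\<forall>t\<in>{0..T}. periodic (\<rho> t)) \<and>
     C1_on ({0..T} \<times> UNIV) (\<lambda>(t, x). m t x) \<and> (\<forall>t\<in>{0..T}. periodic (m t)) \<and>
     C1_on ({0..T} \<times> UNIV) (\<lambda>(t, x). E t x) \<and> (\<forall>t\<in>{0..T}. periodic (E t)) \<and>
     (\<forall>t\<in>{0..T}. \<forall>x. 0 < \<rho> t x) \<and>
     (\<forall>x. \<rho> 0 x = \<rho>0 x \<and> m 0 x = m0 x \<and> E 0 x = E0 x) \<and>
     (\<forall>t\<in>{0..T}. \<forall>x.
        let U = (\<lambda>y. (\<rho> t y, m t y, E t y)) in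
        vector_derivative (\<lambda>r. \<rho> r x) (at t within {0..T}) + divergence (m t) x = 0 \<and>
        vector_derivative (\<lambda>r. m r x) (at t within {0..T})
          + mat_divergence (\<lambda>y. convective_flux (U y)) x + grad (\<lambda>y. pressure \<gamma> (U y)) x = 0 \<and>
        vector_derivative (\<lambda>r. E r x) (at t within {0..T})
          + divergence (\<lambda>y. energy_flux \<gamma> (U y)) x = 0)"


section \<open>Function spaces and modes of convergence\<close>

definition spacetime :: "real \<Rightarrow> (real \<times> (real^'n)) measure" where
  "spacetime T = lebesgue_on ({0<..<T} \<times> torus)"

definition integral_st ::
  "real \<Rightarrow> (real \<Rightarrow> real^'n \<Rightarrow> 'b::{banach, second_countable_topology}) \<Rightarrow> 'b" where
  "integral_st T f = (LINT z|spacetime T. f (fst z) (snd z))"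

definition L1_st ::
  "real \<Rightarrow> (real \<Rightarrow> real^'n \<Rightarrow> 'b::{banach, second_countable_topology}) \<Rightarrow> bool" where
  "L1_st T f \<longleftrightarrow> integrable (spacetime T) (\<lambda>z. f (fst z) (snd z))"

definition Linf_st :: "real \<Rightarrow> (real \<Rightarrow> real^'n \<Rightarrow> real) \<Rightarrow> bool" where
  "Linf_st T \<psi> \<longleftrightarrow> (\<lambda>z. \<psi> (fst z) (snd z)) \<in> borel_measurable (spacetime T) \<and>
     (\<exists>C. AE z in spacetime T. \<bar>\<psi> (fst z) (snd z)\<bar> \<le> C)"

definition weakly_L1 ::
  "real \<Rightarrow> 'h filter \<Rightarrow> ('h \<Rightarrow> real \<Rightarrow> real^'n \<Rightarrow> real) \<Rightarrow> (real \<Rightarrow> real^'n \<Rightarrow> real) \<Rightarrow> bool" where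
  "weakly_L1 T F fs f \<longleftrightarrow> (\<forall>\<^sub>F h in F. L1_st T (fs h)) \<and> L1_st T f \<and>
     (\<forall>\<psi>. Linf_st T \<psi> \<longrightarrow>
        ((\<lambda>h. integral_st T (\<lambda>t x. fs h t x * \<psi> t x))
           \<longlongrightarrow> integral_st T (\<lambda>t x. f t x * \<psi> t x)) F)"

definition strongly_L1 ::
  "real \<Rightarrow> 'h filter \<Rightarrow> ('h \<Rightarrow> real \<Rightarrow> real^'n \<Rightarrow> 'b) \<Rightarrow>
   (real \<Rightarrow> real^'n \<Rightarrow> 'b::{banach, second_countable_topology}) \<Rightarrow> bool" where
  "strongly_L1 T F fs f \<longleftrightarrow> (\<forall>\<^sub>F h in F. L1_st T (fs h)) \<and> L1_st T f \<and>
     ((\<lambda>h. integral_st T (\<lambda>t x. norm (fs h t x - f t x))) \<longlongrightarrow> 0) F"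

definition Linf_Lp :: "real \<Rightarrow> real \<Rightarrow> (real \<Rightarrow> real^'n \<Rightarrow> 'b::euclidean_space) \<Rightarrow> bool" where
  "Linf_Lp T p f \<longleftrightarrow> (\<lambda>z. f (fst z) (snd z)) \<in> borel_measurable (spacetime T) \<and>
     (\<exists>C. AE t in lebesgue_on {0<..<T}.
        integrable (lebesgue_on torus) (\<lambda>x. norm (f t x) powr p) \<and>
        (LINT x|lebesgue_on torus. norm (f t x) powr p) \<le> C)"

definition L1_Lq :: "real \<Rightarrow> real \<Rightarrow> (real \<Rightarrow> real^'n \<Rightarrow> 'b::euclidean_space) \<Rightarrow> bool" where
  "L1_Lq T q \<phi> \<longleftrightarrow> (\<lambda>z. \<phi> (fst z) (snd z)) \<in> borel_measurable (spacetime T) \<and>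
     (AE t in lebesgue_on {0<..<T}.
        integrable (lebesgue_on torus) (\<lambda>x. norm (\<phi> t x) powr q)) \<and>
     integrable (lebesgue_on {0<..<T})
       (\<lambda>t. (LINT x|lebesgue_on torus. norm (\<phi> t x) powr q) powr (1 / q))"

definition L1_C :: "real \<Rightarrow> (real \<Rightarrow> real^'n \<Rightarrow> real) \<Rightarrow> bool" where
  "L1_C T \<phi> \<longleftrightarrow> (\<forall>t\<in>{0<..<T}. periodic (\<phi> t) \<and> continuous_on UNIV (\<phi> t)) \<and>
     (\<forall>x. (\<lambda>t. \<phi> t x) \<in> borel_measurable (lebesgue_on {0<..<T})) \<and>
     integrable (lebesgue_on {0<..<T}) (\<lambda>t. SUP x. \<bar>\<phi> t x\<bar>)"

text \<open>
  For \<open>1 < p\<close> the predual of \<open>L\<^sup>\<infinity>(0,T;L\<^sup>p)\<close> is \<open>L\<^sup>1(0,T;L\<^sup>q)\<close> with \<open>q = p/(p-1)\<close>.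
\<close>

definition weak_star_Linf_Lp ::
  "real \<Rightarrow> real \<Rightarrow> 'h filter \<Rightarrow> ('h \<Rightarrow> real \<Rightarrow> real^'n \<Rightarrow> 'b) \<Rightarrow>
   (real \<Rightarrow> real^'n \<Rightarrow> 'b::euclidean_space) \<Rightarrow> bool" where
  "weak_star_Linf_Lp T p F fs f \<longleftrightarrow> (\<forall>\<^sub>F h in F. Linf_Lp T p (fs h)) \<and> Linf_Lp T p f \<and>
     (\<forall>\<phi>. L1_Lq T (p / (p - 1)) \<phi> \<longrightarrow>
        ((\<lambda>h. integral_st T (\<lambda>t x. fs h t x \<bullet> \<phi> t x))
           \<longlongrightarrow> integral_st T (\<lambda>t x. f t x \<bullet> \<phi> t x)) F)"

definition weak_star_Linf_L1 ::
  "real \<Rightarrow> 'h filter \<Rightarrow> ('h \<Rightarrow> real \<Rightarrow> real^'n \<Rightarrow> real) \<Rightarrow> (real \<Rightarrow> real^'n \<Rightarrow> real) \<Rightarrow> bool" where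
  "weak_star_Linf_L1 T F fs f \<longleftrightarrow> (\<forall>\<^sub>F h in F. Linf_Lp T 1 (fs h)) \<and> Linf_Lp T 1 f \<and>
     (\<forall>\<phi>. L1_C T \<phi> \<longrightarrow>
        ((\<lambda>h. integral_st T (\<lambda>t x. fs h t x * \<phi> t x))
           \<longlongrightarrow> integral_st T (\<lambda>t x. f t x * \<phi> t x)) F)"


section \<open>Young measures\<close>

definition prob_on_states :: "'n::finite state measure set" where
  "prob_on_states = space (prob_algebra (restrict_space borel state_space))"

definition Cc_states :: "('n::finite state \<Rightarrow> real) set" where
  "Cc_states = {g. continuous_on state_space g \<and>
                   (\<exists>C. compact C \<and> C \<subseteq> state_space \<and> (\<forall>U. U \<notin> C \<longrightarrow> g U = 0))}"

definition expect ::
  "'n::finite state measure \<Rightarrow> ('n::finite state \<Rightarrow> 'b::{banach, second_countable_topology}) \<Rightarrow> 'b" where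
  "expect M g = (LINT U|M. g U)"

definition generates_young_measure ::
  "real \<Rightarrow> 'h filter \<Rightarrow> ('h \<Rightarrow> real \<Rightarrow> real^'n \<Rightarrow> 'n::finite state) \<Rightarrow>
   (real \<Rightarrow> real^'n \<Rightarrow> 'n::finite state measure) \<Rightarrow> bool" where
  "generates_young_measure T F Us V \<longleftrightarrow>
     (\<forall>g\<in>Cc_states. weakly_L1 T F (\<lambda>h t x. g (Us h t x)) (\<lambda>t x. expect (V t x) g))"


section \<open>Matrix-valued signed measures\<close>

text \<open>
  Every entry of a matrix-valued signed measure is a difference of two finite positive measures,
  stored as a pair; the pair need not be mutually singular.
\<close>

type_synonym ('n, 'a) matrix_measure = "'n \<Rightarrow> 'n \<Rightarrow> 'a measure \<times> 'a measure"

definition is_matrix_measure :: "'a measure \<Rightarrow> ('n, 'a) matrix_measure \<Rightarrow> bool" where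
  "is_matrix_measure X \<mu> \<longleftrightarrow>
     (\<forall>i j. finite_measure (fst (\<mu> i j)) \<and> sets (fst (\<mu> i j)) = sets X \<and>
            finite_measure (snd (\<mu> i j)) \<and> sets (snd (\<mu> i j)) = sets X)"

definition mm_value :: "('n, 'a) matrix_measure \<Rightarrow> 'a set \<Rightarrow> real^'n^'n" where
  "mm_value \<mu> A = (\<chi> i j. measure (fst (\<mu> i j)) A - measure (snd (\<mu> i j)) A)"

definition mm_variation :: "'a measure \<Rightarrow> ('n::finite, 'a) matrix_measure \<Rightarrow> 'a set \<Rightarrow> real" where
  "mm_variation X \<mu> A =
     (SUP P \<in> {P. finite P \<and> partition_on A P \<and> P \<subseteq> sets X}. \<Sum>B\<in>P. norm (mm_value \<mu> B))"

definition mm_integral :: "('n::finite, 'a) matrix_measure \<Rightarrow> ('a \<Rightarrow> real^'n^'n) \<Rightarrow> real" where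
  "mm_integral \<mu> \<Phi> = (\<Sum>i\<in>UNIV. \<Sum>j\<in>UNIV.
     (LINT z|fst (\<mu> i j). \<Phi> z $ i $ j) - (LINT z|snd (\<mu> i j). \<Phi> z $ i $ j))"


section \<open>Dissipative measure-valued solutions\<close>

text \<open>
  Elements of \<open>C\<^sup>1\<^sub>c([0,T) \<times> \<Omega>)\<close>, extended by zero to later times.
\<close>

definition test_fun :: "real \<Rightarrow> (real \<Rightarrow> real^'n \<Rightarrow> 'b::real_normed_vector) \<Rightarrow> bool" where
  "test_fun T \<phi> \<longleftrightarrow> C1_on ({0..<T} \<times> UNIV) (\<lambda>(t, x). \<phi> t x) \<and>
     (\<forall>t\<in>{0..<T}. periodic (\<phi> t)) \<and>
     (\<exists>\<tau><T. \<forall>t\<ge>\<tau>. \<forall>x. \<phi> t x = 0)"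

definition dt :: "(real \<Rightarrow> real^'n \<Rightarrow> 'b::real_normed_vector) \<Rightarrow> real \<Rightarrow> real^'n \<Rightarrow> 'b" where
  "dt \<phi> t x = vector_derivative (\<lambda>r. \<phi> r x) (at t)"

definition integrable_expect ::
  "real \<Rightarrow> (real \<Rightarrow> real^'n \<Rightarrow> 'n::finite state measure) \<Rightarrow>
   ('n::finite state \<Rightarrow> 'b::{banach, second_countable_topology}) \<Rightarrow> bool" where
  "integrable_expect T V g \<longleftrightarrow>
     (AE z in spacetime T. integrable (V (fst z) (snd z)) g) \<and>
     L1_st T (\<lambda>t x. expect (V t x) g)"

definition integrable_expect0 ::
  "(real^'n \<Rightarrow> 'n::finite state measure) \<Rightarrow>
   ('n::finite state \<Rightarrow> 'b::{banach, second_countable_topology}) \<Rightarrow> bool" where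
  "integrable_expect0 V0 g \<longleftrightarrow>
     (AE x in lebesgue_on torus. integrable (V0 x) g) \<and>
     integrable (lebesgue_on torus) (\<lambda>x. expect (V0 x) g)"

definition entropy_cutoff :: "(real \<Rightarrow> real) \<Rightarrow> bool" where
  "entropy_cutoff \<eta> \<longleftrightarrow> mono \<eta> \<and> concave_on UNIV \<eta> \<and> (\<exists>C. \<forall>s. \<eta> s \<le> C)"

text \<open>
  On \<^const>\<open>state_space\<close> the conventions are: \<open>|m|\<^sup>2/\<rho>\<close> is infinite where \<open>\<rho> = 0 \<noteq> m\<close>,
  the logarithm of a nonpositive number is minus infinity, and \<open>\<rho> S\<^sub>\<eta>\<close>, \<open>S\<^sub>\<eta> m\<close>, \<open>|m|\<^sup>2/\<rho>\<close> vanish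
  where \<open>\<rho> = 0\<close>, \<open>m = 0\<close>. Since a nonconstant \<^const>\<open>entropy_cutoff\<close> tends to minus infinity at
  minus infinity, integrability of these expressions forces the measures to be carried by the
  following set, on which the total functions \<open>/\<close> and \<^const>\<open>ln\<close> give the intended values.
\<close>

definition finite_entropy_states :: "'n::finite state set" where
  "finite_entropy_states = {U. (0 < dens U \<and> 0 < internal_energy U) \<or> (dens U = 0 \<and> mom U = 0)}"

text \<open>
  The argument \<open>c\<close> is the function \<open>c(N, \<gamma>)\<close> of the bound on the concentration measure.
\<close>

definition dmv_solution ::
  "(nat \<Rightarrow> real \<Rightarrow> real) \<Rightarrow> real \<Rightarrow> real \<Rightarrow> (real^'n \<Rightarrow> 'n::finite state measure) \<Rightarrow>
   (real \<Rightarrow> real^'n \<Rightarrow> 'n::finite state measure) \<Rightarrow> bool" where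
  "dmv_solution c \<gamma> T V0 V \<longleftrightarrow>
     (\<forall>t\<in>{0<..<T}. \<forall>x\<in>torus. V t x \<in> prob_on_states) \<and>
     (\<forall>x\<in>torus. V0 x \<in> prob_on_states) \<and>
     (AE z in spacetime T. AE U in V (fst z) (snd z). U \<in> finite_entropy_states) \<and>
     (AE x in lebesgue_on torus. AE U in V0 x. U \<in> finite_entropy_states) \<and>
     integrable_expect T V dens \<and> integrable_expect T V mom \<and> integrable_expect T V ener \<and>
     integrable_expect T V convective_flux \<and> integrable_expect T V internal_energy \<and>
     integrable_expect0 V0 dens \<and> integrable_expect0 V0 mom \<and> integrable_expect0 V0 ener \<and>
     (\<forall>\<eta>. entropy_cutoff \<eta> \<longrightarrow>
        integrable_expect T V (\<lambda>U. dens U * S_eta \<gamma> \<eta> U) \<and>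
        integrable_expect T V (\<lambda>U. S_eta \<gamma> \<eta> U *\<^sub>R mom U) \<and>
        integrable_expect0 V0 (\<lambda>U. dens U * S_eta \<gamma> \<eta> U)) \<and>
     \<comment> \<open>weak-(*) measurability\<close>
     (\<forall>g\<in>Cc_states. (\<lambda>z. expect (V (fst z) (snd z)) g) \<in> borel_measurable (spacetime T)) \<and>
     \<comment> \<open>continuity equation\<close>
     (\<forall>\<phi>. test_fun T \<phi> \<longrightarrow>
        integral_st T (\<lambda>t x. expect (V t x) dens * dt \<phi> t x + expect (V t x) mom \<bullet> grad (\<phi> t) x)
        = - (LINT x|lebesgue_on torus. expect (V0 x) dens * \<phi> 0 x)) \<and>
     \<comment> \<open>energy inequality\<close>
     (AE \<tau> in lebesgue_on {0<..<T}.
        (LINT x|lebesgue_on torus. expect (V \<tau> x) ener)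
        \<le> (LINT x|lebesgue_on torus. expect (V0 x) ener)) \<and>
     \<comment> \<open>entropy inequality\<close>
     (\<forall>\<eta> \<phi>. entropy_cutoff \<eta> \<and> test_fun T \<phi> \<and> (\<forall>t\<in>{0..<T}. \<forall>x. 0 \<le> \<phi> t x) \<longrightarrow>
        integral_st T (\<lambda>t x. expect (V t x) (\<lambda>U. dens U * S_eta \<gamma> \<eta> U) * dt \<phi> t x
                           + expect (V t x) (\<lambda>U. S_eta \<gamma> \<eta> U *\<^sub>R mom U) \<bullet> grad (\<phi> t) x)
        \<le> - (LINT x|lebesgue_on torus. expect (V0 x) (\<lambda>U. dens U * S_eta \<gamma> \<eta> U) * \<phi> 0 x)) \<and>
     \<comment> \<open>momentum equation, and the bound on its concentration measure\<close>
     (let X = restrict_space borel ({0..T} \<times> torus) in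
      \<exists>\<mu>. is_matrix_measure X \<mu> \<and>
       (\<forall>\<phi>. test_fun T \<phi> \<longrightarrow>
          integral_st T (\<lambda>t x. expect (V t x) mom \<bullet> dt \<phi> t x
                             + expect (V t x) convective_flux \<bullet> jac (\<phi> t) x
                             + (\<gamma> - 1) * expect (V t x) internal_energy * divergence (\<phi> t) x)
          = - (LINT x|lebesgue_on torus. expect (V0 x) mom \<bullet> \<phi> 0 x)
            + mm_integral \<mu> (\<lambda>z. jac (\<phi> (fst z)) (snd z))) \<and>
       (\<forall>\<tau>. 0 \<le> \<tau> \<and> \<tau> < T \<longrightarrow>
          mm_variation X \<mu> ({0..\<tau>} \<times> torus)
          \<le> c CARD('n) \<gamma> *
            integral_st \<tau> (\<lambda>t x. expect (V0 x) ener - expect (V t x) ener)))"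

end

theory Submission
 imports Defs
begin

text \<open>
  The theorem combines uniform stability of the schemes, weak-strong uniqueness in the class of
  DMV solutions, and an upgrade from weak to strong convergence.

  Stability. In a cell where the quotient of internal energy density and \<open>\<rho>\<^sup>\<gamma>\<close> is minimal among all cells,
  this quotient cannot decrease: its differential is, up to a positive factor, the linear
  functional \<open>ent_dual\<close> frozen at that cell, and the numerical diffusion, whose speed is at
  least \<open>|u| + c\<close>, dominates the flux differences (\<open>flux_dominated_by_diffusion\<close>). Hence
  \<open>minimum_entropy_principle\<close>: the internal energy is at least \<open>\<kappa> \<rho>\<^sup>\<gamma>\<close>. As the total energy is
  conserved, density, momentum and energy are bounded in \<open>L\<^sup>\<gamma>\<close>, \<open>L\<^sup>2\<^sup>\<gamma>\<^sup>/\<^sup>(\<^sup>\<gamma>\<^sup>+\<^sup>1\<^sup>)\<close> and \<open>L\<^sup>1\<close>.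

  Weak-strong uniqueness. Let \<open>u\<close>, \<open>\<theta>\<close>, \<open>s\<close>, \<open>p\<close> be velocity, temperature, entropy and pressure of the
  strong solution. The relative energy of a state \<open>(\<rho>, m, E)\<close> of entropy \<open>S\<close> is
  \<open>E - m u + a \<rho> - \<theta> \<rho> min S K + p\<close> with \<open>a = |u|\<^sup>2/2 - \<gamma>/(\<gamma>-1) \<theta> + \<theta> s\<close> and a constant \<open>K\<close> above
  all values of \<open>s\<close>; it is nonnegative and vanishes only at the state of the strong solution.
  It is affine in the quantities occurring in the definition of a DMV solution, so testing the
  momentum, continuity and entropy relations with \<open>\<psi> u\<close>, \<open>\<psi> a\<close>, \<open>\<psi> \<theta>\<close> gives
  \<open>relative_energy_inequality\<close>. Its production term is bounded by the relative energy
  (\<open>pointwise_control\<close>) once \<open>S\<close> is bounded below, which the entropy inequality with a cut-off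
  from below provides (\<open>dmv_min_entropy\<close>). The concentration measure is bounded by the energy
  defect. With the weight \<open>\<psi> = exp (-\<Lambda> t) (1 - t/\<tau>)\<^sup>2\<close> on \<open>[0, \<tau>]\<close> the derivative \<open>-\<psi>'\<close> exceeds \<open>\<Lambda> \<psi>\<close>,
  so Gronwall's argument is contained in the choice of the test function, and the Young measure
  is the Dirac mass at the strong solution (\<open>young_measure_is_Dirac\<close>).

  Strong convergence. For a bounded truncation of a component both the truncation and its square
  converge weakly to their values at the strong solution, hence in \<open>L\<^sup>2\<close>. What is cut off is
  small: the energy of the approximations is that of the strong solution, so none of it is lost at
  infinity; the density is controlled by its \<open>L\<^sup>\<gamma>\<close> bound; and \<open>|m| \<le> \<rho> + E\<close>. The weak-(*)
  statements follow from strong \<open>L\<^sup>1\<close> convergence and the uniform bounds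
  (\<open>strong_convergence_from_Dirac\<close>).
\<close>

lemmas lint_cong = Bochner_Integration.integral_cong
 and lint_bound = Bochner_Integration.integrable_bound
 and lint_sum = Bochner_Integration.integral_sum
 and lint_add = Bochner_Integration.integral_add
 and integrable_sum2 = Bochner_Integration.integrable_add

text \<open>A sum without range extends over a finite type.\<close>

no_notation suminf (binder "\<Sum>" 10)

abbreviation sum_all :: "('n::finite \<Rightarrow> 'b::comm_monoid_add) \<Rightarrow> 'b" (binder "\<Sum>" 10) where "sum_all f \<equiv> sum f UNIV"

abbreviation eventually_h :: "(real \<Rightarrow> bool) \<Rightarrow> bool" (binder "EV " 10) where "eventually_h P \<equiv> eventually P h_to_0"

abbreviation strip :: "real \<Rightarrow> (real \<times> (real^'n)) set" where "strip T \<equiv> {0..T} \<times> UNIV"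

abbreviation torus_measure :: "(real^'n) measure" ("\<Omega>") where "\<Omega> \<equiv> lebesgue_on torus"

section \<open>Convexity inequalities for the power law\<close>

text \<open>
  The tangent line at \<open>1\<close> of the convex function \<open>y\<^sup>\<gamma>\<close>.
\<close>
lemma bernoulli_powr:
 fixes y \<gamma> :: real
 assumes "\<gamma> > 1" "y \<ge> 0" shows "\<gamma> * y <= y powr \<gamma> + (\<gamma> - 1)"
proof (cases "y = 0")
 case False
 then have y: "y > 0" using assms by simp
 have "(%x. x powr \<gamma>) y - 1 powr \<gamma> \<ge> (\<gamma> * 1 powr (\<gamma> - 1)) * (y - 1)"
 proof (rule convex_on_imp_above_tangent[of "{0<..}"])
  show "convex_on {0<..} (%x::real. x powr \<gamma>)" using assms by (intro powr_convex) simp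
  show "((%x. x powr \<gamma>) has_real_derivative \<gamma> * 1 powr (\<gamma> - 1)) (at 1 within {0<..})"
   using has_real_derivative_powr[of 1 \<gamma>] by (intro DERIV_subset[where t="{0<..}" and s=UNIV]) auto
 qed (use y in \<open>auto simp: connected_iff_interval interior_open\<close>)
 then show ?thesis by (simp add: algebra_simps)
qed (use assms in simp)

text \<open>
  Both sides and their first derivatives vanish at \<open>r = 1\<close>. The right side is the convexity gap of \<open>r\<^sup>\<gamma>\<close>;
  the estimate measures it in the variable \<open>r\<^sup>\<gamma>\<^sup>-\<^sup>1\<close> (the squared sound speed).
\<close>
lemma rarefaction_gap:
 fixes r \<gamma> :: real
 assumes g: "\<gamma> > 1" and r: "0 < r" "r <= 1"
 shows "\<gamma> * r * ((1 - r powr (\<gamma> - 1)) / (\<gamma> - 1))^2 <= 2 * ((r powr \<gamma> - \<gamma> * r + \<gamma> - 1) / (\<gamma> - 1))"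
proof -
 define k where "k = 1 / (\<gamma> - 1)"
 have k: "k > 0" "k * (\<gamma> - 1) = 1" using g by (auto simp: k_def)
 let ?J = "%x. k * (1 - x powr (\<gamma> - 1))"
 let ?f = "%x. 2 * (k * (x powr \<gamma> - \<gamma> * x + \<gamma> - 1)) - \<gamma> * x * (?J x * ?J x)"
 have "?f 1 <= ?f r"
 proof (rule DERIV_nonpos_imp_nonincreasing[OF r(2)])
  fix x assume x: "r <= x" "x <= 1"
  then have x0: "x > 0" using r by simp
  have p1: "x powr (\<gamma> - 1) <= 1" using x x0 g by (simp add: powr_le1)
  then have J: "?J x \<ge> 0" using k by simp
  have pw: "x powr (\<gamma> - 1 - 1) * x = x powr (\<gamma> - 1)" using powr_mult_base[of x "\<gamma>-2"] x0 by (simp add: mult.commute add.commute)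
  have d: "(?f has_real_derivative 2 * (k * (\<gamma> * x powr (\<gamma> - 1) - \<gamma>))
    - (\<gamma> * (?J x * ?J x) + \<gamma> * x * (2 * ?J x * (- k * (\<gamma> - 1) * x powr (\<gamma> - 1 - 1))))) (at x)"
   using x0 g by (auto intro!: derivative_eq_intros simp: algebra_simps)
  have e: "2 * (k * (\<gamma> * x powr (\<gamma> - 1) - \<gamma>))
    - (\<gamma> * (?J x * ?J x) + \<gamma> * x * (2 * ?J x * (- k * (\<gamma> - 1) * x powr (\<gamma> - 1 - 1))))
    = \<gamma> * ?J x * (2 * x powr (\<gamma> - 1) - 2 - ?J x)"
  proof -
   have "\<gamma> * x * (2 * ?J x * (- k * (\<gamma> - 1) * x powr (\<gamma> - 1 - 1)))
     = - (k * (\<gamma> - 1)) * (2 * \<gamma> * ?J x * (x powr (\<gamma> - 1 - 1) * x))" by (simp only: mult_ac mult_minus_left mult_minus_right)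
   then show ?thesis unfolding pw k(2) by (simp add: algebra_simps)
  qed
  have n: "\<gamma> * ?J x * (2 * x powr (\<gamma> - 1) - 2 - ?J x) <= 0" using J g p1 by (intro mult_nonneg_nonpos) auto
  show "EX y. (?f has_real_derivative y) (at x) & y <= 0" using d[unfolded e] n by (rule_tac exI, rule_tac conjI)
 qed
 then show ?thesis by (simp add: k_def power2_eq_square)
qed

text \<open>
  The counterpart of \<open>rarefaction_gap\<close> for \<open>y \<ge> 1\<close>, measured in the pressure ratio \<open>y\<^sup>\<gamma>\<close>.
\<close>
lemma compression_gap:
 fixes y \<gamma> :: real
 assumes g: "\<gamma> > 1" and y: "1 <= y"
 shows "(y powr \<gamma> - 1)^2 <= 2 * \<gamma> * y powr \<gamma> * ((y powr \<gamma> - \<gamma> * y + \<gamma> - 1) / (\<gamma> - 1))"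
proof -
 define k where "k = 1 / (\<gamma> - 1)"
 have k: "k > 0" "k * (\<gamma> - 1) = 1" using g by (auto simp: k_def)
 then have kg: "k * \<gamma> = 1 + k" by (simp add: algebra_simps)
 let ?B = "%x. k * (x powr \<gamma> - \<gamma> * x + \<gamma> - 1)"
 let ?f = "%x. 2 * \<gamma> * x powr \<gamma> * ?B x - (x powr \<gamma> - 1) * (x powr \<gamma> - 1)"
 have "?f 1 <= ?f y"
 proof (rule DERIV_nonneg_imp_nondecreasing[OF y])
  fix x :: real assume x: "1 <= x" "x <= y"
  then have x0: "x > 0" by simp
  have B: "?B x \<ge> 0" using bernoulli_powr[OF g, of x] x0 k by simp
  have pw: "x powr \<gamma> = x powr (\<gamma> - 1) * x" using powr_mult_base[of x "\<gamma>-1"] x0 by (simp add: mult.commute)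
  define q where "q = x powr (\<gamma> - 1)"
  have d: "(?f has_real_derivative 2 * \<gamma> * (\<gamma> * q) * ?B x
     + 2 * \<gamma> * x powr \<gamma> * (k * (\<gamma> * q - \<gamma>))
     - 2 * (x powr \<gamma> - 1) * (\<gamma> * q)) (at x)" unfolding q_def using x0 g by (auto intro!: derivative_eq_intros simp: algebra_simps)
  have "2 * \<gamma> * (\<gamma> * q) * ?B x + 2 * \<gamma> * x powr \<gamma> * (k * (\<gamma> * q - \<gamma>)) - 2 * (x powr \<gamma> - 1) * (\<gamma> * q)
    = 2 * \<gamma> * q * (\<gamma> * ?B x + x * ((k * \<gamma>) * (q - 1)) - (x powr \<gamma> - 1))" unfolding pw q_def[symmetric] by (simp add: algebra_simps)
  also have "\<gamma> * ?B x + x * ((k * \<gamma>) * (q - 1)) - (x powr \<gamma> - 1) = (\<gamma> + 1) * ?B x"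
  proof -
   have "?B x = k * x powr \<gamma> - (k * \<gamma>) * x + k * \<gamma> - k" by (simp add: algebra_simps)
   also have "... = x * ((k * \<gamma>) * (q - 1)) - (x powr \<gamma> - 1)" unfolding kg pw q_def[symmetric] by (simp add: algebra_simps)
   finally show ?thesis by (simp only: distrib_right mult_1 add_diff_eq)
  qed
  finally have e: "2 * \<gamma> * (\<gamma> * q) * ?B x + 2 * \<gamma> * x powr \<gamma> * (k * (\<gamma> * q - \<gamma>))
     - 2 * (x powr \<gamma> - 1) * (\<gamma> * q) = 2 * \<gamma> * q * ((\<gamma> + 1) * ?B x)" .
  have n: "2 * \<gamma> * q * ((\<gamma> + 1) * ?B x) \<ge> 0" using B g by (auto simp: q_def)
  show "EX z. (?f has_real_derivative z) (at x) & z \<ge> 0" using d[unfolded e] n by (rule_tac exI, rule_tac conjI)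
 qed
 then show ?thesis by (simp add: k_def power2_eq_square)
qed

text \<open>
  \<open>B\<close> is the thermal part of the convexity gap of the energy at the state \<open>(\<rho>0, p0)\<close>. A state of
  larger entropy has a pressure difference that is at most of the order of the square root of \<open>B\<close>;
  for \<open>p < p0\<close> a summand \<open>B\<close> is needed, since the square root vanishes at vacuum.
\<close>
lemma entropy_gap:
 fixes \<gamma> \<rho> p \<rho>0 p0 :: real
 assumes g: "\<gamma> > 1" and pos: "\<rho> > 0" "p > 0" "\<rho>0 > 0" "p0 > 0" and s: "p0 / \<rho>0 powr \<gamma> <= p / \<rho> powr \<gamma>"
 defines "B \<equiv> p / (\<gamma> - 1) - \<gamma> / (\<gamma> - 1) * (p0 / \<rho>0) * \<rho> + p0" shows "0 <= B"
  and "p0 <= p ==> (p - p0)^2 <= 2 * \<gamma> * p * B" and "p < p0 ==> p0 - p <= B + sqrt (2 * \<gamma> * (p0 / \<rho>0) * \<rho> * B)"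
proof -
 define r where "r = \<rho> / \<rho>0"
 define q where "q = p / p0"
 define b where "b = (%x. (q - \<gamma> * x + \<gamma> - 1) / (\<gamma> - 1))"
 have r: "r > 0" and q: "q > 0" using pos by (auto simp: r_def q_def)
 have Bb: "B = p0 * b r"
 proof -
  have "p0 * b r = (p0 * q - \<gamma> * (p0 * r) + (\<gamma> - 1) * p0) / (\<gamma> - 1)" by (simp add: b_def algebra_simps)
  also have "p0 * q = p" using pos by (simp add: q_def)
  also have "p0 * r = p0 / \<rho>0 * \<rho>" by (simp add: r_def)
  also have "(p - \<gamma> * (p0 / \<rho>0 * \<rho>) + (\<gamma> - 1) * p0) / (\<gamma> - 1) = B"
  proof -
   have "(p - \<gamma> * X + (\<gamma> - 1) * p0) / (\<gamma> - 1) = p / (\<gamma> - 1) - \<gamma> / (\<gamma> - 1) * X + p0" for X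
    using g by (simp add: diff_divide_distrib add_divide_distrib)
   from this[of "p0 / \<rho>0 * \<rho>"] show ?thesis by (simp only: B_def mult.assoc)
  qed
  finally show ?thesis by simp
 qed
 have rq: "r powr \<gamma> <= q" using s pos by (simp add: r_def q_def powr_divide field_simps)
 have le: "(r powr \<gamma> - \<gamma> * r + \<gamma> - 1) / (\<gamma> - 1) <= b r" unfolding b_def using rq g by (intro divide_right_mono) auto
 have b0: "b r \<ge> 0" by (rule order_trans[OF _ le]) (use bernoulli_powr[OF g, of r] r g in simp)
 then show "0 <= B" using Bb pos by simp
 show "(p - p0)^2 <= 2 * \<gamma> * p * B" if "p0 <= p"
 proof -
  define y where "y = q powr (1 / \<gamma>)"
  have q1: "1 <= q" using that pos by (simp add: q_def)
  then have y1: "1 <= y" unfolding y_def using g by (simp add: ge_one_powr_ge_zero)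
  have yg: "y powr \<gamma> = q" using q g by (simp add: y_def powr_powr)
  have ry: "r <= y"
  proof -
   have "r = (r powr \<gamma>) powr (1 / \<gamma>)" using r g by (simp add: powr_powr)
   also have "... <= y" unfolding y_def using rq r g by (intro powr_mono2) auto
   finally show ?thesis .
  qed
  have "(q - 1)^2 <= 2 * \<gamma> * q * b y" using compression_gap[OF g y1] unfolding yg b_def .
  also have "... <= 2 * \<gamma> * q * b r" unfolding b_def using ry g q by (intro mult_left_mono divide_right_mono) auto
  finally have "(q - 1)^2 <= 2 * \<gamma> * q * b r" .
  then have "p0^2 * (q - 1)^2 <= p0^2 * (2 * \<gamma> * q * b r)" by (intro mult_left_mono) auto
  moreover have "p0^2 * (q - 1)^2 = (p - p0)^2" using pos by (simp add: q_def field_simps power2_eq_square)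
  moreover have "p0^2 * (2 * \<gamma> * q * b r) = 2 * \<gamma> * p * B" using pos by (simp add: Bb q_def field_simps power2_eq_square)
  ultimately show ?thesis by simp
 qed
 show "p0 - p <= B + sqrt (2 * \<gamma> * (p0 / \<rho>0) * \<rho> * B)" if "p < p0"
 proof -
  let ?b = "(r powr \<gamma> - \<gamma> * r + \<gamma> - 1) / (\<gamma> - 1)"
  let ?J = "(1 - r powr (\<gamma> - 1)) / (\<gamma> - 1)"
  have q1: "q < 1" using that pos by (simp add: q_def)
  have r1: "r <= 1"
  proof (rule ccontr)
   assume "~ r <= 1"
   then have "1 <= r powr \<gamma>" using g by (simp add: ge_one_powr_ge_zero)
   then show False using rq q1 by simp
  qed
  have bn: "?b \<ge> 0" using bernoulli_powr[OF g, of r] r g by simp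
  have pw: "r powr (\<gamma> - 1) * r = r powr \<gamma>" using powr_mult_base[of r "\<gamma>-1"] r by (simp add: mult.commute)
  have eq: "1 - r powr \<gamma> - ?b = \<gamma> * r * ?J" unfolding pw[symmetric] using g by (simp add: field_simps)
  have "(\<gamma> * r * ?J)^2 <= 2 * \<gamma> * r * ?b" using mult_left_mono[OF rarefaction_gap[OF g r r1], of "\<gamma> * r"] r g
   by (simp add: power2_eq_square algebra_simps)
  then have "\<gamma> * r * ?J <= sqrt (2 * \<gamma> * r * ?b)" by (rule real_le_rsqrt)
  also have "... <= sqrt (2 * \<gamma> * r * b r)" using le r g by (intro real_sqrt_le_mono mult_left_mono) auto
  finally have "1 - q <= b r + sqrt (2 * \<gamma> * r * b r)" using eq le rq by linarith
  then have "p0 * (1 - q) <= p0 * (b r + sqrt (2 * \<gamma> * r * b r))" using pos by (intro mult_left_mono) auto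
  also have "... = B + sqrt (p0^2 * (2 * \<gamma> * r * b r))" using pos by (simp add: Bb real_sqrt_mult distrib_left)
  also have "p0^2 * (2 * \<gamma> * r * b r) = 2 * \<gamma> * (p0 / \<rho>0) * \<rho> * B" by (simp add: Bb r_def power2_eq_square)
  finally show ?thesis using pos by (simp add: q_def algebra_simps)
 qed
qed

lemma two_sqrt_le:
 fixes a b w :: real
 assumes "a \<ge> 0" "b \<ge> 0" "w \<ge> 0" shows "w * sqrt (2 * a * b) <= a * w^2 / 2 + b"
proof -
 have "0 <= (sqrt (a / 2) * w - sqrt b)^2" by simp
 also have "... = a * w^2 / 2 + b - 2 * w * (sqrt (a / 2) * sqrt b)" using assms by (simp add: power2_diff power_mult_distrib)
 also have "2 * w * (sqrt (a / 2) * sqrt b) = w * (sqrt 4 * (sqrt (a / 2) * sqrt b))" by simp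
 also have "sqrt 4 * (sqrt (a / 2) * sqrt b) = sqrt (4 * (a / 2 * b))" by (simp only: real_sqrt_mult)
 also have "4 * (a / 2 * b) = 2 * a * b" by simp
 finally show ?thesis by simp
qed

text \<open>
  The one-dimensional heart of the minimum entropy principle. The left side is the flux of the
  frozen functional, \<open>A\<close> its density, both relative to the frozen state. The excess over \<open>v A\<close> is
  absorbed by the sound speeds contained in \<open>lam\<close>, by means of \<open>entropy_gap\<close> and \<open>two_sqrt_le\<close>.
\<close>
lemma flux_dominated_by_diffusion:
 fixes \<gamma> \<rho> p \<rho>0 p0 v v0 lam A :: real
 assumes g: "\<gamma> > 1" and pos: "\<rho> > 0" "p > 0" "\<rho>0 > 0" "p0 > 0" and s: "p0 / \<rho>0 powr \<gamma> <= p / \<rho> powr \<gamma>"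
  and speed: "\<bar>v\<bar> + sqrt (\<gamma> * p / \<rho>) <= lam" and speed0: "\<bar>v0\<bar> + sqrt (\<gamma> * p0 / \<rho>0) <= lam"
  and A: "\<rho> * (v - v0)^2 / 2 + (p / (\<gamma> - 1) - \<gamma> / (\<gamma> - 1) * (p0 / \<rho>0) * \<rho> + p0) <= A"
 shows "\<bar>v * A + (p - p0) * (v - v0)\<bar> <= 2 * lam * A"
proof -
 define B where "B = p / (\<gamma> - 1) - \<gamma> / (\<gamma> - 1) * (p0 / \<rho>0) * \<rho> + p0"
 note gap = entropy_gap[OF g pos s, folded B_def]
 define w where "w = \<bar>v - v0\<bar>"
 define c where "c = sqrt (\<gamma> * p / \<rho>)"
 define c0 where "c0 = sqrt (\<gamma> * p0 / \<rho>0)"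
 have c: "c \<ge> 0" "c0 \<ge> 0" using g pos by (auto simp: c_def c0_def)
 have w0: "w \<ge> 0" by (simp add: w_def)
 have A1: "\<rho> * w^2 / 2 + B <= A" using A by (simp add: B_def w_def)
 have A2: "w * sqrt (2 * \<rho> * B) <= A" using two_sqrt_le[of \<rho> B w] pos gap(1) w0 A1 by linarith
 have A0: "A \<ge> 0" using A1 gap(1) pos by (smt (verit) zero_le_power2 mult_nonneg_nonneg divide_nonneg_nonneg)
 have sp: "\<bar>v\<bar> + c <= lam" "\<bar>v0\<bar> + c0 <= lam" using speed speed0 by (auto simp: c_def c0_def)
 show ?thesis
 proof (cases "p0 <= p")
  case True
  have "p - p0 <= sqrt (2 * \<gamma> * p * B)" using gap(2)[OF True] by (rule real_le_rsqrt)
  also have "2 * \<gamma> * p * B = (\<gamma> * p / \<rho>) * (2 * \<rho> * B)" using pos by simp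
  also have "sqrt ... = c * sqrt (2 * \<rho> * B)" by (simp only: real_sqrt_mult c_def)
  finally have "(p - p0) * w <= c * sqrt (2 * \<rho> * B) * w" using w0 by (rule mult_right_mono)
  also have "... = c * (w * sqrt (2 * \<rho> * B))" by simp
  also have "... <= c * A" using A2 c by (intro mult_left_mono) auto
  finally have 1: "(p - p0) * w <= c * A" .
  have "\<bar>v * A + (p - p0) * (v - v0)\<bar> <= \<bar>v\<bar> * A + (p - p0) * w"
   using True A0 by (simp add: abs_mult w_def order_trans[OF abs_triangle_ineq])
  also have "... <= (\<bar>v\<bar> + c) * A" using 1 by (simp add: distrib_right)
  also have "... <= 2 * lam * A" using sp c A0 by (intro mult_right_mono) auto
  finally show ?thesis .
 next
  case False
  define d where "d = p0 - p"
  have d: "d > 0" using False by (simp add: d_def)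
  show ?thesis
  proof (cases "d <= A")
   case True
   have "v * A + (p - p0) * (v - v0) = v * (A - d) + d * v0" by (simp add: d_def algebra_simps)
   also have "\<bar>...\<bar> <= \<bar>v\<bar> * (A - d) + d * \<bar>v0\<bar>" using True d by (intro order_trans[OF abs_triangle_ineq]) (simp add: abs_mult)
   also have "... <= lam * (A - d) + d * lam" using True d sp c by (intro add_mono mult_right_mono mult_left_mono) auto
   also have "... = lam * A" by (simp add: algebra_simps)
   also have "... <= 2 * lam * A" using sp c A0 by (intro mult_right_mono) auto
   finally show ?thesis .
  next
   case dA: False
   have "d <= B + sqrt (2 * \<gamma> * (p0 / \<rho>0) * \<rho> * B)" using gap(3) False by (simp add: d_def)
   also have "2 * \<gamma> * (p0 / \<rho>0) * \<rho> * B = (\<gamma> * p0 / \<rho>0) * (2 * \<rho> * B)" using pos by simp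
   also have "sqrt ... = c0 * sqrt (2 * \<rho> * B)" by (simp only: real_sqrt_mult c0_def)
   finally have "w * d <= w * (B + c0 * sqrt (2 * \<rho> * B))" using w0 by (rule mult_left_mono)
   also have "... = w * B + c0 * (w * sqrt (2 * \<rho> * B))" by (simp add: algebra_simps)
   also have "... <= w * A + c0 * A"
   proof -
    have "B <= A" using A1 pos by (smt (verit) zero_le_power2 mult_nonneg_nonneg divide_nonneg_nonneg)
    then show ?thesis using w0 c A2 by (intro add_mono mult_left_mono) auto
   qed
   finally have wd: "w * d <= (w + c0) * A" by (simp add: distrib_right)
   have "v * A + (p - p0) * (v - v0) = v0 * A + (v - v0) * (A - d)" by (simp add: d_def algebra_simps)
   also have "\<bar>...\<bar> <= \<bar>v0\<bar> * A + w * (d - A)" using dA A0 by (intro order_trans[OF abs_triangle_ineq]) (simp add: abs_mult w_def)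
   also have "... <= (\<bar>v0\<bar> + c0) * A" using wd by (simp add: algebra_simps)
   also have "... <= 2 * lam * A" using sp c A0 by (intro mult_right_mono) auto
   finally show ?thesis .
  qed
 qed
qed

section \<open>A minimum principle, and sums over periodic cells\<close>

text \<open>
  Only the derivative at a cell that is minimal at that instant is known to be nonnegative. The
  minimum over the cells need not be differentiable, so it is compared with barriers of slightly
  negative slope, whose slope then tends to zero.
\<close>
lemma min_principle_barrier:
 fixes a :: "real => 'k => real"
 assumes fin: "finite I" and T: "T > 0" and kap: "\<kappa> > 0" and cont: "!!k. k : I ==> continuous_on {0..T} (%t. a t k)"
  and init: "!!k. k : I ==> a 0 k \<ge> \<kappa>" and step: "!!t k. [|0 < t; t < T; k : I; a t k > 0; !!l. l : I ==> a t k <= a t l|] ==>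
    \<exists>d\<ge>0. ((%t. a t k) has_real_derivative d) (at t)" and t: "t : {0..T}" and k: "k : I" shows "a t k \<ge> \<kappa>"
proof -
 have below: "a t k \<ge> \<kappa> - \<delta> * (1 + t)"
  if d: "0 < \<delta>" "\<delta> * (1 + T) < \<kappa>" and tT: "0 <= t" "t < T" and k: "k : I" for \<delta> t k
 proof (rule ccontr)
  define \<beta> where "\<beta> = (%t::real. \<kappa> - \<delta> * (1 + t))"
  assume "~ ?thesis"
  then have viol: "a t k < \<beta> t" by (simp add: \<beta>_def)
  define S where "S = (\<Union>l\<in>I. {s : {0..t}. a s l <= \<beta> s})"
  have "closed {s : {0..t}. a s l <= \<beta> s}" if "l : I" for l unfolding \<beta>_def by (intro continuous_on_closed_Collect_le continuous_intros
     continuous_on_subset[OF cont[OF that]]) (use tT in auto)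
  then have "closed S" unfolding S_def by (intro closed_UN fin) auto
  moreover have "bounded S" by (rule bounded_subset[of "{0..t}"]) (auto simp: S_def)
  ultimately have "compact S" by (simp add: compact_eq_bounded_closed)
  moreover have "t : S" using viol k tT by (auto simp: S_def intro!: bexI[of _ k])
  ultimately obtain s where s: "s : S" "!!r. r : S ==> s <= r" using compact_attains_inf[of S] by blast
  then obtain j where j: "j : I" "a s j <= \<beta> s" and st: "0 <= s" "s <= t" by (auto simp: S_def)
  have "s ~= 0" using init[OF j(1)] j(2) d by (auto simp: \<beta>_def)
  then have s0: "s > 0" using st by simp
  have above: "a r l > \<beta> r" if "0 <= r" "r < s" "l : I" for r l using s(2)[of r] that st by (force simp: S_def)
  have ge: "a s l \<ge> \<beta> s" if l: "l : I" for l
  proof -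
   let ?F = "at s within {0..<s}"
   have nt: "?F ~= bot" using s0 by (simp add: trivial_limit_within islimpt_Ico)
   have "((%r. a r l) \<longlongrightarrow> a s l) ?F"
    using cont[OF l] st tT by (meson atLeastAtMost_iff atLeastLessThan_subseteq_atLeastAtMost_iff continuous_on le_less_trans less_le_not_le order_refl subset_iff tendsto_within_subset less_imp_le)
   moreover have "(\<beta> \<longlongrightarrow> \<beta> s) ?F" unfolding \<beta>_def by (intro tendsto_intros)
   moreover have "\<forall>\<^sub>F r in ?F. \<beta> r <= a r l"
    unfolding eventually_at_filter using above[OF _ _ l] by (intro always_eventually) (auto simp: less_imp_le)
   ultimately show ?thesis using tendsto_le[OF nt] by blast
  qed
  have eq: "a s j = \<beta> s" using ge[OF j(1)] j(2) by simp
  have bpos: "\<beta> s > 0"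
  proof -
   have "\<delta> * (1 + s) <= \<delta> * (1 + T)" using d st tT by (intro mult_left_mono) auto
   then show ?thesis using d unfolding \<beta>_def by linarith
  qed
  obtain e where e: "e \<ge> 0" "((%t. a t j) has_real_derivative e) (at s)" using step[OF s0 _ j(1)] ge eq bpos st tT by force
  have "((%r. a r j - \<beta> r) has_real_derivative (e + \<delta>)) (at s)" unfolding \<beta>_def by (auto intro!: derivative_eq_intros e(2))
  then obtain \<epsilon> where eps: "\<epsilon> > 0" "!!h. 0 < h ==> h < \<epsilon> ==> a (s - h) j - \<beta> (s - h) < a s j - \<beta> s"
   using DERIV_pos_inc_left[of "%r. a r j - \<beta> r" "e + \<delta>" s] e d by auto
  define h where "h = min (\<epsilon> / 2) (s / 2)"
  have h: "0 < h" "h < \<epsilon>" "h < s" using eps s0 by (auto simp: h_def)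
  from eps(2)[OF h(1,2)] above[of "s - h" j] h j eq show False by simp
 qed
 have main: "a t k \<ge> \<kappa>" if tT: "0 <= t" "t < T" and k: "k : I" for t k
 proof (rule ccontr)
  assume n: "~ ?thesis"
  define \<delta> where "\<delta> = min (\<kappa> / (2 * (1 + T))) ((\<kappa> - a t k) / (2 * (1 + T)))"
  have dp: "\<delta> > 0" using n kap T by (simp add: \<delta>_def)
  have "\<delta> * (1 + T) <= \<kappa> / (2 * (1 + T)) * (1 + T)" unfolding \<delta>_def using T by (intro mult_right_mono) auto
  also have "... = \<kappa> / 2" using T by (simp add: field_simps)
  also have "... < \<kappa>" using kap by simp
  finally have d1: "\<delta> * (1 + T) < \<kappa>" .
  have "\<delta> * (1 + t) <= \<delta> * (1 + T)" using dp tT by (intro mult_left_mono) auto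
  also have "... <= (\<kappa> - a t k) / (2 * (1 + T)) * (1 + T)" unfolding \<delta>_def using T by (intro mult_right_mono) auto
  also have "... = (\<kappa> - a t k) / 2" using T by (simp add: field_simps)
  also have "... < \<kappa> - a t k" using n by simp
  finally show False using below[OF dp d1 tT k] by simp
 qed
 show ?thesis
 proof (cases "t < T")
  case True then show ?thesis using main t k by simp
 next
  case False
  then have tT: "t = T" using t by simp
  let ?F = "at T within {0..<T}"
  have nt: "?F ~= bot" using T by (simp add: trivial_limit_within islimpt_Ico)
  have "((%r. a r k) \<longlongrightarrow> a T k) (at T within {0..T})" using cont[OF k] T by (auto simp: continuous_on)
  then have "((%r. a r k) \<longlongrightarrow> a T k) ?F" by (rule tendsto_within_subset) auto
  moreover have "\<forall>\<^sub>F r in ?F. \<kappa> <= a r k" unfolding eventually_at_filter using main[OF _ _ k] by (intro always_eventually) auto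
  ultimately show ?thesis unfolding tT using nt by (intro tendsto_lowerbound) auto
 qed
qed

lemma mesh_size_props:
 assumes "h : mesh_sizes" shows "h > 0" "h * of_int \<lfloor>1 / h\<rfloor> = 1" "\<lfloor>1 / h\<rfloor> \<ge> 1"
proof -
 show h: "h > 0" using assms by (simp add: mesh_sizes_def)
 obtain n :: nat where n: "1 / h = of_nat n" using assms unfolding mesh_sizes_def Nats_def by auto
 then have fl: "\<lfloor>1 / h\<rfloor> = int n" by simp
 show "h * of_int \<lfloor>1 / h\<rfloor> = 1" unfolding fl using n h by (simp add: field_simps)
 have "n ~= 0" using n h by (cases n) auto
 then show "\<lfloor>1 / h\<rfloor> \<ge> 1" unfolding fl by simp
qed

lemma finite_cells: "finite (cells h :: 'n::finite cell set)"
proof -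
 have "(cells h :: 'n cell set) \<subseteq> (%f. \<chi> i. f i) ` (UNIV \<rightarrow>\<^sub>E {0..<\<lfloor>1/h\<rfloor>})"
 proof
  fix K :: "'n cell" assume "K : cells h"
  then have "(%i. K $ i) : UNIV \<rightarrow>\<^sub>E {0..<\<lfloor>1/h\<rfloor>}" by (auto simp: cells_def)
  then have "vec_lambda (%i. K $ i) : vec_lambda ` (UNIV \<rightarrow>\<^sub>E {0..<\<lfloor>1/h\<rfloor>})" by (rule imageI)
  then show "K : vec_lambda ` (UNIV \<rightarrow>\<^sub>E {0..<\<lfloor>1/h\<rfloor>})" by simp
 qed
 moreover have "finite (UNIV \<rightarrow>\<^sub>E {0..<\<lfloor>1/h\<rfloor>} :: ('n => int) set)" by (intro finite_PiE) auto
 ultimately show ?thesis by (meson finite_imageI finite_subset)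
qed

lemma next_prev_in_cells:
 assumes "h : mesh_sizes" shows "next_cell h s K : cells h" "prev_cell h s K : cells h"
 using mesh_size_props(3)[OF assms] by (auto simp: cells_def next_cell_def prev_cell_def)

lemma next_prev_inverse:
 assumes "K : cells h" shows "next_cell h s (prev_cell h s K) = K" "prev_cell h s (next_cell h s K) = K"
 using assms by (auto simp: cells_def next_cell_def prev_cell_def vec_eq_iff mod_simps)

lemma bij_next_cell: "h : mesh_sizes ==> bij_betw (next_cell h s) (cells h) (cells h)"
 by (rule bij_betwI[where g="prev_cell h s"]) (auto simp: next_prev_in_cells next_prev_inverse)

lemma bij_prev_cell: "h : mesh_sizes ==> bij_betw (prev_cell h s) (cells h) (cells h)"
 by (rule bij_betwI[where g="next_cell h s"]) (auto simp: next_prev_in_cells next_prev_inverse)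

lemma neighbours_subset: "h : mesh_sizes ==> neighbours h K \<subseteq> cells h" by (auto simp: neighbours_def next_prev_in_cells)

lemma neighbours_sym:
 fixes K L :: "'n::finite cell"
 assumes "K : cells h" "L : cells h" shows "L : neighbours h K \<longleftrightarrow> K : neighbours h L"
proof -
 have "K : neighbours h L" if LK: "L : neighbours h K" and K: "K : cells h" for K L :: "'n cell"
 proof -
  from LK obtain s where "L = next_cell h s K | L = prev_cell h s K" by (auto simp: neighbours_def)
  then have "K = prev_cell h s L | K = next_cell h s L" using next_prev_inverse[OF K, of s] by auto
  then show ?thesis by (auto simp: neighbours_def)
 qed
 then show ?thesis using assms by blast
qed

text \<open>
  The forward and backward neighbours of a cell are pairwise distinct only if there are at least
  three cells in each direction, which is where \<open>h \<le> 1/3\<close> comes from.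
\<close>
lemma sum_neighbours:
 fixes g :: "'n::finite cell => real"
 assumes h: "h : mesh_sizes" and h3: "h <= 1 / 3" and K: "K : cells h"
 shows "(\<Sum>L\<in>neighbours h K. g L) = (\<Sum>s. g (next_cell h s K) + g (prev_cell h s K))"
proof -
 define n where "n = \<lfloor>1 / h\<rfloor>"
 have h0: "h > 0" using mesh_size_props[OF h] by simp
 have "3 <= 1 / h" using h0 h3 by (simp add: field_simps)
 then have n3: "n \<ge> 3" unfolding n_def by linarith
 have Kb: "0 <= K $ i" "K $ i < n" for i using K by (auto simp: cells_def n_def)
 have mods: "(k + 1) mod n ~= k" "(k - 1) mod n ~= k" "(k + 1) mod n ~= (k - 1) mod n" if "0 <= k" "k < n" for k
 proof -
  have a: "(k + 1) mod n = (if k + 1 = n then 0 else k + 1)" using that by auto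
  have b: "(k - 1) mod n = (if k = 0 then n - 1 else k - 1)" using that n3  by (auto simp: zmod_minus1)
  show "(k + 1) mod n ~= k" "(k - 1) mod n ~= k" "(k + 1) mod n ~= (k - 1) mod n" unfolding a b using n3 that by auto
 qed
 have nx: "next_cell h s K $ i = (if i = s then (K $ i + 1) mod n else K $ i)" for s i using Kb[of i] by (simp add: next_cell_def n_def axis_def)
 have px: "prev_cell h s K $ i = (if i = s then (K $ i - 1) mod n else K $ i)" for s i using Kb[of i] by (simp add: prev_cell_def n_def axis_def)
 have i1: "inj (%s. next_cell h s K)" by (rule injI) (metis nx mods(1) Kb)
 have i2: "inj (%s. prev_cell h s K)" by (rule injI) (metis px mods(2) Kb)
 have i3: "range (%s. next_cell h s K) \<inter> range (%s. prev_cell h s K) = {}"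
 proof -
  have "next_cell h s K ~= prev_cell h s' K" for s s'
  proof
   assume "next_cell h s K = prev_cell h s' K"
   then have "next_cell h s K $ s = prev_cell h s' K $ s" by simp
   then show False using mods[OF Kb, of s] by (auto simp: nx px split: if_splits)
  qed
  then show ?thesis by blast
 qed
 show ?thesis unfolding neighbours_def using i3 by (subst sum.union_disjoint) (auto simp: sum.reindex[OF i1] sum.reindex[OF i2] sum.distrib)
qed

lemma sum_div_h_zero:
 assumes h: "h : mesh_sizes" shows "(\<Sum>K\<in>cells h. div_h h g K) = 0"
proof -
 have "(\<Sum>K\<in>cells h. g (next_cell h s K) $ s) = (\<Sum>K\<in>cells h. g K $ s)"
    "(\<Sum>K\<in>cells h. g (prev_cell h s K) $ s) = (\<Sum>K\<in>cells h. g K $ s)" for s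
  using sum.reindex_bij_betw[OF bij_next_cell[OF h], of "%K. g K $ s" s]
   sum.reindex_bij_betw[OF bij_prev_cell[OF h], of "%K. g K $ s" s] by auto
 then show ?thesis unfolding div_h_def by (subst sum.swap) (simp add: sum_divide_distrib[symmetric] sum_subtractf)
qed

lemma face_speed_sym: "face_speed v \<gamma> h U K L = face_speed v \<gamma> h U L K" by (cases v) (auto simp: max.commute)

lemma sum_diffusion_zero:
 fixes g :: "'n::finite cell => real"
 assumes h: "h : mesh_sizes" shows "(\<Sum>K\<in>cells h. diffusion_h h (face_speed v \<gamma> h U) g K) = 0"
proof -
 let ?F = "%K L. if L : neighbours h K then face_speed v \<gamma> h U K L * (g L - g K) else 0"
 have eq: "(\<Sum>L\<in>neighbours h K. face_speed v \<gamma> h U K L *\<^sub>R (g L - g K)) = (\<Sum>L\<in>cells h. ?F K L)" if "K : cells h" for K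
  using neighbours_subset[OF h, of K] finite_cells[of h, where 'n='n] by (simp add: sum.If_cases Int_absorb1)
 define S where "S = (\<Sum>K\<in>cells h. \<Sum>L\<in>cells h. ?F K L)"
 have "S = (\<Sum>L\<in>cells h. \<Sum>K\<in>cells h. ?F K L)" unfolding S_def by (rule sum.swap)
 also have "... = (\<Sum>L\<in>cells h. \<Sum>K\<in>cells h. - ?F L K)"
  by (intro sum.cong refl) (auto simp: neighbours_sym face_speed_sym[of v \<gamma> h U] algebra_simps)
 also have "... = - S" unfolding S_def by (simp only: sum_negf)
 finally have "S = 0" by simp
 moreover have "S = (\<Sum>K\<in>cells h. \<Sum>L\<in>neighbours h K. face_speed v \<gamma> h U K L *\<^sub>R (g L - g K))"
  unfolding S_def by (intro sum.cong refl eq[symmetric])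
 ultimately show ?thesis unfolding diffusion_h_def by (simp add: sum_divide_distrib[symmetric])
qed

section \<open>Minimum entropy principle and energy conservation for the schemes\<close>

definition entropy_fun :: "real => 'n::finite state => real" where
 "entropy_fun \<gamma> U = internal_energy U / dens U powr \<gamma>"

text \<open>
  The linear functional of \<open>V\<close> proportional to the differential at \<open>W\<close> of \<^term>\<open>entropy_fun\<close>; \<open>ent_flux\<close>
  is the same combination of the fluxes.
\<close>
definition ent_dual :: "real => 'n::finite state => 'n state => real" where
 "ent_dual \<gamma> W V = ((norm (velocity W))^2 / 2 - \<gamma> / (\<gamma> - 1) * (pressure \<gamma> W / dens W)) * dens V
   - velocity W \<bullet> mom V + ener V"

definition ent_flux :: "real => 'n::finite state => 'n => 'n state => real" where
 "ent_flux \<gamma> W s V = ((norm (velocity W))^2 / 2 - \<gamma> / (\<gamma> - 1) * (pressure \<gamma> W / dens W)) * mom V $ s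
   - velocity W \<bullet> column s (convective_flux V + mat (pressure \<gamma> V)) + energy_flux \<gamma> V $ s"

lemma mom_eq_velocity: "dens V ~= 0 ==> mom V = dens V *\<^sub>R velocity V" by (simp add: velocity_def)

lemma ener_eq:
 assumes "dens V ~= 0" "\<gamma> ~= 1" shows "ener V = dens V * (norm (velocity V))^2 / 2 + pressure \<gamma> V / (\<gamma> - 1)"
proof -
 have "dens V * (norm (velocity V))^2 = (norm (mom V))^2 / dens V" using assms by (simp add: velocity_def power_mult_distrib field_simps power2_eq_square)
 then show ?thesis using assms by (simp add: pressure_def internal_energy_def)
qed

lemma ent_dual_self:
 assumes g: "\<gamma> > 1" and W: "dens W > 0" shows "ent_dual \<gamma> W W = - pressure \<gamma> W"
proof -
 have e: "ener W = dens W * (norm (velocity W))^2 / 2 + pressure \<gamma> W / (\<gamma> - 1)" using ener_eq[of W \<gamma>] W g by simp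
 have "velocity W \<bullet> mom W = dens W * (norm (velocity W))^2" by (subst mom_eq_velocity) (use W in \<open>auto simp: power2_norm_eq_inner\<close>)
 then have "ent_dual \<gamma> W W = pressure \<gamma> W / (\<gamma> - 1) - \<gamma> / (\<gamma> - 1) * ((pressure \<gamma> W / dens W) * dens W)"
  unfolding ent_dual_def e
 proof -
  fix n d P c q x :: real
  assume x: "x = d * n"
  show "(n / 2 - c * q) * d - x + (d * n / 2 + P) = P - c * (q * d)" unfolding x by (simp add: algebra_simps)
 qed
 also have "(pressure \<gamma> W / dens W) * dens W = pressure \<gamma> W" using W by simp
 also have "pressure \<gamma> W / (\<gamma> - 1) - \<gamma> / (\<gamma> - 1) * pressure \<gamma> W = (1 - \<gamma>) / (\<gamma> - 1) * pressure \<gamma> W"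
  by (simp add: diff_divide_distrib left_diff_distrib)
 also have "(1 - \<gamma>) / (\<gamma> - 1) = -1" using g by (simp add: field_simps)
 finally show ?thesis by simp
qed

text \<open>
  The gap of the frozen functional is a kinetic part plus the thermal gap of \<open>entropy_gap\<close>, in
  particular it is nonnegative for states of larger entropy.
\<close>
lemma ent_dual_diff:
 assumes g: "\<gamma> > 1" and V: "dens V > 0" and W: "dens W > 0" shows "ent_dual \<gamma> W V - ent_dual \<gamma> W W =
   dens V * (norm (velocity V - velocity W))^2 / 2 +
   (pressure \<gamma> V / (\<gamma> - 1) - \<gamma> / (\<gamma> - 1) * (pressure \<gamma> W / dens W) * dens V + pressure \<gamma> W)"
proof -
 let ?u = "velocity V" and ?w = "velocity W"
 have n: "(norm (?u - ?w))^2 = (norm ?u)^2 - 2 * (?w \<bullet> ?u) + (norm ?w)^2" by (simp add: power2_norm_eq_inner inner_diff inner_commute)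
 have dd: "ent_dual \<gamma> W X = dens X * ((norm ?w)^2 / 2 - ?w \<bullet> velocity X + (norm (velocity X))^2 / 2)
   + pressure \<gamma> X / (\<gamma> - 1) - \<gamma> / (\<gamma> - 1) * (pressure \<gamma> W / dens W) * dens X" if "dens X > 0" for X
 proof -
  have "ener X = dens X * (norm (velocity X))^2 / 2 + pressure \<gamma> X / (\<gamma> - 1)" using ener_eq[of X \<gamma>] that g by simp
  moreover have "?w \<bullet> mom X = dens X * (?w \<bullet> velocity X)" using mom_eq_velocity[of X] that by (metis inner_scaleR_right less_irrefl)
  ultimately show ?thesis unfolding ent_dual_def by (simp add: algebra_simps)
 qed
 note ent_dual_self[OF g W]
 moreover have "dens V * (norm (?u - ?w))^2 / 2 = dens V * ((norm ?w)^2 / 2 - ?w \<bullet> ?u + (norm ?u)^2 / 2)"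
  unfolding n by (simp add: algebra_simps add_divide_distrib diff_divide_distrib)
 ultimately show ?thesis using dd[OF V] by linarith
qed

lemma inner_mat_column: "(a::real^'n) \<bullet> column s (mat p) = p * a $ s"
proof -
 have "column s (mat p) = p *\<^sub>R (axis s 1 :: real^'n)" by (simp add: vec_eq_iff column_def mat_def axis_def)
 then show ?thesis by (simp add: inner_axis)
qed

lemma column_add: "column s (A + B) = column s A + column s B" by (simp add: vec_eq_iff column_def)

lemma column_convective: "column s (convective_flux V) = velocity V $ s *\<^sub>R mom V"
 by (simp add: vec_eq_iff column_def convective_flux_def outer_def velocity_def)

lemma ent_flux_eq:
 assumes g: "\<gamma> > 1" and V: "dens V > 0"
 shows "ent_flux \<gamma> W s V = velocity V $ s * ent_dual \<gamma> W V + pressure \<gamma> V * (velocity V $ s - velocity W $ s)"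
proof -
 have "mom V $ s = dens V * velocity V $ s" using V by (simp add: velocity_def)
 then show ?thesis unfolding ent_flux_def ent_dual_def column_add inner_add_right inner_mat_column column_convective
   energy_flux_def inner_scaleR_right vector_scaleR_component by (simp add: algebra_simps)
qed

lemma ent_flux_diff_bound:
 assumes g: "\<gamma> > 1" and V: "dens V > 0" "pressure \<gamma> V > 0" and W: "dens W > 0" "pressure \<gamma> W > 0"
  and ent: "entropy_fun \<gamma> W <= entropy_fun \<gamma> V" and lam: "max_char_speed \<gamma> V <= lam" "max_char_speed \<gamma> W <= lam"
 shows "\<bar>ent_flux \<gamma> W s V - ent_flux \<gamma> W s W\<bar> <= 2 * lam * (ent_dual \<gamma> W V - ent_dual \<gamma> W W)"
proof -
 define A where "A = ent_dual \<gamma> W V - ent_dual \<gamma> W W"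
 let ?v = "velocity V $ s" and ?w = "velocity W $ s"
 note dWW = ent_dual_self[OF g W(1)]
 have eq: "ent_flux \<gamma> W s V - ent_flux \<gamma> W s W = ?v * A + (pressure \<gamma> V - pressure \<gamma> W) * (?v - ?w)"
  unfolding ent_flux_eq[OF g V(1)] ent_flux_eq[OF g W(1)] A_def dWW by (simp add: algebra_simps)
 have "pressure \<gamma> W / dens W powr \<gamma> <= pressure \<gamma> V / dens V powr \<gamma>"
  using mult_left_mono[OF ent, of "\<gamma> - 1"] g by (simp add: entropy_fun_def pressure_def)
 moreover have "\<bar>?v\<bar> + sqrt (\<gamma> * pressure \<gamma> V / dens V) <= lam"
  using lam component_le_norm_cart[of "velocity V" s] by (simp add: max_char_speed_def)
 moreover have "\<bar>?w\<bar> + sqrt (\<gamma> * pressure \<gamma> W / dens W) <= lam"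
  using lam component_le_norm_cart[of "velocity W" s] by (simp add: max_char_speed_def)
 moreover have "dens V * (?v - ?w)^2 / 2 +
   (pressure \<gamma> V / (\<gamma> - 1) - \<gamma> / (\<gamma> - 1) * (pressure \<gamma> W / dens W) * dens V + pressure \<gamma> W) <= A"
 proof -
  have "\<bar>?v - ?w\<bar> <= norm (velocity V - velocity W)" using component_le_norm_cart[of "velocity V - velocity W" s] by simp
  then have "(?v - ?w)^2 <= (norm (velocity V - velocity W))^2" by (metis abs_le_square_iff abs_norm_cancel)
  then have "dens V * (?v - ?w)^2 / 2 <= dens V * (norm (velocity V - velocity W))^2 / 2" using V by (intro divide_right_mono mult_left_mono) auto
  then show ?thesis unfolding A_def ent_dual_diff[OF g V(1) W(1)] by simp
 qed
 ultimately show ?thesis unfolding eq A_def[symmetric] by (intro flux_dominated_by_diffusion[OF g V W])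
qed

lemma max_char_le_face_speed:
 fixes U :: "'n::finite cell => 'n state"
 assumes "K : cells h" "L : cells h"
 shows "max_char_speed \<gamma> (U K) <= face_speed v \<gamma> h U K L" "max_char_speed \<gamma> (U L) <= face_speed v \<gamma> h U K L"
 using assms finite_cells[of h, where 'n='n] by (cases v; auto)+

text \<open>
  At a cell of minimal entropy each face contributes the diffusive term \<open>lam\<close> times the gap of the
  neighbour minus half a flux difference, which is nonnegative by \<open>ent_flux_diff_bound\<close>. Both the local
  and the global speed are admissible, since they dominate the characteristic speeds of both cells.
\<close>
lemma entropy_production_nonneg:
 fixes U :: "'n::finite cell => 'n state" and v :: lf_variant
 assumes g: "\<gamma> > 1" and h: "h : mesh_sizes" "h <= 1 / 3" and K: "K : cells h"
  and pos: "!!L. L : cells h ==> dens (U L) > 0 & pressure \<gamma> (U L) > 0"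
  and min: "!!L. L : cells h ==> entropy_fun \<gamma> (U K) <= entropy_fun \<gamma> (U L)"
 defines "lam \<equiv> face_speed v \<gamma> h U" shows "0 <= ent_dual \<gamma> (U K)
   (- div_h h (%L. mom (U L)) K + diffusion_h h lam (%L. dens (U L)) K,
    - mat_div_h h (%L. convective_flux (U L) + mat (pressure \<gamma> (U L))) K + diffusion_h h lam (%L. mom (U L)) K,
    - div_h h (%L. energy_flux \<gamma> (U L)) K + diffusion_h h lam (%L. ener (U L)) K)"
  (is "0 <= ent_dual \<gamma> (U K) ?R")
proof -
 define w where "w = velocity (U K)"
 define b where "b = (norm w)^2 / 2 - \<gamma> / (\<gamma> - 1) * (pressure \<gamma> (U K) / dens (U K))"
 define F where "F = (%s L. ent_flux \<gamma> (U K) s (U L))"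
 define A where "A = (%L. ent_dual \<gamma> (U K) (U L) - ent_dual \<gamma> (U K) (U K))"
 have h0: "h > 0" using mesh_size_props[OF h(1)] by simp
 have "ent_dual \<gamma> (U K) ?R =
   - (\<Sum>s. (F s (next_cell h s K) - F s (prev_cell h s K)) / (2 * h))
   + 1 / h * (\<Sum>L\<in>neighbours h K. lam K L * A L)"
 proof -
  have 1: "b * div_h h (%L. mom (U L)) K - w \<bullet> mat_div_h h (%L. convective_flux (U L) + mat (pressure \<gamma> (U L))) K
    + div_h h (%L. energy_flux \<gamma> (U L)) K = (\<Sum>s. (F s (next_cell h s K) - F s (prev_cell h s K)) / (2 * h))"
   unfolding div_h_def mat_div_h_def inner_sum_right sum_distrib_left sum_subtractf[symmetric] sum.distrib[symmetric]
  proof (rule sum.cong[OF refl], goal_cases)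
   case (1 s)
   have *: "w \<bullet> ((c1 - c2) /\<^sub>R H) = (w \<bullet> c1 - w \<bullet> c2) / H" for c1 c2 H by (simp add: inner_diff_right divide_inverse mult.commute)
   have **: "b * ((m1 - m2) / H) - (w1 - w2) / H + (e1 - e2) / H
     = ((b * m1 - w1 + e1) - (b * m2 - w2 + e2)) / H" for m1 m2 w1 w2 e1 e2 H :: real by (simp add: add_divide_distrib diff_divide_distrib right_diff_distrib)
   show ?case unfolding F_def ent_flux_def b_def[symmetric] w_def[symmetric] * by (rule **)
  qed
  have 2: "b * diffusion_h h lam (%L. dens (U L)) K - w \<bullet> diffusion_h h lam (%L. mom (U L)) K
    + diffusion_h h lam (%L. ener (U L)) K = 1 / h * (\<Sum>L\<in>neighbours h K. lam K L * A L)"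
  proof -
   have "(\<Sum>L\<in>neighbours h K. lam K L * A L) = b * (\<Sum>L\<in>neighbours h K. lam K L * (dens (U L) - dens (U K)))
     - w \<bullet> (\<Sum>L\<in>neighbours h K. lam K L *\<^sub>R (mom (U L) - mom (U K)))
     + (\<Sum>L\<in>neighbours h K. lam K L * (ener (U L) - ener (U K)))"
    unfolding inner_sum_right sum_distrib_left sum_subtractf[symmetric] sum.distrib[symmetric]
   proof (rule sum.cong[OF refl], goal_cases)
    case (1 L)
    show ?case unfolding A_def ent_dual_def b_def[symmetric] w_def[symmetric] by (simp add: inner_diff_right algebra_simps)
   qed
   then show ?thesis unfolding diffusion_h_def by (simp add: inner_scaleR_right diff_divide_distrib add_divide_distrib)
  qed
  have "ent_dual \<gamma> (U K) ?R = - (b * div_h h (%L. mom (U L)) K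
     - w \<bullet> mat_div_h h (%L. convective_flux (U L) + mat (pressure \<gamma> (U L))) K + div_h h (%L. energy_flux \<gamma> (U L)) K)
    + (b * diffusion_h h lam (%L. dens (U L)) K - w \<bullet> diffusion_h h lam (%L. mom (U L)) K
    + diffusion_h h lam (%L. ener (U L)) K)" unfolding ent_dual_def b_def[symmetric] w_def[symmetric]
   by (simp add: dens_def mom_def ener_def inner_add_right inner_diff_right algebra_simps)
  then show ?thesis unfolding 1 2 by simp
 qed
 also have "... = (\<Sum>s\<in>UNIV.
   ((lam K (next_cell h s K) * A (next_cell h s K) - (F s (next_cell h s K) - F s K) / 2)
   + (lam K (prev_cell h s K) * A (prev_cell h s K) + (F s (prev_cell h s K) - F s K) / 2)) / h)"
  unfolding sum_neighbours[OF h K] sum_negf[symmetric] sum_distrib_left sum.distrib[symmetric]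
 proof (rule sum.cong[OF refl], goal_cases)
  case (1 s)
  have *: "- ((x - y) / (2 * h)) + 1 / h * (p + q) = ((p - (x - z) / 2) + (q + (y - z) / 2)) / h" for x y z p q :: real using h0 by (simp add: field_simps)
  show ?case by (rule *)
 qed
 also have "... \<ge> 0"
 proof (rule sum_nonneg)
  fix s
  have half: "x <= 2 * y ==> 0 <= y - x / 2" "- x <= 2 * y ==> 0 <= y + x / 2" for x y :: real by linarith+
  have bd: "\<bar>F s L - F s K\<bar> <= 2 * (lam K L * A L)" if L: "L : cells h" for L unfolding F_def A_def mult.assoc[symmetric]
   using pos[OF L] pos[OF K] min[OF L] max_char_le_face_speed[OF K L, where U=U and \<gamma>=\<gamma> and v=v]
   by (intro ent_flux_diff_bound[OF g]) (auto simp: lam_def)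
  have n: "0 <= lam K (next_cell h s K) * A (next_cell h s K) - (F s (next_cell h s K) - F s K) / 2"
   using abs_le_D1[OF bd[OF next_prev_in_cells(1)[OF h(1)], of s K]] by (rule half(1))
  have p: "0 <= lam K (prev_cell h s K) * A (prev_cell h s K) + (F s (prev_cell h s K) - F s K) / 2"
   using abs_le_D2[OF bd[OF next_prev_in_cells(2)[OF h(1)], of s K]] by (rule half(2))
  show "0 <= ((lam K (next_cell h s K) * A (next_cell h s K) - (F s (next_cell h s K) - F s K) / 2)
   + (lam K (prev_cell h s K) * A (prev_cell h s K) + (F s (prev_cell h s K) - F s K) / 2)) / h" by (rule divide_nonneg_pos[OF add_nonneg_nonneg[OF n p] h0])
 qed
 finally show ?thesis .
qed

lemma continuous_on_state_parts:
 fixes U :: "'a::topological_space => 'n::finite state"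
 assumes "continuous_on S U" shows "continuous_on S (%t. dens (U t))" "continuous_on S (%t. mom (U t))" "continuous_on S (%t. ener (U t))"
 unfolding dens_def mom_def ener_def by (intro continuous_intros assms)+

text \<open>
  Positivity of the pressure is not presupposed: the barrier argument sees the sign of the derivative
  only where the minimal entropy is positive, and then all pressures are positive.
\<close>
theorem minimum_entropy_principle:
 fixes U :: "real => 'n::finite cell => 'n state"
 assumes g: "\<gamma> > 1" and T: "T > 0" and h: "h : mesh_sizes" "h <= 1 / 3" and sol: "lax_friedrichs_solution v \<gamma> T h \<rho>0 m0 E0 U"
  and kap: "\<kappa> > 0" and init: "!!K. K : cells h ==> entropy_fun \<gamma> (U 0 K) \<ge> \<kappa>" and t: "t : {0..T}" and K: "K : cells h"
 shows "entropy_fun \<gamma> (U t K) \<ge> \<kappa>"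
proof (rule min_principle_barrier[where a="%t K. entropy_fun \<gamma> (U t K)" and I="cells h", OF finite_cells T kap])
 have dpos: "dens (U t K) > 0" if "t : {0..T}" "K : cells h" for t K using sol that by (auto simp: lax_friedrichs_solution_def)
 show "continuous_on {0..T} (%t. entropy_fun \<gamma> (U t k))" if k: "k : cells h" for k
 proof -
  have "continuous_on {0..T} (%t. U t k)" using sol k by (auto simp: lax_friedrichs_solution_def)
  note c = continuous_on_state_parts[OF this]
  show ?thesis unfolding entropy_fun_def internal_energy_def by (intro continuous_intros c) (use dpos k in \<open>force+\<close>)
 qed
 show "\<exists>d\<ge>0. ((%t. entropy_fun \<gamma> (U t k)) has_real_derivative d) (at t)"
  if tT: "0 < t" "t < T" and k: "k : cells h" and ep: "entropy_fun \<gamma> (U t k) > 0"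
   and mn: "!!l. l : cells h ==> entropy_fun \<gamma> (U t k) <= entropy_fun \<gamma> (U t l)" for t k
 proof -
  have t: "t : {0..T}" using tT by simp
  have pos: "dens (U t l) > 0 & pressure \<gamma> (U t l) > 0" if l: "l : cells h" for l
  proof -
   have "0 < internal_energy (U t l) / dens (U t l) powr \<gamma>" using ep mn[OF l] by (simp add: entropy_fun_def)
   then show ?thesis using dpos[OF t l] g by (simp add: zero_less_divide_iff pressure_def)
  qed
  let ?lam = "face_speed v \<gamma> h (U t)"
  define r' where "r' = - div_h h (%L. mom (U t L)) k + diffusion_h h ?lam (%L. dens (U t L)) k"
  define m' where "m' = - mat_div_h h (%L. convective_flux (U t L) + mat (pressure \<gamma> (U t L))) k + diffusion_h h ?lam (%L. mom (U t L)) k"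
  define e' where "e' = - div_h h (%L. energy_flux \<gamma> (U t L)) k + diffusion_h h ?lam (%L. ener (U t L)) k"
  have dual: "0 <= ent_dual \<gamma> (U t k) (r', m', e')" unfolding r'_def m'_def e'_def by (rule entropy_production_nonneg[where U="U t", OF g h k pos mn])
  have der: "((%t. dens (U t k)) has_vector_derivative r') (at t)"
   "((%t. mom (U t k)) has_vector_derivative m') (at t)"
   "((%t. ener (U t k)) has_vector_derivative e') (at t)" using sol k tT unfolding lax_friedrichs_solution_def Let_def r'_def m'_def e'_def by auto
  define r where "r = dens (U t k)"
  define e where "e = internal_energy (U t k)"
  have r: "r > 0" using pos[OF k] by (simp add: r_def)
  have dr: "((%t. dens (U t k)) has_real_derivative r') (at t)" and de: "((%t. ener (U t k)) has_real_derivative e') (at t)"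
   using der by (auto simp: has_real_derivative_iff_has_vector_derivative)
  have "((%t. mom (U t k) \<bullet> mom (U t k)) has_derivative
    (%x. mom (U t k) \<bullet> (x *\<^sub>R m') + (x *\<^sub>R m') \<bullet> mom (U t k))) (at t)"
   using der(2) unfolding has_vector_derivative_def by (intro has_derivative_inner)
  then have "((%t. mom (U t k) \<bullet> mom (U t k)) has_derivative (%x. x * (2 * (mom (U t k) \<bullet> m')))) (at t)"
   by (rule has_derivative_eq_rhs) (auto simp: inner_commute algebra_simps)
  then have dm: "((%t. (norm (mom (U t k)))^2) has_real_derivative 2 * (mom (U t k) \<bullet> m')) (at t)"
   unfolding power2_norm_eq_inner has_field_derivative_def by (simp add: mult_commute_abs)
  define M where "M = (norm (mom (U t k)))^2"
  define d where "d = (e' - ((2 * (mom (U t k) \<bullet> m')) * r - M * r') / (r * r) / 2 - \<gamma> * e / r * r') / r powr \<gamma>"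
  have dint: "((%t. internal_energy (U t k)) has_real_derivative
    (e' - ((2 * (mom (U t k) \<bullet> m')) * r - M * r') / (r * r) / 2)) (at t)" unfolding internal_energy_def r_def M_def
   by (intro DERIV_diff de DERIV_cdivide DERIV_divide dm dr) (use r in \<open>simp add: r_def\<close>)
  have dpow: "((%t. dens (U t k) powr \<gamma>) has_real_derivative (\<gamma> * r powr (\<gamma> - 1) * r')) (at t)"
   using DERIV_fun_powr[OF dr, of \<gamma>] r by (simp add: r_def)
  have "((%t. entropy_fun \<gamma> (U t k)) has_real_derivative
    ((e' - ((2 * (mom (U t k) \<bullet> m')) * r - M * r') / (r * r) / 2) * r powr \<gamma> - e * (\<gamma> * r powr (\<gamma> - 1) * r')) / (r powr \<gamma> * r powr \<gamma>)) (at t)"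
   unfolding entropy_fun_def e_def using DERIV_divide[OF dint dpow] r by (simp add: r_def)
  moreover have "((e' - ((2 * (mom (U t k) \<bullet> m')) * r - M * r') / (r * r) / 2) * r powr \<gamma> - e * (\<gamma> * r powr (\<gamma> - 1) * r')) / (r powr \<gamma> * r powr \<gamma>) = d"
  proof -
   have pw: "r powr (\<gamma> - 1) = r powr \<gamma> / r" using r by (simp add: powr_diff)
   have *: "(X * P - e * (\<gamma> * (P / r) * r')) / (P * P) = (X - \<gamma> * e / r * r') / P" if "P > 0" for X P using that r by (simp add: field_simps)
   show ?thesis unfolding pw d_def by (rule *) (use r in simp)
  qed
  moreover have "d = ent_dual \<gamma> (U t k) (r', m', e') / r powr \<gamma>"
  proof -
   have v2: "(norm (velocity (U t k)))^2 = M / r^2" using r by (simp add: velocity_def M_def r_def power_mult_distrib power_inverse divide_inverse)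
   have vm: "velocity (U t k) \<bullet> m' = (mom (U t k) \<bullet> m') / r" by (simp add: velocity_def r_def divide_inverse mult.commute)
   have H: "\<gamma> / (\<gamma> - 1) * (pressure \<gamma> (U t k) / dens (U t k)) = \<gamma> * e / r" using g by (simp add: pressure_def e_def r_def)
   have "ent_dual \<gamma> (U t k) (r', m', e') = (M / r^2 / 2 - \<gamma> * e / r) * r' - (mom (U t k) \<bullet> m') / r + e'"
    unfolding ent_dual_def v2 vm H by (simp add: dens_def mom_def ener_def vm[unfolded mom_def])
   also have "... = e' - ((2 * (mom (U t k) \<bullet> m')) * r - M * r') / (r * r) / 2 - \<gamma> * e / r * r'"
    using r by (simp add: power2_eq_square field_simps)
   finally show ?thesis by (simp add: d_def)
  qed
  moreover have "ent_dual \<gamma> (U t k) (r', m', e') / r powr \<gamma> \<ge> 0" using dual by simp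
  ultimately show ?thesis by auto
 qed
qed (use init t K in auto)

text \<open>
  Centred differences and symmetric diffusion have zero sum over the periodic cells.
\<close>
lemma total_energy_conserved:
 fixes U :: "real => 'n::finite cell => 'n state"
 assumes T: "T > 0" and h: "h : mesh_sizes" and sol: "lax_friedrichs_solution v \<gamma> T h \<rho>0 m0 E0 U" and t: "t : {0..T}"
 shows "(\<Sum>K\<in>cells h. ener (U t K)) = (\<Sum>K\<in>cells h. ener (U 0 K))"
proof (rule DERIV_isconst2[OF T])
 show "continuous_on {0..T} (%t. \<Sum>K\<in>cells h. ener (U t K))"
  using sol by (intro continuous_on_sum continuous_on_state_parts) (auto simp: lax_friedrichs_solution_def)
 fix x assume x: "0 < x" "x < T"
 let ?d = "%K. - div_h h (%L. energy_flux \<gamma> (U x L)) K + diffusion_h h (face_speed v \<gamma> h (U x)) (%L. ener (U x L)) K"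
 have "((%t. \<Sum>K\<in>cells h. ener (U t K)) has_real_derivative (\<Sum>K\<in>cells h. ?d K)) (at x)" unfolding has_real_derivative_iff_has_vector_derivative
  using sol x by (intro has_vector_derivative_sum) (auto simp: lax_friedrichs_solution_def Let_def)
 moreover have "(\<Sum>K\<in>cells h. ?d K) = 0" by (simp add: sum.distrib sum_subtractf sum_div_h_zero[OF h] sum_diffusion_zero[OF h])
 ultimately show "((%t. \<Sum>K\<in>cells h. ener (U t K)) has_real_derivative 0) (at x)" by simp
qed (use t in auto)

section \<open>Lebesgue measure on the torus and on space-time\<close>

lemma AE_lebesgue_on_iff:
 fixes S :: "'a::euclidean_space set"
 assumes "S : sets borel" shows "(AE x in lebesgue_on S. P x) \<longleftrightarrow> (AE x in lborel. x : S --> P x)"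
 using assms by (subst AE_restrict_space_iff) (auto simp: AE_completion_iff)

lemma measurable_lebesgue_on_borel:
 assumes "f : borel_measurable (restrict_space borel S)" shows "f : borel_measurable (lebesgue_on S)"
proof (rule measurableI)
 fix A assume A: "A : sets (borel :: 'b measure)"
 have "f -` A \<inter> space (restrict_space borel S) : sets (restrict_space borel S)" using assms A by (rule measurable_sets)
 then obtain X where X: "X : sets borel" "f -` A \<inter> S = S \<inter> X" by (auto simp: sets_restrict_space space_restrict_space)
 then have "X : sets lebesgue" by auto
 then show "f -` A \<inter> space (lebesgue_on S) : sets (lebesgue_on S)" using X(2) by (auto simp: sets_restrict_space space_restrict_space)
qed simp

text \<open>
  Product measures are available for Borel measures only; Lebesgue measurable functions are reduced to
  Borel functions equal to them almost everywhere.
\<close>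
lemma lebesgue_on_borel_representative:
 fixes f :: "'a::euclidean_space => real"
 assumes S: "S : sets borel" and f: "f : borel_measurable (lebesgue_on S)"
 obtains g where "g : borel_measurable borel" "AE x in lborel. (if x : S then f x else 0) = g x"
proof -
 have "(%x. if x : S then f x else 0) : borel_measurable lebesgue" using f S borel_measurable_if[of S f] by auto
 from completion_ex_borel_measurable_real[OF this] show ?thesis using that by auto
qed

lemma
 fixes f :: "'a::euclidean_space => 'b::{banach, second_countable_topology}"
 assumes "integrable lborel f" shows integrable_lborel_imp_lebesgue: "integrable lebesgue f"
  and integral_lborel_eq_lebesgue: "integral\<^sup>L lebesgue f = integral\<^sup>L lborel f"
 using integrable_completion[of f lborel] integral_completion[of f lborel] assms borel_measurable_integrable[OF assms] by blast+

lemma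
 fixes f :: "'a::euclidean_space \<times> 'b::euclidean_space => real"
 assumes I: "I : sets borel" and B: "B : sets borel" and f: "integrable (lebesgue_on (I \<times> B)) f"
 shows AE_integrable_slice: "AE t in lebesgue_on I. integrable (lebesgue_on B) (%x. f (t, x))"
  and integrable_slice_integral: "integrable (lebesgue_on I) (%t. LINT x|lebesgue_on B. f (t, x))"
  and Fubini_lebesgue_on: "integral\<^sup>L (lebesgue_on (I \<times> B)) f = (LINT t|lebesgue_on I. LINT x|lebesgue_on B. f (t, x))"
proof -
 have IB: "I \<times> B : sets borel" using I B by (metis borel_prod pair_measureI)
 let ?F = "%z. if z : I \<times> B then f z else 0"
 obtain g where g[measurable]: "g : borel_measurable borel" and ae: "AE z in lborel. ?F z = g z"
  using lebesgue_on_borel_representative[OF IB borel_measurable_integrable[OF f]] by blast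
 have Fi: "integrable lebesgue ?F" by (rule Lebesgue_Measure.integrable_restrict_UNIV[THEN iffD2]) (use f IB in auto)
 have ae': "AE z in lebesgue. ?F z = g z" using ae by (simp add: AE_completion_iff)
 have gl: "g : borel_measurable lebesgue" using g by (intro measurable_completion) simp
 have gi: "integrable lebesgue g" by (rule integrable_cong_AE_imp[OF Fi gl ae'])
 then have gi2: "integrable lborel g" by (simp add: integrable_completion)
 have "integral\<^sup>L (lebesgue_on (I \<times> B)) f = integral\<^sup>L lebesgue ?F" using IB by (subst Lebesgue_Measure.integral_restrict_UNIV) auto
 also have "... = integral\<^sup>L lebesgue g" by (rule integral_cong_AE) (use Fi gi ae' in \<open>auto intro: borel_measurable_integrable\<close>)
 finally have int1: "integral\<^sup>L (lebesgue_on (I \<times> B)) f = integral\<^sup>L lborel g" by (simp add: integral_completion)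
 have gp: "integrable (lborel \<Otimes>\<^sub>M lborel) g" using gi2 by (simp add: lborel_prod)
 have gm: "g : borel_measurable (lborel \<Otimes>\<^sub>M lborel)" using gp by auto
 have a1: "AE t in lborel. integrable lborel (%x. g (t, x))" by (rule lborel_pair.AE_integrable_fst'[OF gp])
 have a2: "AE t in lborel. AE x in lborel. ?F (t, x) = g (t, x)"
  by (rule lborel_pair.AE_pair[of "%z. ?F z = g z"]) (use ae in \<open>simp only: lborel_prod\<close>)
 have slice: "AE t in lborel. integrable lebesgue (%x. ?F (t, x)) & integral\<^sup>L lebesgue (%x. ?F (t, x)) = (LINT x|lborel. g (t, x))" using a1 a2
 proof eventually_elim
  case (elim t)
  have gt: "integrable lebesgue (%x. g (t, x))" by (rule integrable_lborel_imp_lebesgue[OF elim(1)])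
  have aet: "AE x in lebesgue. g (t, x) = ?F (t, x)" unfolding AE_completion_iff using elim(2) by eventually_elim (rule sym)
  have aet': "AE x in lebesgue. ?F (t, x) = g (t, x)" unfolding AE_completion_iff by (rule elim(2))
  have Fm: "(%x. ?F (t, x)) : borel_measurable lebesgue" by (rule borel_measurable_AE[OF borel_measurable_integrable[OF gt] aet])
  have "integrable lebesgue (%x. ?F (t, x))" by (rule integrable_cong_AE_imp[OF gt Fm aet])
  moreover have "integral\<^sup>L lebesgue (%x. ?F (t, x)) = integral\<^sup>L lebesgue (%x. g (t, x))"
   by (rule integral_cong_AE[OF Fm borel_measurable_integrable[OF gt] aet'])
  ultimately show ?case by (simp add: integral_lborel_eq_lebesgue[OF elim(1)])
 qed
 have conv: "integrable lebesgue (%x. ?F (t, x)) = integrable (lebesgue_on B) (%x. f (t, x))"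
   "integral\<^sup>L lebesgue (%x. ?F (t, x)) = (LINT x|lebesgue_on B. f (t, x))" if "t : I" for t
  using Lebesgue_Measure.integrable_restrict_UNIV[of B "%x. f (t, x)"] Lebesgue_Measure.integral_restrict_UNIV[of B "%x. f (t, x)"] B that by auto
 show "AE t in lebesgue_on I. integrable (lebesgue_on B) (%x. f (t, x))"
  unfolding AE_lebesgue_on_iff[OF I] using slice by eventually_elim (use conv(1) in blast)
 define G where "G = (%t. LINT x|lborel. g (t, x))"
 have Gi: "integrable lborel G" unfolding G_def by (rule lborel_pair.integrable_fst'[OF gp])
 then have Gi': "integrable lebesgue G" by (rule integrable_lborel_imp_lebesgue)
 have aeG: "AE t in lebesgue. G t = (if t : I then LINT x|lebesgue_on B. f (t, x) else 0)" unfolding AE_completion_iff using slice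
 proof eventually_elim
  case (elim t) then show ?case by (auto simp: G_def conv simp flip: conv(2))
 qed
 have Hm: "(%t. if t : I then LINT x|lebesgue_on B. f (t, x) else 0) : borel_measurable lebesgue"
  by (rule borel_measurable_AE[OF borel_measurable_integrable[OF Gi'] aeG])
 have Hi: "integrable lebesgue (%t. if t : I then LINT x|lebesgue_on B. f (t, x) else 0)" by (rule integrable_cong_AE_imp[OF Gi' Hm aeG])
 then show "integrable (lebesgue_on I) (%t. LINT x|lebesgue_on B. f (t, x))" using I by (subst (asm) Lebesgue_Measure.integrable_restrict_UNIV) auto
 have "(LINT t|lebesgue_on I. LINT x|lebesgue_on B. f (t, x)) = integral\<^sup>L lebesgue G"
 proof (subst Lebesgue_Measure.integral_restrict_UNIV[symmetric])
  show "(LINT t|lebesgue. (if t : I then LINT x|lebesgue_on B. f (t, x) else 0)) = integral\<^sup>L lebesgue G"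
  proof (rule integral_cong_AE[OF Hm borel_measurable_integrable[OF Gi']])
   from aeG show "AE t in lebesgue. (if t : I then LINT x|lebesgue_on B. f (t, x) else 0) = G t" by eventually_elim (rule sym)
  qed
 qed (use I in auto)
 also have "... = integral\<^sup>L lborel G" by (rule integral_lborel_eq_lebesgue[OF Gi])
 also have "... = integral\<^sup>L lborel g" unfolding G_def using lborel_pair.integral_fst'[OF gp] by (simp add: lborel_prod)
 finally show "integral\<^sup>L (lebesgue_on (I \<times> B)) f = (LINT t|lebesgue_on I. LINT x|lebesgue_on B. f (t, x))" using int1 by simp
qed

lemma Tonelli_integrable_lebesgue_on:
 fixes f :: "'a::euclidean_space \<times> 'b::euclidean_space => real"
 assumes I: "I : sets borel" and B: "B : sets borel" and f: "f : borel_measurable (lebesgue_on (I \<times> B))"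
  and sl: "AE t in lebesgue_on I. integrable (lebesgue_on B) (%x. f (t, x)) & (LINT x|lebesgue_on B. \<bar>f (t, x)\<bar>) <= b t"
  and b: "integrable (lebesgue_on I) b" shows "integrable (lebesgue_on (I \<times> B)) f"
proof -
 have IB: "I \<times> B : sets borel" using I B by (metis borel_prod pair_measureI)
 let ?F = "%z. if z : I \<times> B then f z else 0"
 have Fm: "?F : borel_measurable lebesgue" using f IB borel_measurable_if[of "I \<times> B" f] by auto
 obtain g where g: "g : borel_measurable borel" and ae: "AE z in lborel. ?F z = g z" using lebesgue_on_borel_representative[OF IB f] by blast
 have gm: "g : borel_measurable (lborel \<Otimes>\<^sub>M lborel)" using g by (simp add: lborel_prod)
 have a2: "AE t in lborel. AE x in lborel. ?F (t, x) = g (t, x)"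
  by (rule lborel_pair.AE_pair[of "%z. ?F z = g z"]) (use ae in \<open>simp only: lborel_prod\<close>)
 have gtm: "(%x. g (t, x)) : borel_measurable borel" for t
 proof -
  have "(%x. g (t, x)) : borel_measurable lborel" using gm by measurable
  then show ?thesis by simp
 qed
 have sl': "AE t in lborel. integrable lborel (%x. g (t, x)) \<and>
   (LINT x|lborel. norm (g (t, x))) <= (if t : I then b t else 0)" using a2 sl[unfolded AE_lebesgue_on_iff[OF I]]
 proof eventually_elim
  case (elim t)
  have aet: "AE x in lebesgue. ?F (t, x) = g (t, x)" using elim(1) by (simp add: AE_completion_iff)
  have gl: "(%x. g (t, x)) : borel_measurable lebesgue" using gtm[of t] by (simp add: measurable_completion)
  show ?case
  proof (cases "t : I")
   case True
   then have e: "integrable (lebesgue_on B) (%x. f (t, x))" "(LINT x|lebesgue_on B. \<bar>f (t, x)\<bar>) <= b t" using elim by auto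
   have Fi: "integrable lebesgue (%x. ?F (t, x))" using e(1) Lebesgue_Measure.integrable_restrict_UNIV[of B "%x. f (t, x)"] B True by auto
   then have gi: "integrable lebesgue (%x. g (t, x))" by (rule integrable_cong_AE_imp[OF _ gl aet])
   have "(LINT x|lborel. norm (g (t, x))) = (LINT x|lebesgue. \<bar>g (t, x)\<bar>)" using gtm by (subst integral_completion) auto
   also have "... = (LINT x|lebesgue. \<bar>?F (t, x)\<bar>)" by (rule integral_cong_AE) (use aet gl borel_measurable_integrable[OF Fi] in \<open>auto\<close>)
   also have "... = (LINT x|lebesgue. (if x : B then \<bar>f (t, x)\<bar> else 0))" using True by (auto intro!: lint_cong)
   also have "... = (LINT x|lebesgue_on B. \<bar>f (t, x)\<bar>)" using B by (subst Lebesgue_Measure.integral_restrict_UNIV) auto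
   finally show ?thesis using gi e(2) True gtm by (simp add: integrable_completion)
  next
   case False
   then have z: "AE x in lborel. g (t, x) = 0" using elim(1) by auto
   have "integrable lborel (%x. g (t, x))" using z gtm by (subst integrable_cong_AE[where g="%x. 0"]) auto
   moreover have "(LINT x|lborel. norm (g (t, x))) = 0" using z gtm by (subst integral_cong_AE[where g="%x. 0"]) auto
   ultimately show ?thesis using False by simp
  qed
 qed
 have bi: "integrable lebesgue (%t. if t : I then b t else 0)" using b I by (subst Lebesgue_Measure.integrable_restrict_UNIV) auto
 have "integrable (lborel \<Otimes>\<^sub>M lborel) g"
 proof (rule lborel_pair.Fubini_integrable[OF gm])
  have "integrable lebesgue (%t. LINT x|lborel. norm (g (t, x)))"
  proof (rule lint_bound[OF bi])
   have "(%t. LINT x|lborel. norm (g (t, x))) : borel_measurable lborel" by (rule lborel.borel_measurable_lebesgue_integral) (use gm in measurable)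
   then show "(%t. LINT x|lborel. norm (g (t, x))) : borel_measurable lebesgue" by (simp add: measurable_completion)
   show "AE t in lebesgue. norm (LINT x|lborel. norm (g (t, x))) <= norm (if t : I then b t else 0)" unfolding AE_completion_iff using sl'
   proof eventually_elim
    case (elim t)
    have "0 <= (LINT x|lborel. norm (g (t, x)))" by (rule integral_nonneg_AE) simp
    then show ?case using elim by auto
   qed
  qed
  moreover have "(%t. LINT x|lborel. norm (g (t, x))) : borel_measurable lborel" by (rule lborel.borel_measurable_lebesgue_integral) (use gm in measurable)
  ultimately show "integrable lborel (%t. LINT x|lborel. norm (g (t, x)))" by (simp add: integrable_completion)
  show "AE t in lborel. integrable lborel (%x. g (t, x))" using sl' by eventually_elim auto
 qed
 then have "integrable lebesgue g" using g by (simp add: lborel_prod integrable_completion)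
 then have "integrable lebesgue ?F"
 proof (rule integrable_cong_AE_imp[OF _ Fm])
  show "AE z in lebesgue. g z = ?F z" unfolding AE_completion_iff using ae by eventually_elim (rule sym)
 qed
 then show ?thesis using IB by (subst (asm) Lebesgue_Measure.integrable_restrict_UNIV) auto
qed

lemma torus_borel [measurable]: "(torus :: (real^'n) set) : sets borel"
proof -
 have "(torus :: (real^'n) set) = (\<Inter>i. {x. 0 <= x $ i} \<inter> {x. x $ i < 1})" by (auto simp: torus_def)
 also have "... : sets borel" by (intro sets.countable_INT'' sets.Int borel_closed borel_open closed_Collect_le open_Collect_less continuous_intros) auto
 finally show ?thesis .
qed

lemma cell_cube_borel [measurable]: "cell_cube h K : sets borel"
proof -
 have "cell_cube h K = (\<Inter>i. {x. h * of_int (K$i) <= x $ i} \<inter> {x. x $ i < h * (of_int (K$i) + 1)})" by (auto simp: cell_cube_def)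
 also have "... : sets borel" by (intro sets.countable_INT'' sets.Int borel_closed borel_open closed_Collect_le open_Collect_less continuous_intros) auto
 finally show ?thesis .
qed

lemma emeasure_half_open_cube:
 fixes a :: "real^'n"
 assumes l: "l \<ge> 0" and sub: "box a (a + (\<chi> i. l)) \<subseteq> C" "C \<subseteq> cbox a (a + (\<chi> i. l))" and C: "C : sets borel"
 shows "emeasure lborel C = ennreal (l ^ CARD('n))"
proof -
 have P: "(\<Prod>b\<in>Basis. (a + (\<chi> i. l) - a) \<bullet> b) = l ^ CARD('n)"
 proof -
  have "(\<Prod>b\<in>(Basis::(real^'n) set). (a + (\<chi> i. l) - a) \<bullet> b) = (\<Prod>b\<in>(Basis::(real^'n) set). l)"
   by (intro prod.cong refl) (auto simp: Basis_vec_def inner_axis)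
  then show ?thesis by simp
 qed
 have le: "a \<bullet> b <= (a + (\<chi> i. l)) \<bullet> b" if "b : Basis" for b using that l by (auto simp: Basis_vec_def inner_axis)
 have "emeasure lborel (box a (a + (\<chi> i. l))) = ennreal (l ^ CARD('n))" by (subst emeasure_lborel_box) (use le P in auto)
 moreover have "emeasure lborel (cbox a (a + (\<chi> i. l))) = ennreal (l ^ CARD('n))" by (subst emeasure_lborel_cbox) (use le P in auto)
 moreover have "emeasure lborel (box a (a + (\<chi> i. l))) <= emeasure lborel C" using sub C by (intro emeasure_mono) auto
 moreover have "emeasure lborel C <= emeasure lborel (cbox a (a + (\<chi> i. l)))" using sub C by (intro emeasure_mono) auto
 ultimately show ?thesis by simp
qed

lemma emeasure_cell_cube:
 assumes "h > 0" shows "emeasure lborel (cell_cube h K :: (real^'n) set) = ennreal (h ^ CARD('n))"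
proof (rule emeasure_half_open_cube[where a="\<chi> i. h * of_int (K $ i)"])
 show "box (\<chi> i. h * real_of_int (K $ i)) ((\<chi> i. h * real_of_int (K $ i)) + (\<chi> i. h)) \<subseteq> cell_cube h K"
  by (auto simp: cell_cube_def mem_box_cart algebra_simps less_imp_le)
 show "cell_cube h K \<subseteq> cbox (\<chi> i. h * real_of_int (K $ i)) ((\<chi> i. h * real_of_int (K $ i)) + (\<chi> i. h))"
  by (auto simp: cell_cube_def mem_box_cart algebra_simps less_imp_le)
qed (use assms in auto)

lemma torus_subset_cbox: "torus \<subseteq> cbox 0 (1 :: real^'n)" by (auto simp: torus_def mem_box_cart less_imp_le)

lemma emeasure_torus: "emeasure lborel (torus :: (real^'n) set) = 1"
proof -
 have "emeasure lborel (torus :: (real^'n) set) = ennreal (1 ^ CARD('n))"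
  by (rule emeasure_half_open_cube[where a=0]) (auto simp: torus_def mem_box_cart less_imp_le)
 then show ?thesis by simp
qed

lemma emeasure_lebesgue_on_borel:
 assumes "S : sets borel" "A : sets borel" "A \<subseteq> S" shows "emeasure (lebesgue_on S) A = emeasure lborel A"
 using assms by (subst emeasure_restrict_space) auto

lemma finite_measure_torus: "finite_measure (lebesgue_on (torus :: (real^'n) set))"
 by (rule finite_measureI) (simp add: emeasure_lebesgue_on_borel emeasure_torus)

lemma measure_torus: "measure (lebesgue_on (torus :: (real^'n) set)) (space \<Omega>) = 1" by (simp add: measure_def emeasure_lebesgue_on_borel emeasure_torus)

lemma spacetime_set_borel [measurable]:
 fixes T :: real shows "{0<..<T} \<times> (torus :: (real^'n) set) : sets borel"
proof -
 have "{0<..<T::real} : sets borel" by simp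
 then show ?thesis using torus_borel by (metis borel_prod pair_measureI)
qed

lemma space_spacetime: "space (spacetime T) = {0<..<T} \<times> torus" by (simp add: spacetime_def)

lemma emeasure_spacetime:
 assumes "T > 0" shows "emeasure (spacetime T :: (real \<times> (real^'n)) measure) (space (spacetime T)) = ennreal T"
proof -
 have "emeasure (spacetime T :: (real \<times> (real^'n)) measure) (space (spacetime T)) = emeasure lborel ({0<..<T} \<times> (torus::(real^'n) set))"
  unfolding space_spacetime unfolding spacetime_def by (rule emeasure_lebesgue_on_borel) auto
 also have "... = emeasure (lborel \<Otimes>\<^sub>M lborel) ({0<..<T} \<times> (torus::(real^'n) set))" by (simp add: lborel_prod)
 also have "... = emeasure lborel {0<..<T} * emeasure lborel (torus::(real^'n) set)" by (rule lborel.emeasure_pair_measure_Times) auto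
 finally show ?thesis using assms by (simp add: emeasure_torus)
qed

lemma finite_measure_spacetime: "finite_measure (spacetime T :: (real \<times> (real^'n)) measure)"
proof (cases "T > 0")
 case True then show ?thesis by (intro finite_measureI) (simp add: emeasure_spacetime)
next
 case False
 then show ?thesis by (intro finite_measureI) (simp add: space_spacetime)
qed

lemma cell_of_in_cells: "h : mesh_sizes ==> cell_of h x : cells h" using mesh_size_props[of h] by (auto simp: cell_of_def cells_def)

lemma cell_of_eq_iff:
 assumes h: "h : mesh_sizes" and x: "x : torus" and K: "K : cells h" shows "cell_of h x = K \<longleftrightarrow> x : cell_cube h K"
proof -
 note m = mesh_size_props[OF h]
 have "\<lfloor>x $ i / h\<rfloor> mod \<lfloor>1 / h\<rfloor> = \<lfloor>x $ i / h\<rfloor>" for i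
 proof (rule mod_pos_pos_trivial)
  have xi: "0 <= x $ i" "x $ i < 1" using x by (auto simp: torus_def)
  then show "0 <= \<lfloor>x $ i / h\<rfloor>" using m by simp
  have "x $ i / h < of_int \<lfloor>1 / h\<rfloor>" using xi m by (simp add: field_simps)
  then show "\<lfloor>x $ i / h\<rfloor> < \<lfloor>1 / h\<rfloor>" by (simp add: floor_less_iff)
 qed
 then have "cell_of h x = K \<longleftrightarrow> (ALL i. \<lfloor>x $ i / h\<rfloor> = K $ i)" by (simp add: cell_of_def vec_eq_iff)
 also have "... \<longleftrightarrow> x : cell_cube h K" using m(1) by (simp add: cell_cube_def floor_eq_iff field_simps)
 finally show ?thesis .
qed

lemma cell_cube_subset_torus:
 assumes h: "h : mesh_sizes" and K: "K : cells h" shows "cell_cube h K \<subseteq> torus"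
proof
 fix x assume x: "x : cell_cube h K"
 note m = mesh_size_props[OF h]
 have "0 <= x $ i & x $ i < 1" for i
 proof -
  have k: "0 <= K $ i" "K $ i + 1 <= \<lfloor>1 / h\<rfloor>" using K by (auto simp: cells_def zless_imp_add1_zle)
  have xi: "h * of_int (K $ i) <= x $ i" "x $ i < h * (of_int (K $ i) + 1)" using x by (auto simp: cell_cube_def)
  have "0 <= h * of_int (K $ i)" using k m(1) by simp
  moreover have "h * (of_int (K $ i) + 1) <= h * of_int \<lfloor>1 / h\<rfloor>"
  proof (rule mult_left_mono)
   show "of_int (K $ i) + 1 <= (of_int \<lfloor>1 / h\<rfloor> :: real)" using k(2) by linarith
  qed (use m(1) in simp)
  ultimately show ?thesis using xi m(2) by linarith
 qed
 then show "x : torus" by (simp add: torus_def)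
qed

lemma grid_fun_indicator:
 fixes g :: "'n::finite cell => 'b::real_vector"
 assumes h: "h : mesh_sizes" and x: "x : torus" shows "grid_fun h g x = (\<Sum>K\<in>cells h. indicator (cell_cube h K) x *\<^sub>R g K)"
proof -
 have "(\<Sum>K\<in>cells h. indicator (cell_cube h K) x *\<^sub>R g K) = (\<Sum>K\<in>cells h. if K = cell_of h x then g K else 0)"
  by (intro sum.cong refl) (auto simp: indicator_def cell_of_eq_iff[OF h x, symmetric])
 also have "... = g (cell_of h x)" using cell_of_in_cells[OF h] finite_cells by (subst sum.delta) auto
 finally show ?thesis by (simp add: grid_fun_def)
qed

lemma
 fixes g :: "'n::finite cell => 'b::{banach, second_countable_topology}"
 assumes h: "h : mesh_sizes" shows integrable_grid_fun: "integrable \<Omega> (grid_fun h g)"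
  and integral_grid_fun: "(LINT x|\<Omega>. grid_fun h g x) = (h ^ CARD('n)) *\<^sub>R (\<Sum>K\<in>cells h. g K)"
proof -
 have h0: "h > 0" using mesh_size_props[OF h] by simp
 have bi: "has_bochner_integral \<Omega> (%x. indicator (cell_cube h K) x *\<^sub>R g K) ((h ^ CARD('n)) *\<^sub>R g K)" if K: "K : cells h" for K
 proof -
  have em: "emeasure \<Omega> (cell_cube h K) = ennreal (h ^ CARD('n))"
   using cell_cube_subset_torus[OF h K] h0 by (simp add: emeasure_lebesgue_on_borel emeasure_cell_cube)
  have s: "cell_cube h K : sets \<Omega>" using cell_cube_subset_torus[OF h K] by (subst sets_restrict_space_iff) auto
  have "has_bochner_integral \<Omega> (indicator (cell_cube h K)) (measure \<Omega> (cell_cube h K))"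
   using s em by (intro has_bochner_integral_real_indicator) auto
  then show ?thesis using em h0 by (intro has_bochner_integral_scaleR_left) (simp add: measure_def)
 qed
 have "has_bochner_integral \<Omega> (%x. \<Sum>K\<in>cells h. indicator (cell_cube h K) x *\<^sub>R g K)
    (\<Sum>K\<in>cells h. (h ^ CARD('n)) *\<^sub>R g K)" by (intro has_bochner_integral_sum bi)
 then have "has_bochner_integral \<Omega> (grid_fun h g) (\<Sum>K\<in>cells h. (h ^ CARD('n)) *\<^sub>R g K)"
  by (subst has_bochner_integral_cong[OF refl grid_fun_indicator refl]) (use h in auto)
 then show "integrable \<Omega> (grid_fun h g)"
  "(LINT x|\<Omega>. grid_fun h g x) = (h ^ CARD('n)) *\<^sub>R (\<Sum>K\<in>cells h. g K)" by (auto simp: has_bochner_integral_iff scaleR_sum_right)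
qed

text \<open>
  An approximate solution is a finite sum of indicators of cells times continuous functions of time.
\<close>
lemma measurable_spacetime_grid_fun:
 fixes f :: "real => 'n::finite cell => 'b::{banach, second_countable_topology}"
 assumes h: "h : mesh_sizes" and cont: "!!K. K : cells h ==> continuous_on {0..T} (%t. f t K)"
 shows "(%z. grid_fun h (f (fst z)) (snd z)) : borel_measurable (spacetime T)" unfolding spacetime_def
proof (rule measurable_lebesgue_on_borel)
 let ?S = "{0<..<T} \<times> (torus :: (real^'n) set)"
 have m: "(%z. f (fst z) K) : borel_measurable (restrict_space borel ?S)" if "K : cells h" for K by (rule borel_measurable_continuous_on_restrict,
    rule continuous_on_compose2[OF cont[OF that]]) (auto intro!: continuous_intros)
 have i: "(%z. indicator (cell_cube h K) (snd z) :: real) : borel_measurable (restrict_space borel ?S)" for K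
  by (rule measurable_restrict_space1) (use measurable_snd in \<open>simp add: borel_prod[symmetric]\<close>)
 have "(%z. \<Sum>K\<in>cells h. indicator (cell_cube h K) (snd z) *\<^sub>R f (fst z) K) : borel_measurable (restrict_space borel ?S)"
  by (intro borel_measurable_sum borel_measurable_scaleR m i)
 then show "(%z. grid_fun h (f (fst z)) (snd z)) : borel_measurable (restrict_space borel ?S)"
  by (rule measurable_cong[THEN iffD2, rotated]) (auto simp: space_restrict_space grid_fun_indicator[OF h])
qed

section \<open>Uniform bounds for the schemes\<close>

lemma C1_on_continuous_on: "C1_on S f ==> continuous_on S f" unfolding C1_on_def continuous_on_eq_continuous_within by (meson has_derivative_continuous)

lemma C1_torus_continuous: "C1_torus f ==> continuous_on UNIV f" unfolding C1_torus_def by (blast intro: C1_on_continuous_on)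

lemma compact_pos_lower_bound:
 fixes f :: "'a::topological_space => real"
 assumes "compact K" "continuous_on K f" "!!x. x : K ==> f x > 0"
 obtains c where "c > 0" "!!x. x : K ==> c <= f x"
proof (cases "K = {}")
 case True then show ?thesis using that[of 1] by auto
next
 case False
 then obtain x where "x : K" "ALL y:K. f x <= f y" using continuous_attains_inf[OF assms(1) _ assms(2)] by blast
 then show ?thesis using that[of "f x"] assms(3) by auto
qed

lemma compact_norm_bound:
 fixes f :: "'a::topological_space => 'b::real_normed_vector"
 assumes "compact K" "continuous_on K f"
 obtains c where "c > 0" "!!x. x : K ==> norm (f x) <= c"
proof -
 have "bounded (f ` K)" using assms compact_continuous_image compact_imp_bounded by blast
 then show ?thesis using that unfolding bounded_pos by auto
qed

lemma cell_cube_subset_cbox: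
 "cell_cube h K \<subseteq> cbox (\<chi> i. h * of_int (K $ i)) (\<chi> i. h * (of_int (K $ i) + 1))" by (auto simp: cell_cube_def mem_box_cart less_imp_le)

lemma set_integrable_cell_cube:
 fixes f :: "real^'n => 'b::{banach, second_countable_topology}"
 assumes "continuous_on UNIV f" shows "set_integrable lborel (cell_cube h K) f"
proof -
 let ?C = "cbox (\<chi> i. h * real_of_int (K $ i)) (\<chi> i. h * (real_of_int (K $ i) + 1)) :: (real^'n) set"
 have "set_integrable lborel ?C f" unfolding set_integrable_def by (rule borel_integrable_compact[OF compact_cbox]) (use assms continuous_on_subset in blast)
 then show ?thesis by (rule set_integrable_subset) (use cell_cube_subset_cbox in auto)
qed

lemma cell_average_lower_bound:
 fixes f :: "real^'n => real"
 assumes h: "h > 0" and f: "continuous_on UNIV f" and le: "!!x. x : cell_cube h K ==> c <= f x" shows "c <= cell_average h f K"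
proof -
 have fin: "emeasure lborel (cell_cube h K :: (real^'n) set) = ennreal (h ^ CARD('n))" by (rule emeasure_cell_cube[OF h])
 have "(LINT x:cell_cube h K|lborel. c) = h ^ CARD('n) * c" using h by (subst set_integral_const) (auto simp: fin measure_def)
 moreover have "(LINT x:cell_cube h K|lborel. c) <= (LINT x:cell_cube h K|lborel. f x)"
  by (rule set_integral_mono) (use le set_integrable_cell_cube[OF f] set_integrable_cell_cube[of "%_. c"] in auto)
 ultimately show ?thesis using h by (simp add: cell_average_def field_simps)
qed

lemma cell_average_affine:
 fixes r e :: "real^'n => real" and m :: "real^'n => real^'n"
 assumes "continuous_on UNIV r" "continuous_on UNIV m" "continuous_on UNIV e"
 shows "cell_average h (%x. e x - u \<bullet> m x + a * r x) K = cell_average h e K - u \<bullet> cell_average h m K + a * cell_average h r K"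
proof -
 note i = set_integrable_cell_cube[OF assms(1), of h K] set_integrable_cell_cube[OF assms(2), of h K] set_integrable_cell_cube[OF assms(3), of h K]
 have 1: "set_integrable lborel (cell_cube h K) (%x. u \<bullet> m x)" by (rule set_integrable_cell_cube) (intro continuous_intros assms)
 have 2: "(LINT x:cell_cube h K|lborel. u \<bullet> m x) = u \<bullet> (LINT x:cell_cube h K|lborel. m x)"
 proof -
  have "(LINT x:cell_cube h K|lborel. u \<bullet> m x) = (LINT x|lborel. u \<bullet> (indicator (cell_cube h K) x *\<^sub>R m x))"
   unfolding set_lebesgue_integral_def by simp
  also have "... = u \<bullet> (LINT x:cell_cube h K|lborel. m x)"
   unfolding set_lebesgue_integral_def using i(2) by (intro integral_inner_right) (auto simp: set_integrable_def)
  finally show ?thesis .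
 qed
 have "(LINT x:cell_cube h K|lborel. e x - u \<bullet> m x + a * r x) =
   (LINT x:cell_cube h K|lborel. e x) - u \<bullet> (LINT x:cell_cube h K|lborel. m x) + a * (LINT x:cell_cube h K|lborel. r x)"
  using i 1 by (simp add: set_integral_add set_integral_diff set_integrable_mult_right 2)
 then show ?thesis unfolding cell_average_def by (simp add: add_divide_distrib diff_divide_distrib)
qed

lemma powr_tangent:
 fixes x r \<gamma> :: real
 assumes "\<gamma> > 1" "r > 0" "x > 0" shows "r powr \<gamma> + \<gamma> * r powr (\<gamma> - 1) * (x - r) <= x powr \<gamma>"
proof -
 have "r powr \<gamma> * (\<gamma> * (x / r)) <= r powr \<gamma> * ((x / r) powr \<gamma> + (\<gamma> - 1))"
  using assms by (intro mult_left_mono bernoulli_powr) auto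
 also have "r powr \<gamma> * ((x / r) powr \<gamma> + (\<gamma> - 1)) = x powr \<gamma> + (\<gamma> - 1) * r powr \<gamma>"
  using assms by (simp add: powr_divide algebra_simps)
 also have "r powr \<gamma> * (\<gamma> * (x / r)) = \<gamma> * r powr (\<gamma> - 1) * x" using assms by (simp add: powr_diff)
 finally show ?thesis using powr_mult_base[of r "\<gamma> - 1"] assms by (simp add: algebra_simps)
qed

text \<open>
  Jensen's inequality: the region \<open>\<kappa> \<rho>\<^sup>\<gamma> \<le> \<epsilon>\<close> is convex, being the intersection of the half-spaces
  given by the tangent planes; the plane through the averaged state is integrated over the cell.
\<close>
lemma cell_average_entropy:
 fixes \<rho>0 E0 :: "real^'n => real" and m0 :: "real^'n => real^'n"
 assumes g: "\<gamma> > 1" and h: "h > 0" and kap: "\<kappa> \<ge> 0" and c: "continuous_on UNIV \<rho>0" "continuous_on UNIV m0" "continuous_on UNIV E0"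
  and d: "\<delta> > 0" "!!x. x : cell_cube h K ==> \<delta> <= \<rho>0 x"
  and ent: "!!x. x : cell_cube h K ==> \<kappa> <= entropy_fun \<gamma> (\<rho>0 x, m0 x, E0 x)"
 shows "\<kappa> <= entropy_fun \<gamma> (cell_average h \<rho>0 K, cell_average h m0 K, cell_average h E0 K)"
proof -
 define r where "r = cell_average h \<rho>0 K"
 define M where "M = cell_average h m0 K"
 define u where "u = M /\<^sub>R r"
 have r: "r > 0" using cell_average_lower_bound[OF h c(1), of K, OF d(2)] d(1) by (simp add: r_def)
 define a where "a = (norm u)^2 / 2 - \<kappa> * (\<gamma> * r powr (\<gamma> - 1))"
 have pw: "r powr (\<gamma> - 1) * r = r powr \<gamma>" using powr_mult_base[of r "\<gamma>-1"] r by (simp add: mult.commute)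
 have pt: "\<kappa> * (r powr \<gamma> * (1 - \<gamma>)) <= E0 x - u \<bullet> m0 x + a * \<rho>0 x" if x: "x : cell_cube h K" for x
 proof -
  have rx: "\<rho>0 x > 0" using d x by force
  have e: "\<kappa> * \<rho>0 x powr \<gamma> <= E0 x - (norm (m0 x))^2 / \<rho>0 x / 2"
   using ent[OF x] rx by (simp add: entropy_fun_def internal_energy_def dens_def mom_def ener_def field_simps)
  have k: "\<kappa> * (r powr \<gamma> + \<gamma> * r powr (\<gamma> - 1) * (\<rho>0 x - r)) <= \<kappa> * \<rho>0 x powr \<gamma>"
   using powr_tangent[OF g r rx] kap by (rule mult_left_mono)
  have "0 <= (norm (m0 x - \<rho>0 x *\<^sub>R u))^2 / \<rho>0 x" using rx by simp
  also have "... = (norm (m0 x))^2 / \<rho>0 x - 2 * (u \<bullet> m0 x) + \<rho>0 x * (norm u)^2"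
   using rx by (simp add: power2_norm_eq_inner inner_diff inner_commute field_simps)
  finally have q: "u \<bullet> m0 x - \<rho>0 x * (norm u)^2 / 2 <= (norm (m0 x))^2 / \<rho>0 x / 2" by simp
  have "\<kappa> * (r powr \<gamma> + \<gamma> * r powr (\<gamma> - 1) * (\<rho>0 x - r)) =
    \<kappa> * (r powr \<gamma> * (1 - \<gamma>)) + \<kappa> * (\<gamma> * r powr (\<gamma> - 1)) * \<rho>0 x"
   unfolding pw[symmetric] by (simp add: algebra_simps)
  then have "\<kappa> * (r powr \<gamma> * (1 - \<gamma>)) + \<kappa> * (\<gamma> * r powr (\<gamma> - 1)) * \<rho>0 x + (u \<bullet> m0 x - \<rho>0 x * (norm u)^2 / 2) <= E0 x"
   using e k q by linarith
  then show ?thesis unfolding a_def by (simp add: algebra_simps)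
 qed
 have "\<kappa> * (r powr \<gamma> * (1 - \<gamma>)) <= cell_average h (%x. E0 x - u \<bullet> m0 x + a * \<rho>0 x) K"
  by (rule cell_average_lower_bound[OF h _ pt]) (intro continuous_intros c)
 also have "... = cell_average h E0 K - u \<bullet> M + a * r" unfolding cell_average_affine[OF c] M_def r_def ..
 also have "u \<bullet> M = (norm M)^2 / r" by (simp add: u_def power2_norm_eq_inner divide_inverse mult.commute)
 also have "a * r = (norm M)^2 / r / 2 - \<kappa> * \<gamma> * (r powr (\<gamma> - 1) * r)"
  using r by (simp add: a_def u_def power_mult_distrib field_simps power2_eq_square)
 finally have "\<kappa> * r powr \<gamma> <= cell_average h E0 K - (norm M)^2 / r / 2" unfolding pw by (simp add: algebra_simps)
 then show ?thesis using r by (simp add: entropy_fun_def internal_energy_def dens_def mom_def ener_def r_def[symmetric] M_def[symmetric] field_simps)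
qed

lemma integral_torus_cells:
 fixes f :: "real^'n => real"
 assumes h: "h : mesh_sizes" and f: "continuous_on UNIV f" shows "(LINT x|\<Omega>. f x) = h ^ CARD('n) * (\<Sum>K\<in>cells h. cell_average h f K)"
proof -
 have h0: "h > 0" using mesh_size_props[OF h] by simp
 have fb: "f : borel_measurable borel" using f by (rule borel_measurable_continuous_onI)
 have "h ^ CARD('n) * (\<Sum>K\<in>cells h. cell_average h f K) = (\<Sum>K\<in>cells h. LINT x:cell_cube h K|lborel. f x)"
  unfolding cell_average_def sum_distrib_left using h0 by simp
 also have "... = (LINT x|lborel. (\<Sum>K\<in>cells h. indicator (cell_cube h K) x *\<^sub>R f x))" unfolding set_lebesgue_integral_def
  using set_integrable_cell_cube[OF f] by (subst lint_sum) (auto simp: set_integrable_def)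
 also have "... = (LINT x|lborel. indicator torus x *\<^sub>R f x)"
 proof (rule lint_cong[OF refl])
  fix x show "(\<Sum>K\<in>cells h. indicator (cell_cube h K) x *\<^sub>R f x) = indicator torus x *\<^sub>R f x"
  proof (cases "x : torus")
   case True
   then show ?thesis using grid_fun_indicator[OF h True, of "%_. f x"] by (simp add: grid_fun_def)
  next
   case False
   then have "indicator (cell_cube h K) x *\<^sub>R f x = 0" if "K : cells h" for K using cell_cube_subset_torus[OF h that] by (auto simp: indicator_def)
   then show ?thesis using False by (simp add: sum.neutral)
  qed
 qed
 also have "... = (LINT x|lebesgue. indicator torus x *\<^sub>R f x)" by (rule integral_completion[symmetric]) (use fb in measurable)
 also have "... = (LINT x|\<Omega>. f x)" by (subst integral_restrict_space) auto
 finally show ?thesis by simp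
qed

lemma initial_entropy_bound:
 fixes \<rho>0 E0 :: "real^'n => real" and m0 :: "real^'n => real^'n"
 assumes g: "\<gamma> > 1" and c: "continuous_on UNIV \<rho>0" "continuous_on UNIV m0" "continuous_on UNIV E0"
  and pos: "!!x. \<rho>0 x > 0" "!!x. pressure \<gamma> (\<rho>0 x, m0 x, E0 x) > 0"
 obtains \<kappa> \<delta> where "\<kappa> > 0" "\<delta> > 0" "!!x. x : torus ==> \<delta> <= \<rho>0 x"
  "!!x. x : torus ==> \<kappa> <= entropy_fun \<gamma> (\<rho>0 x, m0 x, E0 x)"
proof -
 have cs: "continuous_on (cbox 0 1) \<rho>0" "continuous_on (cbox 0 1) m0" "continuous_on (cbox 0 1) E0" using c continuous_on_subset by blast+
 obtain \<delta> where d: "\<delta> > 0" "!!x. x : cbox 0 1 ==> \<delta> <= \<rho>0 x" using compact_pos_lower_bound[OF compact_cbox cs(1)] pos(1) by blast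
 have "continuous_on (cbox 0 1) (%x. entropy_fun \<gamma> (\<rho>0 x, m0 x, E0 x))"
  unfolding entropy_fun_def internal_energy_def dens_def mom_def ener_def fst_conv snd_conv
  by (intro continuous_intros cs) (use pos(1) in \<open>simp_all add: less_imp_neq[THEN not_sym]\<close>)
 moreover have "entropy_fun \<gamma> (\<rho>0 x, m0 x, E0 x) > 0" for x
  using pos(1)[of x] pos(2)[of x] g by (simp add: entropy_fun_def pressure_def dens_def zero_less_mult_iff)
 ultimately obtain \<kappa> where "\<kappa> > 0" "!!x. x : cbox 0 1 ==> \<kappa> <= entropy_fun \<gamma> (\<rho>0 x, m0 x, E0 x)"
  using compact_pos_lower_bound[OF compact_cbox, of 0 1 "%x. entropy_fun \<gamma> (\<rho>0 x, m0 x, E0 x)"] by blast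
 then show ?thesis using that d torus_subset_cbox by blast
qed

theorem scheme_uniform_bounds:
 fixes \<rho>0 E0 :: "real^'n => real" and m0 :: "real^'n => real^'n"
 assumes g: "\<gamma> > 1" and T: "T > 0" and c: "continuous_on UNIV \<rho>0" "continuous_on UNIV m0" "continuous_on UNIV E0"
  and k: "\<kappa> > 0" "\<delta> > 0" "!!x. x : torus ==> \<delta> <= \<rho>0 x"
  "!!x. x : torus ==> \<kappa> <= entropy_fun \<gamma> (\<rho>0 x, m0 x, E0 x)"
  and h: "h : mesh_sizes" "h <= 1 / 3" and sol: "lax_friedrichs_solution v \<gamma> T h \<rho>0 m0 E0 U" and t: "t : {0..T}"
 shows "!!K. K : cells h ==> 0 < dens (U t K)" and "!!K. K : cells h ==> \<kappa> * dens (U t K) powr \<gamma> <= internal_energy (U t K)"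
  and "(LINT x|\<Omega>. ener (grid_fun h (U t) x)) = (LINT x|\<Omega>. E0 x)"
proof -
 have h0: "h > 0" using mesh_size_props[OF h(1)] by simp
 have U0: "U 0 K = (cell_average h \<rho>0 K, cell_average h m0 K, cell_average h E0 K)" if "K : cells h" for K
  using sol that by (auto simp: lax_friedrichs_solution_def)
 have e0: "\<kappa> <= entropy_fun \<gamma> (U 0 K)" if K: "K : cells h" for K unfolding U0[OF K] using cell_cube_subset_torus[OF h(1) K] k
  by (intro cell_average_entropy[OF g h0 _ c k(2)]) auto
 show pos: "0 < dens (U t K)" if "K : cells h" for K using sol that t by (auto simp: lax_friedrichs_solution_def)
 show "\<kappa> * dens (U t K) powr \<gamma> <= internal_energy (U t K)" if K: "K : cells h" for K
  using minimum_entropy_principle[OF g T h sol k(1) e0 t K] pos[OF K] by (simp add: entropy_fun_def field_simps)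
 have "(LINT x|\<Omega>. ener (grid_fun h (U t) x)) = (LINT x|\<Omega>. grid_fun h (%K. ener (U t K)) x)" by (simp add: grid_fun_def)
 also have "... = h ^ CARD('n) * (\<Sum>K\<in>cells h. ener (U t K))" by (subst integral_grid_fun[OF h(1)]) simp
 also have "(\<Sum>K\<in>cells h. ener (U t K)) = (\<Sum>K\<in>cells h. ener (U 0 K))" by (rule total_energy_conserved[OF T h(1) sol t])
 also have "... = (\<Sum>K\<in>cells h. cell_average h E0 K)" by (intro sum.cong refl) (simp add: U0 ener_def)
 finally show "(LINT x|\<Omega>. ener (grid_fun h (U t) x)) = (LINT x|\<Omega>. E0 x)" using integral_torus_cells[OF h(1) c(3)] by simp
qed

section \<open>Tools for convergence in mean\<close>

text \<open>
  The common last step of all the convergence proofs: an error that is uniformly small up to a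
  multiple of a null sequence.
\<close>
lemma tendsto_zero_split:
 fixes X Y :: "'h => real"
 assumes Y: "(Y \<longlongrightarrow> 0) F" and X0: "\<forall>\<^sub>F h in F. 0 <= X h"
  and split: "!!\<delta>. \<delta> > 0 ==> \<exists>C\<ge>0. \<forall>\<^sub>F h in F. X h <= \<delta> * K + C * Y h" shows "(X \<longlongrightarrow> 0) F"
proof (rule tendstoI)
 fix e :: real assume e: "e > 0"
 define \<delta> where "\<delta> = e / (2 * (\<bar>K\<bar> + 1))"
 have d: "\<delta> > 0" using e by (simp add: \<delta>_def)
 obtain C where C: "C \<ge> 0" "\<forall>\<^sub>F h in F. X h <= \<delta> * K + C * Y h" using split[OF d] by blast
 have "\<delta> * K <= \<delta> * (\<bar>K\<bar> + 1)" using d by (intro mult_left_mono) auto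
 also have "... = e / 2"
 proof -
  have "\<bar>K\<bar> + 1 ~= 0" by linarith
  then show ?thesis by (simp add: \<delta>_def field_simps)
 qed
 finally have dk: "\<delta> * K <= e / 2" .
 have "\<forall>\<^sub>F h in F. dist (Y h) 0 < e / (2 * (C + 1))" using Y e C by (intro tendstoD) auto
 then show "\<forall>\<^sub>F h in F. dist (X h) 0 < e" using C(2) X0
 proof eventually_elim
  case (elim h)
  have "C * Y h <= C * (e / (2 * (C + 1)))" using elim(1) C(1) by (intro mult_left_mono) auto
  also have "... < e / 2" using C(1) e by (simp add: field_simps)
  finally show ?case using elim dk by simp
 qed
qed

text \<open>
  Weak convergence together with convergence of the squares is convergence in \<open>L\<^sup>2\<close>.
\<close>
lemma weak_square_imp_L1:
 fixes a :: "'h => 'z => real"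
 assumes M: "finite_measure M" and a: "\<forall>\<^sub>F h in F. a h : borel_measurable M & (ALL z:space M. \<bar>a h z\<bar> <= C)"
  and b: "b : borel_measurable M" "!!z. z : space M ==> \<bar>b z\<bar> <= C"
  and w: "((%h. LINT z|M. a h z * b z) \<longlongrightarrow> (LINT z|M. b z * b z)) F"
  and w2: "((%h. LINT z|M. a h z * a h z) \<longlongrightarrow> (LINT z|M. b z * b z)) F"
 shows "((%h. LINT z|M. \<bar>a h z - b z\<bar>) \<longlongrightarrow> 0) F"
proof (rule tendsto_zero_split[where K="measure M (space M)"
   and Y="%h. (LINT z|M. a h z * a h z) - 2 * (LINT z|M. a h z * b z) + (LINT z|M. b z * b z)"])
 interpret finite_measure M by (rule M)
 have "((%h. (LINT z|M. a h z * a h z) - 2 * (LINT z|M. a h z * b z) + (LINT z|M. b z * b z)) \<longlongrightarrow>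
   (LINT z|M. b z * b z) - 2 * (LINT z|M. b z * b z) + (LINT z|M. b z * b z)) F" by (intro tendsto_intros w w2)
 then show "((%h. (LINT z|M. a h z * a h z) - 2 * (LINT z|M. a h z * b z) + (LINT z|M. b z * b z)) \<longlongrightarrow> 0) F" by simp
 show "\<forall>\<^sub>F h in F. 0 <= (LINT z|M. \<bar>a h z - b z\<bar>)" by (intro always_eventually allI integral_nonneg_AE) auto
 fix \<delta> :: real assume d: "\<delta> > 0"
 show "\<exists>c\<ge>0. \<forall>\<^sub>F h in F. (LINT z|M. \<bar>a h z - b z\<bar>) <= \<delta> * measure M (space M) + c *
   ((LINT z|M. a h z * a h z) - 2 * (LINT z|M. a h z * b z) + (LINT z|M. b z * b z))"
 proof (intro exI[of _ "1 / \<delta>"] conjI)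
  show "\<forall>\<^sub>F h in F. (LINT z|M. \<bar>a h z - b z\<bar>) <= \<delta> * measure M (space M) + 1 / \<delta> *
   ((LINT z|M. a h z * a h z) - 2 * (LINT z|M. a h z * b z) + (LINT z|M. b z * b z))" using a
  proof eventually_elim
   case (elim h)
   have prod: "integrable M (%z. f z * g z)"
    if "f : borel_measurable M" "g : borel_measurable M" "!!z. z : space M ==> \<bar>f z\<bar> <= C" "!!z. z : space M ==> \<bar>g z\<bar> <= C" for f g :: "'z => real"
    by (rule integrable_const_bound[of _ "C * C"])
     (use that in \<open>auto intro!: AE_I2 mult_mono simp: abs_mult\<close>, meson abs_ge_zero order_trans)
   have i: "integrable M (%z. a h z * a h z)" "integrable M (%z. a h z * b z)" "integrable M (%z. b z * b z)" using prod elim b by auto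
   have young: "\<bar>x - y\<bar> <= \<delta> + 1 / \<delta> * (x * x - 2 * (x * y) + y * y)" for x y :: real
   proof -
    have "0 <= (\<bar>x - y\<bar> - \<delta>)^2 + \<delta> * \<bar>x - y\<bar>" using d by simp
    also have "... = \<bar>x - y\<bar>^2 - \<delta> * \<bar>x - y\<bar> + \<delta>^2" by (simp add: power2_diff)
    also have "\<bar>x - y\<bar>^2 = x * x - 2 * (x * y) + y * y" by (simp add: power2_eq_square algebra_simps)
    finally have "\<delta> * \<bar>x - y\<bar> <= (x * x - 2 * (x * y) + y * y) + \<delta>^2" by simp
    then have "\<bar>x - y\<bar> <= ((x * x - 2 * (x * y) + y * y) + \<delta>^2) / \<delta>" using d by (simp add: pos_le_divide_eq mult.commute)
    also have "... = \<delta> + 1 / \<delta> * (x * x - 2 * (x * y) + y * y)" using d by (simp add: add_divide_distrib power2_eq_square)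
    finally show ?thesis .
   qed
   have "(LINT z|M. \<bar>a h z - b z\<bar>) <= (LINT z|M. \<delta> + 1 / \<delta> * (a h z * a h z - 2 * (a h z * b z) + b z * b z))"
   proof (rule integral_mono_AE')
    show "integrable M (%z. \<delta> + 1 / \<delta> * (a h z * a h z - 2 * (a h z * b z) + b z * b z))" using i by auto
    show "AE z in M. 0 <= \<delta> + 1 / \<delta> * (a h z * a h z - 2 * (a h z * b z) + b z * b z)" by (rule AE_I2, rule order_trans[OF abs_ge_zero young])
   qed (rule AE_I2, rule young)
   also have "... = \<delta> * measure M (space M) + 1 / \<delta> *
     ((LINT z|M. a h z * a h z) - 2 * (LINT z|M. a h z * b z) + (LINT z|M. b z * b z))" using i by simp
   finally show ?case .
  qed
 qed (use d in simp)
qed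

text \<open>
  Young's inequality with a small factor on the first term.
\<close>
lemma young_delta:
 fixes p \<delta> :: real
 assumes p: "p > 1" and d: "\<delta> > 0"
 obtains C where "C \<ge> 0" "!!a b. a \<ge> 0 ==> b \<ge> 0 ==> a * b <= \<delta> * a powr p + C * b powr (p / (p - 1))"
proof (rule that[of "(1 / \<delta>) powr (1 / (p - 1))"])
 fix a b :: real assume a: "a \<ge> 0" and b: "b \<ge> 0"
 have eq: "1 + 1 / (p - 1) = p / (p - 1)" using p by (simp add: field_simps)
 show "a * b <= \<delta> * a powr p + (1 / \<delta>) powr (1 / (p - 1)) * b powr (p / (p - 1))"
 proof (cases "b <= \<delta> * a powr (p - 1)")
  case True
  then have "a * b <= a * (\<delta> * a powr (p - 1))" using a by (rule mult_left_mono)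
  also have "... = \<delta> * a powr p" using powr_mult_base[of a "p - 1"] a by (cases "a = 0") auto
  also have "... <= \<delta> * a powr p + (1 / \<delta>) powr (1 / (p - 1)) * b powr (p / (p - 1))" using d by simp
  finally show ?thesis .
 next
  case False
  then have bp: "b > 0" using d by (smt (verit) mult_nonneg_nonneg powr_ge_zero)
  have "a powr (p - 1) <= 1 / \<delta> * b" using False d by (simp add: field_simps)
  then have "(a powr (p - 1)) powr (1 / (p - 1)) <= (1 / \<delta> * b) powr (1 / (p - 1))" using p by (intro powr_mono2) auto
  then have "a <= (1 / \<delta>) powr (1 / (p - 1)) * b powr (1 / (p - 1))" using p a d bp by (simp add: powr_powr powr_mult[symmetric] split: if_splits)
  then have "a * b <= (1 / \<delta>) powr (1 / (p - 1)) * b powr (1 / (p - 1)) * b" using b by (rule mult_right_mono)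
  also have "... = (1 / \<delta>) powr (1 / (p - 1)) * b powr (p / (p - 1))" using powr_mult_base[of b "1 / (p - 1)"] b bp eq by (simp add: mult_ac)
  also have "... <= \<delta> * a powr p + (1 / \<delta>) powr (1 / (p - 1)) * b powr (p / (p - 1))" using d by simp
  finally show ?thesis .
 qed
qed simp

lemma AE_lborel_fst:
 fixes P :: "'a::euclidean_space => bool"
 assumes "AE t in lborel. P t" shows "AE z in (lborel :: ('a \<times> 'b::euclidean_space) measure). P (fst z)"
proof -
 obtain N where N: "{t. ~ P t} \<subseteq> N" "N : null_sets lborel" using assms by (auto simp: eventually_ae_filter)
 have "emeasure (lborel \<Otimes>\<^sub>M (lborel :: 'b measure)) (N \<times> UNIV) = 0" using N by (subst lborel.emeasure_pair_measure_Times) auto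
 moreover have "N \<times> (UNIV :: 'b set) : sets (lborel \<Otimes>\<^sub>M lborel)" using N by (intro pair_measureI) auto
 ultimately have "N \<times> (UNIV :: 'b set) : null_sets (lborel \<Otimes>\<^sub>M lborel)" by (rule null_setsI)
 then have "N \<times> (UNIV :: 'b set) : null_sets lborel" by (simp only: lborel_prod)
 then show ?thesis by (rule AE_I') (use N in auto)
qed

lemma measurable_lift_fst:
 fixes w :: "'a::euclidean_space => real"
 assumes I: "I : sets borel" and B: "(B :: 'b::euclidean_space set) : sets borel" and w: "w : borel_measurable (lebesgue_on I)"
 shows "(%z. w (fst z)) : borel_measurable (lebesgue_on (I \<times> B))"
proof -
 have IB: "I \<times> B : sets borel" using I B by (metis borel_prod pair_measureI)
 obtain g where g: "g : borel_measurable borel" and ae: "AE t in lborel. (if t : I then w t else 0) = g t"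
  using lebesgue_on_borel_representative[OF I w] by blast
 have "(%z. g (fst z)) : borel_measurable (lborel :: ('a \<times> 'b) measure)" using g by (simp add: borel_prod[symmetric])
 then have gm: "(%z. g (fst z)) : borel_measurable (lebesgue :: ('a \<times> 'b) measure)" by (rule measurable_completion)
 have "AE z in (lborel :: ('a \<times> 'b) measure). g (fst z) = (if fst z : I then w (fst z) else 0)" using AE_lborel_fst[OF ae] by eventually_elim (rule sym)
 then have "(%z. if fst z : I then w (fst z) else 0) : borel_measurable (lebesgue :: ('a \<times> 'b) measure)"
  by (intro borel_measurable_AE[OF gm]) (simp only: AE_completion_iff)
 then have "(%z. if fst z : I then w (fst z) else 0) : borel_measurable (lebesgue_on (I \<times> B))" by (rule measurable_restrict_space1)
 then show ?thesis by (rule measurable_cong[THEN iffD1, rotated]) (auto simp: space_restrict_space)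
qed

lemma torus_lebesgue_sets: "{0<..<T::real} : sets borel" "torus : sets borel" by (simp_all add: torus_borel)

lemma weighted_slice_bound:
 fixes f :: "real \<times> (real^'n) => real"
 assumes f: "f : borel_measurable (spacetime T)" and w: "integrable (lebesgue_on {0<..<T}) w"
  and w0: "!!t. t : {0<..<T} ==> 0 <= w t" and f0: "!!z. z : {0<..<T} \<times> torus ==> 0 <= f z"
  and sl: "AE t in lebesgue_on {0<..<T}. integrable \<Omega> (%x. f (t, x)) & (LINT x|\<Omega>. f (t, x)) <= K"
 shows "integrable (spacetime T) (%z. w (fst z) * f z)" and "(LINT z|spacetime T. w (fst z) * f z) <= K * (LINT t|lebesgue_on {0<..<T}. w t)"
proof -
 have wm: "(%z. w (fst z)) : borel_measurable (lebesgue_on ({0<..<T} \<times> (torus::(real^'n) set)))"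
  by (rule measurable_lift_fst[OF torus_lebesgue_sets borel_measurable_integrable[OF w]])
 have sp: "AE t in lebesgue_on {0<..<T}. t : {0<..<T}" by (rule AE_I2) simp
 show i: "integrable (spacetime T) (%z. w (fst z) * f z)" unfolding spacetime_def
 proof (rule Tonelli_integrable_lebesgue_on[OF torus_lebesgue_sets, where b="%t. K * w t"])
  show "(%z. w (fst z) * f z) : borel_measurable (lebesgue_on ({0<..<T} \<times> torus))" using wm f unfolding spacetime_def by simp
  show "AE t in lebesgue_on {0<..<T}. integrable \<Omega> (%x. w (fst (t, x)) * f (t, x)) \<and>
    (LINT x|\<Omega>. \<bar>w (fst (t, x)) * f (t, x)\<bar>) <= K * w t" using sl sp
  proof eventually_elim
   case (elim t)
   have "(LINT x|\<Omega>. \<bar>w t * f (t, x)\<bar>) = (LINT x|\<Omega>. w t * f (t, x))" using f0 w0 elim by (intro lint_cong) auto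
   also have "... = w t * (LINT x|\<Omega>. f (t, x))" by simp
   also have "... <= w t * K" using elim w0 by (intro mult_left_mono) auto
   finally show ?case using elim by (simp add: mult.commute)
  qed
 qed (use w in simp)
 have "(LINT z|spacetime T. w (fst z) * f z) = (LINT t|lebesgue_on {0<..<T}. LINT x|\<Omega>. w t * f (t, x))"
  unfolding spacetime_def using Fubini_lebesgue_on[OF torus_lebesgue_sets i[unfolded spacetime_def]] by simp
 also have "... <= (LINT t|lebesgue_on {0<..<T}. w t * K)"
 proof (rule integral_mono_AE)
  show "integrable (lebesgue_on {0<..<T}) (%t. LINT x|\<Omega>. w t * f (t, x))"
   using integrable_slice_integral[OF torus_lebesgue_sets i[unfolded spacetime_def]] by simp
  show "AE t in lebesgue_on {0<..<T}. (LINT x|\<Omega>. w t * f (t, x)) <= w t * K" using sl sp by eventually_elim (auto intro!: mult_left_mono w0)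
 qed (use w in simp)
 finally show "(LINT z|spacetime T. w (fst z) * f z) <= K * (LINT t|lebesgue_on {0<..<T}. w t)" by (simp add: mult.commute)
qed

lemma integral_tail_small:
 fixes f :: "'z => real" and s :: "'z => real"
 assumes f: "integrable M f" and s: "s : borel_measurable M" and e: "e > 0"
 obtains k :: nat where "(LINT z|M. (if s z > real k then \<bar>f z\<bar> else 0)) < e"
proof -
 have "(%k. LINT z|M. (if s z > real k then \<bar>f z\<bar> else 0)) \<longlonglongrightarrow> (LINT z|M. 0)"
 proof (rule integral_dominated_convergence[where w="%z. \<bar>f z\<bar>"])
  show "AE z in M. (%k. if s z > real k then \<bar>f z\<bar> else 0) \<longlonglongrightarrow> 0"
  proof (rule AE_I2)
   fix z
   obtain n :: nat where "s z < real n" using reals_Archimedean2 by blast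
   then have "(if s z > real k then \<bar>f z\<bar> else 0) = 0" if "n <= k" for k using that by auto
   then have "\<forall>\<^sub>F k in sequentially. (if s z > real k then \<bar>f z\<bar> else 0) = 0" by (rule eventually_sequentiallyI)
   then show "(%k. if s z > real k then \<bar>f z\<bar> else 0) \<longlonglongrightarrow> 0" by (rule tendsto_eventually)
  qed
 qed (use f s in auto)
 then have "\<forall>\<^sub>F k in sequentially. dist (LINT z|M. (if s z > real k then \<bar>f z\<bar> else 0)) 0 < e" using e by (intro tendstoD) auto
 then obtain k where "dist (LINT z|M. (if s z > real k then \<bar>f z\<bar> else 0)) 0 < e" by (auto simp: eventually_sequentially)
 then show ?thesis using that[of k] by (simp add: dist_real_def)
qed

section \<open>Weak-(*) convergence from strong convergence\<close>

text \<open>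
  Reduction of a point to the fundamental cell.
\<close>
lemma periodic_frac:
 fixes f :: "real^'n => 'b"
 assumes per: "periodic f" shows "f (\<chi> i. frac (y $ i)) = f y"
proof -
 have shift: "f (y + of_int k *\<^sub>R axis s 1) = f y" for y k s
 proof (induction k rule: int_induct[where k=0])
  case (step1 i)
  have "y + of_int (i + 1) *\<^sub>R axis s 1 = (y + of_int i *\<^sub>R axis s 1) + axis s 1" by (simp add: algebra_simps)
  then show ?case using per step1 unfolding periodic_def by metis
 next
  case (step2 i)
  have "(y + of_int (i - 1) *\<^sub>R axis s 1) + axis s 1 = y + of_int i *\<^sub>R axis s 1" by (simp add: algebra_simps)
  then show ?case using per step2 unfolding periodic_def by metis
 qed simp
 have shiftS: "f (y + (\<Sum>s\<in>A. of_int (k s) *\<^sub>R axis s 1)) = f y" if "finite A" for A y and k :: "'n => int" using that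
 proof (induction A arbitrary: y)
  case (insert a A)
  then show ?case using shift[of "y + (\<Sum>s\<in>A. of_int (k s) *\<^sub>R axis s 1)" "k a" a] by (simp add: add_ac)
 qed simp
 have "(\<chi> i. frac (y $ i)) = y + (\<Sum>s. of_int (- \<lfloor>y $ s\<rfloor>) *\<^sub>R axis s 1)"
  by (simp add: vec_eq_iff frac_def axis_def if_distrib sum.delta cong: if_cong)
 then show ?thesis using shiftS[where A=UNIV and y=y and k="%s. - \<lfloor>y $ s\<rfloor>"] by simp
qed

lemma frac_vec_in_cbox: "(\<chi> i. frac (y $ i)) : cbox 0 (1 :: real^'n)" unfolding mem_box_cart by (auto intro: less_imp_le[OF frac_lt_1])

text \<open>
  The test function lies only in \<open>L\<^sup>1(0,T;L\<^sup>q)\<close>, so at each time it is normalised by the weight \<open>w\<close>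
  before Young's inequality is applied; where the test function is bounded strong convergence suffices,
  and the remaining part is uniformly small.
\<close>
lemma weak_star_Lp_convergence:
 fixes fs :: "'h => real => real^'n => 'b::euclidean_space"
 assumes p: "p > 1" and T: "T > 0" and strong: "strongly_L1 T F fs f"
  and ev: "\<forall>\<^sub>F h in F. (%z. fs h (fst z) (snd z)) : borel_measurable (spacetime T) \<and>
    (ALL t:{0<..<T}. integrable \<Omega> (%x. norm (fs h t x) powr p) \<and>
      (LINT x|\<Omega>. norm (fs h t x) powr p) <= K)" and lim: "!!t. t : {0<..<T} ==> integrable \<Omega> (%x. norm (f t x) powr p)"
   "!!t. t : {0<..<T} ==> (LINT x|\<Omega>. norm (f t x) powr p) <= K" and phi: "L1_Lq T (p / (p - 1)) \<phi>"
 shows "((%h. integral_st T (%t x. fs h t x \<bullet> \<phi> t x)) \<longlongrightarrow> integral_st T (%t x. f t x \<bullet> \<phi> t x)) F"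
proof -
 define q where "q = p / (p - 1)"
 have q: "q > 1" using p by (simp add: q_def field_simps)
 define M where "M = (spacetime T :: (real \<times> (real^'n)) measure)"
 define u where "u = (%h z. fs h (fst z) (snd z))"
 define v where "v = (%z. f (fst z) (snd z))"
 define P where "P = (%z. \<phi> (fst z) (snd z))"
 define I where "I = (%t. LINT x|\<Omega>. norm (\<phi> t x) powr q)"
 define w where "w = (%t. I t powr (1 / q) + 1)"
 have Pm: "P : borel_measurable M" using phi by (simp add: L1_Lq_def P_def M_def)
 have vm: "v : borel_measurable M" using strong by (auto simp: strongly_L1_def L1_st_def v_def M_def)
 interpret fin: finite_measure "lebesgue_on {0<..<T}" by (rule finite_measureI) (use T in \<open>simp add: emeasure_lebesgue_on_borel\<close>)
 have wi: "integrable (lebesgue_on {0<..<T}) w" using phi unfolding L1_Lq_def w_def I_def q_def by (intro integrable_sum2) auto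
 have w1: "w t \<ge> 1" for t by (simp add: w_def)
 then have w0: "w t > 0" for t by (meson less_le_trans zero_less_one)
 have wm: "(%z. w (fst z)) : borel_measurable M"
  unfolding M_def spacetime_def by (rule measurable_lift_fst[OF torus_lebesgue_sets borel_measurable_integrable[OF wi]])
 define Q where "Q = (%z. (norm (P z) / w (fst z)) powr q)"
 have Qm: "Q : borel_measurable M" unfolding Q_def using Pm wm by measurable
 have wQ: "integrable M (%z. w (fst z) * Q z)" unfolding M_def
 proof (rule weighted_slice_bound(1)[OF _ wi])
  show "Q : borel_measurable (spacetime T)" using Qm by (simp add: M_def)
  show "0 <= w t" for t using w0[of t] by simp
  show "0 <= Q z" for z by (simp add: Q_def)
  have "AE t in lebesgue_on {0<..<T}. integrable \<Omega> (%x. norm (\<phi> t x) powr q)" using phi by (simp add: L1_Lq_def q_def)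
  then show "AE t in lebesgue_on {0<..<T}. integrable \<Omega> (%x. Q (t, x)) & (LINT x|\<Omega>. Q (t, x)) <= 1"
  proof eventually_elim
   case (elim t)
   have Qe: "Q (t, x) = norm (\<phi> t x) powr q / w t powr q" for x using w0[of t] by (simp add: Q_def P_def powr_divide)
   have I0: "I t \<ge> 0" unfolding I_def by (rule integral_nonneg_AE) simp
   have "I t = (I t powr (1 / q)) powr q" using I0 q by (simp add: powr_powr)
   also have "... <= w t powr q" unfolding w_def using q by (intro powr_mono2) auto
   finally have "I t / w t powr q <= 1" using w0[of t] by (simp add: pos_divide_le_eq)
   then show ?case unfolding Qe using elim by (simp add: I_def)
  qed
 qed
 define W where "W = (LINT t|lebesgue_on {0<..<T}. w t)"
 have bnd: "integrable M (%z. w (fst z) * norm (g (fst z) (snd z)) powr p)"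
    "(LINT z|M. w (fst z) * norm (g (fst z) (snd z)) powr p) <= K * W" if gm: "(%z. g (fst z) (snd z)) : borel_measurable M"
   and gb: "!!t. t : {0<..<T} ==> integrable \<Omega> (%x. norm (g t x) powr p) \<and>
      (LINT x|\<Omega>. norm (g t x) powr p) <= K" for g :: "real => real^'n => 'b"
 proof -
  have ae: "AE t in lebesgue_on {0<..<T}. integrable \<Omega> (%x. norm (g (fst (t, x)) (snd (t, x))) powr p)
    & (LINT x|\<Omega>. norm (g (fst (t, x)) (snd (t, x))) powr p) <= K" by (rule AE_I2) (use gb in auto)
  have m: "(%z. norm (g (fst z) (snd z)) powr p) : borel_measurable (spacetime T)" using gm by (simp add: M_def)
  show "integrable M (%z. w (fst z) * norm (g (fst z) (snd z)) powr p)"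
    "(LINT z|M. w (fst z) * norm (g (fst z) (snd z)) powr p) <= K * W"
   using weighted_slice_bound[OF m wi _ _ ae] w0 unfolding M_def W_def by (auto simp: less_imp_le)
 qed
 have yw: "norm x * norm (P z) <= \<delta> * (w (fst z) * norm x powr p) + C * (w (fst z) * Q z)"
  if C: "!!a b. a \<ge> 0 ==> b \<ge> 0 ==> a * b <= \<delta> * a powr p + C * b powr (p / (p - 1))" for C \<delta> z and x :: 'b
 proof -
  have "norm x * (norm (P z) / w (fst z)) <= \<delta> * norm x powr p + C * Q z" unfolding Q_def q_def using w0[of "fst z"] by (intro C) auto
  then have "w (fst z) * (norm x * (norm (P z) / w (fst z))) <= w (fst z) * (\<delta> * norm x powr p + C * Q z)"
   using w0[of "fst z"] by (intro mult_left_mono) auto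
  then show ?thesis using w0[of "fst z"] by (simp add: algebra_simps)
 qed
 have int_prod: "integrable M (%z. norm (g (fst z) (snd z)) * norm (P z))" if gm: "(%z. g (fst z) (snd z)) : borel_measurable M"
   and gb: "!!t. t : {0<..<T} ==> integrable \<Omega> (%x. norm (g t x) powr p) \<and>
      (LINT x|\<Omega>. norm (g t x) powr p) <= K" for g :: "real => real^'n => 'b"
 proof -
  obtain C where C: "C \<ge> 0" "!!a b. a \<ge> 0 ==> b \<ge> 0 ==> a * b <= 1 * a powr p + C * b powr (p / (p - 1))" using young_delta[OF p, of 1] by auto
  show ?thesis
  proof (rule lint_bound)
   show "integrable M (%z. 1 * (w (fst z) * norm (g (fst z) (snd z)) powr p) + C * (w (fst z) * Q z))" using bnd(1)[OF gm gb] wQ by auto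
   show "(%z. norm (g (fst z) (snd z)) * norm (P z)) : borel_measurable M" using gm Pm by simp
   show "AE z in M. norm (norm (g (fst z) (snd z)) * norm (P z)) <=
     norm (1 * (w (fst z) * norm (g (fst z) (snd z)) powr p) + C * (w (fst z) * Q z))"
   proof (rule AE_I2)
    fix z
    have "norm (norm (g (fst z) (snd z)) * norm (P z)) = norm (g (fst z) (snd z)) * norm (P z)" by simp
    also have "... <= 1 * (w (fst z) * norm (g (fst z) (snd z)) powr p) + C * (w (fst z) * Q z)" by (rule yw[OF C(2)])
    finally show "norm (norm (g (fst z) (snd z)) * norm (P z)) <=
     norm (1 * (w (fst z) * norm (g (fst z) (snd z)) powr p) + C * (w (fst z) * Q z))" unfolding real_norm_def by (rule order_trans[OF _ abs_ge_self])
   qed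
  qed
 qed
 have vP: "integrable M (%z. norm (v z) * norm (P z))" unfolding v_def by (rule int_prod) (use vm lim in \<open>auto simp: v_def\<close>)
 have ev': "\<forall>\<^sub>F h in F. u h : borel_measurable M & integrable M (%z. norm (u h z) * norm (P z)) \<and>
   integrable M (%z. w (fst z) * norm (u h z) powr p) & (LINT z|M. w (fst z) * norm (u h z) powr p) <= K * W" using ev
 proof eventually_elim
  case (elim h)
  then have m: "(%z. fs h (fst z) (snd z)) : borel_measurable M" by (simp add: M_def)
  show ?case using m int_prod[OF m] bnd[OF m] elim by (auto simp: u_def)
 qed
 have vb: "integrable M (%z. w (fst z) * norm (v z) powr p)" "(LINT z|M. w (fst z) * norm (v z) powr p) <= K * W" using bnd[of f] vm lim by (auto simp: v_def)
 have ip: "integrable M (%z. g z \<bullet> P z)" if "g : borel_measurable M" "integrable M (%z. norm (g z) * norm (P z))" for g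
  by (rule lint_bound[OF that(2)]) (use that(1) Pm Cauchy_Schwarz_ineq2 in \<open>auto simp: abs_mult\<close>)
 have evL1: "\<forall>\<^sub>F h in F. integrable M (u h)" and vL1: "integrable M v"
  and conv: "((%h. (LINT z|M. norm (u h z - v z))) \<longlongrightarrow> 0) F"
  using strong by (auto simp: strongly_L1_def L1_st_def integral_st_def u_def v_def M_def)
 have X0: "((%h. (LINT z|M. norm (u h z - v z) * norm (P z))) \<longlongrightarrow> 0) F"
 proof (rule tendsto_zero_split[OF conv, where K="2 * (K * W) + 1"])
  show "\<forall>\<^sub>F h in F. 0 <= (LINT z|M. norm (u h z - v z) * norm (P z))" by (intro always_eventually allI integral_nonneg_AE) auto
  fix \<delta> :: real assume d: "\<delta> > 0"
  obtain C where C: "C \<ge> 0" "!!a b. a \<ge> 0 ==> b \<ge> 0 ==> a * b <= \<delta> * a powr p + C * b powr (p / (p - 1))" using young_delta[OF p d] by auto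
  obtain k where k: "(LINT z|M. (if norm (P z) > real k then \<bar>w (fst z) * Q z\<bar> else 0)) < \<delta> / (2 * (C + 1))"
   using integral_tail_small[OF wQ, of "%z. norm (P z)" "\<delta> / (2 * (C + 1))"] Pm d C(1) by auto
  let ?tail = "%z. (if norm (P z) > real k then \<bar>w (fst z) * Q z\<bar> else 0)"
  have ti: "integrable M ?tail" by (rule lint_bound[OF wQ]) (use Pm Qm wm in auto)
  show "\<exists>c\<ge>0. \<forall>\<^sub>F h in F. (LINT z|M. norm (u h z - v z) * norm (P z)) <=
    \<delta> * (2 * (K * W) + 1) + c * (LINT z|M. norm (u h z - v z))"
  proof (intro exI[of _ "real k"] conjI)
   show "\<forall>\<^sub>F h in F. (LINT z|M. norm (u h z - v z) * norm (P z)) <=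
    \<delta> * (2 * (K * W) + 1) + real k * (LINT z|M. norm (u h z - v z))" using ev' evL1
   proof eventually_elim
    case (elim h)
    let ?G = "%z. real k * norm (u h z - v z) + \<delta> * (w (fst z) * norm (u h z) powr p)
       + \<delta> * (w (fst z) * norm (v z) powr p) + 2 * C * ?tail z"
    have Gi: "integrable M ?G" using elim vL1 vb ti by auto
    have pt: "norm (u h z - v z) * norm (P z) <= ?G z" for z
    proof (cases "norm (P z) > real k")
     case True
     have "norm (u h z - v z) * norm (P z) <= norm (u h z) * norm (P z) + norm (v z) * norm (P z)"
      unfolding distrib_right[symmetric] by (intro mult_right_mono norm_triangle_ineq4) auto
     also have "... <= (\<delta> * (w (fst z) * norm (u h z) powr p) + C * (w (fst z) * Q z)) + (\<delta> * (w (fst z) * norm (v z) powr p) + C * (w (fst z) * Q z))"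
      by (intro add_mono yw[OF C(2)])
     also have "... <= ?G z"
     proof -
      have "w (fst z) * Q z \<ge> 0" using w0[of "fst z"] by (simp add: Q_def)
      then show ?thesis using True by simp
     qed
     finally show ?thesis .
    next
     case False
     then have "norm (u h z - v z) * norm (P z) <= norm (u h z - v z) * real k" by (intro mult_left_mono) auto
     moreover have "w (fst z) * norm (u h z) powr p \<ge> 0" "w (fst z) * norm (v z) powr p \<ge> 0" using w0[of "fst z"] by auto
     ultimately show ?thesis using False d by (simp add: mult.commute add_nonneg_nonneg add_increasing2)
    qed
    have "(LINT z|M. norm (u h z - v z) * norm (P z)) <= integral\<^sup>L M ?G"
    proof (rule integral_mono_AE'[OF Gi])
     show "AE z in M. norm (u h z - v z) * norm (P z) <= ?G z" by (rule AE_I2, rule pt)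
     show "AE z in M. 0 <= ?G z" by (rule AE_I2, rule order_trans[OF _ pt]) simp
    qed
    also have "... = real k * (LINT z|M. norm (u h z - v z)) + \<delta> * (LINT z|M. w (fst z) * norm (u h z) powr p)
      + \<delta> * (LINT z|M. w (fst z) * norm (v z) powr p) + 2 * C * integral\<^sup>L M ?tail" using elim vL1 vb ti by simp
    also have "... <= real k * (LINT z|M. norm (u h z - v z)) + \<delta> * (K * W) + \<delta> * (K * W) + \<delta>"
    proof (intro add_mono order_refl mult_left_mono)
     have "2 * C * integral\<^sup>L M ?tail <= 2 * C * (\<delta> / (2 * (C + 1)))" using k C(1) by (intro mult_left_mono) auto
     also have "... <= \<delta>" using C(1) d by (simp add: field_simps)
     finally show "2 * C * integral\<^sup>L M ?tail <= \<delta>" .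
    qed (use elim vb d in auto)
    finally show ?case by (simp add: algebra_simps)
   qed
  qed simp
 qed
 have "((%h. (LINT z|M. u h z \<bullet> P z) - (LINT z|M. v z \<bullet> P z)) \<longlongrightarrow> 0) F"
 proof (rule Lim_null_comparison[OF _ X0])
  show "\<forall>\<^sub>F h in F. norm ((LINT z|M. u h z \<bullet> P z) - (LINT z|M. v z \<bullet> P z)) <= (LINT z|M. norm (u h z - v z) * norm (P z))"
   using ev'
  proof eventually_elim
   case (elim h)
   have i1: "integrable M (%z. u h z \<bullet> P z)" using elim ip by auto
   have i2: "integrable M (%z. v z \<bullet> P z)" using vm vP ip by auto
   have i3: "integrable M (%z. norm (u h z - v z) * norm (P z))"
   proof (rule lint_bound)
    show "integrable M (%z. norm (u h z) * norm (P z) + norm (v z) * norm (P z))" using elim vP by auto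
    show "AE z in M. norm (norm (u h z - v z) * norm (P z)) <= norm (norm (u h z) * norm (P z) + norm (v z) * norm (P z))"
     unfolding distrib_right[symmetric] by (intro AE_I2) (auto simp: abs_mult intro!: mult_right_mono norm_triangle_ineq4)
   qed (use elim vm Pm in auto)
   have "(LINT z|M. u h z \<bullet> P z) - (LINT z|M. v z \<bullet> P z) = (LINT z|M. (u h z - v z) \<bullet> P z)" using i1 i2 by (simp add: inner_diff_left)
   also have "norm ... <= (LINT z|M. norm ((u h z - v z) \<bullet> P z))" by (rule integral_norm_bound)
   also have "... <= (LINT z|M. norm (u h z - v z) * norm (P z))" by (rule integral_mono_AE'[OF i3]) (use Cauchy_Schwarz_ineq2 in auto)
   finally show ?case .
  qed
 qed
 then show ?thesis unfolding integral_st_def u_def v_def P_def M_def by (rule LIM_zero_cancel)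
qed

lemma grid_point_tendsto:
 fixes x :: "real^'n"
 assumes x: "x : torus" shows "(%n. (\<chi> i. (1 / real (Suc n)) * of_int (cell_of (1 / real (Suc n)) x $ i)) :: real^'n) \<longlonglongrightarrow> x"
proof (rule vec_tendstoI)
 fix i
 have xi: "0 <= x $ i" "x $ i < 1" using x by (auto simp: torus_def)
 have eq: "(\<chi> i. (1 / real (Suc n)) * of_int (cell_of (1 / real (Suc n)) x $ i)) $ i = of_int \<lfloor>real (Suc n) * x $ i\<rfloor> / real (Suc n)" for n
 proof -
  have "x $ i * real (Suc n) < real (Suc n)" using xi by (simp del: of_nat_Suc)
  then have "\<lfloor>x $ i * real (Suc n)\<rfloor> < int (Suc n)" by (simp add: floor_less_iff del: of_nat_Suc)
  then have "\<lfloor>x $ i * real (Suc n)\<rfloor> mod int (Suc n) = \<lfloor>x $ i * real (Suc n)\<rfloor>" using xi by (intro mod_pos_pos_trivial) auto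
  moreover have "\<lfloor>1 / (1 / real (Suc n))\<rfloor> = int (Suc n)" by (simp del: of_nat_Suc)
  ultimately show ?thesis by (simp add: cell_of_def mult.commute del: of_nat_Suc)
 qed
 have "(%n. of_int \<lfloor>real (Suc n) * x $ i\<rfloor> / real (Suc n)) \<longlonglongrightarrow> x $ i"
 proof (rule tendsto_sandwich[of "%n. x $ i - 1 / real (Suc n)" _ _ "%n. x $ i"])
  show "\<forall>\<^sub>F n in sequentially. x $ i - 1 / real (Suc n) <= of_int \<lfloor>real (Suc n) * x $ i\<rfloor> / real (Suc n)"
  proof (rule always_eventually, rule allI)
   fix n
   have "real (Suc n) * x $ i - 1 <= of_int \<lfloor>real (Suc n) * x $ i\<rfloor>" by linarith
   then have "(real (Suc n) * x $ i - 1) / real (Suc n) <= of_int \<lfloor>real (Suc n) * x $ i\<rfloor> / real (Suc n)" by (intro divide_right_mono) auto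
   then show "x $ i - 1 / real (Suc n) <= of_int \<lfloor>real (Suc n) * x $ i\<rfloor> / real (Suc n)" by (simp add: diff_divide_distrib del: of_nat_Suc)
  qed
  show "\<forall>\<^sub>F n in sequentially. of_int \<lfloor>real (Suc n) * x $ i\<rfloor> / real (Suc n) <= x $ i"
  proof (rule always_eventually, rule allI)
   fix n
   have "of_int \<lfloor>real (Suc n) * x $ i\<rfloor> <= real (Suc n) * x $ i" by linarith
   then show "of_int \<lfloor>real (Suc n) * x $ i\<rfloor> / real (Suc n) <= x $ i" by (simp add: pos_divide_le_eq mult.commute del: of_nat_Suc)
  qed
  have "(%n. x $ i - 1 / real (Suc n)) \<longlonglongrightarrow> x $ i - 0" by (intro tendsto_intros LIMSEQ_Suc[OF lim_1_over_n])
  then show "(%n. x $ i - 1 / real (Suc n)) \<longlonglongrightarrow> x $ i" by simp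
 qed simp
 then show "(%n. (\<chi> i. (1 / real (Suc n)) * of_int (cell_of (1 / real (Suc n)) x $ i)) $ i) \<longlonglongrightarrow> x $ i" unfolding eq .
qed

text \<open>
  Sampling at the corners of ever finer grids exhibits the function as a limit of measurable functions.
\<close>
lemma Caratheodory_measurable:
 fixes \<phi> :: "real => real^'n => real"
 assumes c: "!!t. t : {0<..<T} ==> continuous_on UNIV (\<phi> t)" and m: "!!x. (%t. \<phi> t x) : borel_measurable (lebesgue_on {0<..<T})"
 shows "(%z. \<phi> (fst z) (snd z)) : borel_measurable (spacetime T)"
proof (rule borel_measurable_LIMSEQ_real)
 let ?h = "%n. 1 / real (Suc n)"
 let ?pt = "%n K. (\<chi> i. ?h n * of_int (K $ i)) :: real^'n"
 have hm: "?h n : mesh_sizes" for n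
 proof -
  have "1 / ?h n = of_nat (Suc n)" by simp
  then show ?thesis unfolding mesh_sizes_def by (metis (mono_tags, lifting) mem_Collect_eq of_nat_0_less_iff of_nat_in_Nats zero_less_Suc zero_less_divide_1_iff)
 qed
 show "(%n. \<phi> (fst z) (?pt n (cell_of (?h n) (snd z)))) \<longlonglongrightarrow> \<phi> (fst z) (snd z)" if z: "z : space (spacetime T)" for z
 proof -
  have t: "fst z : {0<..<T}" "snd z : torus" using z by (auto simp: space_spacetime)
  have "isCont (\<phi> (fst z)) (snd z)" using c[OF t(1)] by (simp add: continuous_on_eq_continuous_at)
  then show ?thesis by (rule isCont_tendsto_compose) (rule grid_point_tendsto[OF t(2)])
 qed
 show "(%z. \<phi> (fst z) (?pt n (cell_of (?h n) (snd z)))) : borel_measurable (spacetime T)" for n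
 proof -
  let ?f = "%z. \<Sum>K\<in>cells (?h n). indicator (cell_cube (?h n) K) (snd z) *\<^sub>R \<phi> (fst z) (?pt n K)"
  have i: "(%z. indicator (cell_cube (?h n) K) (snd z) :: real) : borel_measurable (spacetime T)" for K :: "'n cell" unfolding spacetime_def
   by (rule measurable_lebesgue_on_borel, rule measurable_restrict_space1) (use measurable_snd in \<open>simp add: borel_prod[symmetric]\<close>)
  have l: "(%z. \<phi> (fst z) x) : borel_measurable (spacetime T)" for x
   unfolding spacetime_def using measurable_lift_fst[OF torus_lebesgue_sets m[of x]] by simp
  have "?f : borel_measurable (spacetime T)" by (intro borel_measurable_sum borel_measurable_scaleR i l)
  then show ?thesis
  proof (rule measurable_cong[THEN iffD1, rotated])
   fix z :: "real \<times> (real^'n)" assume "z : space (spacetime T)"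
   then have "snd z : torus" by (auto simp: space_spacetime)
   from grid_fun_indicator[OF hm this, of n "%K. \<phi> (fst z) (?pt n K)"]
   show "?f z = \<phi> (fst z) (?pt n (cell_of (?h n) (snd z)))" by (simp add: grid_fun_def)
  qed
 qed
qed

text \<open>
  The test function is bounded in space by \<open>N t\<close>. Times with large \<open>N t\<close> contribute little because of
  the bound on the \<open>L\<^sup>1\<close> norm at fixed time; on the other times strong convergence suffices.
\<close>
lemma weak_star_L1_convergence:
 fixes fs :: "'h => real => real^'n => real"
 assumes T: "T > 0" and strong: "strongly_L1 T F fs f" and ev: "\<forall>\<^sub>F h in F. (%z. fs h (fst z) (snd z)) : borel_measurable (spacetime T) \<and>
    (ALL t:{0<..<T}. integrable \<Omega> (%x. \<bar>fs h t x\<bar>) \<and>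
      (LINT x|\<Omega>. \<bar>fs h t x\<bar>) <= K)" and lim: "!!t. t : {0<..<T} ==> integrable \<Omega> (%x. \<bar>f t x\<bar>)"
   "!!t. t : {0<..<T} ==> (LINT x|\<Omega>. \<bar>f t x\<bar>) <= K" and phi: "L1_C T \<phi>"
 shows "((%h. integral_st T (%t x. fs h t x * \<phi> t x)) \<longlongrightarrow> integral_st T (%t x. f t x * \<phi> t x)) F"
proof -
 define M where "M = (spacetime T :: (real \<times> (real^'n)) measure)"
 define u where "u = (%h z. fs h (fst z) (snd z))"
 define v where "v = (%z. f (fst z) (snd z))"
 define P where "P = (%z. \<phi> (fst z) (snd z))"
 define N where "N = (%t. SUP x. \<bar>\<phi> t x\<bar>)"
 have Pm: "P : borel_measurable M" unfolding P_def M_def by (rule Caratheodory_measurable) (use phi in \<open>auto simp: L1_C_def\<close>)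
 have vm: "v : borel_measurable M" using strong by (auto simp: strongly_L1_def L1_st_def v_def M_def)
 have Ni: "integrable (lebesgue_on {0<..<T}) N" using phi by (simp add: L1_C_def N_def)
 have Nb: "\<bar>\<phi> t x\<bar> <= N t" if t: "t : {0<..<T}" and x: "x : torus" for t x
 proof -
  have per: "periodic (\<phi> t)" and ct: "continuous_on UNIV (\<phi> t)" using phi t by (auto simp: L1_C_def)
  have cs: "continuous_on (cbox 0 1) (\<phi> t)" by (rule continuous_on_subset[OF ct]) simp
  obtain c where c: "!!y. y : cbox 0 1 ==> norm (\<phi> t y) <= c" using compact_norm_bound[OF compact_cbox cs] by metis
  have "\<bar>\<phi> t y\<bar> <= c" for y using c[OF frac_vec_in_cbox[of y]] periodic_frac[OF per, of y] by simp
  then have "bdd_above (range (%x. \<bar>\<phi> t x\<bar>))" by (intro bdd_aboveI[of _ c]) auto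
  then show ?thesis unfolding N_def by (rule cSUP_upper[rotated]) simp
 qed
 have N0: "0 <= N t" if "t : {0<..<T}" for t
 proof -
  have "(0::real^'n) : torus" by (simp add: torus_def)
  then show ?thesis by (rule order_trans[OF abs_ge_zero Nb[OF that]])
 qed
 have sl: "integrable M (%z. w (fst z) * \<bar>g (fst z) (snd z)\<bar>)"
    "(LINT z|M. w (fst z) * \<bar>g (fst z) (snd z)\<bar>) <= K * (LINT t|lebesgue_on {0<..<T}. w t)" if gm: "(%z. g (fst z) (snd z)) : borel_measurable M"
   and gb: "!!t. t : {0<..<T} ==> integrable \<Omega> (%x. \<bar>g t x\<bar>) \<and>
      (LINT x|\<Omega>. \<bar>g t x\<bar>) <= K"
   and w: "integrable (lebesgue_on {0<..<T}) w" "!!t. t : {0<..<T} ==> 0 <= w t" for g :: "real => real^'n => real" and w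
 proof -
  have ae: "AE t in lebesgue_on {0<..<T}. integrable \<Omega> (%x. \<bar>g (fst (t, x)) (snd (t, x))\<bar>)
    & (LINT x|\<Omega>. \<bar>g (fst (t, x)) (snd (t, x))\<bar>) <= K" by (rule AE_I2) (use gb in auto)
  have m: "(%z. \<bar>g (fst z) (snd z)\<bar>) : borel_measurable (spacetime T)" using gm by (simp add: M_def)
  show "integrable M (%z. w (fst z) * \<bar>g (fst z) (snd z)\<bar>)"
    "(LINT z|M. w (fst z) * \<bar>g (fst z) (snd z)\<bar>) <= K * (LINT t|lebesgue_on {0<..<T}. w t)"
   using weighted_slice_bound[OF m w(1) w(2) _ ae] unfolding M_def by auto
 qed
 have PN: "\<bar>P z\<bar> <= N (fst z)" if "z : space M" for z using Nb that by (auto simp: M_def space_spacetime P_def)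
 have sp: "fst z : {0<..<T}" if "z : space M" for z using that by (auto simp: M_def space_spacetime)
 have ip: "integrable M (%z. g z * P z)" if "g : borel_measurable M" "integrable M (%z. N (fst z) * \<bar>g z\<bar>)" for g
 proof (rule lint_bound[OF that(2)])
  show "AE z in M. norm (g z * P z) <= norm (N (fst z) * \<bar>g z\<bar>)"
  proof (rule AE_I2)
   fix z assume z: "z : space M"
   have "norm (g z * P z) = \<bar>P z\<bar> * \<bar>g z\<bar>" by (simp add: abs_mult)
   also have "... <= N (fst z) * \<bar>g z\<bar>" using PN[OF z] by (intro mult_right_mono) auto
   finally show "norm (g z * P z) <= norm (N (fst z) * \<bar>g z\<bar>)" by simp
  qed
 qed (use that Pm in auto)
 have evL1: "\<forall>\<^sub>F h in F. integrable M (u h)" and vL1: "integrable M v"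
  and conv: "((%h. (LINT z|M. \<bar>u h z - v z\<bar>)) \<longlongrightarrow> 0) F"
  using strong by (auto simp: strongly_L1_def L1_st_def integral_st_def u_def v_def M_def)
 have vb: "integrable M (%z. w (fst z) * \<bar>v z\<bar>)" "(LINT z|M. w (fst z) * \<bar>v z\<bar>) <= K * (LINT t|lebesgue_on {0<..<T}. w t)"
  if w: "integrable (lebesgue_on {0<..<T}) w" "!!t. t : {0<..<T} ==> 0 <= w t" for w using sl[of f w] vm lim w by (auto simp: v_def)
 have ev': "\<forall>\<^sub>F h in F. u h : borel_measurable M & (ALL w. integrable (lebesgue_on {0<..<T}) w & (ALL t:{0<..<T}. 0 <= w t) -->
   integrable M (%z. w (fst z) * \<bar>u h z\<bar>) & (LINT z|M. w (fst z) * \<bar>u h z\<bar>) <= K * (LINT t|lebesgue_on {0<..<T}. w t))" using ev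
 proof eventually_elim
  case (elim h)
  then have m: "(%z. fs h (fst z) (snd z)) : borel_measurable M" by (simp add: M_def)
  show ?case using m sl[OF m] elim by (auto simp: u_def)
 qed
 have K0: "K \<ge> 0"
 proof -
  have "0 <= (LINT x|\<Omega>. \<bar>f (T/2) x\<bar>)" by (rule integral_nonneg_AE) simp
  also have "... <= K" by (rule lim(2)) (use T in simp)
  finally show ?thesis .
 qed
 have X0: "((%h. (LINT z|M. \<bar>u h z - v z\<bar> * \<bar>P z\<bar>)) \<longlongrightarrow> 0) F"
 proof (rule tendsto_zero_split[OF conv, where K="2 * K"])
  show "\<forall>\<^sub>F h in F. 0 <= (LINT z|M. \<bar>u h z - v z\<bar> * \<bar>P z\<bar>)" by (intro always_eventually allI integral_nonneg_AE) auto
  fix \<delta> :: real assume d: "\<delta> > 0"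
  obtain k where k: "(LINT t|lebesgue_on {0<..<T}. (if N t > real k then \<bar>N t\<bar> else 0)) < \<delta>"
   using integral_tail_small[OF Ni borel_measurable_integrable[OF Ni] d] by auto
  define w where "w = (%t. if N t > real k then \<bar>N t\<bar> else 0)"
  have wi: "integrable (lebesgue_on {0<..<T}) w" unfolding w_def by (rule lint_bound[OF Ni]) (use borel_measurable_integrable[OF Ni] in auto)
  have w0: "ALL t:{0<..<T}. 0 <= w t" by (simp add: w_def)
  show "\<exists>c\<ge>0. \<forall>\<^sub>F h in F. (LINT z|M. \<bar>u h z - v z\<bar> * \<bar>P z\<bar>) <=
    \<delta> * (2 * K) + c * (LINT z|M. \<bar>u h z - v z\<bar>)"
  proof (intro exI[of _ "real k"] conjI)
   show "\<forall>\<^sub>F h in F. (LINT z|M. \<bar>u h z - v z\<bar> * \<bar>P z\<bar>) <= \<delta> * (2 * K) + real k * (LINT z|M. \<bar>u h z - v z\<bar>)"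
    using ev' evL1
   proof eventually_elim
    case (elim h)
    have ub: "integrable M (%z. w (fst z) * \<bar>u h z\<bar>)" "(LINT z|M. w (fst z) * \<bar>u h z\<bar>) <= K * (LINT t|lebesgue_on {0<..<T}. w t)"
     using elim wi w0 by auto
    let ?G = "%z. real k * \<bar>u h z - v z\<bar> + w (fst z) * \<bar>u h z\<bar> + w (fst z) * \<bar>v z\<bar>"
    have vb': "integrable M (%z. w (fst z) * \<bar>v z\<bar>)" "(LINT z|M. w (fst z) * \<bar>v z\<bar>) <= K * (LINT t|lebesgue_on {0<..<T}. w t)"
     using vb[OF wi] w0 by auto
    have Gi: "integrable M ?G" using elim vL1 vb' ub by auto
    have pt: "\<bar>u h z - v z\<bar> * \<bar>P z\<bar> <= ?G z" if z: "z : space M" for z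
    proof (cases "N (fst z) > real k")
     case True
     have "\<bar>u h z - v z\<bar> * \<bar>P z\<bar> <= (\<bar>u h z\<bar> + \<bar>v z\<bar>) * N (fst z)" using PN[OF z] by (intro mult_mono) auto
     also have "... = w (fst z) * \<bar>u h z\<bar> + w (fst z) * \<bar>v z\<bar>" using True by (simp add: w_def algebra_simps)
     also have "... <= real k * \<bar>u h z - v z\<bar> + (w (fst z) * \<bar>u h z\<bar> + w (fst z) * \<bar>v z\<bar>)" by simp
     finally show ?thesis by (simp only: add.assoc)
    next
     case False
     then have "\<bar>u h z - v z\<bar> * \<bar>P z\<bar> <= \<bar>u h z - v z\<bar> * real k" using PN[OF z] by (intro mult_left_mono) auto
     then show ?thesis using False by (simp add: w_def mult.commute)
    qed
    have "(LINT z|M. \<bar>u h z - v z\<bar> * \<bar>P z\<bar>) <= integral\<^sup>L M ?G"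
    proof (rule integral_mono_AE'[OF Gi])
     show "AE z in M. \<bar>u h z - v z\<bar> * \<bar>P z\<bar> <= ?G z" by (rule AE_I2, rule pt)
     show "AE z in M. 0 <= ?G z" by (rule AE_I2, rule order_trans[OF _ pt]) simp_all
    qed
    also have "... = real k * (LINT z|M. \<bar>u h z - v z\<bar>) + (LINT z|M. w (fst z) * \<bar>u h z\<bar>)
      + (LINT z|M. w (fst z) * \<bar>v z\<bar>)" using elim vL1 vb' ub by simp
    also have "... <= real k * (LINT z|M. \<bar>u h z - v z\<bar>) + K * \<delta> + K * \<delta>"
    proof -
     have "K * (LINT t|lebesgue_on {0<..<T}. w t) <= K * \<delta>" using k K0 by (intro mult_left_mono) (auto simp: w_def)
     then show ?thesis using ub vb' by linarith
    qed
    finally show ?case by (simp add: algebra_simps)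
   qed
  qed simp
 qed
 have vP: "integrable M (%z. v z * P z)" using ip[OF vm] vb(1)[OF Ni N0] by auto
 have "((%h. (LINT z|M. u h z * P z) - (LINT z|M. v z * P z)) \<longlongrightarrow> 0) F"
 proof (rule Lim_null_comparison[OF _ X0])
  show "\<forall>\<^sub>F h in F. norm ((LINT z|M. u h z * P z) - (LINT z|M. v z * P z)) <= (LINT z|M. \<bar>u h z - v z\<bar> * \<bar>P z\<bar>)" using ev'
  proof eventually_elim
   case (elim h)
   have i1: "integrable M (%z. u h z * P z)" using elim ip Ni N0 by auto
   have "(LINT z|M. u h z * P z) - (LINT z|M. v z * P z) = (LINT z|M. (u h z - v z) * P z)" using i1 vP by (simp add: left_diff_distrib)
   also have "norm ... <= (LINT z|M. norm ((u h z - v z) * P z))" by (rule integral_norm_bound)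
   finally show ?case by (simp add: abs_mult)
  qed
 qed
 then show ?thesis unfolding integral_st_def u_def v_def P_def M_def by (rule LIM_zero_cancel)
qed

section \<open>From a Dirac Young measure to strong convergence\<close>

text \<open>
  The factor vanishes outside a compact set and is \<open>1\<close> on the ball of radius \<open>R\<close>. It is set to zero off
  \<^term>\<open>state_space\<close> because test functions of Young measures vanish there.
\<close>
definition cutoff :: "real => 'n::finite state => real" where
 "cutoff R U = (if U : state_space then max 0 (min 1 (2 - norm U / R)) else 0)"

lemma cutoff_range: "0 <= cutoff R U" "cutoff R U <= 1" by (auto simp: cutoff_def)

lemma closed_state_space: "closed (state_space :: 'n::finite state set)"
proof -
 have "(state_space :: 'n state set) = {U. 0 <= dens U} \<inter> {U. 0 <= ener U}" by (auto simp: state_space_def)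
 moreover have "closed {U :: 'n state. 0 <= dens U}" "closed {U :: 'n state. 0 <= ener U}"
  unfolding dens_def ener_def by (intro closed_Collect_le continuous_intros)+
 ultimately show ?thesis by (metis closed_Int)
qed

lemma cutoff_times_Cc:
 fixes l :: "'n::finite state => real"
 assumes R: "R > 0" and l: "continuous_on UNIV l" shows "(%U. l U * cutoff R U) : Cc_states" "(%U. (l U * cutoff R U) * (l U * cutoff R U)) : Cc_states"
  and "EX C. ALL U. \<bar>l U * cutoff R U\<bar> <= C"
proof -
 have c: "continuous_on state_space (cutoff R :: 'n state => real)"
 proof (rule continuous_on_eq)
  show "continuous_on state_space (%U :: 'n state. max 0 (min 1 (2 - norm U / R)))" by (intro continuous_intros) (use R in auto)
 qed (simp add: cutoff_def)
 have ls: "continuous_on state_space l" by (rule continuous_on_subset[OF l]) simp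
 let ?C = "state_space \<inter> cball 0 (2 * R) :: 'n state set"
 have C: "compact ?C" using closed_state_space by (intro closed_Int_compact) auto
 have z: "cutoff R U = 0" if "U \<notin> ?C" for U :: "'n state" using that R by (auto simp: cutoff_def field_simps)
 show "(%U. l U * cutoff R U) : Cc_states" "(%U. (l U * cutoff R U) * (l U * cutoff R U)) : Cc_states" unfolding Cc_states_def mem_Collect_eq
  by (intro conjI continuous_intros ls c exI[of _ ?C] C allI impI Int_lower1; simp add: z)+
 have "continuous_on ?C (%U. l U * cutoff R U)" by (intro continuous_intros continuous_on_subset[OF c] continuous_on_subset[OF ls]) auto
 then obtain B where B: "B > 0" "!!U. U : ?C ==> norm (l U * cutoff R U) <= B" using compact_norm_bound[OF C] by blast
 have "\<bar>l U * cutoff R U\<bar> <= B" for U using B z[of U] by (cases "U : ?C") auto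
 then show "EX C. ALL U. \<bar>l U * cutoff R U\<bar> <= C" by blast
qed

text \<open>
  The last bound interpolates between \<open>|m|\<^sup>2 \<le> 2 \<rho> E\<close> and the bound on \<open>\<rho>\<^sup>\<gamma>\<close>.
\<close>
lemma admissible_state_bounds:
 fixes U :: "'n::finite state"
 assumes g: "\<gamma> > 1" and k: "\<kappa> > 0" and r: "dens U > 0" and e: "\<kappa> * dens U powr \<gamma> <= internal_energy U"
 shows "0 <= ener U" "dens U powr \<gamma> <= ener U / \<kappa>" "norm (mom U) <= dens U + ener U"
  "norm (mom U) powr (2 * \<gamma> / (\<gamma> + 1)) <= ener U / \<kappa> + 2 * ener U"
proof -
 have kp: "\<kappa> * dens U powr \<gamma> \<ge> 0" using k by simp
 have q: "0 <= (norm (mom U))^2 / dens U / 2" using r by simp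
 show E0: "0 <= ener U" using e kp q by (simp add: internal_energy_def)
 have "\<kappa> * dens U powr \<gamma> <= ener U" using e q by (simp add: internal_energy_def)
 then show rE: "dens U powr \<gamma> <= ener U / \<kappa>" using k by (simp add: field_simps)
 have "(norm (mom U))^2 / dens U / 2 <= ener U" using e kp by (simp add: internal_energy_def)
 then have m2: "(norm (mom U))^2 <= dens U * (2 * ener U)" using r by (simp add: field_simps)
 also have "... <= (dens U + ener U)^2" by (simp add: power2_sum)
 finally show "norm (mom U) <= dens U + ener U" by (rule power2_le_imp_le) (use r E0 in simp)
 define a where "a = max (dens U powr \<gamma>) (2 * ener U)"
 have a0: "a > 0" using r by (auto simp: a_def less_max_iff_disj)
 then have a0': "a \<ge> 0" by simp
 have "norm (mom U) powr (2 * \<gamma> / (\<gamma> + 1)) = ((norm (mom U))^2) powr (\<gamma> / (\<gamma> + 1))"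
  by (cases "mom U = 0") (simp_all add: powr_powr powr_numeral[symmetric] del: powr_numeral)
 also have "... <= (dens U * (2 * ener U)) powr (\<gamma> / (\<gamma> + 1))" using m2 g by (intro powr_mono2) auto
 also have "... <= (a powr (1 / \<gamma>) * a) powr (\<gamma> / (\<gamma> + 1))"
 proof (rule powr_mono2)
  have "dens U = (dens U powr \<gamma>) powr (1 / \<gamma>)" using r g by (simp add: powr_powr)
  also have "... <= a powr (1 / \<gamma>)" using g by (intro powr_mono2) (auto simp: a_def)
  finally show "dens U * (2 * ener U) <= a powr (1 / \<gamma>) * a" using E0 r by (intro mult_mono) (auto simp: a_def)
 qed (use g r E0 in auto)
 also have "a powr (1 / \<gamma>) * a = a powr ((\<gamma> + 1) / \<gamma>)"
  using a0 g by (simp add: powr_mult_base[symmetric] mult.commute add_divide_distrib add.commute)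
 also have "(a powr ((\<gamma> + 1) / \<gamma>)) powr (\<gamma> / (\<gamma> + 1)) = a" using a0 g by (simp add: powr_powr)
 also have "a <= dens U powr \<gamma> + 2 * ener U" using E0 by (simp add: a_def)
 finally show "norm (mom U) powr (2 * \<gamma> / (\<gamma> + 1)) <= ener U / \<kappa> + 2 * ener U" using rE by linarith
qed

lemma eventually_h_to_0:
 "EV h. h : mesh_sizes & h <= 1 / 3" unfolding eventually_at by (intro exI[of _ "1/3"]) (auto simp: dist_real_def)

lemma measurable_spacetime_continuous:
 fixes f :: "real \<times> (real^'n) => 'b::{banach, second_countable_topology}"
 assumes "continuous_on ({0<..<T} \<times> UNIV) f" shows "f : borel_measurable (spacetime T)" unfolding spacetime_def
 by (intro measurable_lebesgue_on_borel borel_measurable_continuous_on_restrict continuous_on_subset[OF assms]) auto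

lemma measurable_torus_continuous:
 fixes f :: "(real^'n) => 'b::{banach, second_countable_topology}"
 assumes "continuous_on UNIV f" shows "f : borel_measurable \<Omega>"
 by (intro measurable_lebesgue_on_borel borel_measurable_continuous_on_restrict continuous_on_subset[OF assms]) auto

lemma lebesgue_on_interval_integral_const:
 assumes "T > 0" shows "integrable (lebesgue_on {0<..<T}) (%t. c :: real)" "(LINT t|lebesgue_on {0<..<T}. c) = T * c"
proof -
 have e: "emeasure (lebesgue_on {0<..<T}) {0<..<T} = ennreal T" using assms by (simp add: emeasure_lebesgue_on_borel)
 interpret finite_measure "lebesgue_on {0<..<T}" by (rule finite_measureI) (use e in simp)
 show "integrable (lebesgue_on {0<..<T}) (%t. c :: real)" by simp
 show "(LINT t|lebesgue_on {0<..<T}. c) = T * c" using assms e by (simp add: measure_def)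
qed

text \<open>
  Equality of the energies (\<open>en\<close>, \<open>energy\<close>) is what excludes concentration: the truncated energies
  converge to the full energy of the limit, so the remainders tend to zero.
\<close>
theorem strong_convergence_from_Dirac:
 fixes Uh :: "real => real => 'n::finite cell => 'n state" and \<rho> E :: "real => real^'n => real" and m :: "real => real^'n => real^'n"
 assumes g: "\<gamma> > 1" and T: "T > 0" and kap: "\<kappa> > 0" and cont: "!!h K. h : mesh_sizes ==> K : cells h ==> continuous_on {0..T} (%t. Uh h t K)"
  and pos: "!!h t K. [|h : mesh_sizes; h <= 1 / 3; t : {0..T}; K : cells h|] ==> 0 < dens (Uh h t K)"
  and ent: "!!h t K. [|h : mesh_sizes; h <= 1 / 3; t : {0..T}; K : cells h|] ==>
    \<kappa> * dens (Uh h t K) powr \<gamma> <= internal_energy (Uh h t K)" and en: "!!h t. [|h : mesh_sizes; h <= 1 / 3; t : {0..T}|] ==>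
    (LINT x|\<Omega>. ener (grid_fun h (Uh h t) x)) = Et" and cW: "continuous_on (strip T) (%(t, x). \<rho> t x)" "continuous_on (strip T) (%(t, x). m t x)"
   "continuous_on (strip T) (%(t, x). E t x)" and W0: "!!t x. t : {0..T} ==> 0 <= \<rho> t x" "!!t x. t : {0..T} ==> 0 <= E t x"
  and weak: "!!g. g : Cc_states ==>
    weakly_L1 T h_to_0 (%h t x. g (approx Uh h t x)) (%t x. g (\<rho> t x, m t x, E t x))" and energy: "integral_st T E = T * Et"
 shows "strongly_L1 T h_to_0 (approx Uh) (%t x. (\<rho> t x, m t x, E t x)) \<and>
     weak_star_Linf_Lp T \<gamma> h_to_0 (%h t x. dens (approx Uh h t x)) \<rho> \<and>
     strongly_L1 T h_to_0 (%h t x. dens (approx Uh h t x)) \<rho> \<and>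
     weak_star_Linf_Lp T (2 * \<gamma> / (\<gamma> + 1)) h_to_0 (%h t x. mom (approx Uh h t x)) m \<and>
     strongly_L1 T h_to_0 (%h t x. mom (approx Uh h t x)) m \<and>
     weak_star_Linf_L1 T h_to_0 (%h t x. ener (approx Uh h t x)) E \<and>
     strongly_L1 T h_to_0 (%h t x. ener (approx Uh h t x)) E"
proof -
 define M where "M = (spacetime T :: (real \<times> (real^'n)) measure)"
 interpret M: finite_measure M unfolding M_def by (rule finite_measure_spacetime)
 define u where "u = (%h z. approx Uh h (fst z) (snd z))"
 define W where "W = (%z. (\<rho> (fst z) (snd z), m (fst z) (snd z), E (fst z) (snd z)))"
 have spM: "space M = {0<..<T} \<times> torus" by (simp add: M_def space_spacetime)
 have cWW: "continuous_on (strip T) W" unfolding W_def using cW by (intro continuous_on_Pair) (simp_all add: case_prod_beta')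
 have Wm: "W : borel_measurable M" unfolding M_def by (rule measurable_spacetime_continuous, rule continuous_on_subset[OF cWW]) auto
 have cWc: "continuous_on ({0..T} \<times> cbox 0 1) W" by (rule continuous_on_subset[OF cWW]) auto
 obtain R where R: "R > 0" "!!z. z : {0..T} \<times> cbox 0 1 ==> norm (W z) <= R"
  using compact_norm_bound[OF compact_Times[OF compact_Icc compact_cbox] cWc] by blast
 have WR: "norm (W z) <= R" if "z : space M" for z using that torus_subset_cbox by (intro R(2)) (auto simp: spM)
 have norms: "\<bar>\<rho> t x\<bar> <= R" "norm (m t x) <= R" "\<bar>E t x\<bar> <= R" if "t : {0<..<T}" "x : torus" for t x
 proof -
  have "norm (W (t, x)) <= R" using WR that by (auto simp: spM)
  then have *: "norm (\<rho> t x, m t x, E t x) <= R" by (simp add: W_def)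
  show "\<bar>\<rho> t x\<bar> <= R" "norm (m t x) <= R" "\<bar>E t x\<bar> <= R"
   using * norm_fst_le[of "\<rho> t x" "(m t x, E t x)"] norm_snd_le[of "(m t x, E t x)" "\<rho> t x"]
    norm_fst_le[of "m t x" "E t x"] norm_snd_le[of "E t x" "m t x"] by auto
 qed
 have Wss: "W z : state_space" if "z : space M" for z using that W0 by (auto simp: spM W_def state_space_def dens_def ener_def)
 let ?eta = "cutoff R :: 'n state => real"
 have etaW: "?eta (W z) = 1" if "z : space M" for z using Wss[OF that] WR[OF that] R(1) by (simp add: cutoff_def field_simps)
 define good where "good = (%h::real. h : mesh_sizes & h <= 1 / 3)"
 have ev_good: "EV h. good h" unfolding good_def by (rule eventually_h_to_0)
 have um: "u h : borel_measurable M" if "good h" for h using that cont unfolding u_def approx_def M_def good_def by (intro measurable_spacetime_grid_fun) auto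
 have cell: "EX K:cells h. u h z = Uh h (fst z) K" if "good h" for h z using that cell_of_in_cells unfolding u_def approx_def grid_fun_def good_def by blast
 have adm: "0 < dens (u h z)" "\<kappa> * dens (u h z) powr \<gamma> <= internal_energy (u h z)" if gd: "good h" and z: "z : space M" for h z
  using cell[OF gd, of z] pos[of h "fst z"] ent[of h "fst z"] gd z by (auto simp: good_def spM)
 have sb: "0 <= ener (u h z)" "dens (u h z) powr \<gamma> <= ener (u h z) / \<kappa>" "norm (mom (u h z)) <= dens (u h z) + ener (u h z)"
  "norm (mom (u h z)) powr (2 * \<gamma> / (\<gamma> + 1)) <= ener (u h z) / \<kappa> + 2 * ener (u h z)" if "good h" "z : space M" for h z
  by (rule admissible_state_bounds[OF g kap adm(1)[OF that] adm(2)[OF that]])+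
 have cl: "continuous_on UNIV (dens :: 'n state => real)" "continuous_on UNIV (ener :: 'n state => real)"
   "continuous_on UNIV (%U :: 'n state. mom U $ i)" "continuous_on UNIV (mom :: 'n state => _)" for i
  unfolding dens_def ener_def mom_def by (intro continuous_intros)+
 have cm: "(dens :: 'n state => real) : borel_measurable borel" "(ener :: 'n state => real) : borel_measurable borel"
   "(%U :: 'n state. mom U $ i) : borel_measurable borel" "(mom :: 'n state => _) : borel_measurable borel" for i
  using cl by (auto intro: borel_measurable_continuous_onI)
 have trunc: "((%h. LINT z|M. \<bar>l (u h z) * ?eta (u h z) - l (W z)\<bar>) \<longlongrightarrow> 0) h_to_0"
  and trunc_ev: "EV h. integrable M (%z. l (u h z) * ?eta (u h z))" and trunc_W: "integrable M (%z. l (W z))"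
  if l: "continuous_on UNIV l" for l :: "'n state => real"
 proof -
  let ?g = "%U. l U * ?eta U"
  note Cc = cutoff_times_Cc[OF R(1) l]
  obtain C where C: "!!U. \<bar>?g U\<bar> <= C" using Cc(3) by blast
  have gW: "?g (W z) = l (W z)" if "z : space M" for z using etaW[OF that] by simp
  have w1: "weakly_L1 T h_to_0 (%h t x. ?g (approx Uh h t x)) (%t x. ?g (\<rho> t x, m t x, E t x))" by (rule weak[OF Cc(1)])
  have w2: "weakly_L1 T h_to_0 (%h t x. ?g (approx Uh h t x) * ?g (approx Uh h t x))
    (%t x. ?g (\<rho> t x, m t x, E t x) * ?g (\<rho> t x, m t x, E t x))" by (rule weak[OF Cc(2)])
  have evi: "EV h. integrable M (%z. ?g (u h z))" and iW: "integrable M (%z. ?g (W z))" using w1 by (auto simp: weakly_L1_def L1_st_def M_def u_def W_def)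
  then show "EV h. integrable M (%z. ?g (u h z))" by simp
  show "integrable M (%z. l (W z))" using iW by (rule Bochner_Integration.integrable_cong[THEN iffD1, rotated 2]) (auto simp: gW)
  have "Linf_st T (%t x. ?g (\<rho> t x, m t x, E t x))" unfolding Linf_st_def using borel_measurable_integrable[OF iW] C
   by (auto simp: M_def W_def intro!: exI[of _ C])
  then have t1: "((%h. LINT z|M. ?g (u h z) * ?g (W z)) \<longlongrightarrow> (LINT z|M. ?g (W z) * ?g (W z))) h_to_0"
   using w1 unfolding weakly_L1_def integral_st_def u_def W_def M_def by blast
  have "Linf_st T (%t (x::real^'n). 1)" unfolding Linf_st_def by (auto intro!: exI[of _ 1])
  then have t2: "((%h. LINT z|M. ?g (u h z) * ?g (u h z)) \<longlongrightarrow> (LINT z|M. ?g (W z) * ?g (W z))) h_to_0"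
   using w2 unfolding weakly_L1_def integral_st_def u_def W_def M_def by fastforce
  have "((%h. LINT z|M. \<bar>?g (u h z) - ?g (W z)\<bar>) \<longlongrightarrow> 0) h_to_0"
  proof (rule weak_square_imp_L1[OF M.finite_measure_axioms, where C=C])
   show "EV h. (%z. ?g (u h z)) : borel_measurable M & (ALL z:space M. \<bar>?g (u h z)\<bar> <= C)" using evi by eventually_elim (use C in auto)
  qed (use iW C t1 t2 in auto)
  moreover have "(LINT z|M. \<bar>?g (u h z) - ?g (W z)\<bar>) = (LINT z|M. \<bar>?g (u h z) - l (W z)\<bar>)" for h by (rule lint_cong) (simp_all add: gW)
  ultimately show "((%h. LINT z|M. \<bar>?g (u h z) - l (W z)\<bar>) \<longlongrightarrow> 0) h_to_0" by simp
 qed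
 have slice_int: "integrable \<Omega> (%x. l (approx Uh h t x))" if "good h" for h t and l :: "'n state => real"
 proof -
  have "(%x. l (approx Uh h t x)) = grid_fun h (%K. l (Uh h t K))" by (simp add: fun_eq_iff approx_def grid_fun_def)
  then show ?thesis using integrable_grid_fun[of h "%K. l (Uh h t K)"] that by (simp add: good_def)
 qed
 have slice_ener: "(LINT x|\<Omega>. ener (approx Uh h t x)) = Et" if "good h" "t : {0<..<T}" for h t using en[of h t] that by (simp add: approx_def good_def)
 have spacebound: "integrable M (%z. l (u h z))" "(LINT z|M. l (u h z)) <= T * (c * Et)" if gd: "good h" and lm: "l : borel_measurable borel"
   and le: "!!z. z : space M ==> 0 <= l (u h z) & l (u h z) <= c * ener (u h z)" for l :: "'n state => real" and h c
 proof -
  have m: "(%z. l (u h z)) : borel_measurable (spacetime T)" using measurable_compose[OF um[OF gd] lm] by (simp add: M_def)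
  have ae: "AE t in lebesgue_on {0<..<T}. integrable \<Omega> (%x. l (u h (t, x))) & (LINT x|\<Omega>. l (u h (t, x))) <= c * Et"
  proof (rule AE_I2)
   fix t assume "t : space (lebesgue_on {0<..<T})"
   then have t: "t : {0<..<T}" by simp
   have "(LINT x|\<Omega>. l (u h (t, x))) <= (LINT x|\<Omega>. c * ener (u h (t, x)))" using slice_int[OF gd, of l t] slice_int[OF gd, of ener t] le t
    by (intro integral_mono_AE AE_I2) (auto simp: u_def spM)
   also have "... = c * Et" using slice_ener[OF gd t] by (simp add: u_def)
   finally show "integrable \<Omega> (%x. l (u h (t, x))) & (LINT x|\<Omega>. l (u h (t, x))) <= c * Et" using slice_int[OF gd, of l t] by (simp add: u_def)
  qed
  have nn: "!!z. z : {0<..<T} \<times> torus ==> 0 <= l (u h z)" using le by (simp add: spM)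
  note ws = weighted_slice_bound[OF m lebesgue_on_interval_integral_const(1)[OF T, of 1] _ nn ae]
  show "integrable M (%z. l (u h z))" "(LINT z|M. l (u h z)) <= T * (c * Et)"
   using ws lebesgue_on_interval_integral_const(2)[OF T, of 1] by (auto simp: M_def mult.commute)
 qed
 have iE: "integrable M (%z. ener (u h z))" and IE: "(LINT z|M. ener (u h z)) = T * Et" if gd: "good h" for h
 proof -
  show i: "integrable M (%z. ener (u h z))" using spacebound(1)[OF gd cm(2), of 1] sb(1)[OF gd] by simp
  have "(LINT z|M. ener (u h z)) = (LINT t|lebesgue_on {0<..<T}. LINT x|\<Omega>. ener (u h (t, x)))" unfolding M_def spacetime_def
   by (rule Fubini_lebesgue_on[OF torus_lebesgue_sets]) (use i in \<open>simp add: M_def spacetime_def\<close>)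
  also have "... = (LINT t|lebesgue_on {0<..<T}. Et)" by (rule lint_cong) (auto simp: u_def slice_ener[OF gd])
  finally show "(LINT z|M. ener (u h z)) = T * Et" using lebesgue_on_interval_integral_const(2)[OF T] by simp
 qed
 have ir: "integrable M (%z. dens (u h z) powr \<gamma>)" "(LINT z|M. dens (u h z) powr \<gamma>) <= T * (1 / \<kappa> * Et)" if gd: "good h" for h
  using spacebound[OF gd, of "%U. dens U powr \<gamma>" "1 / \<kappa>"] sb(2)[OF gd] cm(1) by auto
 have meta: "?eta : borel_measurable borel"
 proof -
  have "?eta = (%U. indicator state_space U * max 0 (min 1 (2 - norm U / R)))" by (auto simp: cutoff_def indicator_def)
  moreover have "state_space : sets (borel :: 'n state measure)" using closed_state_space by (rule borel_closed)
  ultimately show ?thesis by simp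
 qed
 have eta1: "((%h. LINT z|M. (1 - ?eta (u h z))) \<longlongrightarrow> 0) h_to_0"
 proof -
  have "((%h. LINT z|M. \<bar>1 * ?eta (u h z) - 1\<bar>) \<longlongrightarrow> 0) h_to_0" by (rule trunc[of "%_. 1"]) simp
  moreover have "\<bar>1 * ?eta U - 1\<bar> = 1 - ?eta U" for U using cutoff_range[of R U] by simp
  ultimately show ?thesis by simp
 qed
 have remE: "((%h. LINT z|M. ener (u h z) * (1 - ?eta (u h z))) \<longlongrightarrow> 0) h_to_0"
 proof -
  have WE: "(LINT z|M. ener (W z)) = T * Et" using energy by (simp add: integral_st_def M_def W_def ener_def)
  have "((%h. (LINT z|M. ener (u h z) * ?eta (u h z)) - (LINT z|M. ener (W z))) \<longlongrightarrow> 0) h_to_0"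
  proof (rule Lim_null_comparison[OF _ trunc[OF cl(2)]])
   show "EV h. norm ((LINT z|M. ener (u h z) * ?eta (u h z)) - (LINT z|M. ener (W z)))
     <= (LINT z|M. \<bar>ener (u h z) * ?eta (u h z) - ener (W z)\<bar>)" using trunc_ev[OF cl(2)]
   proof eventually_elim
    case (elim h)
    have "(LINT z|M. ener (u h z) * ?eta (u h z)) - (LINT z|M. ener (W z)) = (LINT z|M. ener (u h z) * ?eta (u h z) - ener (W z))"
     using elim trunc_W[OF cl(2)] by simp
    also have "norm ... <= (LINT z|M. \<bar>ener (u h z) * ?eta (u h z) - ener (W z)\<bar>)"
     using integral_norm_bound[of M "%z. ener (u h z) * ?eta (u h z) - ener (W z)"] by simp
    finally show ?case .
   qed
  qed
  then have l: "((%h. - ((LINT z|M. ener (u h z) * ?eta (u h z)) - (LINT z|M. ener (W z)))) \<longlongrightarrow> 0) h_to_0" using tendsto_minus by fastforce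
  show ?thesis
  proof (rule Lim_transform_eventually[OF l])
   show "EV h. - ((LINT z|M. ener (u h z) * ?eta (u h z)) - (LINT z|M. ener (W z))) =
     (LINT z|M. ener (u h z) * (1 - ?eta (u h z)))" using trunc_ev[OF cl(2)] ev_good
   proof eventually_elim
    case (elim h)
    have "(LINT z|M. ener (u h z) * (1 - ?eta (u h z))) = (LINT z|M. ener (u h z) - ener (u h z) * ?eta (u h z))" by (simp add: right_diff_distrib)
    also have "... = T * Et - (LINT z|M. ener (u h z) * ?eta (u h z))" using elim iE IE by simp
    finally show ?case using WE by simp
   qed
  qed
 qed
 have remR: "((%h. LINT z|M. dens (u h z) * (1 - ?eta (u h z))) \<longlongrightarrow> 0) h_to_0"
 proof (rule tendsto_zero_split[OF eta1, where K="T * (1 / \<kappa> * Et)"])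
  show "EV h. 0 <= (LINT z|M. dens (u h z) * (1 - ?eta (u h z)))" using ev_good
  proof eventually_elim
   case (elim h)
   show ?case by (rule integral_nonneg_AE, rule AE_I2, rule mult_nonneg_nonneg[OF less_imp_le[OF adm(1)[OF elim]]])
      (simp_all add: cutoff_range)
  qed
  fix \<delta> :: real assume d: "\<delta> > 0"
  obtain C where C: "C \<ge> 0" "!!a b. a \<ge> 0 ==> b \<ge> 0 ==> a * b <= \<delta> * a powr \<gamma> + C * b powr (\<gamma> / (\<gamma> - 1))"
   using young_delta[OF g d] by auto
  show "\<exists>C\<ge>0. EV h. (LINT z|M. dens (u h z) * (1 - ?eta (u h z))) <= \<delta> * (T * (1 / \<kappa> * Et)) + C * (LINT z|M. (1 - ?eta (u h z)))"
  proof (intro exI[of _ C] conjI C(1))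
   show "EV h. (LINT z|M. dens (u h z) * (1 - ?eta (u h z))) <= \<delta> * (T * (1 / \<kappa> * Et)) + C * (LINT z|M. (1 - ?eta (u h z)))" using ev_good
   proof eventually_elim
    case (elim h)
    have em: "(%z. ?eta (u h z)) : borel_measurable M" by (rule measurable_compose[OF um[OF elim] meta])
    have ei: "integrable M (%z. 1 - ?eta (u h z))"
     by (rule M.integrable_const_bound[of _ 1]) (use em in \<open>auto simp: abs_le_iff cutoff_range add_increasing\<close>)
    have pt: "dens (u h z) * (1 - ?eta (u h z)) <= \<delta> * dens (u h z) powr \<gamma> + C * (1 - ?eta (u h z))" if z: "z : space M" for z
    proof -
     have e: "0 <= 1 - ?eta (u h z)" "1 - ?eta (u h z) <= 1" using cutoff_range[of R "u h z"] by auto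
     have "dens (u h z) * 1 <= \<delta> * dens (u h z) powr \<gamma> + C" using C(2)[of "dens (u h z)" 1] adm(1)[OF elim z] by simp
     then have "dens (u h z) * (1 - ?eta (u h z)) <= (\<delta> * dens (u h z) powr \<gamma> + C) * (1 - ?eta (u h z))" using e by (intro mult_right_mono) auto
     also have "... = \<delta> * dens (u h z) powr \<gamma> * (1 - ?eta (u h z)) + C * (1 - ?eta (u h z))" by (simp add: distrib_right)
     also have "... <= \<delta> * dens (u h z) powr \<gamma> + C * (1 - ?eta (u h z))" using d e by (intro add_mono mult_left_le) auto
     finally show ?thesis .
    qed
    have "(LINT z|M. dens (u h z) * (1 - ?eta (u h z))) <= (LINT z|M. \<delta> * dens (u h z) powr \<gamma> + C * (1 - ?eta (u h z)))"
    proof (rule integral_mono_AE')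
     show "integrable M (%z. \<delta> * dens (u h z) powr \<gamma> + C * (1 - ?eta (u h z)))" using ir[OF elim] ei by auto
     show "AE z in M. 0 <= \<delta> * dens (u h z) powr \<gamma> + C * (1 - ?eta (u h z))"
      using d C(1) by (intro AE_I2 add_nonneg_nonneg mult_nonneg_nonneg) (simp_all add: cutoff_range)
    qed (intro AE_I2 pt)
    also have "... = \<delta> * (LINT z|M. dens (u h z) powr \<gamma>) + C * (LINT z|M. (1 - ?eta (u h z)))"  using ir(1)[OF elim] ei by (subst lint_add) auto
    also have "... <= \<delta> * (T * (1 / \<kappa> * Et)) + C * (LINT z|M. (1 - ?eta (u h z)))"
     using mult_left_mono[OF ir(2)[OF elim] less_imp_le[OF d]] by (simp only: add_le_cancel_right)
    finally show ?case .
   qed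
  qed
 qed
 have idens: "integrable M (%z. dens (u h z))" if gd: "good h" for h
 proof -
  obtain C where C: "C \<ge> 0" "!!a b. a \<ge> 0 ==> b \<ge> 0 ==> a * b <= 1 * a powr \<gamma> + C * b powr (\<gamma> / (\<gamma> - 1))"
   using young_delta[OF g, of 1] by auto
  show ?thesis
  proof (rule lint_bound)
  show "integrable M (%z. dens (u h z) powr \<gamma> + C)" using ir(1)[OF gd] by auto
  show "AE z in M. norm (dens (u h z)) <= norm (dens (u h z) powr \<gamma> + C)"
  proof (rule AE_I2)
   fix z assume z: "z : space M"
   have "dens (u h z) <= dens (u h z) powr \<gamma> + C" using C(2)[of "dens (u h z)" 1] adm(1)[OF gd z] by simp
   then show "norm (dens (u h z)) <= norm (dens (u h z) powr \<gamma> + C)" using adm(1)[OF gd z] by simp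
  qed
  qed (rule measurable_compose[OF um[OF gd] cm(1)])
 qed
 have rem_int: "integrable M (%z. l (u h z) * (1 - ?eta (u h z)))" if gd: "good h" and i: "integrable M (%z. l (u h z))" for h and l :: "'n state => real"
 proof (rule lint_bound[OF i])
  show "(%z. l (u h z) * (1 - ?eta (u h z))) : borel_measurable M" using borel_measurable_integrable[OF i] measurable_compose[OF um[OF gd] meta] by simp
  show "AE z in M. norm (l (u h z) * (1 - ?eta (u h z))) <= norm (l (u h z))"
  proof (rule AE_I2)
   fix z have "\<bar>1 - ?eta (u h z)\<bar> <= 1" using cutoff_range[of R "u h z"] by simp
   then show "norm (l (u h z) * (1 - ?eta (u h z))) <= norm (l (u h z))" by (simp add: abs_mult mult_left_le)
  qed
 qed
 \<comment> \<open>what the truncation cuts off is bounded by the remainders of density and energy\<close>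
 have comp: "EV h. integrable M (%z. l (u h z))" "((%h. LINT z|M. \<bar>l (u h z) - l (W z)\<bar>) \<longlongrightarrow> 0) h_to_0"
  if l: "continuous_on UNIV l" and le: "!!h z. good h ==> z : space M ==> \<bar>l (u h z)\<bar> <= dens (u h z) + ener (u h z)" for l :: "'n state => real"
 proof -
  have il: "integrable M (%z. l (u h z))" if gd: "good h" for h
  proof (rule lint_bound)
   show "integrable M (%z. dens (u h z) + ener (u h z))" using idens[OF gd] iE[OF gd] by auto
   show "(%z. l (u h z)) : borel_measurable M" by (rule measurable_compose[OF um[OF gd] borel_measurable_continuous_onI[OF l]])
   show "AE z in M. norm (l (u h z)) <= norm (dens (u h z) + ener (u h z))"
   proof (rule AE_I2)
    fix z assume z: "z : space M"
    show "norm (l (u h z)) <= norm (dens (u h z) + ener (u h z))" using le[OF gd z] by simp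
   qed
  qed
  show "EV h. integrable M (%z. l (u h z))" using ev_good by eventually_elim (rule il)
  have lim: "((%h. (LINT z|M. \<bar>l (u h z) * ?eta (u h z) - l (W z)\<bar>) + ((LINT z|M. dens (u h z) * (1 - ?eta (u h z)))
    + (LINT z|M. ener (u h z) * (1 - ?eta (u h z))))) \<longlongrightarrow> 0) h_to_0" using tendsto_add[OF trunc[OF l] tendsto_add[OF remR remE]] by simp
  show "((%h. LINT z|M. \<bar>l (u h z) - l (W z)\<bar>) \<longlongrightarrow> 0) h_to_0"
  proof (rule Lim_null_comparison[OF _ lim])
   show "EV h. norm (LINT z|M. \<bar>l (u h z) - l (W z)\<bar>) <=
     (LINT z|M. \<bar>l (u h z) * ?eta (u h z) - l (W z)\<bar>) + ((LINT z|M. dens (u h z) * (1 - ?eta (u h z)))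
     + (LINT z|M. ener (u h z) * (1 - ?eta (u h z))))" using trunc_ev[OF l] ev_good
   proof eventually_elim
    case (elim h)
    let ?G = "%z. \<bar>l (u h z) * ?eta (u h z) - l (W z)\<bar> + (dens (u h z) * (1 - ?eta (u h z)) + ener (u h z) * (1 - ?eta (u h z)))"
    have i1: "integrable M (%z. \<bar>l (u h z) * ?eta (u h z) - l (W z)\<bar>)" using elim trunc_W[OF l] by auto
    have i2: "integrable M (%z. dens (u h z) * (1 - ?eta (u h z)))" "integrable M (%z. ener (u h z) * (1 - ?eta (u h z)))"
     using rem_int[OF elim(2)] idens[OF elim(2)] iE[OF elim(2)] by auto
    have pt: "\<bar>l (u h z) - l (W z)\<bar> <= ?G z" if z: "z : space M" for z
    proof -
     have e: "0 <= 1 - ?eta (u h z)" using cutoff_range[of R "u h z"] by auto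
     have "\<bar>l (u h z) - l (W z)\<bar> <= \<bar>l (u h z) * ?eta (u h z) - l (W z)\<bar> + \<bar>l (u h z) * (1 - ?eta (u h z))\<bar>"
      by (simp add: algebra_simps)
     also have "\<bar>l (u h z) * (1 - ?eta (u h z))\<bar> = \<bar>l (u h z)\<bar> * (1 - ?eta (u h z))" using e by (simp add: abs_mult)
     also have "... <= (dens (u h z) + ener (u h z)) * (1 - ?eta (u h z))" using le[OF elim(2) z] e by (rule mult_right_mono)
     finally show ?thesis by (simp add: distrib_right)
    qed
    have "(LINT z|M. \<bar>l (u h z) - l (W z)\<bar>) <= (LINT z|M. ?G z)"
    proof (rule integral_mono_AE')
     show "integrable M ?G" using i1 i2 by auto
     show "AE z in M. 0 <= ?G z" by (rule AE_I2, rule order_trans[OF abs_ge_zero pt])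
    qed (intro AE_I2 pt)
    also have "... = (LINT z|M. \<bar>l (u h z) * ?eta (u h z) - l (W z)\<bar>) + ((LINT z|M. dens (u h z) * (1 - ?eta (u h z)))
     + (LINT z|M. ener (u h z) * (1 - ?eta (u h z))))" by (subst lint_add[OF i1 integrable_sum2[OF i2]])
       (simp only: lint_add[OF i2])
    finally show ?case by simp
   qed
  qed
 qed
 have sbb: "\<bar>dens (u h z)\<bar> <= dens (u h z) + ener (u h z)" "\<bar>ener (u h z)\<bar> <= dens (u h z) + ener (u h z)"
   "\<bar>mom (u h z) $ i\<bar> <= dens (u h z) + ener (u h z)" if "good h" "z : space M" for h z i
  using adm(1)[OF that] sb(1,3)[OF that] component_le_norm_cart[of "mom (u h z)" i] by auto
 have cD: "EV h. integrable M (%z. dens (u h z))"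
  "((%h. LINT z|M. \<bar>dens (u h z) - dens (W z)\<bar>) \<longlongrightarrow> 0) h_to_0" by (rule comp[OF cl(1)]; rule sbb(1); assumption)+
 have cE: "EV h. integrable M (%z. ener (u h z))"
  "((%h. LINT z|M. \<bar>ener (u h z) - ener (W z)\<bar>) \<longlongrightarrow> 0) h_to_0" by (rule comp[OF cl(2)]; rule sbb(2); assumption)+
 have cMi: "EV h. integrable M (%z. mom (u h z) $ i)"
  "((%h. LINT z|M. \<bar>mom (u h z) $ i - mom (W z) $ i\<bar>) \<longlongrightarrow> 0) h_to_0" for i by (rule comp[OF cl(3)]; rule sbb(3); assumption)+
 have Wp: "dens (W z) = \<rho> (fst z) (snd z)" "mom (W z) = m (fst z) (snd z)" "ener (W z) = E (fst z) (snd z)" for z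
  by (simp_all add: W_def dens_def mom_def ener_def)
 have iW: "integrable M (%z. dens (W z))" "integrable M (%z. ener (W z))" "integrable M (%z. mom (W z) $ i)" for i
  using trunc_W[OF cl(1)] trunc_W[OF cl(2)] trunc_W[OF cl(3)] by auto
 have sD: "strongly_L1 T h_to_0 (%h t x. dens (approx Uh h t x)) \<rho>" unfolding strongly_L1_def L1_st_def integral_st_def
  using cD iW(1) by (auto simp: u_def Wp M_def)
 have sE: "strongly_L1 T h_to_0 (%h t x. ener (approx Uh h t x)) E" unfolding strongly_L1_def L1_st_def integral_st_def
  using cE iW(2) by (auto simp: u_def Wp M_def)
 have vec_int: "integrable M f" if "f : borel_measurable M" "!!i. integrable M (%z. f z $ i)" for f :: "_ => real^'n"
 proof (rule lint_bound)
  show "integrable M (%z. \<Sum>i. \<bar>f z $ i\<bar>)" using that by auto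
  show "AE z in M. norm (f z) <= norm (\<Sum>i. \<bar>f z $ i\<bar>)" by (rule AE_I2) (simp add: norm_le_l1_cart sum_nonneg)
 qed (use that in simp)
 have evM: "EV h. integrable M (%z. mom (u h z))"
 proof -
  have "EV h. ALL i:UNIV. integrable M (%z. mom (u h z) $ i)" by (rule eventually_ball_finite) (use cMi(1) in auto)
  then show ?thesis using ev_good
  proof eventually_elim
   case (elim h)
   show ?case by (rule vec_int[OF measurable_compose[OF um[OF elim(2)] cm(4)]]) (use elim(1) in auto)
  qed
 qed
 have iWm: "integrable M (%z. mom (W z))" by (rule vec_int[OF measurable_compose[OF Wm cm(4)]]) (use iW(3) in auto)
 have limM: "((%h. LINT z|M. norm (mom (u h z) - mom (W z))) \<longlongrightarrow> 0) h_to_0"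
 proof (rule Lim_null_comparison)
  show "((%h. \<Sum>i. LINT z|M. \<bar>mom (u h z) $ i - mom (W z) $ i\<bar>) \<longlongrightarrow> 0) h_to_0" using cMi(2) by (intro tendsto_null_sum) auto
  show "EV h. norm (LINT z|M. norm (mom (u h z) - mom (W z))) <= (\<Sum>i. LINT z|M. \<bar>mom (u h z) $ i - mom (W z) $ i\<bar>)" using evM
  proof eventually_elim
   case (elim h)
   have ii: "integrable M (%z. \<bar>mom (u h z) $ i - mom (W z) $ i\<bar>)" for i
    using bounded_linear_vec_nth[THEN integrable_bounded_linear, OF elim, of i] iW(3)[of i] by auto
   have "(LINT z|M. norm (mom (u h z) - mom (W z))) <= (LINT z|M. (\<Sum>i. \<bar>mom (u h z) $ i - mom (W z) $ i\<bar>))"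
   proof (rule integral_mono_AE')
    show "integrable M (%z. \<Sum>i. \<bar>mom (u h z) $ i - mom (W z) $ i\<bar>)" using ii by auto
    show "AE z in M. norm (mom (u h z) - mom (W z)) <= (\<Sum>i. \<bar>mom (u h z) $ i - mom (W z) $ i\<bar>)"
    proof (rule AE_I2)
     fix z show "norm (mom (u h z) - mom (W z)) <= (\<Sum>i. \<bar>mom (u h z) $ i - mom (W z) $ i\<bar>)"
      using norm_le_l1_cart[of "mom (u h z) - mom (W z)"] by simp
    qed
   qed (auto intro: sum_nonneg)
   also have "... = (\<Sum>i. LINT z|M. \<bar>mom (u h z) $ i - mom (W z) $ i\<bar>)" using ii by (rule lint_sum)
   finally show ?case by simp
  qed
 qed
 have sM: "strongly_L1 T h_to_0 (%h t x. mom (approx Uh h t x)) m" unfolding strongly_L1_def L1_st_def integral_st_def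
  using evM iWm limM by (auto simp: u_def Wp M_def)
 have sU: "strongly_L1 T h_to_0 (approx Uh) (%t x. (\<rho> t x, m t x, E t x))"
 proof -
  have trip: "norm (a - b) <= \<bar>dens a - dens b\<bar> + (norm (mom a - mom b) + \<bar>ener a - ener b\<bar>)" for a b :: "'n state"
  proof -
   obtain a1 a2 a3 b1 b2 b3 where ab: "a = (a1, a2, a3)" "b = (b1, b2, b3)" by (metis prod_cases3)
   have "norm (a - b) <= norm (a1 - b1) + norm (a2 - b2, a3 - b3)" unfolding ab using norm_Pair_le[of "a1 - b1" "(a2 - b2, a3 - b3)"] by simp
   also have "norm (a2 - b2, a3 - b3) <= norm (a2 - b2) + norm (a3 - b3)" by (rule norm_Pair_le)
   finally show ?thesis by (simp add: ab dens_def mom_def ener_def)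
  qed
  have ui: "integrable M f" if "f : borel_measurable M" "integrable M (%z. dens (f z))" "integrable M (%z. mom (f z))" "integrable M (%z. ener (f z))"
   for f :: "_ => 'n state"
  proof (rule lint_bound)
   show "integrable M (%z. \<bar>dens (f z)\<bar> + (norm (mom (f z)) + \<bar>ener (f z)\<bar>))" using that by auto
   show "AE z in M. norm (f z) <= norm (\<bar>dens (f z)\<bar> + (norm (mom (f z)) + \<bar>ener (f z)\<bar>))"
   proof (rule AE_I2)
    fix z show "norm (f z) <= norm (\<bar>dens (f z)\<bar> + (norm (mom (f z)) + \<bar>ener (f z)\<bar>))"
     using trip[of "f z" 0] by (simp add: dens_def mom_def ener_def)
   qed
  qed (use that in simp)
  have ev: "EV h. integrable M (u h)" using cD(1) cE(1) evM ev_good by eventually_elim (rule ui[OF um])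
  have iWW: "integrable M W" by (rule ui[OF Wm iW(1) iWm iW(2)])
  have lim: "((%h. (LINT z|M. \<bar>dens (u h z) - dens (W z)\<bar>) + ((LINT z|M. norm (mom (u h z) - mom (W z))) + (LINT z|M. \<bar>ener (u h z) - ener (W z)\<bar>))) \<longlongrightarrow> 0) h_to_0"
   using tendsto_add[OF cD(2) tendsto_add[OF limM cE(2)]] by simp
  have "((%h. LINT z|M. norm (u h z - W z)) \<longlongrightarrow> 0) h_to_0"
  proof (rule Lim_null_comparison[OF _ lim])
   show "EV h. norm (LINT z|M. norm (u h z - W z)) <= (LINT z|M. \<bar>dens (u h z) - dens (W z)\<bar>) +
     ((LINT z|M. norm (mom (u h z) - mom (W z))) + (LINT z|M. \<bar>ener (u h z) - ener (W z)\<bar>))" using cD(1) cE(1) evM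
   proof eventually_elim
    case (elim h)
    have i: "integrable M (%z. \<bar>dens (u h z) - dens (W z)\<bar>)" "integrable M (%z. norm (mom (u h z) - mom (W z)))"
      "integrable M (%z. \<bar>ener (u h z) - ener (W z)\<bar>)" using elim iW iWm by auto
    have "(LINT z|M. norm (u h z - W z)) <= (LINT z|M. \<bar>dens (u h z) - dens (W z)\<bar> + (norm (mom (u h z) - mom (W z)) + \<bar>ener (u h z) - ener (W z)\<bar>))"
     by (rule integral_mono_AE') (use i trip in \<open>auto\<close>)
    also have "... = (LINT z|M. \<bar>dens (u h z) - dens (W z)\<bar>) +
     ((LINT z|M. norm (mom (u h z) - mom (W z))) + (LINT z|M. \<bar>ener (u h z) - ener (W z)\<bar>))" by (subst lint_add[OF i(1) integrable_sum2[OF i(2,3)]])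
       (simp only: lint_add[OF i(2,3)])
    finally show ?case by simp
   qed
  qed
  then show ?thesis unfolding strongly_L1_def L1_st_def integral_st_def using ev iWW by (auto simp: u_def W_def M_def)
 qed
 have slice_bound: "(LINT x|\<Omega>. l (approx Uh h t x)) <= c * Et"
  if gd: "good h" and t: "t : {0<..<T}" and le: "!!z. z : space M ==> l (u h z) <= c * ener (u h z)" for l :: "'n state => real" and h c t
 proof -
  have "(LINT x|\<Omega>. l (approx Uh h t x)) <= (LINT x|\<Omega>. c * ener (approx Uh h t x))"
  proof (intro integral_mono_AE AE_I2)
   fix x assume "x : space (lebesgue_on (torus :: (real^'n) set))"
   then have "(t, x) : space M" using t by (simp add: spM)
   then show "l (approx Uh h t x) <= c * ener (approx Uh h t x)" using le[of "(t, x)"] by (simp add: u_def)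
  qed (use slice_int[OF gd, of l t] slice_int[OF gd, of ener t] in auto)
  also have "... = c * Et" using slice_ener[OF gd t] by simp
  finally show ?thesis .
 qed
 have limit_slice: "integrable \<Omega> (%x. norm (f x) powr p) & (LINT x|\<Omega>. norm (f x) powr p) <= R powr p"
  if f: "continuous_on UNIV f" and b: "!!x. x : torus ==> norm (f x) <= R" and p: "p > 0" for f :: "real^'n => 'c::euclidean_space" and p
 proof -
  interpret tm: finite_measure "lebesgue_on (torus :: (real^'n) set)" by (rule finite_measure_torus)
  have m: "(%x. norm (f x) powr p) : borel_measurable \<Omega>" using measurable_torus_continuous[OF f] by simp
  have bb: "norm (f x) powr p <= R powr p" if "x : torus" for x using b[OF that] p by (intro powr_mono2) auto
  have i: "integrable \<Omega> (%x. norm (f x) powr p)" by (rule tm.integrable_const_bound[of _ "R powr p"]) (use m bb in \<open>auto intro!: AE_I2\<close>)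
  have "(LINT x|\<Omega>. norm (f x) powr p) <= (LINT x|lebesgue_on (torus :: (real^'n) set). R powr p)"
   by (rule integral_mono_AE[OF i]) (use bb in \<open>auto intro!: AE_I2\<close>)
  also have "... = R powr p" using measure_torus[where 'n='n] by simp
  finally show ?thesis using i by blast
 qed
 have ct: "continuous_on UNIV (\<rho> t)" "continuous_on UNIV (m t)" "continuous_on UNIV (E t)" if t: "t : {0<..<T}" for t
 proof -
  have *: "continuous_on UNIV (%x. g (t, x))" if "continuous_on (strip T) g" for g :: "real \<times> (real^'n) => 'c::topological_space"
   by (rule continuous_on_compose2[OF that]) (use t in \<open>auto intro!: continuous_intros\<close>)
  show "continuous_on UNIV (\<rho> t)" "continuous_on UNIV (m t)" "continuous_on UNIV (E t)" using *[OF cW(1)] *[OF cW(2)] *[OF cW(3)] by simp_all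
 qed
 have weak_star: "(EV h. Linf_Lp T p (%t x. l (approx Uh h t x))) & Linf_Lp T p f \<and>
   (EV h. (%z. l (approx Uh h (fst z) (snd z))) : borel_measurable (spacetime T) \<and>
    (ALL t:{0<..<T}. integrable \<Omega> (%x. norm (l (approx Uh h t x)) powr p) \<and>
      (LINT x|\<Omega>. norm (l (approx Uh h t x)) powr p) <= max (c * Et) (R powr p))) \<and>
   (ALL t:{0<..<T}. integrable \<Omega> (%x. norm (f t x) powr p) \<and>
      (LINT x|\<Omega>. norm (f t x) powr p) <= max (c * Et) (R powr p))"
  if p: "p > 0" and lm: "l : borel_measurable borel" and fm: "(%z. f (fst z) (snd z)) : borel_measurable (spacetime T)"
   and fc': "ALL t:{0<..<T}. continuous_on UNIV (f t)" and fR': "ALL t:{0<..<T}. ALL x:torus. norm (f t x) <= R"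
   and le': "ALL h z. good h --> z : space M --> norm (l (u h z)) powr p <= c * ener (u h z)"
  for l :: "'n state => 'c::euclidean_space" and p c and f :: "real => real^'n => 'c"
 proof -
  have fc: "continuous_on UNIV (f t)" if "t : {0<..<T}" for t using fc' that by blast
  have fR: "norm (f t x) <= R" if "t : {0<..<T}" "x : torus" for t x using fR' that by blast
  have le: "norm (l (u h z)) powr p <= c * ener (u h z)" if "good h" "z : space M" for h z using le' that by blast
  have mh: "(%z. l (approx Uh h (fst z) (snd z))) : borel_measurable (spacetime T)" if gd: "good h" for h
   using measurable_compose[OF um[OF gd] lm] by (simp add: u_def M_def)
  have sh: "integrable \<Omega> (%x. norm (l (approx Uh h t x)) powr p) \<and>
      (LINT x|\<Omega>. norm (l (approx Uh h t x)) powr p) <= c * Et" if gd: "good h" and t: "t : {0<..<T}" for h t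
   using slice_int[OF gd, of "%U. norm (l U) powr p" t] slice_bound[OF gd t, of "%U. norm (l U) powr p" c] le[OF gd] by auto
  have fs: "integrable \<Omega> (%x. norm (f t x) powr p) & (LINT x|\<Omega>. norm (f t x) powr p) <= R powr p" if t: "t : {0<..<T}" for t
   by (rule limit_slice[OF fc[OF t] fR[OF t] p])
  have 1: "EV h. Linf_Lp T p (%t x. l (approx Uh h t x))" using ev_good
  proof eventually_elim
   case (elim h)
   show ?case unfolding Linf_Lp_def using mh[OF elim] sh[OF elim] by (auto intro!: exI[of _ "c * Et"] AE_I2)
  qed
  have 2: "Linf_Lp T p f" unfolding Linf_Lp_def using fm fs by (auto intro!: exI[of _ "R powr p"] AE_I2)
  have 3: "EV h. (%z. l (approx Uh h (fst z) (snd z))) : borel_measurable (spacetime T) \<and>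
    (ALL t:{0<..<T}. integrable \<Omega> (%x. norm (l (approx Uh h t x)) powr p) \<and>
      (LINT x|\<Omega>. norm (l (approx Uh h t x)) powr p) <= max (c * Et) (R powr p))"
   using ev_good by eventually_elim (use mh sh in \<open>auto simp: le_max_iff_disj\<close>)
  show ?thesis using 1 2 3 fs by (auto simp: le_max_iff_disj)
 qed
 have fm: "(%z. \<rho> (fst z) (snd z)) : borel_measurable (spacetime T)" "(%z. m (fst z) (snd z)) : borel_measurable (spacetime T)"
  "(%z. E (fst z) (snd z)) : borel_measurable (spacetime T)"
  using borel_measurable_integrable[OF iW(1)] borel_measurable_integrable[OF iWm] borel_measurable_integrable[OF iW(2)] by (simp_all add: Wp M_def)
 have ct': "ALL t:{0<..<T}. continuous_on UNIV (\<rho> t)" "ALL t:{0<..<T}. continuous_on UNIV (m t)" "ALL t:{0<..<T}. continuous_on UNIV (E t)"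
  using ct by blast+
 have nr: "ALL t:{0<..<T}. ALL x:torus. norm (\<rho> t x) <= R" "ALL t:{0<..<T}. ALL x:torus. norm (m t x) <= R"
  "ALL t:{0<..<T}. ALL x:torus. norm (E t x) <= R" using norms by auto
 have g0: "\<gamma> > 0" using g by simp
 have wD: "weak_star_Linf_Lp T \<gamma> h_to_0 (%h t x. dens (approx Uh h t x)) \<rho>"
 proof -
  have *: "ALL h z. good h --> z : space M --> norm (dens (u h z)) powr \<gamma> <= 1 / \<kappa> * ener (u h z)"
  proof (intro allI impI)
   fix h z assume gz: "good h" "z : space M"
   show "norm (dens (u h z)) powr \<gamma> <= 1 / \<kappa> * ener (u h z)" using sb(2)[OF gz] adm(1)[OF gz] by simp
  qed
  note ws = weak_star[of \<gamma> dens \<rho> "1 / \<kappa>", OF g0 cm(1) fm(1) ct'(1) nr(1) *]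
  show ?thesis unfolding weak_star_Linf_Lp_def using ws weak_star_Lp_convergence[OF g T sD ws[THEN conjunct2, THEN conjunct2, THEN conjunct1]] by blast
 qed
 have wM: "weak_star_Linf_Lp T (2 * \<gamma> / (\<gamma> + 1)) h_to_0 (%h t x. mom (approx Uh h t x)) m"
 proof -
  have p: "2 * \<gamma> / (\<gamma> + 1) > 1" using g by (simp add: field_simps)
  then have p0: "2 * \<gamma> / (\<gamma> + 1) > 0" by linarith
  have *: "ALL h z. good h --> z : space M --> norm (mom (u h z)) powr (2 * \<gamma> / (\<gamma> + 1)) <= (1 / \<kappa> + 2) * ener (u h z)"
   using sb(4) by (simp add: distrib_right)
  note ws = weak_star[of "2 * \<gamma> / (\<gamma> + 1)" mom m "1 / \<kappa> + 2", OF p0 cm(4) fm(2) ct'(2) nr(2) *]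
  show ?thesis unfolding weak_star_Linf_Lp_def using ws weak_star_Lp_convergence[OF p T sM ws[THEN conjunct2, THEN conjunct2, THEN conjunct1]] by blast
 qed
 have wE: "weak_star_Linf_L1 T h_to_0 (%h t x. ener (approx Uh h t x)) E"
 proof -
  have *: "ALL h z. good h --> z : space M --> norm (ener (u h z)) powr 1 <= 1 * ener (u h z)" using sb(1) by simp
  have abs1: "norm x powr 1 = \<bar>x\<bar>" for x :: real by simp
  note ws = weak_star[of 1 ener E 1, OF zero_less_one cm(2) fm(3) ct'(3) nr(3) *]
  show ?thesis unfolding weak_star_Linf_L1_def using ws weak_star_L1_convergence[OF T sE ws[THEN conjunct2, THEN conjunct2, THEN conjunct1, unfolded abs1]]
    ws[THEN conjunct2, THEN conjunct2, THEN conjunct2, unfolded abs1] by blast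
 qed
 show ?thesis using sU sD sM sE wD wM wE by blast
qed

section \<open>Continuously differentiable fields\<close>

lemma C1_on_linear:
 assumes L: "bounded_linear L" and f: "C1_on S f" shows "C1_on S (%z. L (f z))"
proof -
 obtain f' where f': "!!z. z : S ==> (f has_derivative blinfun_apply (f' z)) (at z within S)" "continuous_on S f'" using f by (auto simp: C1_on_def)
 show ?thesis unfolding C1_on_def
 proof (intro exI[of _ "%z. Blinfun L o\<^sub>L f' z"] conjI ballI)
  show "((%z. L (f z)) has_derivative blinfun_apply (Blinfun L o\<^sub>L f' z)) (at z within S)" if "z : S" for z
   using bounded_linear.has_derivative[OF L f'(1)[OF that]] by (simp add: blinfun_compose.rep_eq bounded_linear_Blinfun_apply[OF L] o_def)
  show "continuous_on S (%z. Blinfun L o\<^sub>L f' z)" by (intro bounded_bilinear.continuous_on[OF bounded_bilinear_blinfun_compose] continuous_intros f'(2))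
 qed
qed

lemma C1_on_const: "C1_on S (%z. c)" unfolding C1_on_def by (intro exI[of _ "%z. 0"]) (auto simp: zero_blinfun.rep_eq)

lemma C1_on_add:
 assumes "C1_on S f" "C1_on S g" shows "C1_on S (%z. f z + g z)"
proof -
 obtain f' g' where d: "!!z. z : S ==> (f has_derivative blinfun_apply (f' z)) (at z within S)" "continuous_on S f'"
  "!!z. z : S ==> (g has_derivative blinfun_apply (g' z)) (at z within S)" "continuous_on S g'" using assms by (auto simp: C1_on_def)
 show ?thesis unfolding C1_on_def by (intro exI[of _ "%z. f' z + g' z"] conjI ballI continuous_intros d)
    (use has_derivative_add[OF d(1,3)] in \<open>simp add: plus_blinfun.rep_eq\<close>)
qed

lemma C1_on_sum: "(!!i. i : I ==> C1_on S (f i)) ==> C1_on S (%z. \<Sum>i\<in>I. f i z)"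
 by (induction I rule: infinite_finite_induct) (auto intro: C1_on_const C1_on_add)

lemma C1_on_scaleR:
 fixes f :: "'a::real_normed_vector => real"
 assumes "C1_on S f" "C1_on S g" shows "C1_on S (%z. f z *\<^sub>R g z)"
proof -
 obtain f' g' where d: "!!z. z : S ==> (f has_derivative blinfun_apply (f' z)) (at z within S)" "continuous_on S f'"
  "!!z. z : S ==> (g has_derivative blinfun_apply (g' z)) (at z within S)" "continuous_on S g'" using assms by (auto simp: C1_on_def)
 note c = C1_on_continuous_on[OF assms(1)] C1_on_continuous_on[OF assms(2)]
 show ?thesis unfolding C1_on_def
 proof (intro exI[of _ "%z. f z *\<^sub>R g' z + (blinfun_scaleR_left (g z) o\<^sub>L f' z)"] conjI ballI)
  show "((%z. f z *\<^sub>R g z) has_derivative blinfun_apply (f z *\<^sub>R g' z + (blinfun_scaleR_left (g z) o\<^sub>L f' z))) (at z within S)"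
   if "z : S" for z using has_derivative_scaleR[OF d(1)[OF that] d(3)[OF that]]
   by (simp add: plus_blinfun.rep_eq scaleR_blinfun.rep_eq blinfun_compose.rep_eq blinfun_scaleR_left.rep_eq o_def)
  have "continuous_on S (%z. blinfun_scaleR_left (g z) :: real \<Rightarrow>\<^sub>L 'b)"
   by (rule bounded_linear.continuous_on[OF bounded_linear_blinfun_scaleR_left c(2)])
  then show "continuous_on S (%z. f z *\<^sub>R g' z + (blinfun_scaleR_left (g z) o\<^sub>L f' z))"
   by (intro continuous_intros c d bounded_bilinear.continuous_on[OF bounded_bilinear_blinfun_compose])
 qed
qed

lemma C1_on_mult:
 fixes f g :: "'a::real_normed_vector => real"
 assumes "C1_on S f" "C1_on S g" shows "C1_on S (%z. f z * g z)" using C1_on_scaleR[OF assms] by simp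

lemma C1_on_compose_real:
 fixes f :: "'a::real_normed_vector => real"
 assumes f: "C1_on S f" and h: "!!z. z : S ==> (h has_real_derivative h' (f z)) (at (f z))" and h': "continuous_on (f ` S) h'" shows "C1_on S (%z. h (f z))"
proof -
 obtain f' where d: "!!z. z : S ==> (f has_derivative blinfun_apply (f' z)) (at z within S)" "continuous_on S f'" using f by (auto simp: C1_on_def)
 show ?thesis unfolding C1_on_def
 proof (intro exI[of _ "%z. h' (f z) *\<^sub>R f' z"] conjI ballI)
  show "((%z. h (f z)) has_derivative blinfun_apply (h' (f z) *\<^sub>R f' z)) (at z within S)" if "z : S" for z
   using has_derivative_compose[OF d(1)[OF that] h[OF that, unfolded has_field_derivative_def]] by (simp add: scaleR_blinfun.rep_eq)
  show "continuous_on S (%z. h' (f z) *\<^sub>R f' z)" by (intro continuous_intros d continuous_on_compose2[OF h' C1_on_continuous_on[OF f]]) auto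
 qed
qed

lemma C1_on_divide:
 fixes f g :: "'a::real_normed_vector => real"
 assumes f: "C1_on S f" and g: "C1_on S g" and nz: "!!z. z : S ==> g z ~= 0" shows "C1_on S (%z. f z / g z)"
proof -
 have "C1_on S (%z. inverse (g z))"
 proof (rule C1_on_compose_real[OF g, where h'="%y. - (inverse y * inverse y)"])
  show "(inverse has_real_derivative - (inverse (g z) * inverse (g z))) (at (g z))" if "z : S" for z
   using DERIV_inverse[OF nz[OF that]] by (simp add: power2_eq_square numeral_2_eq_2)
 qed (use nz in \<open>auto intro!: continuous_intros\<close>)
 then show ?thesis using C1_on_mult[OF f] by (simp add: divide_inverse)
qed

lemma C1_on_ln:
 fixes f :: "'a::real_normed_vector => real"
 assumes f: "C1_on S f" and pos: "!!z. z : S ==> f z > 0" shows "C1_on S (%z. ln (f z))"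
proof (rule C1_on_compose_real[OF f, where h'="%y. 1 / y"])
 show "(ln has_real_derivative 1 / f z) (at (f z))" if "z : S" for z using DERIV_ln_divide[OF pos[OF that]] .
 have "y ~= 0" if "y : f ` S" for y using that pos by force
 then show "continuous_on (f ` S) (%y. 1 / y)" by (intro continuous_intros) auto
qed

lemma C1_on_minus:
 fixes f g :: "'a::real_normed_vector => real" shows "C1_on S f ==> C1_on S g ==> C1_on S (%z. f z - g z)"
 using C1_on_add[of S f "%z. - 1 * g z"] C1_on_mult[OF C1_on_const[of S "-1::real"], of g] by simp

lemma C1_on_vec_nth: "C1_on S f ==> C1_on S (%z. f z $ i)" by (rule C1_on_linear[OF bounded_linear_vec_nth])

lemma C1_on_vec_lambda:
 fixes f :: "'n::finite => 'a::real_normed_vector => real"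
 assumes "!!i. C1_on S (f i)" shows "C1_on S (%z. \<chi> i. f i z)"
proof -
 have "C1_on S (%z. \<Sum>i. f i z *\<^sub>R (axis i 1 :: real^'n))" by (intro C1_on_sum C1_on_scaleR C1_on_const assms)
 moreover have "(\<Sum>i. f i z *\<^sub>R (axis i 1 :: real^'n)) = (\<chi> i. f i z)" for z
  by (simp add: vec_eq_iff axis_def if_distrib sum.delta cong: if_cong)
 ultimately show ?thesis by simp
qed

lemma C1_on_subset:
 assumes "C1_on S f" "S' \<subseteq> S" shows "C1_on S' f" using assms unfolding C1_on_def by (meson continuous_on_subset has_derivative_subset subset_eq)

text \<open>
  Time derivatives are one-sided at the ends of the strip, spatial derivatives are not. The continuous
  functions \<open>ft\<close>, \<open>fx\<close> extend the partial derivatives to the closed strip.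
\<close>
lemma C1_strip_partials:
 fixes f :: "real => real^'n => 'b::real_normed_vector"
 assumes f: "C1_on (strip T) (%(t, x). f t x)"
 obtains ft fx where "continuous_on (strip T) ft" "!!j. continuous_on (strip T) (fx j)"
  "!!t x. t : {0<..<T} ==> ((%r. f r x) has_vector_derivative ft (t, x)) (at t)"
  "!!t x. t : {0..T} ==> f t differentiable (at x)"
  "!!t x. t : {0<..<T} ==> dt f t x = ft (t, x)"
  "!!t x j. t : {0..T} ==> pd j (f t) x = fx j (t, x)"
proof -
 let ?S = "{0..T} \<times> (UNIV :: (real^'n) set)"
 let ?F = "%z. f (fst z) (snd z)"
 obtain f' where f': "!!z. z : ?S ==> (?F has_derivative blinfun_apply (f' z)) (at z within ?S)" "continuous_on ?S f'"
  using f by (auto simp: C1_on_def case_prod_beta')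
 have time: "((%r. f r x) has_vector_derivative blinfun_apply (f' (t, x)) (1, 0)) (at t)" if t: "t : {0<..<T}" for t x
 proof -
  have "((%r. ?F (r, x)) has_derivative (%r. blinfun_apply (f' (t, x)) (r, 0))) (at t within {0..T})"
  proof (rule has_derivative_in_compose[where g="?F" and f="%r. (r, x)"])
   show "((%r. (r, x)) has_derivative (%r. (r, 0))) (at t within {0..T})" by (auto intro!: derivative_eq_intros)
   show "(?F has_derivative blinfun_apply (f' (t, x))) (at (t, x) within (%r. (r, x)) ` {0..T})" by (rule has_derivative_subset[OF f'(1)]) (use t in auto)
  qed
  moreover have "at t within {0..T} = at t" using t by (intro at_within_interior) auto
  moreover have "(%r. blinfun_apply (f' (t, x)) (r, 0)) = (%r. r *\<^sub>R blinfun_apply (f' (t, x)) (1, 0))"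
   by (simp add: fun_eq_iff blinfun.scaleR_right[symmetric])
  ultimately show ?thesis by (simp add: has_vector_derivative_def)
 qed
 have space: "(f t has_derivative (%v. blinfun_apply (f' (t, x)) (0, v))) (at x)" if t: "t : {0..T}" for t x
 proof -
  have "((%y. ?F (t, y)) has_derivative (%v. blinfun_apply (f' (t, x)) (0, v))) (at x)"
  proof (rule has_derivative_in_compose[where g="?F" and f="%y. (t, y)"])
   show "((%y. (t, y)) has_derivative (%v. (0, v))) (at x)" by (auto intro!: derivative_eq_intros)
   show "(?F has_derivative blinfun_apply (f' (t, x))) (at (t, x) within range (%y. (t, y)))" by (rule has_derivative_subset[OF f'(1)]) (use t in auto)
  qed
  then show ?thesis by simp
 qed
 show ?thesis
 proof (rule that[of "%z. blinfun_apply (f' z) (1, 0)" "%j z. blinfun_apply (f' z) (0, axis j 1)"])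
  show "continuous_on ?S (%z. blinfun_apply (f' z) (1, 0))" "continuous_on ?S (%z. blinfun_apply (f' z) (0, axis j 1))" for j
   by (intro continuous_intros f'(2))+
  show "((%r. f r x) has_vector_derivative blinfun_apply (f' (t, x)) (1, 0)) (at t)" if "t : {0<..<T}" for t x by (rule time[OF that])
  show "f t differentiable (at x)" if "t : {0..T}" for t x using space[OF that] by (auto simp: differentiable_def)
  show "dt f t x = blinfun_apply (f' (t, x)) (1, 0)" if "t : {0<..<T}" for t x unfolding dt_def by (rule vector_derivative_at[OF time[OF that]])
  show "pd j (f t) x = blinfun_apply (f' (t, x)) (0, axis j 1)" if "t : {0..T}" for t x j
   unfolding pd_def by (rule fun_cong[OF frechet_derivative_at[OF space[OF that, of x]], of "axis j 1", symmetric])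
 qed
qed

lemma pd_line:
 fixes f :: "real^'n => 'b::real_normed_vector"
 assumes "f differentiable (at x)" shows "((%r. f (x + r *\<^sub>R axis j 1)) has_vector_derivative pd j f x) (at 0)"
proof -
 have d: "(f has_derivative frechet_derivative f (at x)) (at x)" using assms by (simp add: frechet_derivative_works)
 have "((%r. f (x + r *\<^sub>R axis j 1)) has_derivative (%r. frechet_derivative f (at x) (r *\<^sub>R axis j 1))) (at 0)"
 proof (rule has_derivative_compose[where g=f and f="%r. x + r *\<^sub>R axis j 1"])
  show "((%r. x + r *\<^sub>R axis j 1) has_derivative (%r. r *\<^sub>R axis j 1)) (at 0)" by (auto intro!: derivative_eq_intros)
  show "(f has_derivative frechet_derivative f (at x)) (at (x + 0 *\<^sub>R axis j 1))" using d by simp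
 qed
 then show ?thesis unfolding has_vector_derivative_def pd_def using linear_frechet_derivative[OF assms] by (simp add: linear_cmul)
qed

lemma pd_component:
 fixes f :: "real^'n => real^'m"
 assumes "f differentiable (at x)" shows "pd j f x $ i = pd j (%y. f y $ i) x"
proof -
 have d: "(f has_derivative frechet_derivative f (at x)) (at x)" using assms by (simp add: frechet_derivative_works)
 have "((%y. f y $ i) has_derivative (%v. frechet_derivative f (at x) v $ i)) (at x)" by (rule bounded_linear.has_derivative[OF bounded_linear_vec_nth d])
 from frechet_derivative_at[OF this] show ?thesis by (simp add: pd_def fun_eq_iff)
qed

section \<open>The strong solution in primitive variables\<close>

text \<open>
  Time and space directions are treated alike: \<open>None\<close> stands for the time variable, \<open>Some j\<close> for the \<open>j\<close>-th
  space variable, and \<open>along\<close> restricts a field to the line in that direction.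
\<close>
definition along :: "'n option => (real => real^'n => real) => real => real^'n => real => real" where
 "along d f t x r = (case d of None => f (t + r) x | Some j => f t (x + r *\<^sub>R axis j 1))"

definition par :: "'n option => (real => real^'n => real) => real => real^'n => real" where
 "par d f t x = (case d of None => dt f t x | Some j => pd j (f t) x)"

lemma along_0 [simp]: "along d f t x 0 = f t x" by (simp add: along_def split: option.split)

abbreviation C1_strip :: "real => (real => real^'n => 'b::real_normed_vector) => bool" where
 "C1_strip T f \<equiv> C1_on (strip T) (%(t, x). f t x)"

lemma has_par:
 assumes f: "C1_strip T f" and t: "t : {0<..<T}" shows "(along d f t x has_real_derivative par d f t x) (at 0)"
proof -
 obtain ft fx where p: "!!t x. t : {0<..<T} ==> ((%r. f r x) has_vector_derivative ft (t, x)) (at t)"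
  "!!t x. t : {0..T} ==> f t differentiable (at x)"
  "!!t x. t : {0<..<T} ==> dt f t x = ft (t, x)" using C1_strip_partials[OF f] by metis
 show ?thesis
 proof (cases d)
  case None
  have "((%r. f r x) has_real_derivative dt f t x) (at t)" using p(1)[OF t, of x] p(3)[OF t, of x] by (simp add: has_real_derivative_iff_has_vector_derivative)
  then have "((%r. f (t + r) x) has_real_derivative dt f t x) (at 0)" using DERIV_at_within_shift[of "%r. f r x" "dt f t x" t 0 UNIV] by (simp add: add.commute)
  then show ?thesis unfolding None along_def par_def by simp
 next
  case (Some j)
  have "((%r. f t (x + r *\<^sub>R axis j 1)) has_vector_derivative pd j (f t) x) (at 0)" by (rule pd_line[OF p(2)]) (use t in auto)
  then show ?thesis unfolding Some along_def par_def by (simp add: has_real_derivative_iff_has_vector_derivative)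
 qed
qed

lemma par_eqI:
 assumes "C1_strip T f" "t : {0<..<T}" "(along d f t x has_real_derivative l) (at 0)" shows "par d f t x = l"
 using DERIV_unique[OF has_par[OF assms(1,2)] assms(3)] .

lemma along_mult: "along d (%t x. f t x * g t x) t x = (%r. along d f t x r * along d g t x r)" by (auto simp: along_def fun_eq_iff split: option.split)
lemma along_add: "along d (%t x. f t x + g t x) t x = (%r. along d f t x r + along d g t x r)" by (auto simp: along_def fun_eq_iff split: option.split)
lemma along_diff: "along d (%t x. f t x - g t x) t x = (%r. along d f t x r - along d g t x r)" by (auto simp: along_def fun_eq_iff split: option.split)
lemma along_divide: "along d (%t x. f t x / g t x) t x = (%r. along d f t x r / along d g t x r)" by (auto simp: along_def fun_eq_iff split: option.split)
lemma along_sum: "along d (%t x. \<Sum>i\<in>I. f i t x) t x = (%r. \<Sum>i\<in>I. along d (f i) t x r)"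
 by (auto simp: along_def fun_eq_iff split: option.split)
lemma along_const: "along d (%t x. c) t x = (%r. c)" by (auto simp: along_def fun_eq_iff split: option.split)
lemma along_ln: "along d (%t x. ln (f t x)) t x = (%r. ln (along d f t x r))" by (auto simp: along_def fun_eq_iff split: option.split)

lemma C1_strip_mult: "C1_strip T f ==> C1_strip T g ==> C1_strip T (%t x. f t x * g t x :: real)"
 using C1_on_mult[of "{0..T} \<times> UNIV" "%(t, x). f t x" "%(t, x). g t x"] by (simp add: case_prod_beta')
lemma C1_strip_add: "C1_strip T f ==> C1_strip T g ==> C1_strip T (%t x. f t x + g t x)"
 using C1_on_add[of "{0..T} \<times> UNIV" "%(t, x). f t x" "%(t, x). g t x"] by (simp add: case_prod_beta')
lemma C1_strip_diff: "C1_strip T f ==> C1_strip T g ==> C1_strip T (%t x. f t x - g t x :: real)"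
 using C1_on_minus[of "{0..T} \<times> UNIV" "%(t, x). f t x" "%(t, x). g t x"] by (simp add: case_prod_beta')
lemma C1_strip_const: "C1_strip T (%t x. c)" using C1_on_const[of "{0..T} \<times> UNIV" c] by (simp add: case_prod_beta')
lemma C1_strip_sum: "(!!i. i : I ==> C1_strip T (f i)) ==> C1_strip T (%t x. \<Sum>i\<in>I. f i t x)"
 using C1_on_sum[of I "{0..T} \<times> UNIV" "%i (t, x). f i t x"] by (simp add: case_prod_beta')
lemma C1_strip_divide:
 "C1_strip T f ==> C1_strip T g ==> (!!t x. t : {0..T} ==> g t x ~= 0) ==> C1_strip T (%t x. f t x / g t x :: real)"
 using C1_on_divide[of "{0..T} \<times> UNIV" "%(t, x). f t x" "%(t, x). g t x"] by (simp add: case_prod_beta' mem_Times_iff)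
lemma C1_strip_ln:
 "C1_strip T f ==> (!!t x. t : {0..T} ==> f t x > 0) ==> C1_strip T (%t x. ln (f t x) :: real)"
 using C1_on_ln[of "{0..T} \<times> UNIV" "%(t, x). f t x"] by (simp add: case_prod_beta' mem_Times_iff)
lemma C1_strip_vec_nth: "C1_strip T f ==> C1_strip T (%t x. f t x $ i)"
 using C1_on_vec_nth[of "{0..T} \<times> UNIV" "%(t, x). f t x" i] by (simp add: case_prod_beta')
lemma C1_strip_vec_lambda: "(!!i. C1_strip T (f i)) ==> C1_strip T (%t x. \<chi> i. (f i t x :: real))"
 using C1_on_vec_lambda[of "{0..T} \<times> UNIV" "%i (t, x). f i t x"] by (simp add: case_prod_beta')

lemma C1_strip_differentiable: "C1_strip T f ==> t : {0..T} ==> f t differentiable (at x)" using C1_strip_partials[of T f] by metis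

lemma C1_strip_dt_component:
 fixes f :: "real => real^'n => real^'m"
 assumes f: "C1_strip T f" and t: "t : {0<..<T}" shows "dt f t x $ i = dt (%t x. f t x $ i) t x"
proof -
 obtain ft fx where p: "!!t x. t : {0<..<T} ==> ((%r. f r x) has_vector_derivative ft (t, x)) (at t)"
  "!!t x. t : {0<..<T} ==> dt f t x = ft (t, x)" using C1_strip_partials[OF f] by metis
 have "((%r. f r x $ i) has_vector_derivative dt f t x $ i) (at t)"
  using bounded_linear.has_vector_derivative[OF bounded_linear_vec_nth p(1)[OF t]] p(2)[OF t] by simp
 then show ?thesis unfolding dt_def[of "%t x. f t x $ i"] using vector_derivative_at by metis
qed

text \<open>
  The conservative momentum equation minus the velocity times the continuity equation.
\<close>
lemma momentum_algebra:
 fixes u :: "'n::finite => real"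
 assumes mass: "r0 + (\<Sum>s. rs s * u s + r * us s s) = 0"
  and mom: "(r0 * u i + r * u0) + (\<Sum>s. (rs s * u i + r * us s i) * u s + r * u i * us s s) + pg = 0" shows "r * (u0 + (\<Sum>s. u s * us s i)) + pg = 0"
proof -
 have "(\<Sum>s. (rs s * u i + r * us s i) * u s + r * u i * us s s)
   = u i * (\<Sum>s. rs s * u s + r * us s s) + r * (\<Sum>s. u s * us s i)"
  unfolding sum_distrib_left sum.distrib[symmetric] by (rule sum.cong[OF refl]) (simp add: algebra_simps)
 moreover have "(\<Sum>s. rs s * u s + r * us s s) = - r0" using mass by simp
 ultimately show ?thesis using mom by (simp add: algebra_simps)
qed

text \<open>
  The energy equation minus the equation of the kinetic energy.
\<close>
lemma pressure_algebra:
 fixes u :: "'n::finite => real" and us :: "'n => 'n => real"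
 assumes g: "\<gamma> > 1" and mass: "r0 + (\<Sum>s. rs s * u s + r * us s s) = 0" and mom: "!!i. r * (u0 i + (\<Sum>s. u s * us s i)) + ps i = 0"
  and en: "(r0 * q / 2 + r * (\<Sum>i. u i * u0 i) + p0 / (\<gamma> - 1))
   + (\<Sum>s. (rs s * q / 2 + r * (\<Sum>i. u i * us s i) + ps s / (\<gamma> - 1) + ps s) * u s
     + (r * q / 2 + p / (\<gamma> - 1) + p) * us s s) = 0" shows "p0 + (\<Sum>s. u s * ps s) + \<gamma> * p * (\<Sum>s. us s s) = 0"
proof -
 define k where "k = 1 / (\<gamma> - 1)"
 have k: "k * (\<gamma> - 1) = 1" "k > 0" using g by (auto simp: k_def)
 have "(\<Sum>s. (rs s * q / 2 + r * (\<Sum>i. u i * us s i) + ps s / (\<gamma> - 1) + ps s) * u s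
     + (r * q / 2 + p / (\<gamma> - 1) + p) * us s s)
   = q / 2 * (\<Sum>s. rs s * u s + r * us s s) + r * (\<Sum>s. u s * (\<Sum>i. u i * us s i))
    + (k + 1) * (\<Sum>s. u s * ps s) + (k + 1) * p * (\<Sum>s. us s s)" unfolding sum_distrib_left[of _ _ UNIV] sum.distrib[symmetric]
 proof (rule sum.cong[OF refl], goal_cases)
  case (1 s)
  show ?case unfolding sum_distrib_left[symmetric] by (simp add: k_def algebra_simps)
 qed
 also have "(\<Sum>s. u s * (\<Sum>i. u i * us s i)) = (\<Sum>i. u i * (\<Sum>s. u s * us s i))"
  unfolding sum_distrib_left by (subst sum.swap) (simp add: mult_ac)
 finally have eq: "(\<Sum>s. (rs s * q / 2 + r * (\<Sum>i. u i * us s i) + ps s / (\<gamma> - 1) + ps s) * u s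
     + (r * q / 2 + p / (\<gamma> - 1) + p) * us s s)
   = q / 2 * (\<Sum>s. rs s * u s + r * us s s) + r * (\<Sum>i. u i * (\<Sum>s. u s * us s i))
    + (k + 1) * (\<Sum>s. u s * ps s) + (k + 1) * p * (\<Sum>s. us s s)" .
 have "r * (\<Sum>i. u i * u0 i) + r * (\<Sum>i. u i * (\<Sum>s. u s * us s i)) = (\<Sum>i. u i * (- ps i))"
 proof -
  have "r * (\<Sum>i. u i * u0 i) + r * (\<Sum>i. u i * (\<Sum>s. u s * us s i)) =
    (\<Sum>i. u i * (r * (u0 i + (\<Sum>s. u s * us s i))))"
   unfolding sum_distrib_left[of r] sum.distrib[symmetric] by (rule sum.cong[OF refl]) (simp add: algebra_simps)
  also have "... = (\<Sum>i. u i * (- ps i))"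
  proof (rule sum.cong[OF refl])
   fix i
   have "r * (u0 i + (\<Sum>s. u s * us s i)) = - ps i" using mom[of i] by linarith
   then show "u i * (r * (u0 i + (\<Sum>s. u s * us s i))) = u i * (- ps i)" by (simp only:)
  qed
  finally show ?thesis .
 qed
 also have "... = - (\<Sum>i. u i * ps i)" by (simp add: sum_negf)
 finally have m: "r * (\<Sum>i. u i * u0 i) + r * (\<Sum>i. u i * (\<Sum>s. u s * us s i)) = - (\<Sum>i. u i * ps i)" .
 have ms: "(\<Sum>s. rs s * u s + r * us s s) = - r0" using mass by simp
 define A where "A = (\<Sum>i. u i * ps i)"
 define D where "D = (\<Sum>s. us s s)"
 have "k * p0 + k * A + (k + 1) * p * D = 0" using en m unfolding eq ms A_def[symmetric] D_def[symmetric] by (simp add: k_def algebra_simps)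
 then have "(\<gamma> - 1) * (k * p0 + k * A + (k + 1) * p * D) = 0" by simp
 also have "(\<gamma> - 1) * (k * p0 + k * A + (k + 1) * p * D) = (k * (\<gamma> - 1)) * (p0 + A + p * D) + (\<gamma> - 1) * (p * D)"
  by (simp add: algebra_simps)
 finally show ?thesis unfolding k A_def D_def by (simp add: algebra_simps)
qed

locale strong_euler =
 fixes \<gamma> T :: real and \<rho>0 :: "real^'n => real" and m0 :: "real^'n => real^'n" and E0 :: "real^'n => real"
  and \<rho> E :: "real => real^'n => real" and m :: "real => real^'n => real^'n"
 assumes g: "\<gamma> > 1" and T: "T > 0" and sol: "strong_solution \<gamma> T \<rho>0 m0 E0 \<rho> m E"
  and p0: "!!x. pressure \<gamma> (\<rho>0 x, m0 x, E0 x) > 0"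
begin

definition "vel i t x = m t x $ i / \<rho> t x"
definition "prs t x = pressure \<gamma> (\<rho> t x, m t x, E t x)"

lemma rpos: "t : {0..T} ==> \<rho> t x > 0" using sol by (auto simp: strong_solution_def)

lemma rnz: "t : {0..T} ==> \<rho> t x ~= 0" using rpos[of t x] by simp

lemma C1_basic: "C1_strip T \<rho>" "C1_strip T m" "C1_strip T E" "C1_strip T (%t x. m t x $ i)" using sol C1_strip_vec_nth by (auto simp: strong_solution_def)

lemma C1_vel: "C1_strip T (vel i)" unfolding vel_def[abs_def] by (rule C1_strip_divide[OF C1_basic(4,1) rnz])

lemma prs_eq: "prs t x = (\<gamma> - 1) * (E t x - (\<Sum>i. m t x $ i * vel i t x) / 2)"
proof -
 have "(norm (m t x))^2 / \<rho> t x = (\<Sum>i. m t x $ i * vel i t x)" unfolding power2_norm_eq_inner inner_vec_def vel_def by (simp add: sum_divide_distrib)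
 then show ?thesis by (simp add: prs_def pressure_def internal_energy_def dens_def mom_def ener_def)
qed

lemma C1_prs: "C1_strip T prs"
proof -
 have "C1_strip T (%t x. (\<gamma> - 1) * (E t x - (\<Sum>i. m t x $ i * vel i t x) * (1 / 2)))"
  by (intro C1_strip_mult C1_strip_diff C1_strip_const C1_strip_sum C1_basic C1_vel)
 then show ?thesis unfolding prs_eq[abs_def] by simp
qed

lemma periodic_fields:
 assumes "t : {0..T}" shows "periodic (\<rho> t)" "periodic (m t)" "periodic (E t)" "periodic (vel i t)" "periodic (prs t)"
 using sol assms by (auto simp: strong_solution_def periodic_def vel_def prs_def)

lemma par_mom:
 assumes t: "t : {0<..<T}" shows "par d (%t x. m t x $ i) t x = par d \<rho> t x * vel i t x + \<rho> t x * par d (vel i) t x"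
proof -
 have r: "\<rho> t x > 0" using rpos t by simp
 have "(along d (vel i) t x has_real_derivative
   (par d (%t x. m t x $ i) t x * \<rho> t x - m t x $ i * par d \<rho> t x) / (\<rho> t x * \<rho> t x)) (at 0)" unfolding vel_def[abs_def] along_divide
  using DERIV_divide[OF has_par[OF C1_basic(4)[of i] t, of d x] has_par[OF C1_basic(1) t, of d x]] r by simp
 from par_eqI[OF C1_vel t this] show ?thesis using r by (simp add: vel_def field_simps)
qed

lemma par_ener:
 assumes t: "t : {0<..<T}" shows "par d E t x = par d \<rho> t x * (\<Sum>i. vel i t x * vel i t x) / 2 + \<rho> t x * (\<Sum>i. vel i t x * par d (vel i) t x)
   + par d prs t x / (\<gamma> - 1)" and "E t x = \<rho> t x * (\<Sum>i. vel i t x * vel i t x) / 2 + prs t x / (\<gamma> - 1)"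
proof -
 have r: "\<rho> t x > 0" using rpos t by simp
 have mv: "m t x $ i = \<rho> t x * vel i t x" for i using r by (simp add: vel_def)
 show "E t x = \<rho> t x * (\<Sum>i. vel i t x * vel i t x) / 2 + prs t x / (\<gamma> - 1)"
  unfolding prs_eq mv using g by (simp add: sum_distrib_left mult.assoc)
 have "(along d prs t x has_real_derivative (\<gamma> - 1) * (par d E t x - (\<Sum>i. par d (%t x. m t x $ i) t x * vel i t x + par d (vel i) t x * m t x $ i) / 2)) (at 0)"
 proof -
  have "(along d (%t x. m t x $ i * vel i t x) t x has_real_derivative (par d (%t x. m t x $ i) t x * vel i t x + par d (vel i) t x * m t x $ i)) (at 0)" for i
   unfolding along_mult using DERIV_mult[OF has_par[OF C1_basic(4)[of i] t, of d x] has_par[OF C1_vel[of i] t, of d x]] by simp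
  then have s: "(along d (%t x. \<Sum>i. m t x $ i * vel i t x) t x has_real_derivative (\<Sum>i. par d (%t x. m t x $ i) t x * vel i t x + par d (vel i) t x * m t x $ i)) (at 0)"
   unfolding along_sum by (intro DERIV_sum) auto
  show ?thesis unfolding prs_eq[abs_def] along_mult along_diff along_divide along_const
   by (intro DERIV_cmult DERIV_diff has_par[OF C1_basic(3) t] DERIV_cdivide s)
 qed
 from par_eqI[OF C1_prs t this]
 have "par d prs t x / (\<gamma> - 1) = par d E t x - (\<Sum>i. par d (%t x. m t x $ i) t x * vel i t x + par d (vel i) t x * m t x $ i) / 2" using g by simp
 also have "(\<Sum>i. par d (%t x. m t x $ i) t x * vel i t x + par d (vel i) t x * m t x $ i) =
   par d \<rho> t x * (\<Sum>i. vel i t x * vel i t x) + 2 * (\<rho> t x * (\<Sum>i. vel i t x * par d (vel i) t x))"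
  unfolding par_mom[OF t] mv sum_distrib_left sum.distrib[symmetric] by (rule sum.cong[OF refl]) (simp add: algebra_simps)
 finally show "par d E t x = par d \<rho> t x * (\<Sum>i. vel i t x * vel i t x) / 2 + \<rho> t x * (\<Sum>i. vel i t x * par d (vel i) t x)
   + par d prs t x / (\<gamma> - 1)" by (simp add: add_divide_distrib)
qed

lemma time_derivative:
 fixes f :: "real => real^'n => 'b::real_normed_vector"
 assumes "t : {0<..<T}" shows "vector_derivative (%r. f r x) (at t within {0..T}) = dt f t x"
proof -
 have "at t within {0..T} = at t" using assms by (intro at_within_interior) auto
 then show ?thesis by (simp add: dt_def)
qed

lemma conservation_laws:
 assumes t: "t : {0<..<T}" shows "dt \<rho> t x + divergence (m t) x = 0"
  "dt m t x + mat_divergence (%y. convective_flux (\<rho> t y, m t y, E t y)) x + grad (prs t) x = 0"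
  "dt E t x + divergence (%y. energy_flux \<gamma> (\<rho> t y, m t y, E t y)) x = 0"
proof -
 have t': "t : {0..T}" using t by simp
 have "ALL t:{0..T}. ALL x. vector_derivative (%r. \<rho> r x) (at t within {0..T}) + divergence (m t) x = 0 \<and>
    vector_derivative (%r. m r x) (at t within {0..T})
     + mat_divergence (%y. convective_flux (\<rho> t y, m t y, E t y)) x + grad (%y. pressure \<gamma> (\<rho> t y, m t y, E t y)) x = 0 \<and>
    vector_derivative (%r. E r x) (at t within {0..T})
     + divergence (%y. energy_flux \<gamma> (\<rho> t y, m t y, E t y)) x = 0" using sol unfolding strong_solution_def Let_def by (elim conjE)
 note P = bspec[OF this t', THEN spec, of x, unfolded time_derivative[OF t]]
 show "dt \<rho> t x + divergence (m t) x = 0" by (rule P[THEN conjunct1])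
 show "dt m t x + mat_divergence (%y. convective_flux (\<rho> t y, m t y, E t y)) x + grad (prs t) x = 0"
  unfolding prs_def[abs_def] by (rule P[THEN conjunct2, THEN conjunct1])
 show "dt E t x + divergence (%y. energy_flux \<gamma> (\<rho> t y, m t y, E t y)) x = 0" by (rule P[THEN conjunct2, THEN conjunct2])
qed

lemma mass_eq:
 assumes t: "t : {0<..<T}" shows "par None \<rho> t x + (\<Sum>s. par (Some s) \<rho> t x * vel s t x + \<rho> t x * par (Some s) (vel s) t x) = 0"
proof -
 note conservation_laws(1)[OF t, of x]
 moreover have "divergence (m t) x = (\<Sum>s. par (Some s) (%t x. m t x $ s) t x)" by (simp add: divergence_def par_def)
 ultimately show ?thesis unfolding par_mom[OF t] by (simp add: par_def)
qed

lemma momentum_eq: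
 assumes t: "t : {0<..<T}" shows "\<rho> t x * (par None (vel i) t x + (\<Sum>s. vel s t x * par (Some s) (vel i) t x)) + par (Some i) prs t x = 0"
proof (rule momentum_algebra[where u="%i. vel i t x" and rs="%s. par (Some s) \<rho> t x" and r="\<rho> t x"
   and us="%s i. par (Some s) (vel i) t x" and ?r0.0="par None \<rho> t x", OF mass_eq[OF t]])
 have t': "t : {0..T}" using t by simp
 have r: "\<rho> t x > 0" using rpos t by simp
 let ?F = "%s t x. column s (convective_flux (\<rho> t x, m t x, E t x))"
 have F: "?F s t x $ j = m t x $ j * vel s t x" for s j t x by (simp add: column_convective velocity_def dens_def mom_def vel_def divide_inverse mult_ac)
 have CF: "C1_strip T (?F s)" for s
 proof -
  have "C1_strip T (%t x. \<chi> j. m t x $ j * vel s t x)" by (intro C1_strip_vec_lambda C1_strip_mult C1_basic C1_vel)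
  moreover have "(\<chi> j. m t x $ j * vel s t x) = ?F s t x" for t x by (simp add: vec_eq_iff F)
  ultimately show ?thesis by simp
 qed
 note eq = conservation_laws(2)[OF t, of x]
 have "dt m t x $ i + mat_divergence (%y. convective_flux (\<rho> t y, m t y, E t y)) x $ i + grad (prs t) x $ i = 0"
  using arg_cong[OF eq, of "%v. v $ i"] by simp
 moreover have "dt m t x $ i = par None (%t x. m t x $ i) t x" using C1_strip_dt_component[OF C1_basic(2) t, of x i] by (simp add: par_def)
 moreover have "grad (prs t) x $ i = par (Some i) prs t x" by (simp add: grad_def par_def)
 moreover have "mat_divergence (%y. convective_flux (\<rho> t y, m t y, E t y)) x $ i =
   (\<Sum>s. par (Some s) (%t x. m t x $ i * vel s t x) t x)" unfolding mat_divergence_def sum_component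
 proof (rule sum.cong[OF refl])
  fix s
  show "pd s (%y. column s (convective_flux (\<rho> t y, m t y, E t y))) x $ i = par (Some s) (%t x. m t x $ i * vel s t x) t x"
   using pd_component[OF C1_strip_differentiable[OF CF t'], where j=s] by (simp add: F par_def)
 qed
 moreover have "par (Some s) (%t x. m t x $ i * vel s t x) t x
   = (par (Some s) \<rho> t x * vel i t x + \<rho> t x * par (Some s) (vel i) t x) * vel s t x + \<rho> t x * vel i t x * par (Some s) (vel s) t x" for s
 proof (rule par_eqI[OF C1_strip_mult[OF C1_basic(4) C1_vel] t])
  have mv: "m t x $ i = \<rho> t x * vel i t x" using r by (simp add: vel_def)
  show "(along (Some s) (%t x. m t x $ i * vel s t x) t x has_real_derivative
   (par (Some s) \<rho> t x * vel i t x + \<rho> t x * par (Some s) (vel i) t x) * vel s t x + \<rho> t x * vel i t x * par (Some s) (vel s) t x) (at 0)"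
   unfolding along_mult using DERIV_mult[OF has_par[OF C1_basic(4)[of i] t, of "Some s" x] has_par[OF C1_vel[of s] t, of "Some s" x]]
   by (simp add: par_mom[OF t] mv mult.commute)
 qed
 ultimately show "par None \<rho> t x * vel i t x + \<rho> t x * par None (vel i) t x +
   (\<Sum>s. (par (Some s) \<rho> t x * vel i t x + \<rho> t x * par (Some s) (vel i) t x) * vel s t x + \<rho> t x * vel i t x * par (Some s) (vel s) t x)
   + par (Some i) prs t x = 0" by (simp add: par_mom[OF t])
qed

lemma pressure_eq:
 assumes t: "t : {0<..<T}" shows "par None prs t x + (\<Sum>s. vel s t x * par (Some s) prs t x) + \<gamma> * prs t x * (\<Sum>s. par (Some s) (vel s) t x) = 0"
proof (rule pressure_algebra[where u="%i. vel i t x" and rs="%s. par (Some s) \<rho> t x" and r="\<rho> t x"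
   and us="%s i. par (Some s) (vel i) t x" and ?r0.0="par None \<rho> t x" and ?u0.0="%i. par None (vel i) t x"
   and ps="%i. par (Some i) prs t x" and q="\<Sum>i. vel i t x * vel i t x", OF g mass_eq[OF t] momentum_eq[OF t]])
 have t': "t : {0..T}" using t by simp
 note conservation_laws(3)[OF t, of x]
 moreover have "divergence (%y. energy_flux \<gamma> (\<rho> t y, m t y, E t y)) x = (\<Sum>s. par (Some s) (%t x. (E t x + prs t x) * vel s t x) t x)"
  unfolding divergence_def par_def by (simp add: energy_flux_def velocity_def ener_def dens_def mom_def prs_def vel_def divide_inverse mult_ac)
 moreover have "par (Some s) (%t x. (E t x + prs t x) * vel s t x) t x
   = (par (Some s) \<rho> t x * (\<Sum>i. vel i t x * vel i t x) / 2 + \<rho> t x * (\<Sum>i. vel i t x * par (Some s) (vel i) t x)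
    + par (Some s) prs t x / (\<gamma> - 1) + par (Some s) prs t x) * vel s t x
    + (\<rho> t x * (\<Sum>i. vel i t x * vel i t x) / 2 + prs t x / (\<gamma> - 1) + prs t x) * par (Some s) (vel s) t x" for s
 proof (rule par_eqI[OF C1_strip_mult[OF C1_strip_add[OF C1_basic(3) C1_prs] C1_vel] t])
  show "(along (Some s) (%t x. (E t x + prs t x) * vel s t x) t x has_real_derivative
    (par (Some s) \<rho> t x * (\<Sum>i. vel i t x * vel i t x) / 2 + \<rho> t x * (\<Sum>i. vel i t x * par (Some s) (vel i) t x)
    + par (Some s) prs t x / (\<gamma> - 1) + par (Some s) prs t x) * vel s t x
    + (\<rho> t x * (\<Sum>i. vel i t x * vel i t x) / 2 + prs t x / (\<gamma> - 1) + prs t x) * par (Some s) (vel s) t x) (at 0)"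
   unfolding along_mult along_add
   using DERIV_mult[OF DERIV_add[OF has_par[OF C1_basic(3) t, of "Some s" x] has_par[OF C1_prs t, of "Some s" x]] has_par[OF C1_vel[of s] t, of "Some s" x]]
   unfolding par_ener(1)[OF t] along_0 by (subst (asm) par_ener(2)[OF t]) (simp add: mult.commute)
 qed
 ultimately show "par None \<rho> t x * (\<Sum>i. vel i t x * vel i t x) / 2 + \<rho> t x * (\<Sum>i. vel i t x * par None (vel i) t x) + par None prs t x / (\<gamma> - 1) +
  (\<Sum>s. (par (Some s) \<rho> t x * (\<Sum>i. vel i t x * vel i t x) / 2 + \<rho> t x * (\<Sum>i. vel i t x * par (Some s) (vel i) t x)
    + par (Some s) prs t x / (\<gamma> - 1) + par (Some s) prs t x) * vel s t x
    + (\<rho> t x * (\<Sum>i. vel i t x * vel i t x) / 2 + prs t x / (\<gamma> - 1) + prs t x) * par (Some s) (vel s) t x) = 0"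
  using par_ener(1)[OF t, of None x] by (simp add: par_def)
qed

end

context strong_euler begin

lemma cont_prs: "continuous_on (strip T) (%z. prs (fst z) (snd z))" using C1_on_continuous_on[OF C1_prs] by (simp add: case_prod_beta')

lemma par_bound_cbox:
 assumes "C1_strip T f"
 obtains B where "B > 0" "!!t x j. t : {0<..<T} ==> x : cbox 0 1 ==> \<bar>par (Some j) f t x\<bar> <= B"
proof -
 obtain ft fx where p: "!!j. continuous_on (strip T) (fx j)"
  "!!t x j. t : {0..T} ==> pd j (f t) x = fx j (t, x)" using C1_strip_partials[OF assms] by metis
 have "EX B>0. ALL z:{0..T} \<times> cbox 0 1. norm (fx j z) <= B" for j
 proof -
  have "continuous_on ({0..T} \<times> cbox 0 1) (fx j)" by (rule continuous_on_subset[OF p(1)]) auto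
  then obtain B where "B > 0" "!!z. z : {0..T} \<times> cbox 0 1 ==> norm (fx j z) <= B"
   using compact_norm_bound[OF compact_Times[OF compact_Icc compact_cbox]] by blast
  then show ?thesis by blast
 qed
 then obtain B where B: "!!j. B j > 0" "!!j z. z : {0..T} \<times> cbox 0 1 ==> norm (fx j z) <= B j" by metis
 have "\<bar>par (Some j) f t x\<bar> <= (\<Sum>j. B j)" if "t : {0<..<T}" "x : cbox 0 1" for t x j
 proof -
  have "\<bar>par (Some j) f t x\<bar> = norm (fx j (t, x))" using p(2)[of t j x] that by (simp add: par_def)
  also have "... <= B j" using that by (intro B(2)) auto
  also have "... <= (\<Sum>j. B j)" using B(1) by (intro member_le_sum) (auto simp: less_imp_le)
  finally show ?thesis .
 qed
 moreover have "(\<Sum>j. B j) > 0" using B(1) by (intro sum_pos) auto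
 ultimately show ?thesis using that by blast
qed

lemma div_bound:
 obtains B where "B > 0" "!!t x. t : {0<..<T} ==> x : cbox 0 1 ==> \<bar>\<Sum>s. par (Some s) (vel s) t x\<bar> <= B"
proof -
 have "EX B>0. ALL t x j. t : {0<..<T} --> x : cbox 0 1 --> \<bar>par (Some j) (vel s) t x\<bar> <= B" for s using par_bound_cbox[OF C1_vel[of s]] by metis
 then obtain B where B: "!!s. B s > 0" "!!s t x j. t : {0<..<T} ==> x : cbox 0 1 ==> \<bar>par (Some j) (vel s) t x\<bar> <= B s" by metis
 show ?thesis
 proof (rule that[of "\<Sum>s. B s"])
  show "(\<Sum>s. B s) > 0" using B(1) by (intro sum_pos) auto
  show "\<bar>\<Sum>s. par (Some s) (vel s) t x\<bar> <= (\<Sum>s. B s)" if "t : {0<..<T}" "x : cbox 0 1" for t x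
   by (rule order_trans[OF sum_abs sum_mono]) (rule B(2)[OF that])
 qed
qed

lemma prs_initial: "prs 0 x = pressure \<gamma> (\<rho>0 x, m0 x, E0 x)" using sol by (simp add: prs_def strong_solution_def)

text \<open>
  The pressure satisfies a linear transport equation along the flow, so it stays positive. Without
  characteristics: if \<open>exp (-C t) (p - \<eta> exp (-C t))\<close> became negative, then at a minimum of it over
  earlier times and the fundamental cell the spatial derivatives of \<open>p\<close> vanish and the time
  derivative is positive by the pressure equation, a contradiction.
\<close>
theorem prs_pos:
 assumes tT: "t : {0..T}" shows "prs t x > 0"
proof -
 obtain B where B: "B > 0" "!!t x. t : {0<..<T} ==> x : cbox 0 1 ==> \<bar>\<Sum>s. par (Some s) (vel s) t x\<bar> <= B" using div_bound by blast
 define C where "C = \<gamma> * B + 1"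
 have C: "C > 0" using B g by (simp add: C_def add_pos_pos)
 have c0: "continuous_on (cbox 0 1) (prs 0)"
 proof -
  define f where "f = (%x::real^'n. (0::real, x))"
  have f: "continuous_on (cbox 0 1) f" "f ` cbox 0 1 \<subseteq> {0..T} \<times> UNIV" unfolding f_def using T by (auto intro!: continuous_intros)
  have "continuous_on (cbox 0 1) (%x. prs (fst (f x)) (snd (f x)))" by (rule continuous_on_compose2[OF cont_prs f])
  then show ?thesis by (simp add: f_def)
 qed
 obtain \<eta> where eta: "\<eta> > 0" "!!x. x : cbox 0 1 ==> \<eta> <= prs 0 x" using compact_pos_lower_bound[OF compact_cbox c0] p0 prs_initial by metis
 define q where "q = (%t x. exp (- C * t) * prs t x - \<eta> * exp (- C * t) * exp (- C * t))"
 have main: "q t x \<ge> 0" if t: "0 <= t" "t < T" and x: "x : cbox 0 1" for t x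
 proof -
  let ?K = "{0..t} \<times> cbox 0 (1::real^'n)"
  have cq: "continuous_on ?K (%z. q (fst z) (snd z))" unfolding q_def by (intro continuous_intros continuous_on_subset[OF cont_prs]) (use t in auto)
  have ne: "?K ~= {}" using t x by auto
  obtain z where z: "z : ?K" "!!w. w : ?K ==> q (fst z) (snd z) <= q (fst w) (snd w)"
   using continuous_attains_inf[OF compact_Times[OF compact_Icc compact_cbox] ne cq] by blast
  obtain t1 x1 where tx: "z = (t1, x1)" by (cases z)
  have t1: "0 <= t1" "t1 <= t" and x1: "x1 : cbox 0 1" using z(1) tx by auto
  have "q t1 x1 \<ge> 0"
  proof (rule ccontr)
   assume "~ q t1 x1 \<ge> 0"
   then have neg: "q t1 x1 < 0" by simp
   define e where "e = exp (- C * t1)"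
   have e: "e > 0" by (simp add: e_def)
   have q1: "q t1 x1 = e * (prs t1 x1 - \<eta> * e)" by (simp add: q_def e_def algebra_simps)
   have pe: "prs t1 x1 < \<eta> * e" using neg e unfolding q1 by (simp add: mult_less_0_iff)
   have "t1 ~= 0"
   proof
    assume "t1 = 0"
    then show False using pe eta(2)[OF x1] by (simp add: e_def)
   qed
   then have ti: "t1 : {0<..<T}" using t1 t by auto
   have ti': "t1 : {0..T}" using ti by auto
   have global: "prs t1 x1 <= prs t1 y" for y
   proof -
    have "q t1 x1 <= q t1 (\<chi> i. frac (y $ i))" using z(2)[of "(t1, \<chi> i. frac (y $ i))"] frac_vec_in_cbox[of y] t1 by (simp add: tx)
    moreover have "q t1 (\<chi> i. frac (y $ i)) = e * (prs t1 y - \<eta> * e)"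
     using periodic_frac[OF periodic_fields(5)[OF ti']] by (simp add: q_def e_def algebra_simps)
    ultimately show ?thesis using e unfolding q1 by simp
   qed
   have dz: "par (Some j) prs t1 x1 = 0" for j by (rule DERIV_local_min[OF has_par[OF C1_prs ti], of 1]) (auto simp: along_def global)
   define D where "D = (\<Sum>s. par (Some s) (vel s) t1 x1)"
   have pt: "par None prs t1 x1 = - (\<gamma> * prs t1 x1 * D)" using pressure_eq[OF ti, of x1] by (simp add: dz D_def)
   have Db: "\<bar>D\<bar> <= B" unfolding D_def by (rule B(2)[OF ti x1])
   have "\<bar>\<gamma> * D\<bar> <= \<gamma> * B" using Db g by (simp add: abs_mult mult_left_mono)
   then have "\<gamma> * D <= \<gamma> * B" "- (\<gamma> * D) <= \<gamma> * B" unfolding abs_le_iff by blast+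
   note up = this[THEN le_less_trans[OF _ less_add_one], folded C_def]
   have a1: "0 < \<gamma> * D + C" using up(2) by (simp add: algebra_simps)
   have a2: "\<gamma> * D + C < 2 * C" using up(1) by (simp add: algebra_simps)
   note a = a1 a2
   define Q' where "Q' = e * (par None prs t1 x1 - C * prs t1 x1 + 2 * C * \<eta> * e)"
   have dq: "((%r. q (t1 + r) x1) has_real_derivative Q') (at 0)"
   proof -
    have ap: "((%r. prs (t1 + r) x1) has_real_derivative par None prs t1 x1) (at 0)"
    proof -
     have "along None prs t1 x1 = (%r. prs (t1 + r) x1)" by (simp add: along_def fun_eq_iff)
     then show ?thesis using has_par[OF C1_prs ti, of None x1] by simp
    qed
    have ex: "((%r. exp (- C * (t1 + r))) has_real_derivative - C * e) (at 0)" unfolding e_def by (auto intro!: derivative_eq_intros)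
    have "((%r. q (t1 + r) x1) has_real_derivative
      ((- C * e * prs t1 x1 + par None prs t1 x1 * e) - (\<eta> * (- C * e) * e + (- C * e) * (\<eta> * e)))) (at 0)" unfolding q_def
     using DERIV_diff[OF DERIV_mult[OF ex ap] DERIV_mult[OF DERIV_cmult[OF ex, of \<eta>] ex]] by (simp add: e_def)
    moreover have "(- C * e * prs t1 x1 + par None prs t1 x1 * e) - (\<eta> * (- C * e) * e + (- C * e) * (\<eta> * e)) = Q'"
     unfolding Q'_def by (simp add: algebra_simps)
    ultimately show ?thesis by simp
   qed
   have "Q' > 0"
   proof -
    have "(\<gamma> * D + C) * prs t1 x1 < 2 * C * (\<eta> * e)"
    proof (cases "prs t1 x1 \<ge> 0")
     case True
     have "(\<gamma> * D + C) * prs t1 x1 <= 2 * C * prs t1 x1" using a True by (intro mult_right_mono) auto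
     also have "... < 2 * C * (\<eta> * e)" using pe C by simp
     finally show ?thesis .
    next
     case False
     then have "(\<gamma> * D + C) * prs t1 x1 < 0" using a by (simp add: mult_pos_neg)
     also have "0 < 2 * C * (\<eta> * e)" using C eta e by simp
     finally show ?thesis .
    qed
    then have "par None prs t1 x1 - C * prs t1 x1 + 2 * C * \<eta> * e > 0" unfolding pt by (simp add: algebra_simps)
    then show ?thesis unfolding Q'_def using e by simp
   qed
   from DERIV_pos_inc_left[OF dq this] obtain d where d: "d > 0" "!!h. 0 < h ==> h < d ==> q (t1 + (0 - h)) x1 < q (t1 + 0) x1" by auto
   define h where "h = min (d / 2) (t1 / 2)"
   have h: "0 < h" "h < d" "h < t1" using d(1) ti by (auto simp: h_def)
   have "q t1 x1 <= q (t1 - h) x1" using z(2)[of "(t1 - h, x1)"] h t1 x1 by (simp add: tx)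
   then show False using d(2)[OF h(1,2)] by simp
  qed
  then show ?thesis using z(2)[of "(t, x)"] t x by (simp add: tx)
 qed
 have low: "prs t x \<ge> \<eta> * exp (- C * T)" if t: "0 <= t" "t < T" for t x
 proof -
  have "q t (\<chi> i. frac (x $ i)) \<ge> 0" by (rule main[OF t frac_vec_in_cbox])
  then have "exp (- C * t) * (prs t x - \<eta> * exp (- C * t)) \<ge> 0"
   using periodic_frac[OF periodic_fields(5)[of t], of x] t by (simp add: q_def algebra_simps)
  then have "prs t x \<ge> \<eta> * exp (- C * t)" by (simp add: zero_le_mult_iff)
  moreover have "\<eta> * exp (- C * T) <= \<eta> * exp (- C * t)" using t C eta by simp
  ultimately show ?thesis by linarith
 qed
 have pos: "\<eta> * exp (- C * T) > 0" using eta by simp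
 show ?thesis
 proof (cases "t < T")
  case True then show ?thesis using low[of t x] tT pos by auto
 next
  case False
  then have t: "t = T" using tT by simp
  have "continuous_on {0..T} (%t. prs t x)"
  proof -
   have "continuous_on {0..T} (%t. prs (fst (t, x)) (snd (t, x)))"
    by (rule continuous_on_compose2[OF cont_prs, where f="%t. (t, x)"]) (auto intro!: continuous_intros)
   then show ?thesis by simp
  qed
  then have "((%t. prs t x) \<longlongrightarrow> prs T x) (at T within {0..T})" using T by (auto simp: continuous_on)
  then have "((%t. prs t x) \<longlongrightarrow> prs T x) (at T within {0..<T})" by (rule tendsto_within_subset) auto
  moreover have "\<forall>\<^sub>F r in at T within {0..<T}. \<eta> * exp (- C * T) <= prs r x"
   unfolding eventually_at_filter using low by (intro always_eventually) auto
  moreover have "at T within {0..<T} ~= bot" using T by (simp add: trivial_limit_within islimpt_Ico)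
  ultimately have "\<eta> * exp (- C * T) <= prs T x" by (intro tendsto_lowerbound) auto
  then show ?thesis using pos t by simp
 qed
qed

definition "temp t x = prs t x / \<rho> t x"
definition "entr t x = (ln (prs t x) - \<gamma> * ln (\<rho> t x)) * (1 / (\<gamma> - 1))"
definition "dens_mult t x = (\<Sum>i. vel i t x * vel i t x) * (1 / 2) - \<gamma> / (\<gamma> - 1) * temp t x + temp t x * entr t x"

lemma C1_derived: "C1_strip T temp" "C1_strip T entr" "C1_strip T dens_mult"
proof -
 show t: "C1_strip T temp" unfolding temp_def[abs_def] by (rule C1_strip_divide[OF C1_prs C1_basic(1) rnz])
 show s: "C1_strip T entr" unfolding entr_def[abs_def] by (intro C1_strip_mult C1_strip_diff C1_strip_const C1_strip_ln C1_prs C1_basic prs_pos rpos)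
 show "C1_strip T dens_mult" unfolding dens_mult_def[abs_def] by (intro C1_strip_mult C1_strip_diff C1_strip_add C1_strip_const C1_strip_sum C1_vel t s)
qed

lemma temp_pos: "t : {0..T} ==> temp t x > 0" using prs_pos rpos by (simp add: temp_def)

lemma periodic_derived:
 assumes "t : {0..T}" shows "periodic (temp t)" "periodic (entr t)" "periodic (dens_mult t)"
 using periodic_fields[OF assms] by (auto simp: periodic_def temp_def entr_def dens_mult_def)

lemma par_temp:
 assumes t: "t : {0<..<T}" shows "par d temp t x = (par d prs t x - temp t x * par d \<rho> t x) / \<rho> t x"
proof (rule par_eqI[OF C1_derived(1) t])
 have r: "\<rho> t x > 0" using rpos t by simp
 have "(along d temp t x has_real_derivative (par d prs t x * \<rho> t x - prs t x * par d \<rho> t x) / (\<rho> t x * \<rho> t x)) (at 0)"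
  unfolding temp_def[abs_def] along_divide using DERIV_divide[OF has_par[OF C1_prs t, of d x] has_par[OF C1_basic(1) t, of d x]] r by simp
 moreover have "(par d prs t x * \<rho> t x - prs t x * par d \<rho> t x) / (\<rho> t x * \<rho> t x) = (par d prs t x - temp t x * par d \<rho> t x) / \<rho> t x"
  using r by (simp add: temp_def field_simps)
 ultimately show "(along d temp t x has_real_derivative (par d prs t x - temp t x * par d \<rho> t x) / \<rho> t x) (at 0)" by simp
qed

lemma par_entr:
 assumes t: "t : {0<..<T}" shows "par d entr t x = (par d prs t x / prs t x - \<gamma> * (par d \<rho> t x / \<rho> t x)) * (1 / (\<gamma> - 1))"
proof (rule par_eqI[OF C1_derived(2) t])
 have r: "\<rho> t x > 0" "prs t x > 0" using rpos prs_pos t by simp_all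
 have 1: "((%r. ln (along d prs t x r)) has_real_derivative par d prs t x / prs t x) (at 0)"
  using DERIV_chain2[OF DERIV_ln_divide has_par[OF C1_prs t, of d x]] r by simp
 have 2: "((%r. ln (along d \<rho> t x r)) has_real_derivative par d \<rho> t x / \<rho> t x) (at 0)"
  using DERIV_chain2[OF DERIV_ln_divide has_par[OF C1_basic(1) t, of d x]] r by simp
 show "(along d entr t x has_real_derivative (par d prs t x / prs t x - \<gamma> * (par d \<rho> t x / \<rho> t x)) * (1 / (\<gamma> - 1))) (at 0)"
  unfolding entr_def[abs_def] along_mult along_diff along_const along_ln by (intro DERIV_cmult_right DERIV_diff DERIV_cmult 1 2)
qed

lemma par_dens_mult:
 assumes t: "t : {0<..<T}" shows "par d dens_mult t x = (\<Sum>i. vel i t x * par d (vel i) t x) + entr t x * par d temp t x - par d prs t x / \<rho> t x"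
proof -
 have r: "\<rho> t x > 0" "prs t x > 0" using rpos prs_pos t by simp_all
 have g1: "\<gamma> - 1 ~= 0" using g by simp
 have sq: "(along d (%t x. vel i t x * vel i t x) t x has_real_derivative 2 * (vel i t x * par d (vel i) t x)) (at 0)" for i
  unfolding along_mult using DERIV_mult[OF has_par[OF C1_vel[of i] t, of d x] has_par[OF C1_vel[of i] t, of d x]] by (simp add: mult.commute)
 have ssq: "(along d (%t x. \<Sum>i. vel i t x * vel i t x) t x has_real_derivative (\<Sum>i. 2 * (vel i t x * par d (vel i) t x))) (at 0)"
  unfolding along_sum by (intro DERIV_sum sq)
 have "(along d dens_mult t x has_real_derivative
   ((\<Sum>i. 2 * (vel i t x * par d (vel i) t x)) * (1 / 2) - \<gamma> / (\<gamma> - 1) * par d temp t x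
    + (par d temp t x * entr t x + par d entr t x * temp t x))) (at 0)" unfolding dens_mult_def[abs_def] along_add along_diff
  unfolding along_mult[of d "%t x. \<Sum>i. vel i t x * vel i t x"] along_mult[of d "%t x. \<gamma> / (\<gamma> - 1)"] along_mult[of d temp] along_const
  using DERIV_mult[OF has_par[OF C1_derived(1) t, of d x] has_par[OF C1_derived(2) t, of d x]]
  by (intro DERIV_add DERIV_diff DERIV_cmult_right ssq DERIV_cmult has_par[OF C1_derived(1) t]) simp
 from par_eqI[OF C1_derived(3) t this]
 have "par d dens_mult t x = (\<Sum>i. vel i t x * par d (vel i) t x) + entr t x * par d temp t x
   + (temp t x * par d entr t x - \<gamma> / (\<gamma> - 1) * par d temp t x)" by (simp add: sum_distrib_left[symmetric] algebra_simps)
 also have "temp t x * par d entr t x - \<gamma> / (\<gamma> - 1) * par d temp t x = - (par d prs t x / \<rho> t x)"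
 proof -
  have k: "temp t x * (Dp / prs t x - \<gamma> * (Dr / \<rho> t x)) = (Dp - \<gamma> * temp t x * Dr) / \<rho> t x" for Dp Dr
   using r by (simp add: temp_def field_simps)
  have "temp t x * par d entr t x = (temp t x * (par d prs t x / prs t x - \<gamma> * (par d \<rho> t x / \<rho> t x))) * (1 / (\<gamma> - 1))"
   unfolding par_entr[OF t] by simp
  also have "... = (par d prs t x - \<gamma> * temp t x * par d \<rho> t x) / \<rho> t x * (1 / (\<gamma> - 1))" unfolding k ..
  finally have a: "temp t x * par d entr t x = (par d prs t x - \<gamma> * temp t x * par d \<rho> t x) / \<rho> t x * (1 / (\<gamma> - 1))" .
  have "temp t x * par d entr t x - \<gamma> / (\<gamma> - 1) * par d temp t x
    = ((par d prs t x - \<gamma> * temp t x * par d \<rho> t x) - \<gamma> * (par d prs t x - temp t x * par d \<rho> t x)) / \<rho> t x * (1 / (\<gamma> - 1))"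
  proof -
   have y: "\<gamma> / (\<gamma> - 1) * (y / \<rho> t x) = \<gamma> * y / \<rho> t x * (1 / (\<gamma> - 1))" for y by simp
   show ?thesis unfolding par_temp[OF t] y a by (simp only: diff_divide_distrib[symmetric] left_diff_distrib[symmetric])
  qed
  also have "(par d prs t x - \<gamma> * temp t x * par d \<rho> t x) - \<gamma> * (par d prs t x - temp t x * par d \<rho> t x) = - ((\<gamma> - 1) * par d prs t x)"
   by (simp add: algebra_simps)
  finally show ?thesis using g1 by simp
 qed
 finally show ?thesis by simp
qed

lemma temp_transport:
 assumes t: "t : {0<..<T}"
 shows "par None temp t x + (\<Sum>s. vel s t x * par (Some s) temp t x) + (\<gamma> - 1) * temp t x * (\<Sum>s. par (Some s) (vel s) t x) = 0"
proof -
 have r: "\<rho> t x > 0" using rpos t by simp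
 let ?D = "\<Sum>s. par (Some s) (vel s) t x"
 have m: "par None \<rho> t x + (\<Sum>s. vel s t x * par (Some s) \<rho> t x) = - (\<rho> t x * ?D)"
  using mass_eq[OF t, of x] by (simp add: sum.distrib sum_distrib_left mult.commute)
 have p: "par None prs t x + (\<Sum>s. vel s t x * par (Some s) prs t x) = - (\<gamma> * prs t x * ?D)" using pressure_eq[OF t, of x] by simp
 have "\<rho> t x * (par None temp t x + (\<Sum>s. vel s t x * par (Some s) temp t x)) =
   (par None prs t x + (\<Sum>s. vel s t x * par (Some s) prs t x))
   - temp t x * (par None \<rho> t x + (\<Sum>s. vel s t x * par (Some s) \<rho> t x))"
 proof -
  have pt: "\<rho> t x * par d temp t x = par d prs t x - temp t x * par d \<rho> t x" for d using r by (simp add: par_temp[OF t])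
  have "\<rho> t x * (par None temp t x + (\<Sum>s. vel s t x * par (Some s) temp t x)) =
    \<rho> t x * par None temp t x + (\<Sum>s. vel s t x * (\<rho> t x * par (Some s) temp t x))" by (simp add: distrib_left sum_distrib_left mult_ac)
  then show ?thesis unfolding pt by (simp add: sum_subtractf sum_distrib_left right_diff_distrib distrib_left mult_ac)
 qed
 also have "... = - (\<gamma> * prs t x * ?D) + temp t x * (\<rho> t x * ?D)" unfolding m p by simp
 also have "... = \<rho> t x * (- ((\<gamma> - 1) * temp t x * ?D))" using r by (simp add: temp_def field_simps)
 finally have "par None temp t x + (\<Sum>s. vel s t x * par (Some s) temp t x) = - ((\<gamma> - 1) * temp t x * ?D)"
  by (rule mult_left_cancel[THEN iffD1, rotated]) (use r in simp)
 then show ?thesis by linarith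
qed

end

text \<open>
  The production of relative energy at a state with density \<open>R\<close>, velocity \<open>v\<close>, internal energy \<open>e\<close>
  and truncated entropy \<open>k\<close>. Every term that is linear in \<open>v - u\<close> alone cancels by the equations for
  \<open>u\<close>, \<open>p\<close>, \<open>\<theta>\<close>; what remains is of second order.
\<close>
lemma relative_energy_production:
 fixes u v ut ps :: "'n::finite => real" and us :: "'n => 'n => real"
 assumes g: "\<gamma> > 1" and r: "r > 0" and mom: "!!i. r * (ut i + (\<Sum>s. u s * us s i)) + ps i = 0"
  and prs: "pt + (\<Sum>s. u s * ps s) + \<gamma> * p * D = 0" and D: "D = (\<Sum>s. us s s)"
  and th: "\<theta>t + (\<Sum>s. u s * \<theta>s s) + (\<gamma> - 1) * \<theta> * D = 0" and theta: "p = r * \<theta>"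
  and at: "a0 = (\<Sum>i. u i * ut i) + s * \<theta>t - pt / r" and aj: "!!j. aj j = (\<Sum>i. u i * us j i) + s * \<theta>s j - ps j / r"
 shows "- (\<Sum>i. R * v i * ut i) - (\<Sum>i. \<Sum>j. R * v i * v j * us j i) - (\<gamma> - 1) * e * D
   + R * a0 + (\<Sum>j. R * v j * aj j) - R * k * \<theta>t - (\<Sum>j. k * (R * v j) * \<theta>s j)
   + (pt + (\<Sum>j. ps j * u j + p * us j j))
  = - R * (\<Sum>i. \<Sum>j. (v i - u i) * (v j - u j) * us j i)
   - D * ((\<gamma> - 1) * e + (\<gamma> - 1) * (R * \<theta> * (s - k)) - \<gamma> * R * \<theta> + (\<gamma> - 1) * p)
   + R * (s - k) * (\<Sum>j. (v j - u j) * \<theta>s j)"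
proof -
 let ?X = "\<Sum>i. \<Sum>j. (v i - u i) * (v j - u j) * us j i"
 define A where "A = (\<Sum>i. u i * ps i)"
 define B where "B = (\<Sum>i. v i * ps i)"
 define Th where "Th = (\<Sum>j. v j * \<theta>s j)"
 define Tu where "Tu = (\<Sum>j. u j * \<theta>s j)"
 have utv: "ut i + (\<Sum>j. v j * us j i) = (\<Sum>j. (v j - u j) * us j i) - ps i / r" for i
 proof -
  have "ut i + (\<Sum>s. u s * us s i) = - ps i / r" using mom[of i] r by (simp add: field_simps)
  then show ?thesis by (simp add: left_diff_distrib sum_subtractf)
 qed
 have S1: "- (\<Sum>i. v i * ut i) - (\<Sum>i. \<Sum>j. v i * v j * us j i) + (\<Sum>i. u i * ut i) + (\<Sum>j. v j * (\<Sum>i. u i * us j i))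
   = - ?X + (B - A) / r"
 proof -
  have sw: "(\<Sum>j. v j * (\<Sum>i. u i * us j i)) = (\<Sum>i. u i * (\<Sum>j. v j * us j i))"
   unfolding sum_distrib_left by (subst sum.swap) (simp add: mult_ac)
  have sv: "(\<Sum>i. \<Sum>j. v i * v j * us j i) = (\<Sum>i. v i * (\<Sum>j. v j * us j i))" unfolding sum_distrib_left by (simp add: mult_ac)
  have "- (\<Sum>i. v i * ut i) - (\<Sum>i. v i * (\<Sum>j. v j * us j i)) + (\<Sum>i. u i * ut i) + (\<Sum>i. u i * (\<Sum>j. v j * us j i))
   = (\<Sum>i. (u i - v i) * (ut i + (\<Sum>j. v j * us j i)))" unfolding sum_negf[symmetric] sum_subtractf[symmetric] sum.distrib[symmetric]
   by (rule sum.cong[OF refl]) (simp add: algebra_simps)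
  also have "... = (\<Sum>i. - (v i - u i) * (\<Sum>j. (v j - u j) * us j i) + (v i * ps i - u i * ps i) / r)"
   unfolding utv using r by (intro sum.cong refl) (simp add: algebra_simps diff_divide_distrib)
  also have "... = - ?X + (B - A) / r"
  proof -
   have "?X = (\<Sum>i. (v i - u i) * (\<Sum>j. (v j - u j) * us j i))" by (simp only: sum_distrib_left mult.assoc)
   then show ?thesis unfolding sum.distrib B_def A_def sum_subtractf[symmetric] sum_divide_distrib[symmetric] by (simp only: mult_minus_left sum_negf)
  qed
  finally show ?thesis unfolding sw sv .
 qed
 have Rf: "(\<Sum>i. R * v i * ut i) = R * (\<Sum>i. v i * ut i)"
  "(\<Sum>i. \<Sum>j. R * v i * v j * us j i) = R * (\<Sum>i. \<Sum>j. v i * v j * us j i)"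
  "(\<Sum>j. k * (R * v j) * \<theta>s j) = R * k * Th" by (simp_all add: sum_distrib_left mult_ac Th_def)
 have Ra: "(\<Sum>j. R * v j * aj j) = R * ((\<Sum>j. v j * (\<Sum>i. u i * us j i)) + s * Th - B / r)"
  unfolding aj Th_def B_def sum_distrib_left[of s] sum_divide_distrib sum.distrib[symmetric] sum_subtractf[symmetric] sum_distrib_left[of R]
  by (rule sum.cong[OF refl]) (simp add: algebra_simps)
 have last: "(\<Sum>j. ps j * u j + p * us j j) = A + p * D" unfolding A_def D by (simp add: sum.distrib sum_distrib_left mult.commute)
 have Tvu: "(\<Sum>j. (v j - u j) * \<theta>s j) = Th - Tu" by (simp add: Th_def Tu_def left_diff_distrib sum_subtractf)
 have e1: "pt + A = - (\<gamma> * p * D)" using prs by (simp add: A_def)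
 have e2: "\<theta>t = - Tu - (\<gamma> - 1) * \<theta> * D" using th by (simp add: Tu_def)
 have "- (\<Sum>i. R * v i * ut i) - (\<Sum>i. \<Sum>j. R * v i * v j * us j i) - (\<gamma> - 1) * e * D
   + R * a0 + (\<Sum>j. R * v j * aj j) - R * k * \<theta>t - (\<Sum>j. k * (R * v j) * \<theta>s j)
   + (pt + (\<Sum>j. ps j * u j + p * us j j))
  = R * (- (\<Sum>i. v i * ut i) - (\<Sum>i. \<Sum>j. v i * v j * us j i) + (\<Sum>i. u i * ut i) + (\<Sum>j. v j * (\<Sum>i. u i * us j i)))
   + R * (s - k) * (\<theta>t + Th) - R / r * (pt + B) - (\<gamma> - 1) * e * D + ((pt + A) + p * D)"
  unfolding Rf Ra last at by (simp add: algebra_simps add_divide_distrib)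
 also have "... = - R * ?X - R / r * (pt + A) + R * (s - k) * (\<theta>t + Th) - (\<gamma> - 1) * e * D + ((pt + A) + p * D)"
  unfolding S1 using r by (simp add: field_simps)
 also have "R / r * (pt + A) = - (\<gamma> * R * \<theta> * D)" unfolding e1 theta using r by (simp add: field_simps)
 also have "\<theta>t + Th = (Th - Tu) - (\<gamma> - 1) * \<theta> * D" using e2 by simp
 finally show ?thesis unfolding e1 Tvu by (simp add: algebra_simps)
qed

section \<open>Integration by parts on the torus\<close>

lemma integral_lborel_translate:
 fixes f :: "'a::euclidean_space => real"
 assumes "f : borel_measurable borel" shows "(LINT x|lborel. f (c + x)) = (LINT x|lborel. f x)"
proof -
 have "(LINT x|lborel. f x) = (LINT x|distr lborel borel ((+) c). f x)" by (simp add: lborel_distr_plus)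
 also have "... = (LINT x|lborel. f (c + x))" using assms by (intro integral_distr) auto
 finally show ?thesis by simp
qed

lemma integral_torus_eq_lborel:
 fixes f :: "real^'n => real"
 assumes "f : borel_measurable borel" shows "(LINT x|\<Omega>. f x) = (LINT x|lborel. indicator torus x * f x)"
proof -
 have "(LINT x|\<Omega>. f x) = (LINT x|lebesgue. indicator torus x *\<^sub>R f x)" by (subst integral_restrict_space) auto
 also have "... = (LINT x|lborel. indicator torus x *\<^sub>R f x)" by (rule integral_completion) (use assms in measurable)
 finally show ?thesis by simp
qed

lemma integrable_indicator_continuous:
 fixes f :: "real^'n => real"
 assumes f: "continuous_on UNIV f" and A: "A : sets borel" "A \<subseteq> cbox a b" shows "integrable lborel (%x. indicator A x * f x)"
proof -
 have "set_integrable lborel (cbox a b) f" unfolding set_integrable_def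
  by (rule borel_integrable_compact[OF compact_cbox]) (use f continuous_on_subset in blast)
 then have "set_integrable lborel A f" by (rule set_integrable_subset) (use A in auto)
 then show ?thesis by (simp add: set_integrable_def)
qed

text \<open>
  Cutting the translated cell at the wall \<open>x\<^sub>s = 1\<close> and moving the protruding part back by a period.
\<close>
lemma torus_translation_invariance:
 fixes w :: "real^'n => real"
 assumes w: "continuous_on UNIV w" and per: "periodic w" and h: "0 < h" "h < 1" shows "(LINT x|\<Omega>. w (x + h *\<^sub>R axis s 1)) = (LINT x|\<Omega>. w x)"
proof -
 let ?e = "axis s 1 :: real^'n"
 have wm: "w : borel_measurable borel" using w by (rule borel_measurable_continuous_onI)
 define A where "A = {x :: real^'n. x : torus & h <= x $ s}"
 define A' where "A' = {x :: real^'n. x : torus & x $ s < h}"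
 have ms: "{x :: real^'n. h <= x $ s} : sets borel" "{x :: real^'n. x $ s < h} : sets borel"
  by (intro borel_closed borel_open closed_Collect_le open_Collect_less continuous_intros)+
 have Am: "A : sets borel" "A' : sets borel" using sets.Int[OF torus_borel ms(1)] sets.Int[OF torus_borel ms(2)] by (simp_all add: A_def A'_def Int_def)
 have Ai: "integrable lborel (%x. indicator A x * w x)" "integrable lborel (%x. indicator A' x * w x)"
  using torus_subset_cbox by (auto intro!: integrable_indicator_continuous[OF w] Am simp: A_def A'_def)
 have ax: "?e $ i = (if i = s then 1 else 0)" for i by (simp add: axis_def)
 have shiftA: "indicator torus (x - h *\<^sub>R ?e) = (indicator A x + indicator A' (x - ?e) :: real)" for x
 proof -
  have "x - h *\<^sub>R ?e : torus \<longleftrightarrow> x : A | x - ?e : A'"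
  proof
   assume a: "x - h *\<^sub>R ?e : torus"
   then have o: "0 <= x $ i & x $ i < 1" if "i ~= s" for i using that unfolding torus_def by (auto simp: ax dest!: spec[of _ i])
   have s: "h <= x $ s" "x $ s < 1 + h" using a unfolding torus_def by (auto simp: ax dest!: spec[of _ s])
   show "x : A | x - ?e : A'"
   proof (cases "x $ s < 1")
    case True
    have "0 <= x $ i & x $ i < 1" for i using o[of i] s True h by (cases "i = s") auto
    then show ?thesis using s by (auto simp: A_def torus_def)
   next
    case False
    have "0 <= (x - ?e) $ i & (x - ?e) $ i < 1" for i using o[of i] s False h by (cases "i = s") (auto simp: ax)
    then show ?thesis using s by (auto simp: A'_def torus_def ax)
   qed
  next
   assume "x : A | x - ?e : A'"
   then show "x - h *\<^sub>R ?e : torus"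
   proof
    assume a: "x : A"
    have "0 <= (x - h *\<^sub>R ?e) $ i & (x - h *\<^sub>R ?e) $ i < 1" for i
    proof -
     have "0 <= x $ i" "x $ i < 1" "h <= x $ s" using a by (auto simp: A_def torus_def)
     then show ?thesis using h by (auto simp: ax)
    qed
    then show ?thesis by (simp add: torus_def)
   next
    assume a: "x - ?e : A'"
    have "0 <= (x - h *\<^sub>R ?e) $ i & (x - h *\<^sub>R ?e) $ i < 1" for i
    proof -
     have "0 <= (x - ?e) $ i" "(x - ?e) $ i < 1" "(x - ?e) $ s < h" using a unfolding A'_def torus_def by blast+
     then show ?thesis using h by (auto simp: ax split: if_splits)
    qed
    then show ?thesis by (simp add: torus_def)
   qed
  qed
  moreover have "~ (x : A & x - ?e : A')"
  proof
   assume "x : A & x - ?e : A'"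
   then have "x : torus" "x - ?e : torus" by (auto simp: A_def A'_def)
   then have "x $ s < 1" "0 <= (x - ?e) $ s" unfolding torus_def by blast+
   then show False by (simp add: ax)
  qed
  ultimately show ?thesis by (auto simp: indicator_def)
 qed
 have tm: "indicator torus : borel_measurable (borel :: (real^'n) measure)" by simp
 have "(LINT x|\<Omega>. w (x + h *\<^sub>R ?e)) = (LINT x|lborel. indicator torus x * w (x + h *\<^sub>R ?e))"
  by (rule integral_torus_eq_lborel) (use wm in measurable)
 also have "... = (LINT x|lborel. (%y. indicator torus (y - h *\<^sub>R ?e) * w y) (h *\<^sub>R ?e + x))" by (simp add: add.commute)
 also have "... = (LINT x|lborel. indicator torus (x - h *\<^sub>R ?e) * w x)" by (rule integral_lborel_translate) (use wm in measurable)
 also have "... = (LINT x|lborel. indicator A x * w x + indicator A' (x - ?e) * w x)" unfolding shiftA by (simp add: distrib_right)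
 also have "... = (LINT x|lborel. indicator A x * w x) + (LINT x|lborel. indicator A' (x - ?e) * w x)"
 proof (rule lint_add[OF Ai(1)])
  have eq: "(%x. indicator A' (x - ?e) * w x) = (%x. indicator ((%x. x - ?e) -` A') x * w x)" by (simp add: fun_eq_iff indicator_def)
  moreover have "integrable lborel (%x. indicator ((%x. x - ?e) -` A') x * w x)"
  proof (rule integrable_indicator_continuous[OF w])
   have "(%x. x - ?e) : borel_measurable borel" by simp
   from measurable_sets[OF this Am(2)] show "(%x. x - ?e) -` A' : sets borel" by simp
   show "(%x. x - ?e) -` A' \<subseteq> cbox 0 2"
   proof
    fix x assume "x : (%x. x - ?e) -` A'"
    then have "0 <= (x - ?e) $ i & (x - ?e) $ i < 1" for i by (auto simp: A'_def torus_def)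
    from this have "0 <= x $ i & x $ i <= 2" for i using \<open>!!i. 0 <= (x - ?e) $ i & (x - ?e) $ i < 1\<close>[of i] by (cases "i = s") (auto simp: ax)
    then show "x : cbox 0 2" by (simp add: mem_box_cart)
   qed
  qed
  ultimately show "integrable lborel (%x. indicator A' (x - ?e) * w x)" by (simp only: eq)
 qed
 also have "(LINT x|lborel. indicator A' (x - ?e) * w x) = (LINT x|lborel. (%y. indicator A' (y - ?e) * w y) (?e + x))"
  by (rule integral_lborel_translate[symmetric]) (use wm Am in measurable)
 also have "... = (LINT x|lborel. indicator A' x * w x)"
 proof -
  have "w (?e + x) = w x" for x using per by (simp add: periodic_def add.commute)
  then show ?thesis by simp
 qed
 also have "(LINT x|lborel. indicator A x * w x) + (LINT x|lborel. indicator A' x * w x)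
   = (LINT x|lborel. indicator A x * w x + indicator A' x * w x)" by (rule lint_add[OF Ai, symmetric])
 also have "... = (LINT x|lborel. indicator torus x * w x)" by (rule lint_cong) (auto simp: indicator_def A_def A'_def)
 also have "... = (LINT x|\<Omega>. w x)" by (rule integral_torus_eq_lborel[OF wm, symmetric])
 finally show ?thesis .
qed

text \<open>
  The integral of a difference quotient is zero by translation invariance.
\<close>
lemma torus_integral_derivative_zero:
 fixes w :: "real^'n => real"
 assumes w: "continuous_on UNIV w" and per: "periodic w" and diff: "!!x. w differentiable (at x)" and c': "continuous_on UNIV (pd s w)"
 shows "(LINT x|\<Omega>. pd s w x) = 0"
proof -
 let ?e = "axis s 1 :: real^'n"
 interpret tm: finite_measure "lebesgue_on (torus :: (real^'n) set)" by (rule finite_measure_torus)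
 have line: "((%r. w (x + r *\<^sub>R ?e)) has_real_derivative pd s w (x + r *\<^sub>R ?e)) (at r)" for x r
 proof -
  have "((%q. w ((x + r *\<^sub>R ?e) + q *\<^sub>R ?e)) has_real_derivative pd s w (x + r *\<^sub>R ?e)) (at 0)"
   using pd_line[OF diff, of "x + r *\<^sub>R ?e" s] by (simp add: has_real_derivative_iff_has_vector_derivative)
  then have "((%q. w (x + (r + q) *\<^sub>R ?e)) has_real_derivative pd s w (x + r *\<^sub>R ?e)) (at 0)" by (simp add: scaleR_add_left add.assoc)
  then show ?thesis using DERIV_at_within_shift[of "%r. w (x + r *\<^sub>R ?e)" "pd s w (x + r *\<^sub>R ?e)" r 0 UNIV] by simp
 qed
 obtain B where B: "B > 0" "!!x. x : cbox 0 2 ==> norm (pd s w x) <= B"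
  using compact_norm_bound[OF compact_cbox continuous_on_subset[OF c' subset_UNIV]] by metis
 define h where "h = (%n. 1 / real (n + 2))"
 have h: "0 < h n" "h n < 1" for n by (auto simp: h_def)
 define q where "q = (%n x. (w (x + h n *\<^sub>R ?e) - w x) / h n)"
 have wms: "(%x. w (x + c)) : borel_measurable \<Omega>" for c
  by (rule measurable_torus_continuous, rule continuous_on_compose2[OF w]) (auto intro!: continuous_intros)
 have wi: "integrable \<Omega> (%x. w (x + c))" for c
 proof -
  have "continuous_on (cbox 0 1) (%x. w (x + c))" by (rule continuous_on_compose2[OF w]) (auto intro!: continuous_intros)
  then obtain C where "!!x. x : cbox 0 1 ==> norm (w (x + c)) <= C" using compact_norm_bound[OF compact_cbox] by metis
  then show ?thesis using torus_subset_cbox by (intro tm.integrable_const_bound[of _ C] wms AE_I2) auto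
 qed
 have q0: "(LINT x|\<Omega>. q n x) = 0" for n
 proof -
  have "(LINT x|\<Omega>. q n x) = ((LINT x|\<Omega>. w (x + h n *\<^sub>R ?e)) - (LINT x|\<Omega>. w x)) / h n"
   unfolding q_def using wi[of "h n *\<^sub>R ?e"] wi[of 0] by simp
  then show ?thesis using torus_translation_invariance[OF w per h] by simp
 qed
 have "(%n. LINT x|\<Omega>. q n x) \<longlonglongrightarrow> (LINT x|\<Omega>. pd s w x)"
 proof (rule integral_dominated_convergence[where w="%_. B"])
  show "pd s w : borel_measurable \<Omega>" by (rule measurable_torus_continuous[OF c'])
  show "q n : borel_measurable \<Omega>" for n unfolding q_def using wms[of "h n *\<^sub>R ?e"] wms[of 0] by simp
  show "AE x in \<Omega>. (%n. q n x) \<longlonglongrightarrow> pd s w x"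
  proof (rule AE_I2)
   fix x
   have "((%r. w (x + r *\<^sub>R ?e)) has_real_derivative pd s w x) (at 0)" using line[of x 0] by simp
   then have lim: "((%r. (w (x + r *\<^sub>R ?e) - w x) / r) \<longlongrightarrow> pd s w x) (at 0)" by (simp add: has_field_derivative_iff)
   have "filterlim h (at 0) sequentially" unfolding filterlim_at
   proof
    show "\<forall>\<^sub>F n in sequentially. h n : UNIV & h n ~= 0" using h(1) by (intro always_eventually) (auto simp: less_imp_neq[THEN not_sym])
    show "h \<longlonglongrightarrow> 0" unfolding h_def by (rule LIMSEQ_ignore_initial_segment[OF lim_1_over_n])
   qed
   from filterlim_compose[OF lim this] show "(%n. q n x) \<longlonglongrightarrow> pd s w x" by (simp add: q_def)
  qed
  show "AE x in \<Omega>. norm (q n x) <= B" for n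
  proof (rule AE_I2)
   fix x assume "x : space (lebesgue_on (torus :: (real^'n) set))"
   then have x: "x : torus" by simp
   obtain z where z: "0 < z" "z < h n" "w (x + h n *\<^sub>R ?e) - w (x + 0 *\<^sub>R ?e) = (h n - 0) * pd s w (x + z *\<^sub>R ?e)"
    using MVT2[of 0 "h n" "%r. w (x + r *\<^sub>R ?e)" "%r. pd s w (x + r *\<^sub>R ?e)"] line h(1) by blast
   have "x + z *\<^sub>R ?e : cbox 0 2"
   proof -
    have "0 <= (x + z *\<^sub>R ?e) $ i & (x + z *\<^sub>R ?e) $ i <= 2" for i
    proof -
     have "0 <= x $ i" "x $ i < 1" using x by (auto simp: torus_def)
     then show ?thesis using z(1,2) h(2)[of n] by (auto simp: axis_def)
    qed
    then show ?thesis by (simp add: mem_box_cart)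
   qed
   moreover have "q n x = pd s w (x + z *\<^sub>R ?e)" using z(3) h(1)[of n] by (simp add: q_def)
   ultimately show "norm (q n x) <= B" using B(2) by simp
  qed
 qed (simp)
 then have "(%n. 0 :: real) \<longlonglongrightarrow> (LINT x|\<Omega>. pd s w x)" by (simp add: q0)
 then show ?thesis using LIMSEQ_unique tendsto_const by metis
qed

lemma C1_strip_time_within:
 fixes f :: "real => real^'n => real"
 assumes f: "C1_strip T f" and T: "T > 0"
 obtains ft where "continuous_on (strip T) ft"
  "!!t x. t : {0..T} ==> ((%r. f r x) has_vector_derivative ft (t, x)) (at t within {0..T})"
  "!!t x. t : {0<..<T} ==> dt f t x = ft (t, x)"
proof -
 let ?S = "{0..T} \<times> (UNIV :: (real^'n) set)"
 let ?F = "%z. f (fst z) (snd z)"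
 obtain f' where f': "!!z. z : ?S ==> (?F has_derivative blinfun_apply (f' z)) (at z within ?S)" "continuous_on ?S f'"
  using f by (auto simp: C1_on_def case_prod_beta')
 have time: "((%r. f r x) has_vector_derivative blinfun_apply (f' (t, x)) (1, 0)) (at t within {0..T})" if t: "t : {0..T}" for t x
 proof -
  have "((%r. ?F (r, x)) has_derivative (%r. blinfun_apply (f' (t, x)) (r, 0))) (at t within {0..T})"
  proof (rule has_derivative_in_compose[where g="?F" and f="%r. (r, x)"])
   show "((%r. (r, x)) has_derivative (%r. (r, 0))) (at t within {0..T})" by (auto intro!: derivative_eq_intros)
   show "(?F has_derivative blinfun_apply (f' (t, x))) (at (t, x) within (%r. (r, x)) ` {0..T})" by (rule has_derivative_subset[OF f'(1)]) (use t in auto)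
  qed
  moreover have "(%r. blinfun_apply (f' (t, x)) (r, 0)) = (%r. r *\<^sub>R blinfun_apply (f' (t, x)) (1, 0))"
  proof
   fix r :: real
   have "(r, 0) = r *\<^sub>R (1, 0 :: real^'n)" by simp
   then show "blinfun_apply (f' (t, x)) (r, 0) = r *\<^sub>R blinfun_apply (f' (t, x)) (1, 0)" by (metis blinfun.scaleR_right)
  qed
  ultimately show ?thesis by (simp add: has_vector_derivative_def)
 qed
 show ?thesis
 proof (rule that[of "%z. blinfun_apply (f' z) (1, 0)"])
  show "continuous_on ?S (%z. blinfun_apply (f' z) (1, 0))" by (intro continuous_intros f'(2))
  show "((%r. f r x) has_vector_derivative blinfun_apply (f' (t, x)) (1, 0)) (at t within {0..T})" if "t : {0..T}" for t x by (rule time[OF that])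
  show "dt f t x = blinfun_apply (f' (t, x)) (1, 0)" if t: "t : {0<..<T}" for t x
  proof -
   have "at t within {0..T} = at t" using t by (intro at_within_interior) auto
   then show ?thesis unfolding dt_def using vector_derivative_at time[of t x] t by fastforce
  qed
 qed
qed

lemma bounded_integrable_spacetime:
 fixes f :: "real \<times> (real^'n) => real"
 assumes "continuous_on (strip T) f" shows "integrable (spacetime T) f"
proof -
 interpret M: finite_measure "spacetime T :: (real \<times> (real^'n)) measure" by (rule finite_measure_spacetime)
 obtain B where B: "!!z. z : {0..T} \<times> cbox 0 1 ==> norm (f z) <= B"
  using compact_norm_bound[OF compact_Times[OF compact_Icc compact_cbox] continuous_on_subset[OF assms]] by (metis Sigma_mono subset_UNIV subset_refl)
 have "f : borel_measurable (spacetime T)" by (rule measurable_spacetime_continuous, rule continuous_on_subset[OF assms]) auto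
 then show ?thesis by (rule M.integrable_const_bound[of _ B, rotated]) (use B torus_subset_cbox in \<open>auto simp: space_spacetime intro!: AE_I2\<close>)
qed

lemma spacetime_time_derivative:
 fixes f :: "real => real^'n => real"
 assumes T: "T > 0" and f: "C1_strip T f" shows "integral_st T (dt f) = (LINT x|\<Omega>. f T x - f 0 x)"
proof -
 obtain ft where ft: "continuous_on (strip T) ft"
  "!!t x. t : {0..T} ==> ((%r. f r x) has_vector_derivative ft (t, x)) (at t within {0..T})"
  "!!t x. t : {0<..<T} ==> dt f t x = ft (t, x)" using C1_strip_time_within[OF f T] by metis
 let ?S = "{0<..<T} \<times> (torus :: (real^'n) set)"
 let ?Q = "{0..T} \<times> (torus :: (real^'n) set)"
 have Qb: "?Q : sets borel" using torus_borel by (metis borel_prod pair_measureI borel_closed closed_atLeastAtMost)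
 have ftm: "(%z. indicator ?Q z * ft z) : borel_measurable borel"
 proof -
  have "(%z. indicator ?Q z *\<^sub>R ft z) : borel_measurable borel"
   by (rule borel_measurable_continuous_on_indicator[OF Qb continuous_on_subset[OF ft(1)]]) auto
  then show ?thesis by simp
 qed
 obtain B where B: "!!z. z : {0..T} \<times> cbox 0 1 ==> norm (ft z) <= B"
  using compact_norm_bound[OF compact_Times[OF compact_Icc compact_cbox] continuous_on_subset[OF ft(1)]] by (metis Sigma_mono subset_UNIV subset_refl)
 have em: "emeasure lborel ?Q < \<infinity>"
 proof -
  have "emeasure lborel ?Q = emeasure (lborel \<Otimes>\<^sub>M lborel) ?Q" by (simp add: lborel_prod)
  also have "... = emeasure lborel {0..T} * emeasure lborel (torus::(real^'n) set)" by (rule lborel.emeasure_pair_measure_Times) auto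
  finally show ?thesis using T by (simp add: emeasure_torus)
 qed
 have int: "integrable lborel (%z. indicator ?Q z * ft z)"
 proof (rule integrableI_bounded_set[where A="?Q" and B=B])
  show "AE z\<in>?Q in lborel. norm (indicator ?Q z * ft z) <= B" using B torus_subset_cbox by (intro AE_I2) (auto simp: indicator_def)
 qed (use Qb ftm em in \<open>auto simp: indicator_def\<close>)
 then have intp: "integrable (lborel \<Otimes>\<^sub>M lborel) (%z. indicator ?Q z * ft z)" by (simp add: lborel_prod)
 have "integral_st T (dt f) = (LINT z|lebesgue_on ?S. ft z)" unfolding integral_st_def spacetime_def by (rule lint_cong) (auto simp: ft(3))
 also have "... = (LINT z|lebesgue. indicator ?S z *\<^sub>R ft z)" by (subst integral_restrict_space) auto
 also have "... = (LINT z|lebesgue. indicator ?Q z * ft z)"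
 proof (rule integral_cong_AE)
  have Qm: "(%z. indicator ?Q z * ft z) : borel_measurable lebesgue" using ftm by (intro measurable_completion) simp
  show "(%z. indicator ?Q z * ft z) : borel_measurable lebesgue" by (rule Qm)
  have ae: "AE z in (lborel :: (real \<times> (real^'n)) measure). fst z ~= 0 & fst z ~= T"
   by (rule AE_lborel_fst[where P="%t. t ~= 0 & t ~= T"]) (intro AE_conjI AE_lborel_singleton)
  then have ae': "AE z in lebesgue. indicator ?Q z * ft z = indicator ?S z *\<^sub>R ft z"
   unfolding AE_completion_iff by eventually_elim (auto simp: indicator_def)
  show "(%z. indicator ?S z *\<^sub>R ft z) : borel_measurable lebesgue" by (rule borel_measurable_AE[OF Qm ae'])
  from ae' show "AE z in lebesgue. indicator ?S z *\<^sub>R ft z = indicator ?Q z * ft z" by eventually_elim (rule sym)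
 qed
 also have "... = (LINT z|lborel. indicator ?Q z * ft z)" using ftm by (intro integral_completion) simp
 also have "... = (LINT x|lborel. LINT t|lborel. indicator ?Q (t, x) * ft (t, x))"
  using lborel_pair.integral_snd[of "%t x. indicator ?Q (t, x) * ft (t, x)"] intp by (simp add: lborel_prod case_prod_beta')
 also have "... = (LINT x|lborel. indicator torus x * (f T x - f 0 x))"
 proof (rule lint_cong[OF refl])
  fix x :: "real^'n"
  have "(LINT t|lborel. indicator {0..T} t *\<^sub>R ft (t, x)) = f T x - f 0 x"
  proof (rule integral_FTC_atLeastAtMost)
   show "continuous_on {0..T} (%t. ft (t, x))" by (rule continuous_on_compose2[OF ft(1), where f="%t. (t, x)"]) (auto intro!: continuous_intros)
  qed (use T ft(2) in auto)
  moreover have eq: "indicator ?Q (t, x) * ft (t, x) = indicator torus x * (indicator {0..T} t *\<^sub>R ft (t, x))" for t by (auto simp: indicator_def)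
  moreover have "(LINT t|lborel. indicator torus x * (indicator {0..T} t *\<^sub>R ft (t, x)))
    = indicator torus x * (LINT t|lborel. indicator {0..T} t *\<^sub>R ft (t, x))" by simp
  ultimately show "(LINT t|lborel. indicator ?Q (t, x) * ft (t, x)) = indicator torus x * (f T x - f 0 x)" by (simp only: eq)
 qed
 also have "... = (LINT x|\<Omega>. f T x - f 0 x)"
 proof (rule integral_torus_eq_lborel[symmetric])
  have cf: "continuous_on (strip T) (%z. f (fst z) (snd z))" using C1_on_continuous_on[OF f] by (simp add: case_prod_beta')
  have "continuous_on UNIV (%x. f t x)" if "t : {0..T}" for t
  proof -
   define k where "k = (%x::real^'n. (t, x))"
   have "continuous_on UNIV (%x. f (fst (k x)) (snd (k x)))"
    by (rule continuous_on_compose2[OF cf]) (use that in \<open>auto simp: k_def intro!: continuous_intros\<close>)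
   then show ?thesis by (simp add: k_def)
  qed
  then have "continuous_on UNIV (%x. f T x - f 0 x)" using T by (intro continuous_intros) auto
  then show "(%x. f T x - f 0 x) : borel_measurable borel" by (rule borel_measurable_continuous_onI)
 qed
 finally show ?thesis .
qed

section \<open>Matrix-valued measures and test functions\<close>

lemma sum_swap_innermost: "(\<Sum>i\<in>A. \<Sum>j\<in>B. \<Sum>k\<in>C. f i j k) = (\<Sum>k\<in>C. \<Sum>i\<in>A. \<Sum>j\<in>B. f i j k)"
 by (simp only: sum.swap[of _ B C] sum.swap[of _ A C])

lemma norm_mm_value_le:
 fixes \<mu> :: "('n::finite, 'a) matrix_measure"
 shows "norm (mm_value \<mu> B) <= (\<Sum>i. \<Sum>j. measure (fst (\<mu> i j)) B + measure (snd (\<mu> i j)) B)"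
proof -
 have "norm (mm_value \<mu> B) <= (\<Sum>i. norm (mm_value \<mu> B $ i))" unfolding norm_vec_def by (rule L2_set_le_sum) simp
 also have "... <= (\<Sum>i. \<Sum>j. \<bar>mm_value \<mu> B $ i $ j\<bar>)" by (intro sum_mono norm_le_l1_cart)
 also have "... <= (\<Sum>i. \<Sum>j. measure (fst (\<mu> i j)) B + measure (snd (\<mu> i j)) B)"
  by (intro sum_mono) (simp add: mm_value_def abs_le_iff add_increasing add_increasing2)
 finally show ?thesis .
qed

lemma mm_variation_upper:
 fixes \<mu> :: "('n::finite, 'a) matrix_measure"
 assumes mm: "is_matrix_measure X \<mu>" and A: "A : sets X" and P: "finite P" "partition_on A P" "P \<subseteq> sets X"
 shows "(\<Sum>B\<in>P. norm (mm_value \<mu> B)) <= mm_variation X \<mu> A" unfolding mm_variation_def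
proof (rule cSUP_upper)
 show "P : {P. finite P & partition_on A P & P \<subseteq> sets X}" using P by simp
 show "bdd_above ((%P. \<Sum>B\<in>P. norm (mm_value \<mu> B)) ` {P. finite P & partition_on A P & P \<subseteq> sets X})"
 proof (rule bdd_aboveI2)
  fix P assume P: "P : {P. finite P & partition_on A P & P \<subseteq> sets X}"
  have add: "(\<Sum>B\<in>P. measure N B) = measure N A" if "finite_measure N" "sets N = sets X" for N
  proof -
   interpret finite_measure N by fact
   have "measure N (\<Union>B\<in>P. B) = (\<Sum>B\<in>P. measure N B)"
    by (rule finite_measure_finite_Union) (use P that in \<open>auto simp: partition_on_def disjoint_family_on_def disjoint_def\<close>)
   then show ?thesis using P by (simp add: partition_on_def)
  qed
  have "(\<Sum>B\<in>P. norm (mm_value \<mu> B)) <= (\<Sum>B\<in>P. \<Sum>i. \<Sum>j. measure (fst (\<mu> i j)) B + measure (snd (\<mu> i j)) B)"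
   by (intro sum_mono norm_mm_value_le)
  also have "... = (\<Sum>i. \<Sum>j. (\<Sum>B\<in>P. measure (fst (\<mu> i j)) B) + (\<Sum>B\<in>P. measure (snd (\<mu> i j)) B))"
   by (subst sum.swap, intro sum.cong refl, subst sum.swap, simp add: sum.distrib)
  also have "... = (\<Sum>i. \<Sum>j. measure (fst (\<mu> i j)) A + measure (snd (\<mu> i j)) A)"
   using mm unfolding is_matrix_measure_def by (intro sum.cong refl arg_cong2[where f="(+)"] add) auto
  finally show "(\<Sum>B\<in>P. norm (mm_value \<mu> B)) <= (\<Sum>i. \<Sum>j. measure (fst (\<mu> i j)) A + measure (snd (\<mu> i j)) A)" .
 qed
qed

text \<open>
  Rounding the entries of \<open>\<Phi>\<close> down to multiples of \<open>e\<close> makes it constant on finitely many pieces, for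
  which the definition of the variation applies.
\<close>
lemma mm_integral_indicator_bound:
 fixes \<mu> :: "('n::finite, 'a) matrix_measure"
 assumes mm: "is_matrix_measure X \<mu>" and A: "A : sets X" and Pm: "!!i j. (%z. \<Phi> z $ i $ j) : borel_measurable X"
  and Pb: "!!z. z : A ==> norm (\<Phi> z) <= B" shows "\<bar>mm_integral \<mu> (%z. indicator A z *\<^sub>R \<Phi> z)\<bar> <= B * mm_variation X \<mu> A"
proof -
 have AX: "A \<subseteq> space X" using A by (rule sets.sets_into_space)
 define tot where "tot = (\<Sum>i. \<Sum>j. measure (fst (\<mu> i j)) A + measure (snd (\<mu> i j)) A)"
 define n where "n = real CARD('n)"
 have key: "\<bar>mm_integral \<mu> (%z. indicator A z *\<^sub>R \<Phi> z)\<bar> <= (B + n * n * e) * mm_variation X \<mu> A + tot * e" if e: "e > 0" for e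
 proof -
  define b where "b = (%z. (\<chi> i j. \<lfloor>\<Phi> z $ i $ j / e\<rfloor>) :: int^'n^'n)"
  define vl where "vl = (%w::int^'n^'n. (\<chi> i j. e * of_int (w $ i $ j)) :: real^'n^'n)"
  have close: "0 <= \<Phi> z $ i $ j - vl (b z) $ i $ j" "\<Phi> z $ i $ j - vl (b z) $ i $ j <= e" for z i j
  proof -
   have f: "of_int \<lfloor>\<Phi> z $ i $ j / e\<rfloor> <= \<Phi> z $ i $ j / e" "\<Phi> z $ i $ j / e <= of_int \<lfloor>\<Phi> z $ i $ j / e\<rfloor> + 1" by linarith+
   have v: "vl (b z) $ i $ j = e * of_int \<lfloor>\<Phi> z $ i $ j / e\<rfloor>" by (simp add: vl_def b_def)
   have q: "e * (\<Phi> z $ i $ j / e) = \<Phi> z $ i $ j" using e by simp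
   have "e * of_int \<lfloor>\<Phi> z $ i $ j / e\<rfloor> <= e * (\<Phi> z $ i $ j / e)" by (rule mult_left_mono[OF f(1)]) (use e in simp)
   then show "0 <= \<Phi> z $ i $ j - vl (b z) $ i $ j" unfolding v q by linarith
   have "e * (\<Phi> z $ i $ j / e) <= e * (of_int \<lfloor>\<Phi> z $ i $ j / e\<rfloor> + 1)" by (rule mult_left_mono[OF f(2)]) (use e in simp)
   then show "\<Phi> z $ i $ j - vl (b z) $ i $ j <= e" unfolding v q distrib_left by linarith
  qed
  have entry: "\<bar>\<Phi> z $ i $ j\<bar> <= B" if "z : A" for z i j
   using Pb[OF that] component_le_norm_cart[of "\<Phi> z $ i" j] Finite_Cartesian_Product.norm_nth_le[of "\<Phi> z" i] by linarith
  have normvl: "norm (vl (b z)) <= B + n * n * e" if z: "z : A" for z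
  proof -
   have "norm (vl (b z)) <= norm (\<Phi> z) + norm (\<Phi> z - vl (b z))" by (metis norm_minus_commute norm_triangle_sub add.commute)
   also have "norm (\<Phi> z - vl (b z)) <= (\<Sum>i. norm ((\<Phi> z - vl (b z)) $ i))"
    unfolding norm_vec_def[of "\<Phi> z - vl (b z)"] by (rule L2_set_le_sum) simp
   also have "... <= (\<Sum>i\<in>(UNIV::'n set). \<Sum>j\<in>(UNIV::'n set). e)"
   proof (intro sum_mono order_trans[OF norm_le_l1_cart])
    fix i j
    show "\<bar>(\<Phi> z - vl (b z)) $ i $ j\<bar> <= e" using close[where z=z and i=i and j=j] by simp
   qed
   also have "... = n * n * e" by (simp add: n_def)
   finally show ?thesis using Pb[OF z] by simp
  qed
  have fin: "finite (b ` A)"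
  proof -
   define N where "N = \<lceil>B / e\<rceil> + 1"
   have "b ` A \<subseteq> (%f. \<chi> i j. f (i, j)) ` (UNIV \<rightarrow>\<^sub>E {-N..N})"
   proof
    fix w assume "w : b ` A"
    then obtain z where z: "z : A" "w = b z" by blast
    have "-N <= w $ i $ j & w $ i $ j <= N" for i j
    proof -
     have "\<bar>\<Phi> z $ i $ j / e\<bar> <= B / e" using entry[OF z(1), of i j] e by (simp add: abs_divide divide_right_mono)
     then have "\<Phi> z $ i $ j / e <= B / e" "- (B / e) <= \<Phi> z $ i $ j / e" unfolding abs_le_iff by auto
     then show ?thesis unfolding z(2) b_def N_def by (simp, linarith)
    qed
    then have "(%(i, j). w $ i $ j) : UNIV \<rightarrow>\<^sub>E {-N..N}" by auto
    then show "w : (%f. \<chi> i j. f (i, j)) ` (UNIV \<rightarrow>\<^sub>E {-N..N})" by (rule rev_image_eqI) (simp add: vec_eq_iff)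
   qed
   moreover have "finite (UNIV \<rightarrow>\<^sub>E {-N..N} :: ('n \<times> 'n => int) set)" by (intro finite_PiE) auto
   ultimately show ?thesis by (meson finite_imageI finite_subset)
  qed
  define piece where "piece = (%w. A \<inter> b -` {w})"
  have pm: "piece w : sets X" for w
  proof -
   have "piece w = (\<Inter>p. {z : A. \<lfloor>\<Phi> z $ fst p $ snd p / e\<rfloor> = w $ fst p $ snd p})" by (auto simp: piece_def b_def vec_eq_iff)
   also have "... : sets X"
   proof (rule sets.finite_INT)
    fix p
    have "{z : space X. \<lfloor>\<Phi> z $ fst p $ snd p / e\<rfloor> = w $ fst p $ snd p} : sets X" using Pm by measurable
    moreover have "{z : A. \<lfloor>\<Phi> z $ fst p $ snd p / e\<rfloor> = w $ fst p $ snd p} =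
      A \<inter> {z : space X. \<lfloor>\<Phi> z $ fst p $ snd p / e\<rfloor> = w $ fst p $ snd p}" using AX by auto
    ultimately show "{z : A. \<lfloor>\<Phi> z $ fst p $ snd p / e\<rfloor> = w $ fst p $ snd p} : sets X" using A by auto
   qed auto
   finally show ?thesis .
  qed
  have inj: "inj_on piece (b ` A)" by (rule inj_onI) (auto simp: piece_def)
  have part: "partition_on A (piece ` (b ` A))" by (rule partition_onI) (auto simp: piece_def disjnt_def)
  have var: "(\<Sum>w\<in>b ` A. norm (mm_value \<mu> (piece w))) <= mm_variation X \<mu> A"
   using mm_variation_upper[OF mm A _ part] fin pm by (auto simp: sum.reindex[OF inj])
  have step: "(\<Sum>w\<in>b ` A. vl w $ i $ j * indicator (piece w) z) = indicator A z * vl (b z) $ i $ j" for z i j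
  proof (cases "z : A")
   case True
   have "(\<Sum>w\<in>b ` A. vl w $ i $ j * indicator (piece w) z) = (\<Sum>w\<in>b ` A. if w = b z then vl w $ i $ j else 0)"
    using True by (intro sum.cong refl) (auto simp: piece_def indicator_def)
   also have "... = vl (b z) $ i $ j" using True fin by (subst sum.delta) auto
   finally show ?thesis using True by simp
  next
   case False
   then show ?thesis by (simp add: piece_def)
  qed
  define S where "S = mm_integral \<mu> (%z. indicator A z *\<^sub>R vl (b z))"
  have one: "\<bar>(LINT z|N. indicator A z * \<Phi> z $ i $ j) - (LINT z|N. indicator A z * vl (b z) $ i $ j)\<bar> <= e * measure N A
    & (LINT z|N. indicator A z * vl (b z) $ i $ j) = (\<Sum>w\<in>b ` A. vl w $ i $ j * measure N (piece w))"
   if N: "finite_measure N" "sets N = sets X" for N i j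
  proof -
   interpret finite_measure N by fact
   have AN: "A : sets N" using A N by simp
   have iv: "integrable N (%z. \<Sum>w\<in>b ` A. vl w $ i $ j * indicator (piece w) z)"
    using pm N by (intro Bochner_Integration.integrable_sum) (auto simp: emeasure_eq_measure)
   have e2: "(LINT z|N. indicator A z * vl (b z) $ i $ j) = (\<Sum>w\<in>b ` A. vl w $ i $ j * measure N (piece w))" unfolding step[symmetric] using pm N
    by (subst lint_sum) (auto simp: emeasure_eq_measure)
   have ip: "integrable N (%z. indicator A z * \<Phi> z $ i $ j)"
   proof (rule integrable_const_bound[of _ "\<bar>B\<bar>"])
    have "(%z. \<Phi> z $ i $ j) : borel_measurable N" using Pm[of i j] N by (simp cong: measurable_cong_sets)
    then show "(%z. indicator A z * \<Phi> z $ i $ j) : borel_measurable N" using AN by simp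
    show "AE z in N. norm (indicator A z * \<Phi> z $ i $ j) <= \<bar>B\<bar>"
     using entry[of _ i j] by (intro AE_I2) (auto simp: indicator_def intro: order_trans[OF _ abs_ge_self])
   qed
   have iv': "integrable N (%z. indicator A z * vl (b z) $ i $ j)" using iv unfolding step .
   have "\<bar>(LINT z|N. indicator A z * \<Phi> z $ i $ j) - (LINT z|N. indicator A z * vl (b z) $ i $ j)\<bar>
     = \<bar>LINT z|N. indicator A z * \<Phi> z $ i $ j - indicator A z * vl (b z) $ i $ j\<bar>" using ip iv' by simp
   also have "... <= (LINT z|N. \<bar>indicator A z * \<Phi> z $ i $ j - indicator A z * vl (b z) $ i $ j\<bar>)" by (rule integral_abs_bound)
   also have "... <= (LINT z|N. e * indicator A z)"
   proof (rule integral_mono_AE')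
    show "integrable N (%z. e * indicator A z)" using AN by (simp add: emeasure_eq_measure)
    show "AE z in N. \<bar>indicator A z * \<Phi> z $ i $ j - indicator A z * vl (b z) $ i $ j\<bar> <= e * indicator A z"
     using close[where i=i and j=j] by (intro AE_I2) (auto simp: indicator_def)
    show "AE z in N. 0 <= e * indicator A z" using e by simp
   qed
   also have "... = e * measure N A" using AN by simp
   finally show ?thesis using e2 by simp
  qed
  have S1: "\<bar>mm_integral \<mu> (%z. indicator A z *\<^sub>R \<Phi> z) - S\<bar> <= tot * e"
  proof -
   have "\<bar>mm_integral \<mu> (%z. indicator A z *\<^sub>R \<Phi> z) - S\<bar> <= (\<Sum>i. \<Sum>j. e * measure (fst (\<mu> i j)) A + e * measure (snd (\<mu> i j)) A)"
    unfolding mm_integral_def S_def sum_subtractf[symmetric]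
   proof (intro order_trans[OF sum_abs] sum_mono)
    fix i j
    have "finite_measure (fst (\<mu> i j))" "sets (fst (\<mu> i j)) = sets X" "finite_measure (snd (\<mu> i j))" "sets (snd (\<mu> i j)) = sets X"
     using mm by (auto simp: is_matrix_measure_def)
    from one[OF this(1,2), of i j] one[OF this(3,4), of i j]
    show "\<bar>(LINT z|fst (\<mu> i j). (indicator A z *\<^sub>R \<Phi> z) $ i $ j) - (LINT z|snd (\<mu> i j). (indicator A z *\<^sub>R \<Phi> z) $ i $ j) -
      ((LINT z|fst (\<mu> i j). (indicator A z *\<^sub>R vl (b z)) $ i $ j) - (LINT z|snd (\<mu> i j). (indicator A z *\<^sub>R vl (b z)) $ i $ j))\<bar>
      <= e * measure (fst (\<mu> i j)) A + e * measure (snd (\<mu> i j)) A" unfolding vector_scaleR_component real_scaleR_def abs_le_iff by linarith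
   qed
   also have "... = tot * e" unfolding tot_def by (simp add: sum_distrib_left distrib_left mult.commute[of _ e])
   finally show ?thesis .
  qed
  have S2: "S = (\<Sum>w\<in>b ` A. vl w \<bullet> mm_value \<mu> (piece w))"
  proof -
   have "S = (\<Sum>i. \<Sum>j. \<Sum>w\<in>b ` A. vl w $ i $ j * mm_value \<mu> (piece w) $ i $ j)" unfolding S_def mm_integral_def
   proof (intro sum.cong refl)
    fix i j
    have "finite_measure (fst (\<mu> i j))" "sets (fst (\<mu> i j)) = sets X" "finite_measure (snd (\<mu> i j))" "sets (snd (\<mu> i j)) = sets X"
     using mm by (auto simp: is_matrix_measure_def)
    from one[OF this(1,2), of i j, THEN conjunct2] one[OF this(3,4), of i j, THEN conjunct2]
    show "(LINT z|fst (\<mu> i j). (indicator A z *\<^sub>R vl (b z)) $ i $ j) - (LINT z|snd (\<mu> i j). (indicator A z *\<^sub>R vl (b z)) $ i $ j)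
      = (\<Sum>w\<in>b ` A. vl w $ i $ j * mm_value \<mu> (piece w) $ i $ j)" by (simp add: mm_value_def sum_subtractf[symmetric] right_diff_distrib)
   qed
   also have "... = (\<Sum>w\<in>b ` A. \<Sum>i. \<Sum>j. vl w $ i $ j * mm_value \<mu> (piece w) $ i $ j)" by (rule sum_swap_innermost)
   finally show ?thesis by (simp add: inner_vec_def)
  qed
  have "\<bar>S\<bar> <= (\<Sum>w\<in>b ` A. norm (vl w) * norm (mm_value \<mu> (piece w)))"
   unfolding S2 by (intro order_trans[OF sum_abs] sum_mono Cauchy_Schwarz_ineq2)
  also have "... <= (\<Sum>w\<in>b ` A. (B + n * n * e) * norm (mm_value \<mu> (piece w)))" using normvl by (intro sum_mono mult_right_mono) auto
  also have "... = (B + n * n * e) * (\<Sum>w\<in>b ` A. norm (mm_value \<mu> (piece w)))" by (simp add: sum_distrib_left)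
  also have "... <= (B + n * n * e) * mm_variation X \<mu> A"
  proof (cases "A = {}")
   case True
   have "mm_value \<mu> {} = 0" by (simp add: mm_value_def vec_eq_iff)
   moreover have "mm_variation X \<mu> {} = 0"
   proof -
    have "P = {}" if "partition_on {} P" for P :: "'a set set" using that by (auto simp: partition_on_def)
    then have "{P :: 'a set set. finite P & partition_on {} P & P \<subseteq> sets X} = {{}}" by (auto simp: partition_on_def)
    then show ?thesis by (simp add: mm_variation_def)
   qed
   ultimately show ?thesis using True by simp
  next
   case False
   then obtain z where "z : A" by blast
   then have "0 <= B + n * n * e" using normvl norm_ge_zero order_trans by blast
   then show ?thesis using var by (rule mult_left_mono[rotated])
  qed
  finally have S3: "\<bar>S\<bar> <= (B + n * n * e) * mm_variation X \<mu> A" .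
  have "\<bar>mm_integral \<mu> (%z. indicator A z *\<^sub>R \<Phi> z)\<bar> <= \<bar>S\<bar> + \<bar>mm_integral \<mu> (%z. indicator A z *\<^sub>R \<Phi> z) - S\<bar>"
   by (simp add: abs_if)
  then show ?thesis using S1 S3 by (meson add_mono order_trans)
 qed
 have lim: "((%e. (B + n * n * e) * mm_variation X \<mu> A + tot * e) \<longlongrightarrow> (B + n * n * 0) * mm_variation X \<mu> A + tot * 0) (at_right 0)"
  by (intro tendsto_intros)
 have "\<bar>mm_integral \<mu> (%z. indicator A z *\<^sub>R \<Phi> z)\<bar> <= (B + n * n * 0) * mm_variation X \<mu> A + tot * 0"
  by (rule tendsto_lowerbound[OF lim]) (use key in \<open>auto simp: eventually_at_right_less intro: eventually_mono[OF eventually_at_right_less]\<close>)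
 then show ?thesis by simp
qed

text \<open>
  The square makes the function continuously differentiable at \<open>\<tau>\<close>.
\<close>
definition bump :: "real => real => real => real" where
 "bump lam \<tau> t = exp (- lam * t) * (max 0 (1 - t / \<tau>) * max 0 (1 - t / \<tau>))"

definition bump' :: "real => real => real => real" where
 "bump' lam \<tau> t = - lam * bump lam \<tau> t - exp (- lam * t) * (2 / \<tau>) * max 0 (1 - t / \<tau>)"

lemma DERIV_max0_square: "((%y. max 0 y * max 0 y) has_real_derivative 2 * max 0 y) (at (y::real))"
proof -
 consider "y > 0" | "y < 0" | "y = 0" by linarith
 then show ?thesis
 proof cases
  case 1
  have "((%y. y * y) has_real_derivative 2 * max 0 y) (at y)" using 1 by (auto intro!: derivative_eq_intros)
  then show ?thesis by (rule has_field_derivative_transform_within_open[of _ _ _ "{0<..}"]) (use 1 in auto)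
 next
  case 2
  have "((%y. 0) has_real_derivative 2 * max 0 y) (at y)" using 2 by simp
  then show ?thesis by (rule has_field_derivative_transform_within_open[of _ _ _ "{..<0}"]) (use 2 in auto)
 next
  case 3
  have "((%h. (max 0 (0 + h) * max 0 (0 + h) - max 0 0 * max 0 0) / h) \<longlongrightarrow> (0::real)) (at 0)"
  proof (rule Lim_null_comparison[where g="%h. \<bar>h\<bar>"])
   show "\<forall>\<^sub>F h in at 0. norm ((max 0 (0 + h) * max 0 (0 + h) - max 0 0 * max 0 0) / h) <= \<bar>h::real\<bar>"
    by (intro always_eventually allI) (auto simp: max_def)
   show "((%h. \<bar>h\<bar>) \<longlongrightarrow> (0::real)) (at 0)" by (rule tendsto_eq_intros refl | simp)+
  qed
  then show ?thesis using 3 by (simp add: DERIV_def)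
 qed
qed

lemma bump_props:
 assumes tau: "\<tau> > 0" and lam: "lam \<ge> 0"
 shows "(bump lam \<tau> has_real_derivative bump' lam \<tau> t) (at t)" "continuous_on UNIV (bump' lam \<tau>)"
  "0 <= bump lam \<tau> t" "t \<ge> \<tau> ==> bump lam \<tau> t = 0" "bump' lam \<tau> t <= 0" "bump lam \<tau> 0 = 1"
  "continuous_on UNIV (bump lam \<tau>)"
  "s <= t ==> bump lam \<tau> t <= bump lam \<tau> s"
  "0 <= t ==> bump lam \<tau> t <= 1"
proof -
 show d: "(bump lam \<tau> has_real_derivative bump' lam \<tau> t) (at t)" for t
 proof -
  have "((%t. max 0 (1 - t / \<tau>) * max 0 (1 - t / \<tau>)) has_real_derivative (2 * max 0 (1 - t / \<tau>)) * (- 1 / \<tau>)) (at t)"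
   by (rule DERIV_chain2[OF DERIV_max0_square]) (use tau in \<open>auto intro!: derivative_eq_intros\<close>)
  moreover have "((%t. exp (- lam * t)) has_real_derivative (- lam * exp (- lam * t))) (at t)" by (auto intro!: derivative_eq_intros)
  ultimately have "((%t. exp (- lam * t) * (max 0 (1 - t / \<tau>) * max 0 (1 - t / \<tau>))) has_real_derivative
    (- lam * exp (- lam * t)) * (max 0 (1 - t / \<tau>) * max 0 (1 - t / \<tau>)) + ((2 * max 0 (1 - t / \<tau>)) * (- 1 / \<tau>)) * exp (- lam * t)) (at t)"
   by (rule DERIV_mult[rotated])
  then show ?thesis unfolding bump_def[abs_def] bump'_def by (rule DERIV_cong) (simp add: bump_def)
 qed
 show c: "continuous_on UNIV (bump lam \<tau>)" using d by (meson DERIV_isCont continuous_at_imp_continuous_on)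
 show "continuous_on UNIV (bump' lam \<tau>)" unfolding bump'_def by (intro continuous_intros c) (use tau in auto)
 show n: "0 <= bump lam \<tau> t" for t by (simp add: bump_def)
 show "t \<ge> \<tau> ==> bump lam \<tau> t = 0" using tau by (simp add: bump_def)
 show np: "bump' lam \<tau> t <= 0" for t
 proof -
  have "0 <= lam * bump lam \<tau> t" using lam n by simp
  moreover have "0 <= exp (- lam * t) * (2 / \<tau>) * max 0 (1 - t / \<tau>)" using tau by simp
  ultimately show ?thesis by (simp add: bump'_def)
 qed
 show b0: "bump lam \<tau> 0 = 1" by (simp add: bump_def)
 show mono: "s <= t ==> bump lam \<tau> t <= bump lam \<tau> s" for s t by (rule DERIV_nonpos_imp_nonincreasing) (use d np in blast)+
 show "0 <= t ==> bump lam \<tau> t <= 1" using mono[of 0 t] b0 by simp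
qed

lemma step_sum_value:
 fixes a :: "nat => real"
 assumes "!!k. k < n ==> P k \<longleftrightarrow> j <= k" "j <= n" "a n = 0" shows "(\<Sum>k<n. (a k - a (Suc k)) * of_bool (P k)) = a j"
proof -
 have "(\<Sum>k<n. (a k - a (Suc k)) * of_bool (P k)) = (\<Sum>k\<in>{j..<n}. a k - a (Suc k))" using assms by (intro sum.mono_neutral_cong_right) auto
 also have "... = a j" using sum_Suc_diff'[OF assms(2), of "%k. - a k"] assms(3) by simp
 finally show ?thesis .
qed

text \<open>
  The condition \<open>P n k\<close> stands for \<open>t \<le> t\<^sub>k\<^sub>+\<^sub>1\<close> or for the strict inequality: the variation is bounded on closed
  time intervals, the energy defect is integrated over open ones.
\<close>
lemma step_sum_tendsto:
 fixes \<psi> :: "real => real" and P :: "nat => nat => bool"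
 assumes c: "continuous_on UNIV \<psi>" and mono: "!!s t. s <= t ==> \<psi> t <= \<psi> s" and z: "!!t. t \<ge> \<tau> ==> \<psi> t = 0"
  and tau: "\<tau> > 0" and t: "t \<ge> 0" and P: "!!n k k'. P n k ==> k <= k' ==> P n k'"
   "!!n k. P n k ==> t <= real (Suc k) * \<tau> / real (Suc n)" "!!n k. ~ P n k ==> real (Suc k) * \<tau> / real (Suc n) <= t"
 shows "(%n. \<Sum>k<Suc n. (\<psi> (real k * \<tau> / real (Suc n)) - \<psi> (real (Suc k) * \<tau> / real (Suc n))) * of_bool (P n k)) \<longlonglongrightarrow> \<psi> t"
  and "\<bar>\<Sum>k<Suc n. (\<psi> (real k * \<tau> / real (Suc n)) - \<psi> (real (Suc k) * \<tau> / real (Suc n))) * of_bool (P n k)\<bar> <= \<psi> 0"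
proof -
 define j where "j = (%n. LEAST j. j = Suc n | P n j)"
 define q where "q = (%n. real (j n) * \<tau> / real (Suc n))"
 have j1: "j n = Suc n | P n (j n)" for n unfolding j_def by (rule LeastI_ex) blast
 have j2: "j n <= Suc n" for n unfolding j_def by (rule Least_le) simp
 have j3: "j n <= k" if "k = Suc n | P n k" for n k unfolding j_def by (rule Least_le) (rule that)
 have val: "(\<Sum>k<Suc n. (\<psi> (real k * \<tau> / real (Suc n)) - \<psi> (real (Suc k) * \<tau> / real (Suc n))) * of_bool (P n k)) = \<psi> (q n)" for n
  unfolding q_def
 proof (rule step_sum_value[OF _ j2])
  show "P n k \<longleftrightarrow> j n <= k" if "k < Suc n" for k using j1[of n] j3[of k n] P(1)[of n "j n" k] that by auto
  show "\<psi> (real (Suc n) * \<tau> / real (Suc n)) = 0" by (rule z) simp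
 qed
 have lo: "q n <= min t \<tau>" for n
 proof -
  have "q n <= t"
  proof (cases "j n")
   case (Suc i)
   then have "~ P n i" using j3[of i n] by auto
   from P(3)[OF this] show ?thesis unfolding q_def Suc .
  qed (simp add: q_def t)
  moreover have "real (j n) * \<tau> <= real (Suc n) * \<tau>" using j2[of n] tau by (intro mult_right_mono) auto
  then have "q n <= \<tau>" unfolding q_def by (simp add: pos_divide_le_eq mult.commute)
  ultimately show ?thesis by simp
 qed
 have hi: "min t \<tau> <= q n + \<tau> / real (Suc n)" for n using j1[of n]
 proof
  assume "j n = Suc n" then have "q n = \<tau>" unfolding q_def by simp
  then show ?thesis using tau by (simp add: min.coboundedI2)
 next
  assume "P n (j n)"
  from P(2)[OF this] have "t <= q n + \<tau> / real (Suc n)" unfolding q_def by (simp add: add_divide_distrib distrib_right)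
  then show ?thesis by simp
 qed
 have "(%n. min t \<tau> - \<tau> / real (Suc n)) \<longlonglongrightarrow> min t \<tau> - 0" by (intro tendsto_intros LIMSEQ_Suc[OF lim_const_over_n])
 then have "(%n. min t \<tau> - \<tau> / real (Suc n)) \<longlonglongrightarrow> min t \<tau>" by simp
 then have ql: "q \<longlonglongrightarrow> min t \<tau>"
 proof (rule tendsto_sandwich[rotated 2, where h="%n. min t \<tau>"])
  have "min t \<tau> - \<tau> / real (Suc n) <= q n" for n using hi[of n] by linarith
  then show "\<forall>\<^sub>F n in sequentially. min t \<tau> - \<tau> / real (Suc n) <= q n" by (rule always_eventually[OF allI])
 qed (use lo in auto)
 have "isCont \<psi> (min t \<tau>)" using c by (simp add: continuous_on_eq_continuous_at)
 from isCont_tendsto_compose[OF this ql] have "(%n. \<psi> (q n)) \<longlonglongrightarrow> \<psi> (min t \<tau>)" .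
 moreover have "\<psi> (min t \<tau>) = \<psi> t" using z[of t] z[of \<tau>] by (simp add: min_def)
 ultimately show "(%n. \<Sum>k<Suc n. (\<psi> (real k * \<tau> / real (Suc n)) - \<psi> (real (Suc k) * \<tau> / real (Suc n))) * of_bool (P n k)) \<longlonglongrightarrow> \<psi> t"
  unfolding val by simp
 have "0 <= q n" unfolding q_def using tau by simp
 moreover have "0 <= \<psi> (q n)" using z[of "max (q n) \<tau>"] mono[of "q n" "max (q n) \<tau>"] by simp
 ultimately show "\<bar>\<Sum>k<Suc n. (\<psi> (real k * \<tau> / real (Suc n)) - \<psi> (real (Suc k) * \<tau> / real (Suc n))) * of_bool (P n k)\<bar> <= \<psi> 0"
  unfolding val using mono[of 0 "q n"] by simp
qed

lemma integral_st_restrict: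
 fixes d :: "real \<times> (real^'n) => real"
 assumes "\<tau> <= T" shows "integral_st \<tau> (%t x. d (t, x)) = (LINT z|spacetime T. of_bool (fst z < \<tau>) * d z)"
proof -
 have s: "{0<..<t} \<times> (torus :: (real^'n) set) : sets lebesgue" for t :: real using spacetime_set_borel[of t] by (metis sets_completionI_sets sets_lborel)
 have "integral_st \<tau> (%t x. d (t, x)) = (LINT z|lebesgue. (if z : {0<..<\<tau>} \<times> torus then d z else 0))"
  unfolding integral_st_def spacetime_def by (simp add: Lebesgue_Measure.integral_restrict_UNIV[OF s])
 also have "... = (LINT z|lebesgue. (if z : {0<..<T} \<times> torus then of_bool (fst z < \<tau>) * d z else 0))" using assms by (intro lint_cong) auto
 also have "... = (LINT z|spacetime T. of_bool (fst z < \<tau>) * d z)" unfolding spacetime_def by (rule Lebesgue_Measure.integral_restrict_UNIV[OF s])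
 finally show ?thesis .
qed

text \<open>
  The variation is bounded only on \<open>[0, \<tau>']\<close>, for every \<open>\<tau>'\<close>. A decreasing weight is a limit of
  nonnegative combinations of indicators of such intervals.
\<close>
lemma weighted_concentration_bound:
 fixes \<mu> :: "('n::finite, real \<times> (real^'n)) matrix_measure" and d :: "real \<times> (real^'n) => real" and T \<tau> B cc :: real
 defines "X \<equiv> restrict_space borel ({0..T} \<times> torus) :: (real \<times> (real^'n)) measure"
 assumes mm: "is_matrix_measure X \<mu>"
  and c: "continuous_on UNIV \<psi>" and mono: "!!s t. s <= t ==> \<psi> t <= \<psi> s" and z0: "!!t. t \<ge> \<tau> ==> \<psi> t = 0"
  and tau: "0 < \<tau>" "\<tau> < T" and Jm: "!!i j. (%z. J z $ i $ j) : borel_measurable X" and Jb: "!!z. z : space X ==> norm (J z) <= B" and B: "B \<ge> 0"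
  and d: "integrable (spacetime T) d"
  and var: "!!\<tau>'. 0 <= \<tau>' ==> \<tau>' < T ==> mm_variation X \<mu> ({0..\<tau>'} \<times> torus) <= cc * integral_st \<tau>' (%t x. d (t, x))"
 shows "\<bar>mm_integral \<mu> (%z. \<psi> (fst z) *\<^sub>R J z)\<bar> <= B * cc * (LINT z|spacetime T. \<psi> (fst z) * d z)"
proof -
 define pt where "pt = (%n k. real k * \<tau> / real (Suc n))"
 define w where "w = (%n k. \<psi> (pt n k) - \<psi> (pt n (Suc k)))"
 have w0: "w n k \<ge> 0" for n k unfolding w_def pt_def
  using mono[of "real k * \<tau> / real (Suc n)" "real (Suc k) * \<tau> / real (Suc n)"] tau by (simp add: divide_right_mono mult_right_mono)
 have ptm: "pt n k <= pt n k'" if "k <= k'" for n k k' unfolding pt_def using tau that by (intro divide_right_mono mult_right_mono) auto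
 have ptT: "0 <= pt n (Suc k)" "pt n (Suc k) < T" if "k < Suc n" for n k
 proof -
  have "pt n (Suc k) <= pt n (Suc n)" by (rule ptm) (use that in simp)
  also have "... = \<tau>" by (simp add: pt_def)
  finally show "pt n (Suc k) < T" using tau by simp
  show "0 <= pt n (Suc k)" unfolding pt_def using tau by simp
 qed
 define S where "S = (%n t. \<Sum>k<Suc n. w n k * of_bool (t <= pt n (Suc k)))"
 define S' where "S' = (%n t. \<Sum>k<Suc n. w n k * of_bool (t < pt n (Suc k)))"
 have pm: "real (Suc k) * \<tau> / real (Suc n) <= real (Suc k') * \<tau> / real (Suc n)" if "k <= k'" for n k k'
  using ptm[of "Suc k" "Suc k'" n] that by (simp add: pt_def)
 have S: "(%n. S n t) \<longlonglongrightarrow> \<psi> t" "\<bar>S n t\<bar> <= \<psi> 0" if "t \<ge> 0" for t n unfolding S_def w_def pt_def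
   apply (rule step_sum_tendsto(1)[where P="%n k. t <= real (Suc k) * \<tau> / real (Suc n)" and \<tau>=\<tau>], rule c, erule mono, erule z0, rule tau(1), rule that, erule (1) order_trans[OF _ pm], assumption, simp)
  apply (rule step_sum_tendsto(2)[where P="%n k. t <= real (Suc k) * \<tau> / real (Suc n)" and \<tau>=\<tau>], rule c, erule mono, erule z0, rule tau(1), rule that, erule (1) order_trans[OF _ pm], assumption, simp)
  done
 have S': "(%n. S' n t) \<longlonglongrightarrow> \<psi> t" "\<bar>S' n t\<bar> <= \<psi> 0" if "t \<ge> 0" for t n unfolding S'_def w_def pt_def
   apply (rule step_sum_tendsto(1)[where P="%n k. t < real (Suc k) * \<tau> / real (Suc n)" and \<tau>=\<tau>], rule c, erule mono, erule z0, rule tau(1), rule that, erule (1) less_le_trans[OF _ pm], erule less_imp_le, simp)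
  apply (rule step_sum_tendsto(2)[where P="%n k. t < real (Suc k) * \<tau> / real (Suc n)" and \<tau>=\<tau>], rule c, erule mono, erule z0, rule tau(1), rule that, erule (1) less_le_trans[OF _ pm], erule less_imp_le, simp)
  done
 have spX: "space X = {0..T} \<times> torus" by (simp add: X_def space_restrict_space)
 define A where "A = (%n k. {0..pt n (Suc k)} \<times> (torus :: (real^'n) set))"
 have AX: "A n k : sets X" if "k < Suc n" for n k
 proof -
  have b: "A n k : sets borel" unfolding A_def using torus_borel by (metis borel_prod pair_measureI borel_closed closed_atLeastAtMost)
  have "A n k = ({0..T} \<times> torus) \<inter> A n k" using ptT[OF that] unfolding A_def by force
  then show ?thesis unfolding X_def sets_restrict_space using b by (rule image_eqI)
 qed
 have N: "finite_measure (fst (\<mu> i j))" "sets (fst (\<mu> i j)) = sets X" "finite_measure (snd (\<mu> i j))" "sets (snd (\<mu> i j)) = sets X" for i j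
  using mm by (auto simp: is_matrix_measure_def)
 have entry: "\<bar>J z $ i $ j\<bar> <= B" if "z : space X" for z i j
  using Jb[OF that] component_le_norm_cart[of "J z $ i" j] Finite_Cartesian_Product.norm_nth_le[of "J z" i] by linarith
 have fac: "integrable N (%z. (indicator (A n k) z *\<^sub>R J z) $ i $ j)" if N: "finite_measure N" "sets N = sets X" and k: "k < Suc n" for N n k i j
 proof -
  interpret finite_measure N by fact
  have "(%z. J z $ i $ j) : borel_measurable N" "A n k : sets N" using Jm[of i j] N AX[OF k] by (simp_all cong: measurable_cong_sets)
  then have "(%z. (indicator (A n k) z *\<^sub>R J z) $ i $ j) : borel_measurable N" by simp
  then show ?thesis
   by (rule integrable_const_bound[of _ B, rotated]) (use entry B sets_eq_imp_space_eq[OF N(2)] in \<open>auto simp: indicator_def intro!: AE_I2\<close>)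
 qed
 have Sind: "S n (fst z) * y = (\<Sum>k<Suc n. w n k * (indicator (A n k) z * y))" if "z : space X" for z n y
 proof -
  have "S n (fst z) = (\<Sum>k<Suc n. w n k * indicator (A n k) z)" unfolding S_def using that spX by (intro sum.cong refl) (auto simp: A_def indicator_def)
  then show ?thesis by (simp only: sum_distrib_right mult.assoc)
 qed
 have one: "(LINT z|N. (S n (fst z) *\<^sub>R J z) $ i $ j) = (\<Sum>k<Suc n. w n k * (LINT z|N. (indicator (A n k) z *\<^sub>R J z) $ i $ j))"
  if N: "finite_measure N" "sets N = sets X" for N n i j
 proof -
  have "(LINT z|N. (S n (fst z) *\<^sub>R J z) $ i $ j) = (LINT z|N. (\<Sum>k<Suc n. w n k * (indicator (A n k) z *\<^sub>R J z) $ i $ j))"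
   using Sind sets_eq_imp_space_eq[OF N(2)] by (intro lint_cong refl) (simp add: mult.assoc)
  also have "... = (\<Sum>k<Suc n. (LINT z|N. w n k * (indicator (A n k) z *\<^sub>R J z) $ i $ j))" by (rule lint_sum) (use fac[OF N] in simp)
  finally show ?thesis by simp
 qed
 have two: "(%n. LINT z|N. (S n (fst z) *\<^sub>R J z) $ i $ j) \<longlonglongrightarrow> (LINT z|N. (\<psi> (fst z) *\<^sub>R J z) $ i $ j)"
  if N: "finite_measure N" "sets N = sets X" for N i j
 proof (rule integral_dominated_convergence[where w="%z. \<psi> 0 * B"])
  interpret finite_measure N by fact
  note sp = sets_eq_imp_space_eq[OF N(2)]
  have Jn: "(%z. J z $ i $ j) : borel_measurable N" using Jm[of i j] N by (simp cong: measurable_cong_sets)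
  show "integrable N (%z. \<psi> 0 * B)" by simp
  have "(%z. (\<Sum>k<Suc n. w n k * (indicator (A n k) z *\<^sub>R J z) $ i $ j)) : borel_measurable N" for n
   using fac[OF N] by (intro borel_measurable_sum borel_measurable_times borel_measurable_const borel_measurable_integrable) auto
  moreover have "(\<Sum>k<Suc n. w n k * (indicator (A n k) z *\<^sub>R J z) $ i $ j) = (S n (fst z) *\<^sub>R J z) $ i $ j" if "z : space N" for n z
   using Sind that sp by (simp add: mult.assoc)
  ultimately show m: "(%z. (S n (fst z) *\<^sub>R J z) $ i $ j) : borel_measurable N" for n by (subst measurable_cong[symmetric]) (assumption | blast)+
  show l: "AE z in N. (%n. (S n (fst z) *\<^sub>R J z) $ i $ j) \<longlonglongrightarrow> (\<psi> (fst z) *\<^sub>R J z) $ i $ j"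
   using S(1) sp spX by (intro AE_I2) (auto intro!: tendsto_intros)
  show "AE z in N. norm ((S n (fst z) *\<^sub>R J z) $ i $ j) <= \<psi> 0 * B" for n
  proof (rule AE_I2)
   fix z assume "z : space N"
   then have "z : space X" "0 <= fst z" using sp spX by auto
   then show "norm ((S n (fst z) *\<^sub>R J z) $ i $ j) <= \<psi> 0 * B"
    using mult_mono[OF S(2)[of "fst z" n] entry[of z i j]] S(2)[of "fst z" n] abs_ge_zero[of "S n (fst z)"] by (simp add: abs_mult)
  qed
  show "(%z. (\<psi> (fst z) *\<^sub>R J z) $ i $ j) : borel_measurable N"
  proof -
   have "(%z. \<psi> (fst z)) : borel_measurable (borel :: (real \<times> (real^'n)) measure)"
    by (intro borel_measurable_continuous_onI continuous_on_compose2[OF c]) (auto intro!: continuous_intros)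
   then have "(%z. \<psi> (fst z)) : borel_measurable X" unfolding X_def by (rule measurable_restrict_space1)
   then have "(%z. \<psi> (fst z)) : borel_measurable N" using N by (simp cong: measurable_cong_sets)
   then show ?thesis using Jn by simp
  qed
 qed
 have cut: "integrable (spacetime T) (%z. of_bool (fst z < s) * d z)" for s
 proof (rule lint_bound[OF d])
  have "(%t::real. of_bool (t < s) :: real) : borel_measurable borel" by measurable
  then have "(%z :: real \<times> (real^'n). of_bool (fst z < s) :: real) : borel_measurable borel"
   by (rule measurable_compose[rotated]) (simp add: borel_prod[symmetric])
  then have "(%z :: real \<times> (real^'n). of_bool (fst z < s) :: real) : borel_measurable (spacetime T)"
   unfolding spacetime_def by (intro measurable_lebesgue_on_borel measurable_restrict_space1)
  then show "(%z. of_bool (fst z < s) * d z) : borel_measurable (spacetime T)" using d by simp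
 qed (auto intro!: AE_I2)
 have L1: "(%n. mm_integral \<mu> (%z. S n (fst z) *\<^sub>R J z)) \<longlonglongrightarrow> mm_integral \<mu> (%z. \<psi> (fst z) *\<^sub>R J z)"
  unfolding mm_integral_def by (intro tendsto_sum tendsto_diff two N)
 have bnd: "\<bar>mm_integral \<mu> (%z. S n (fst z) *\<^sub>R J z)\<bar> <= B * cc * (LINT z|spacetime T. S' n (fst z) * d z)" for n
 proof -
  have "mm_integral \<mu> (%z. S n (fst z) *\<^sub>R J z) = (\<Sum>i. \<Sum>j. \<Sum>k<Suc n. w n k * ((LINT z|fst (\<mu> i j). (indicator (A n k) z *\<^sub>R J z) $ i $ j) - (LINT z|snd (\<mu> i j). (indicator (A n k) z *\<^sub>R J z) $ i $ j)))"
   unfolding mm_integral_def by (intro sum.cong refl) (simp only: one[OF N(1,2)] one[OF N(3,4)] sum_subtractf[symmetric] right_diff_distrib)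
  also have "... = (\<Sum>k<Suc n. \<Sum>i. \<Sum>j. w n k * ((LINT z|fst (\<mu> i j). (indicator (A n k) z *\<^sub>R J z) $ i $ j) - (LINT z|snd (\<mu> i j). (indicator (A n k) z *\<^sub>R J z) $ i $ j)))"
   by (rule sum_swap_innermost)
  also have "... = (\<Sum>k<Suc n. w n k * mm_integral \<mu> (%z. indicator (A n k) z *\<^sub>R J z))" unfolding mm_integral_def sum_distrib_left ..
  finally have "\<bar>mm_integral \<mu> (%z. S n (fst z) *\<^sub>R J z)\<bar> <= (\<Sum>k<Suc n. \<bar>w n k * mm_integral \<mu> (%z. indicator (A n k) z *\<^sub>R J z)\<bar>)"
   by (simp only: sum_abs)
  also have "... <= (\<Sum>k<Suc n. w n k * (B * (cc * (LINT z|spacetime T. of_bool (fst z < pt n (Suc k)) * d z))))"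
  proof (rule sum_mono)
   fix k assume "k : {..<Suc n}"
   then have k: "k < Suc n" by simp
   have "\<bar>mm_integral \<mu> (%z. indicator (A n k) z *\<^sub>R J z)\<bar> <= B * mm_variation X \<mu> (A n k)"
    by (rule mm_integral_indicator_bound[OF mm AX[OF k] Jm Jb]) (use sets.sets_into_space[OF AX[OF k]] in blast)
   also have "... <= B * (cc * integral_st (pt n (Suc k)) (%t x. d (t, x)))" unfolding A_def by (rule mult_left_mono[OF var[OF ptT[OF k]] B])
   also have "integral_st (pt n (Suc k)) (%t x. d (t, x)) = (LINT z|spacetime T. of_bool (fst z < pt n (Suc k)) * d z)"
    by (rule integral_st_restrict) (use ptT(2)[OF k] in simp)
   finally show "\<bar>w n k * mm_integral \<mu> (%z. indicator (A n k) z *\<^sub>R J z)\<bar> <= w n k * (B * (cc * (LINT z|spacetime T. of_bool (fst z < pt n (Suc k)) * d z)))"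
    unfolding abs_mult abs_of_nonneg[OF w0] by (rule mult_left_mono[OF _ w0])
  qed
  also have "... = B * cc * (\<Sum>k<Suc n. w n k * (LINT z|spacetime T. of_bool (fst z < pt n (Suc k)) * d z))" by (simp only: sum_distrib_left mult_ac)
  also have "... = B * cc * (\<Sum>k<Suc n. (LINT z|spacetime T. w n k * (of_bool (fst z < pt n (Suc k)) * d z)))" by (simp only: integral_mult_right_zero)
  also have "(\<Sum>k<Suc n. (LINT z|spacetime T. w n k * (of_bool (fst z < pt n (Suc k)) * d z)))
    = (LINT z|spacetime T. (\<Sum>k<Suc n. w n k * (of_bool (fst z < pt n (Suc k)) * d z)))" by (rule lint_sum[symmetric]) (intro integrable_mult_right cut)
  also have "(%z. (\<Sum>k<Suc n. w n k * (of_bool (fst z < pt n (Suc k)) * d z))) = (%z. S' n (fst z) * d z)" unfolding S'_def sum_distrib_right mult.assoc ..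
  finally show ?thesis .
 qed
 have L2: "(%n. LINT z|spacetime T. S' n (fst z) * d z) \<longlonglongrightarrow> (LINT z|spacetime T. \<psi> (fst z) * d z)"
 proof (rule integral_dominated_convergence[where w="%z. \<psi> 0 * \<bar>d z\<bar>"])
  show "(%z. \<psi> (fst z) * d z) : borel_measurable (spacetime T)"
  proof (rule borel_measurable_times)
   show "(%z. \<psi> (fst z)) : borel_measurable (spacetime T)"
    by (intro measurable_spacetime_continuous continuous_on_compose2[OF c]) (auto intro!: continuous_intros)
  qed (use d in simp)
  show "(%z. S' n (fst z) * d z) : borel_measurable (spacetime T)" for n unfolding S'_def sum_distrib_right mult.assoc
   by (intro borel_measurable_sum borel_measurable_integrable integrable_mult_right cut)
  show "AE z in spacetime T. (%n. S' n (fst z) * d z) \<longlonglongrightarrow> \<psi> (fst z) * d z"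
   using S'(1) by (intro AE_I2) (auto simp: space_spacetime intro!: tendsto_intros)
  show "AE z in spacetime T. norm (S' n (fst z) * d z) <= \<psi> 0 * \<bar>d z\<bar>" for n
   using S'(2) by (intro AE_I2) (auto simp: space_spacetime abs_mult intro!: mult_right_mono)
 qed (use d in simp)
 show ?thesis by (rule LIMSEQ_le[OF tendsto_rabs[OF L1] tendsto_mult[OF tendsto_const L2]]) (use bnd in blast)
qed

lemma C1_on_bump: "[|\<tau> > 0; lam \<ge> 0|] ==> C1_on S (%z :: real \<times> (real^'n). bump lam \<tau> (fst z))"
proof (rule C1_on_compose_real[where h'="bump' lam \<tau>" and f=fst])
 show "C1_on S (fst :: real \<times> (real^'n) => real)" unfolding C1_on_def
  by (rule exI[of _ "%z. Blinfun fst"]) (auto simp: bounded_linear_Blinfun_apply[OF bounded_linear_fst] intro: derivative_eq_intros)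
qed (auto intro: bump_props continuous_on_subset[OF bump_props(2)])

lemma bump_mult_strip:
 fixes w :: "real => real^'n => 'b::real_normed_vector"
 assumes tl: "\<tau> > 0" "lam \<ge> 0" and w: "C1_strip T w" shows "C1_strip T (%t x. bump lam \<tau> t *\<^sub>R w t x)"
  and "t : {0<..<T} ==> dt (%t x. bump lam \<tau> t *\<^sub>R w t x) t x = bump' lam \<tau> t *\<^sub>R w t x + bump lam \<tau> t *\<^sub>R dt w t x"
  and "t : {0..T} ==> pd j (%x. bump lam \<tau> t *\<^sub>R w t x) x = bump lam \<tau> t *\<^sub>R pd j (w t) x"
proof -
 show "C1_strip T (%t x. bump lam \<tau> t *\<^sub>R w t x)" using C1_on_scaleR[OF C1_on_bump[OF tl] w] by (simp add: case_prod_beta')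
 obtain ft fx where p: "!!t x. t : {0<..<T} ==> ((%r. w r x) has_vector_derivative ft (t, x)) (at t)"
  "!!t x. t : {0<..<T} ==> dt w t x = ft (t, x)" using C1_strip_partials[OF w] by metis
 show "dt (%t x. bump lam \<tau> t *\<^sub>R w t x) t x = bump' lam \<tau> t *\<^sub>R w t x + bump lam \<tau> t *\<^sub>R dt w t x" if "t : {0<..<T}"
  unfolding p(2)[OF that] unfolding dt_def
  using has_vector_derivative_scaleR[OF bump_props(1)[OF tl] p(1)[OF that]] by (simp add: vector_derivative_at add.commute)
 show "pd j (%x. bump lam \<tau> t *\<^sub>R w t x) x = bump lam \<tau> t *\<^sub>R pd j (w t) x" if "t : {0..T}"
 proof -
  have "(w t has_derivative frechet_derivative (w t) (at x)) (at x)" using C1_strip_differentiable[OF w that] by (simp add: frechet_derivative_works)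
  from frechet_derivative_at[OF has_derivative_scaleR_right[OF this, of "bump lam \<tau> t"]]
  show ?thesis by (simp add: pd_def fun_eq_iff)
 qed
qed

lemma bump_test_fun:
 fixes w :: "real => real^'n => 'b::real_normed_vector"
 assumes tl: "0 < \<tau>" "\<tau> < T" "lam \<ge> 0" and w: "C1_strip T w" and per: "!!t. t : {0..T} ==> periodic (w t)"
 shows "test_fun T (%t x. bump lam \<tau> t *\<^sub>R w t x)" unfolding test_fun_def
proof (intro conjI ballI exI[of _ \<tau>] allI impI)
 show "C1_on ({0..<T} \<times> UNIV) (%(t, x). bump lam \<tau> t *\<^sub>R w t x)" by (rule C1_on_subset[OF bump_mult_strip(1)[OF tl(1,3) w]]) auto
 show "periodic (%x. bump lam \<tau> t *\<^sub>R w t x)" if "t : {0..<T}" for t using per[of t] that by (simp add: periodic_def)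
qed (use tl bump_props(4) in auto)

lemma bump_time_identity:
 fixes w :: "real => real^'n => real"
 assumes tl: "0 < \<tau>" "\<tau> < T" "lam \<ge> 0" and w: "C1_strip T w"
 shows "(LINT z|spacetime T. bump' lam \<tau> (fst z) * w (fst z) (snd z) + bump lam \<tau> (fst z) * par None w (fst z) (snd z)) = - (LINT x|\<Omega>. w 0 x)"
proof -
 have "integral_st T (dt (%t x. bump lam \<tau> t *\<^sub>R w t x)) = (LINT x|\<Omega>. bump lam \<tau> T *\<^sub>R w T x - bump lam \<tau> 0 *\<^sub>R w 0 x)"
  by (rule spacetime_time_derivative[OF _ bump_mult_strip(1)[OF tl(1,3) w]]) (use tl in simp)
 moreover have "integral_st T (dt (%t x. bump lam \<tau> t *\<^sub>R w t x)) = (LINT z|spacetime T. bump' lam \<tau> (fst z) * w (fst z) (snd z) + bump lam \<tau> (fst z) * par None w (fst z) (snd z))"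
  unfolding integral_st_def by (intro lint_cong refl) (auto simp: space_spacetime bump_mult_strip(2)[OF tl(1,3) w, unfolded real_scaleR_def] par_def)
 ultimately show ?thesis using bump_props(4,6)[of \<tau> lam] tl by simp
qed

lemma spatial_derivative_integral_zero:
 fixes f :: "real => real^'n => real"
 assumes c: "continuous_on UNIV \<psi>" and f: "C1_strip T f" and per: "!!t. t : {0..T} ==> periodic (f t)"
 shows "integrable (spacetime T) (%z. \<psi> (fst z) * par (Some s) f (fst z) (snd z))"
  and "(LINT z|spacetime T. \<psi> (fst z) * par (Some s) f (fst z) (snd z)) = 0"
proof -
 obtain ft fx where p: "!!j. continuous_on (strip T) (fx j)"
  "!!t x j. t : {0..T} ==> pd j (f t) x = fx j (t, x)" using C1_strip_partials[OF f] by metis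
 have "integrable (spacetime T) (%z. \<psi> (fst z) * fx s z)" by (intro bounded_integrable_spacetime continuous_intros p continuous_on_compose2[OF c]) auto
 then show i: "integrable (spacetime T) (%z. \<psi> (fst z) * par (Some s) f (fst z) (snd z))"
  by (rule Bochner_Integration.integrable_cong[THEN iffD1, rotated 2]) (auto simp: space_spacetime par_def p(2))
 have "(LINT z|spacetime T. \<psi> (fst z) * par (Some s) f (fst z) (snd z))
   = (LINT t|lebesgue_on {0<..<T}. LINT x|\<Omega>. \<psi> t * pd s (f t) x)"
  unfolding spacetime_def using Fubini_lebesgue_on[OF torus_lebesgue_sets i[unfolded spacetime_def]] by (simp add: par_def)
 also have "... = (LINT t|lebesgue_on {0<..<T}. 0)"
 proof (intro lint_cong refl)
  fix t assume "t : space (lebesgue_on {0<..<T})"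
  then have t: "t : {0..T}" by simp
  have cf: "continuous_on UNIV (f t)" using C1_strip_differentiable[OF f t] differentiable_imp_continuous_within by (metis continuous_at_imp_continuous_on)
  have "continuous_on UNIV (pd s (f t))"
   unfolding p(2)[OF t, abs_def] by (rule continuous_on_compose2[OF p(1)]) (use t in \<open>auto intro!: continuous_intros\<close>)
  from torus_integral_derivative_zero[OF cf per[OF t] C1_strip_differentiable[OF f t] this]
  show "(LINT x|\<Omega>. \<psi> t * pd s (f t) x) = 0" by simp
 qed
 finally show "(LINT z|spacetime T. \<psi> (fst z) * par (Some s) f (fst z) (snd z)) = 0" by simp
qed

section \<open>Pointwise estimates for the relative energy\<close>

text \<open>
  Taylor's formula with remainder.
\<close>
lemma exp_quadratic_lower: "x^2 / 2 * exp (- \<bar>x\<bar>) <= exp x - 1 - (x::real)"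
proof -
 obtain t where t: "\<bar>t\<bar> <= \<bar>x\<bar>" "exp x = (\<Sum>m<2. x ^ m / fact m) + exp t / fact 2 * x ^ 2" using Maclaurin_exp_le[of x 2] by blast
 have "exp x - 1 - x = x^2 / 2 * exp t" unfolding t(2) by (simp add: lessThan_nat_numeral numeral_2_eq_2 fact_numeral)
 moreover have "x^2 / 2 * exp (- \<bar>x\<bar>) <= x^2 / 2 * exp t" using t(1) by (intro mult_left_mono) auto
 ultimately show ?thesis by simp
qed

text \<open>
  In the variables \<open>r = R/r0\<close> and \<open>x = (k - s0)(\<gamma>-1)/\<gamma>\<close>, \<open>e\<close> is at least \<open>p0/(\<gamma>-1)\<close> times the \<open>\<gamma>\<close>-th
  power of \<open>r exp x\<close>, and \<open>bernoulli_powr\<close> applies to it.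
\<close>
lemma thermal_energy_lower_exp:
 fixes \<gamma> R r0 p0 e s s0 k :: real
 assumes g: "\<gamma> > 1" and pos: "R > 0" "r0 > 0" "p0 > 0" "e > 0" and s: "k <= 1 / (\<gamma> - 1) * ln ((\<gamma> - 1) * e / R powr \<gamma>)"
  and s0: "s0 = (ln p0 - \<gamma> * ln r0) * (1 / (\<gamma> - 1))"
 shows "p0 / (\<gamma> - 1) * (\<gamma> * (R / r0) * (exp ((k - s0) * (\<gamma> - 1) / \<gamma>) - 1 - (k - s0) * (\<gamma> - 1) / \<gamma>))
   <= e + R * (p0 / r0) * (s0 - k) - \<gamma> / (\<gamma> - 1) * (R * (p0 / r0)) + p0"
proof -
 define x where "x = (k - s0) * (\<gamma> - 1) / \<gamma>"
 define y where "y = R / r0 * exp x"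
 have g1: "\<gamma> - 1 > 0" using g by simp
 have y: "y > 0" using pos by (simp add: y_def)
 have "ln (p0 / (\<gamma> - 1) * y powr \<gamma>) <= ln e"
 proof -
  have "ln (p0 / (\<gamma> - 1) * y powr \<gamma>) = ln p0 - ln (\<gamma> - 1) + \<gamma> * (ln R - ln r0 + x)"
   using pos g1 y by (simp add: ln_mult ln_div ln_powr y_def)
  also have "\<gamma> * (ln R - ln r0 + x) = \<gamma> * ln R - \<gamma> * ln r0 + (k - s0) * (\<gamma> - 1)"
  proof -
   have "\<gamma> * x = (k - s0) * (\<gamma> - 1)" using g by (simp add: x_def)
   then show ?thesis by (simp only: distrib_left right_diff_distrib)
  qed
  also have "(k - s0) * (\<gamma> - 1) = k * (\<gamma> - 1) - (ln p0 - \<gamma> * ln r0)"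
  proof -
   have "s0 * (\<gamma> - 1) = ln p0 - \<gamma> * ln r0" unfolding s0 using g1 by simp
   then show ?thesis by (simp only: left_diff_distrib)
  qed
  also have "k * (\<gamma> - 1) <= ln (\<gamma> - 1) + ln e - \<gamma> * ln R"
   using mult_right_mono[OF s, of "\<gamma> - 1"] g1 pos by (simp add: ln_mult ln_div ln_powr)
  finally show ?thesis by simp
 qed
 then have e: "p0 / (\<gamma> - 1) * y powr \<gamma> <= e" using pos g1 y by (subst (asm) ln_le_cancel_iff) auto
 have "p0 / (\<gamma> - 1) * (\<gamma> * y - (\<gamma> - 1)) <= p0 / (\<gamma> - 1) * y powr \<gamma>"
  using bernoulli_powr[of \<gamma> y] g y pos g1 by (intro mult_left_mono) auto
 then have "p0 / (\<gamma> - 1) * (\<gamma> * y - (\<gamma> - 1)) <= e" using e by simp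
 moreover have "p0 / (\<gamma> - 1) * (\<gamma> * y - (\<gamma> - 1)) = p0 / (\<gamma> - 1) * \<gamma> * y - p0" using g1 by (simp add: field_simps)
 moreover have "p0 / b * (\<gamma> * (R / r0) * (E - 1 - x)) = p0 / b * \<gamma> * (R / r0 * E) - \<gamma> / b * (R * (p0 / r0)) - p0 / b * (R / r0) * (\<gamma> * x)" for b E
  by (simp add: divide_inverse algebra_simps)
 note this[of "\<gamma> - 1" "exp x", folded y_def]
 moreover have "p0 / (\<gamma> - 1) * (R / r0) * (\<gamma> * x) = R * (p0 / r0) * (k - s0)"
 proof -
  have gx: "\<gamma> * x = (\<gamma> - 1) * (k - s0)" using g by (simp add: x_def)
  show ?thesis unfolding gx using g1 by simp
 qed
 moreover have "R * (p0 / r0) * (s0 - k) = - (R * (p0 / r0) * (k - s0))" by (simp add: right_diff_distrib)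
 ultimately show ?thesis unfolding x_def[symmetric] by linarith
qed

lemma thermal_energy_quadratic:
 fixes \<gamma> R r0 p0 e s s0 k :: real
 assumes g: "\<gamma> > 1" and pos: "R > 0" "r0 > 0" "p0 > 0" "e > 0" and s: "k <= 1 / (\<gamma> - 1) * ln ((\<gamma> - 1) * e / R powr \<gamma>)"
  and s0: "s0 = (ln p0 - \<gamma> * ln r0) * (1 / (\<gamma> - 1))" and M: "\<bar>k - s0\<bar> <= M"
 shows "R * (p0 / r0) * ((\<gamma> - 1) / (2 * \<gamma>)) * exp (- M) * (s0 - k)^2
   <= e + R * (p0 / r0) * (s0 - k) - \<gamma> / (\<gamma> - 1) * (R * (p0 / r0)) + p0"
proof (rule order_trans[OF _ thermal_energy_lower_exp[OF g pos s s0]])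
 let ?x = "(k - s0) * (\<gamma> - 1) / \<gamma>"
 have "\<bar>?x\<bar> = \<bar>k - s0\<bar> * ((\<gamma> - 1) / \<gamma>)" using g by (simp add: abs_mult)
 also have "... <= \<bar>k - s0\<bar> * 1" using g by (intro mult_left_mono) auto
 finally have "exp (- M) <= exp (- \<bar>?x\<bar>)" using M by simp
 then have "?x^2 / 2 * exp (- M) <= ?x^2 / 2 * exp (- \<bar>?x\<bar>)" by (intro mult_left_mono) auto
 also have "... <= exp ?x - 1 - ?x" by (rule exp_quadratic_lower)
 finally have "p0 / (\<gamma> - 1) * (\<gamma> * (R / r0) * (?x^2 / 2 * exp (- M))) <= p0 / (\<gamma> - 1) * (\<gamma> * (R / r0) * (exp ?x - 1 - ?x))"
  using g pos by (intro mult_left_mono) auto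
 moreover have "p0 / (\<gamma> - 1) * (\<gamma> * (R / r0) * (?x^2 / 2 * exp (- M))) = R * (p0 / r0) * ((\<gamma> - 1) / (2 * \<gamma>)) * exp (- M) * (s0 - k)^2"
 proof -
  have "a / b * (c * (R / r0) * ((d * b / c)^2 / 2 * E)) = R * (a / r0) * (b / (2 * c)) * E * d^2" if "b ~= 0" "c ~= 0" for a b c d E :: real
   using that pos by (simp add: field_simps power2_eq_square)
  from this[of "\<gamma> - 1" \<gamma> p0 "k - s0" "exp (- M)"] show ?thesis using g by (simp add: power2_commute[of s0 k])
 qed
 ultimately show "R * (p0 / r0) * ((\<gamma> - 1) / (2 * \<gamma>)) * exp (- M) * (s0 - k)^2 <= p0 / (\<gamma> - 1) * (\<gamma> * (R / r0) * (exp ?x - 1 - ?x))" by linarith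
qed

text \<open>
  \<open>K > s0\<close> excludes that the truncation of the entropy is active. With equal entropies the thermal
  energy is the convexity gap of the power law, which vanishes at \<open>R = r0\<close> only.
\<close>
lemma thermal_energy_zero:
 fixes \<gamma> R r0 p0 e s s0 k :: real
 assumes g: "\<gamma> > 1" and pos: "R > 0" "r0 > 0" "p0 > 0" "e > 0" and s: "s = 1 / (\<gamma> - 1) * ln ((\<gamma> - 1) * e / R powr \<gamma>)"
  and s0: "s0 = (ln p0 - \<gamma> * ln r0) * (1 / (\<gamma> - 1))" and k: "k = min s K" "s0 < K"
  and zero: "e + R * (p0 / r0) * (s0 - k) - \<gamma> / (\<gamma> - 1) * (R * (p0 / r0)) + p0 = 0" shows "R = r0" "e = p0 / (\<gamma> - 1)"
proof -
 have g1: "\<gamma> - 1 > 0" using g by simp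
 have ks: "k <= 1 / (\<gamma> - 1) * ln ((\<gamma> - 1) * e / R powr \<gamma>)" using k(1) s by simp
 have "R * (p0 / r0) * ((\<gamma> - 1) / (2 * \<gamma>)) * exp (- \<bar>k - s0\<bar>) * (s0 - k)^2 <= 0"
  using thermal_energy_quadratic[OF g pos ks s0 order_refl] zero by simp
 moreover have "R * (p0 / r0) * ((\<gamma> - 1) / (2 * \<gamma>)) * exp (- \<bar>k - s0\<bar>) > 0" using pos g by simp
 ultimately have "(s0 - k)^2 <= 0" by (metis mult_le_cancel_left_pos mult_zero_right)
 then have k0: "k = s0" by simp
 then have "s = s0" using k by (simp add: min_def split: if_splits)
 then have "ln ((\<gamma> - 1) * e / R powr \<gamma>) = ln p0 - \<gamma> * ln r0" unfolding s s0 using g1 by simp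
 then have "ln ((\<gamma> - 1) * e) = ln (p0 * (R / r0) powr \<gamma>)" using pos g1 by (simp add: ln_div ln_mult ln_powr algebra_simps)
 then have e: "(\<gamma> - 1) * e = p0 * (R / r0) powr \<gamma>" using pos g1 by (subst (asm) ln_inj_iff) auto
 define q where "q = R / r0"
 have q: "q > 0" using pos by (simp add: q_def)
 have "(\<gamma> - 1) * (e - \<gamma> / (\<gamma> - 1) * (R * (p0 / r0)) + p0) = p0 * (q powr \<gamma> - \<gamma> * q + \<gamma> - 1)"
 proof -
  have "(\<gamma> - 1) * (\<gamma> / (\<gamma> - 1) * (R * (p0 / r0))) = p0 * (\<gamma> * q)" using g1 by (simp add: q_def)
  then show ?thesis using e by (simp add: q_def[symmetric] algebra_simps)
 qed
 moreover have "e - \<gamma> / (\<gamma> - 1) * (R * (p0 / r0)) + p0 = 0" using zero k0 by simp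
 ultimately have b: "q powr \<gamma> - \<gamma> * q + \<gamma> - 1 = 0" using pos by simp
 have "q = 1"
 proof (cases "q <= 1")
  case True
  from rarefaction_gap[OF g q True] b have "\<gamma> * q * ((1 - q powr (\<gamma> - 1)) / (\<gamma> - 1))^2 <= 0" by simp
  then have "((1 - q powr (\<gamma> - 1)) / (\<gamma> - 1))^2 <= 0" using g q by (simp add: mult_le_0_iff)
  then have "q powr (\<gamma> - 1) = 1" using g1 by simp
  then show ?thesis using powr_eq_one_iff_gen[of q "\<gamma> - 1"] q g1 by auto
 next
  case False
  from compression_gap[OF g, of q] False b have "(q powr \<gamma> - 1)^2 <= 0" by simp
  then have "q powr \<gamma> = 1" by simp
  then show ?thesis using powr_eq_one_iff_gen[of q \<gamma>] q g by auto
 qed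
 then show "R = r0" using pos by (simp add: q_def)
 then show "e = p0 / (\<gamma> - 1)" using e pos g1 by (simp add: field_simps)
qed

text \<open>
  The term with the temperature gradient is split by the inequality of arithmetic and geometric means;
  this is where a quadratic lower bound of \<open>Rth\<close> in the entropy difference is needed.
\<close>
lemma production_bound:
 fixes w \<theta>s :: "'n::finite => real" and us :: "'n => 'n => real"
 assumes g: "\<gamma> > 1" and R: "R \<ge> 0" and B: "!!i j. \<bar>us j i\<bar> <= B" "\<bar>D\<bar> <= B" "!!j. \<bar>\<theta>s j\<bar> <= B"
  and Rth: "Rth \<ge> 0" and L: "L \<ge> 0" "R * k^2 <= L * Rth"
 shows "\<bar>- R * (\<Sum>i. \<Sum>j. w i * w j * us j i) - D * ((\<gamma> - 1) * Rth) + R * k * (\<Sum>j. w j * \<theta>s j)\<bar>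
   <= B * (2 * real CARD('n) + (\<gamma> - 1) + (real CARD('n) * L + 2)) * (R * (\<Sum>i. (w i)^2) / 2 + Rth)"
proof -
 define n where "n = real CARD('n)"
 define W where "W = R * (\<Sum>i. (w i)^2)"
 have B0: "B \<ge> 0" using B(2) by linarith
 have W: "W \<ge> 0" unfolding W_def using R by (simp add: sum_nonneg)
 have amgm: "\<bar>a * b\<bar> <= (a^2 + b^2) / 2" for a b :: real using sum_squares_bound[of "\<bar>a\<bar>" "\<bar>b\<bar>"] by (simp add: abs_mult)
 have "\<bar>\<Sum>i. \<Sum>j. w i * w j * us j i\<bar> <= (\<Sum>i. \<Sum>j. ((w i)^2 + (w j)^2) / 2 * B)"
  by (intro order_trans[OF sum_abs] sum_mono order_trans[OF sum_abs] sum_mono) (unfold abs_mult[of "w _ * w _"], intro mult_mono amgm B, auto)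
 also have "... = ((\<Sum>i\<in>(UNIV::'n set). \<Sum>j\<in>(UNIV::'n set). (w i)^2) + (\<Sum>i\<in>(UNIV::'n set). \<Sum>j\<in>(UNIV::'n set). (w j)^2)) / 2 * B"
  by (simp only: sum_distrib_right[symmetric] sum_divide_distrib[symmetric] sum.distrib)
 also have "... = B * n * (\<Sum>i. (w i)^2)" by (simp add: n_def sum_distrib_left[symmetric])
 finally have "R * \<bar>\<Sum>i. \<Sum>j. w i * w j * us j i\<bar> <= R * (B * n * (\<Sum>i. (w i)^2))" using R by (rule mult_left_mono)
 then have 1: "\<bar>- R * (\<Sum>i. \<Sum>j. w i * w j * us j i)\<bar> <= B * n * W"
  unfolding abs_mult abs_minus_cancel abs_of_nonneg[OF R] W_def by (simp only: mult_ac)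
 have 2: "\<bar>D * ((\<gamma> - 1) * Rth)\<bar> <= B * ((\<gamma> - 1) * Rth)" unfolding abs_mult[of D] using g Rth B by (intro mult_mono) auto
 have "\<bar>k * (\<Sum>j. w j * \<theta>s j)\<bar> <= (\<Sum>j. (k^2 + (w j)^2) / 2 * B)" unfolding sum_distrib_left mult.assoc[symmetric]
  by (intro order_trans[OF sum_abs] sum_mono) (unfold abs_mult[of "k * w _"], intro mult_mono amgm B, auto)
 also have "... = B * (n * k^2 + (\<Sum>i. (w i)^2)) / 2"
  by (simp add: sum_distrib_left[symmetric] n_def sum.distrib add_divide_distrib distrib_right sum_divide_distrib[symmetric] sum_distrib_right[symmetric] algebra_simps)
 finally have "R * \<bar>k * (\<Sum>j. w j * \<theta>s j)\<bar> <= R * (B * (n * k^2 + (\<Sum>i. (w i)^2)) / 2)" using R by (rule mult_left_mono)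
 also have "... = B * (n * (R * k^2) + W) / 2" by (simp add: W_def algebra_simps)
 also have "... <= B * (n * (L * Rth) + W) / 2" using L B0 by (intro divide_right_mono mult_left_mono add_mono) (auto simp: n_def)
 finally have 3: "\<bar>R * k * (\<Sum>j. w j * \<theta>s j)\<bar> <= B * (n * (L * Rth) + W) / 2" by (simp add: abs_mult R mult.assoc)
 have "B * n * W + B * ((\<gamma> - 1) * Rth) + B * (n * (L * Rth) + W) / 2 <= B * (2 * n + (\<gamma> - 1) + (n * L + 2)) * (W / 2 + Rth)"
 proof -
  have "0 <= B * ((2 * n * Rth + 2 * Rth) + ((\<gamma> - 1) * W + n * (L * W) + W) / 2 + n * (L * Rth) / 2)"
   using B0 W Rth L g by (intro mult_nonneg_nonneg add_nonneg_nonneg divide_nonneg_nonneg) (auto simp: n_def)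
  then show ?thesis by (simp add: algebra_simps add_divide_distrib)
 qed
 then show ?thesis using 1 2 3 unfolding n_def[symmetric] W_def[symmetric] abs_le_iff by linarith
qed

section \<open>Relative energy and its production\<close>

text \<open>
  The time derivative \<^term>\<open>dt\<close> is meaningful in the open interval only; \<open>g0\<close> is its continuous extension,
  which supplies bounds.
\<close>
definition strip_cont :: "real => (real \<times> (real^'n) => 'b::real_normed_vector) => bool" where
 "strip_cont T g \<longleftrightarrow> (EX g0. continuous_on (strip T) g0 & (ALL z:{0<..<T} \<times> UNIV. g z = g0 z))"

lemma strip_contI: "continuous_on (strip T) g ==> strip_cont T g" by (auto simp: strip_cont_def)

lemma strip_cont_fst:
 assumes "continuous_on UNIV \<psi>" shows "strip_cont T (%z. \<psi> (fst z))"
 by (rule strip_contI, rule continuous_on_compose2[OF assms continuous_on_fst[OF continuous_on_id]]) simp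

lemma strip_cont_add:
 assumes "strip_cont T f" "strip_cont T g" shows "strip_cont T (%z. f z + g z)"
proof -
 obtain f0 g0 where c: "continuous_on (strip T) f0" "continuous_on (strip T) g0"
  and e: "!!z. z : {0<..<T} \<times> UNIV ==> f z = f0 z" "!!z. z : {0<..<T} \<times> UNIV ==> g z = g0 z" using assms unfolding strip_cont_def by blast
 show ?thesis unfolding strip_cont_def by (intro exI[of _ "%z. f0 z + g0 z"] conjI ballI continuous_on_add c) (simp only: e)
qed

lemma strip_cont_scaleR:
 assumes "strip_cont T f" "strip_cont T g" shows "strip_cont T (%z. f z *\<^sub>R g z)"
proof -
 obtain f0 g0 where c: "continuous_on (strip T) f0" "continuous_on (strip T) g0"
  and e: "!!z. z : {0<..<T} \<times> UNIV ==> f z = f0 z" "!!z. z : {0<..<T} \<times> UNIV ==> g z = g0 z" using assms unfolding strip_cont_def by blast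
 show ?thesis unfolding strip_cont_def by (intro exI[of _ "%z. f0 z *\<^sub>R g0 z"] conjI ballI continuous_on_scaleR c) (simp only: e)
qed

lemma strip_cont_mult: "strip_cont T f ==> strip_cont T g ==> strip_cont T (%z. f z * g z :: real)" using strip_cont_scaleR[of T f g] by simp

lemma strip_cont_const: "strip_cont T (%z. a)" by (rule strip_contI) simp

lemma strip_cont_sum: "(!!i. i : I ==> strip_cont T (f i)) ==> strip_cont T (%z. \<Sum>i\<in>I. f i z)"
 by (induction I rule: infinite_finite_induct) (auto intro: strip_cont_add strip_cont_const)

lemma strip_cont_vec_lambda:
 fixes f :: "'m::finite => real \<times> (real^'n) => 'b::real_normed_vector"
 assumes "!!i. strip_cont T (f i)" shows "strip_cont T (%z. \<chi> i. f i z)"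
proof -
 obtain g where g: "!!i. continuous_on (strip T) (g i)" "!!i z. z : {0<..<T} \<times> UNIV ==> f i z = g i z" using assms unfolding strip_cont_def by metis
 show ?thesis unfolding strip_cont_def by (rule exI[of _ "%z. \<chi> i. g i z"]) (use g in \<open>auto intro: continuous_on_vec_lambda\<close>)
qed

lemma C1_strip_cont:
 assumes "C1_strip T f" shows "strip_cont T (%z. f (fst z) (snd z))" "strip_cont T (%z. dt f (fst z) (snd z))" "strip_cont T (%z. pd j (f (fst z)) (snd z))"
proof -
 obtain ft fx where p: "continuous_on (strip T) ft" "!!j. continuous_on (strip T) (fx j)"
  "!!t x. t : {0<..<T} ==> dt f t x = ft (t, x)" "!!t x j. t : {0..T} ==> pd j (f t) x = fx j (t, x)" using C1_strip_partials[OF assms] by metis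
 show "strip_cont T (%z. f (fst z) (snd z))" by (rule strip_contI) (use C1_on_continuous_on[OF assms] in \<open>simp add: case_prod_beta'\<close>)
 show "strip_cont T (%z. dt f (fst z) (snd z))" unfolding strip_cont_def by (rule exI[of _ ft]) (use p in auto)
 show "strip_cont T (%z. pd j (f (fst z)) (snd z))" unfolding strip_cont_def by (rule exI[of _ "fx j"]) (use p in auto)
qed

lemma C1_strip_cont_grad: "C1_strip T f ==> strip_cont T (%z. grad (f (fst z)) (snd z))" unfolding grad_def by (intro strip_cont_vec_lambda C1_strip_cont)

lemma C1_strip_cont_jac:
 assumes "C1_strip T f" shows "strip_cont T (%z. jac (f (fst z)) (snd z))" "strip_cont T (%z. divergence (f (fst z)) (snd z))" unfolding jac_def divergence_def
 using C1_strip_cont(3)[OF C1_strip_vec_nth[OF assms]] by (auto intro!: strip_cont_vec_lambda strip_cont_sum)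

lemma strip_cont_bound:
 assumes "strip_cont T g"
 obtains B where "B > 0" "!!z. z : {0<..<T} \<times> torus ==> norm (g z) <= B"
proof -
 obtain g0 where g0: "continuous_on (strip T) g0" "!!z. z : {0<..<T} \<times> UNIV ==> g z = g0 z" using assms unfolding strip_cont_def by blast
 have "continuous_on ({0..T} \<times> cbox 0 1) g0" by (rule continuous_on_subset[OF g0(1)]) auto
 then obtain B where B: "B > 0" "!!z. z : {0..T} \<times> cbox 0 1 ==> norm (g0 z) <= B"
  using compact_norm_bound[OF compact_Times[OF compact_Icc compact_cbox]] by blast
 show ?thesis
 proof (rule that[OF B(1)])
  show "norm (g z) <= B" if "z : {0<..<T} \<times> torus" for z using g0(2)[of z] B(2)[of z] that torus_subset_cbox by auto
 qed
qed

lemma strip_cont_measurable: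
 fixes g :: "real \<times> (real^'n) => 'b::{banach, second_countable_topology}"
 assumes "strip_cont T g" shows "g : borel_measurable (spacetime T)"
proof -
 obtain g0 where g0: "continuous_on (strip T) g0" "!!z. z : {0<..<T} \<times> UNIV ==> g z = g0 z" using assms unfolding strip_cont_def by blast
 have "g0 : borel_measurable (spacetime T)" by (rule measurable_spacetime_continuous, rule continuous_on_subset[OF g0(1)]) auto
 then show ?thesis by (rule measurable_cong[THEN iffD1, rotated]) (use g0 in \<open>auto simp: space_spacetime\<close>)
qed

lemma strip_cont_integrable:
 fixes f g :: "real \<times> (real^'n) => 'b::euclidean_space"
 assumes f: "integrable (spacetime T) f" and g: "strip_cont T g" shows "integrable (spacetime T) (%z. f z \<bullet> g z)"
proof -
 obtain B where B: "B > 0" "!!z. z : {0<..<T} \<times> torus ==> norm (g z) <= B" using strip_cont_bound[OF g] by blast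
 show ?thesis
 proof (rule lint_bound[of _ "%z. B * norm (f z)"])
  show "(%z. f z \<bullet> g z) : borel_measurable (spacetime T)"
   by (intro borel_measurable_inner borel_measurable_integrable[OF f] strip_cont_measurable[OF g])
  show "AE z in spacetime T. norm (f z \<bullet> g z) <= norm (B * norm (f z))"
  proof (rule AE_I2)
   fix z :: "real \<times> (real^'n)" assume "z : space (spacetime T)"
   then have "norm (g z) <= B" by (intro B(2)) (simp add: space_spacetime)
   then have "norm (f z) * norm (g z) <= norm (f z) * B" by (intro mult_left_mono) auto
   then show "norm (f z \<bullet> g z) <= norm (B * norm (f z))" using Cauchy_Schwarz_ineq2[of "f z" "g z"] B(1) by (simp add: mult.commute)
  qed
 qed (use f in simp)
qed

lemma entropy_cutoff_min: "entropy_cutoff (%s. min (s + b) K)" unfolding entropy_cutoff_def concave_on_iff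
proof (intro conjI ballI allI impI)
 fix x y u v :: real assume uv: "0 <= u" "0 <= v" "u + v = 1"
 have "u * min (x + b) K + v * min (y + b) K <= u * (x + b) + v * (y + b)" using uv by (intro add_mono mult_left_mono) auto
 also have "... = (u *\<^sub>R x + v *\<^sub>R y) + (u + v) * b" by (simp add: algebra_simps)
 finally have 1: "u * min (x + b) K + v * min (y + b) K <= (u *\<^sub>R x + v *\<^sub>R y) + b" using uv by simp
 have "u * min (x + b) K + v * min (y + b) K <= u * K + v * K" using uv by (intro add_mono mult_left_mono) auto
 also have "... = K" using uv by (simp add: distrib_right[symmetric])
 finally show "u * min (x + b) K + v * min (y + b) K <= min (u *\<^sub>R x + v *\<^sub>R y + b) K" using 1 by simp
qed (auto simp: mono_def intro!: exI[of _ K])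

definition spec_entropy :: "real => 'n::finite state => real" where
 "spec_entropy \<gamma> U = 1 / (\<gamma> - 1) * ln ((\<gamma> - 1) * internal_energy U / dens U powr \<gamma>)"

context strong_euler begin

definition "uvec t x = (\<chi> i. vel i t x)"
definition "RE K t x U = ener U - mom U \<bullet> uvec t x + dens U * dens_mult t x - dens U * S_eta \<gamma> (%s. min s K) U * temp t x + prs t x"
definition "work t x = dt prs t x + (\<Sum>s. par (Some s) (%t x. prs t x * vel s t x) t x)"
definition "production K t x U = - (mom U \<bullet> dt uvec t x) - convective_flux U \<bullet> jac (uvec t) x
  - (\<gamma> - 1) * internal_energy U * divergence (uvec t) x + dens U * dt dens_mult t x + mom U \<bullet> grad (dens_mult t) x
  - dens U * S_eta \<gamma> (%s. min s K) U * dt temp t x - (S_eta \<gamma> (%s. min s K) U *\<^sub>R mom U) \<bullet> grad (temp t) x + work t x"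

lemma C1_uvec: "C1_strip T uvec" unfolding uvec_def[abs_def] by (rule C1_strip_vec_lambda[OF C1_vel])

lemma par_flux:
 assumes t: "t : {0<..<T}" shows "par d (%t x. prs t x * vel s t x) t x = par d prs t x * vel s t x + prs t x * par d (vel s) t x"
proof (rule par_eqI[OF C1_strip_mult[OF C1_prs C1_vel] t])
 show "(along d (%t x. prs t x * vel s t x) t x has_real_derivative par d prs t x * vel s t x + prs t x * par d (vel s) t x) (at 0)"
  unfolding along_mult using DERIV_mult[OF has_par[OF C1_prs t, of d x] has_par[OF C1_vel[of s] t, of d x]] by (simp add: mult.commute)
qed

lemma uvec_derivs:
 assumes t: "t : {0<..<T}" shows "dt uvec t x $ i = par None (vel i) t x" "jac (uvec t) x $ i $ j = par (Some j) (vel i) t x"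
  "divergence (uvec t) x = (\<Sum>s. par (Some s) (vel s) t x)"
proof -
 have e: "(%t x. uvec t x $ i) = vel i" "(%y. uvec t y $ i) = vel i t" for i by (simp_all add: uvec_def)
 show "dt uvec t x $ i = par None (vel i) t x" using C1_strip_dt_component[OF C1_uvec t] by (simp add: e par_def)
 show "jac (uvec t) x $ i $ j = par (Some j) (vel i) t x" by (simp add: jac_def e par_def)
 show "divergence (uvec t) x = (\<Sum>s. par (Some s) (vel s) t x)" by (simp add: divergence_def e par_def)
qed

lemma work_eq:
 assumes t: "t : {0<..<T}" shows "work t x = par None prs t x + (\<Sum>j. par (Some j) prs t x * vel j t x + prs t x * par (Some j) (vel j) t x)"
 unfolding work_def par_flux[OF t] by (simp add: par_def)

lemma work_vacuum:
 assumes t: "t : {0<..<T}" shows "work t x = - ((\<gamma> - 1) * prs t x * divergence (uvec t) x)"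
 unfolding work_eq[OF t] uvec_derivs[OF t] using pressure_eq[OF t, of x] by (simp add: sum.distrib sum_distrib_left[symmetric] algebra_simps)

lemma nonvacuum_identities:
 fixes U :: "'n state" and K t :: real and x :: "real^'n"
 assumes t: "t : {0<..<T}" and R: "dens U > 0"
 defines "k \<equiv> min (spec_entropy \<gamma> U) K" and "w \<equiv> %i. velocity U $ i - vel i t x"
 defines "Rth \<equiv> internal_energy U + dens U * (prs t x / \<rho> t x) * (entr t x - k) - \<gamma> / (\<gamma> - 1) * (dens U * (prs t x / \<rho> t x)) + prs t x"
 shows "RE K t x U = dens U * (\<Sum>i. (w i)^2) / 2 + Rth" and "production K t x U = - dens U * (\<Sum>i. \<Sum>j. w i * w j * par (Some j) (vel i) t x)
   - divergence (uvec t) x * ((\<gamma> - 1) * Rth) + dens U * (entr t x - k) * (\<Sum>j. w j * par (Some j) temp t x)"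
proof -
 have r: "\<rho> t x > 0" using rpos t by simp
 have g1: "\<gamma> - 1 ~= 0" using g by simp
 have mv: "mom U $ i = dens U * velocity U $ i" for i using R by (simp add: velocity_def)
 have S: "S_eta \<gamma> (%s. min s K) U = k" by (simp add: S_eta_def k_def spec_entropy_def)
 have en: "ener U = internal_energy U + dens U * (\<Sum>i. (velocity U $ i)^2) / 2"
 proof -
  have "(norm (mom U))^2 = (\<Sum>i. (dens U * velocity U $ i) * (dens U * velocity U $ i))" unfolding power2_norm_eq_inner inner_vec_def mv by simp
  also have "... = dens U * (dens U * (\<Sum>i. (velocity U $ i)^2))" unfolding sum_distrib_left by (intro sum.cong refl) (simp add: power2_eq_square mult_ac)
  finally show ?thesis using R by (simp add: internal_energy_def)
 qed
 have sq: "(\<Sum>i. (w i)^2) = (\<Sum>i. (velocity U $ i)^2) - 2 * (\<Sum>i. velocity U $ i * vel i t x) + (\<Sum>i. vel i t x * vel i t x)"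
 proof -
  have "(w i)^2 = (velocity U $ i)^2 - 2 * (velocity U $ i * vel i t x) + vel i t x * vel i t x" for i by (simp add: w_def power2_eq_square algebra_simps)
  then show ?thesis by (simp only: sum.distrib sum_subtractf sum_distrib_left)
 qed
 have mu: "mom U \<bullet> uvec t x = dens U * (\<Sum>i. velocity U $ i * vel i t x)"
  unfolding inner_vec_def inner_real_def mv uvec_def by (simp add: sum_distrib_left mult.assoc)
 show "RE K t x U = dens U * (\<Sum>i. (w i)^2) / 2 + Rth"
  unfolding RE_def Rth_def S sq mu en dens_mult_def temp_def by (simp add: algebra_simps add_divide_distrib diff_divide_distrib)
 have cf: "convective_flux U $ i $ j = dens U * velocity U $ i * velocity U $ j" for i j using R by (simp add: convective_flux_def outer_def mv)
 have L: "production K t x U = - (\<Sum>i. dens U * velocity U $ i * par None (vel i) t x)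
   - (\<Sum>i. \<Sum>j. dens U * velocity U $ i * velocity U $ j * par (Some j) (vel i) t x)
   - (\<gamma> - 1) * internal_energy U * divergence (uvec t) x
   + dens U * par None dens_mult t x + (\<Sum>j. dens U * velocity U $ j * par (Some j) dens_mult t x)
   - dens U * k * par None temp t x - (\<Sum>j. k * (dens U * velocity U $ j) * par (Some j) temp t x)
   + (par None prs t x + (\<Sum>j. par (Some j) prs t x * vel j t x + prs t x * par (Some j) (vel j) t x))" unfolding production_def S work_eq[OF t]
  unfolding inner_vec_def inner_real_def vector_scaleR_component real_scaleR_def uvec_derivs(1,2)[OF t] cf mv grad_def vec_lambda_beta par_def option.case ..
 have a: "par d dens_mult t x = (\<Sum>i. vel i t x * par d (vel i) t x) + entr t x * par d temp t x - par d prs t x / \<rho> t x" for d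
  by (rule par_dens_mult[OF t])
 have "production K t x U = - dens U * (\<Sum>i. \<Sum>j. w i * w j * par (Some j) (vel i) t x)
   - divergence (uvec t) x * ((\<gamma> - 1) * internal_energy U + (\<gamma> - 1) * (dens U * temp t x * (entr t x - k)) - \<gamma> * dens U * temp t x + (\<gamma> - 1) * prs t x)
   + dens U * (entr t x - k) * (\<Sum>j. w j * par (Some j) temp t x)" unfolding L w_def
  by (rule relative_energy_production[OF g r momentum_eq[OF t] _ uvec_derivs(3)[OF t] _ _ a a])
   (use pressure_eq[OF t, of x] temp_transport[OF t, of x] r in \<open>simp_all add: uvec_derivs(3)[OF t] temp_def\<close>)
 moreover have "(\<gamma> - 1) * internal_energy U + (\<gamma> - 1) * (dens U * temp t x * (entr t x - k)) - \<gamma> * dens U * temp t x + (\<gamma> - 1) * prs t x = (\<gamma> - 1) * Rth"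
 proof -
  have "(\<gamma> - 1) * (\<gamma> / (\<gamma> - 1) * y) = \<gamma> * y" for y using g1 by simp
  then show ?thesis unfolding Rth_def temp_def[symmetric] by (simp only: right_diff_distrib distrib_left mult.assoc)
 qed
 ultimately show "production K t x U = - dens U * (\<Sum>i. \<Sum>j. w i * w j * par (Some j) (vel i) t x)
   - divergence (uvec t) x * ((\<gamma> - 1) * Rth) + dens U * (entr t x - k) * (\<Sum>j. w j * par (Some j) temp t x)" by simp
qed

lemma E_pos: "t : {0..T} ==> E t x > 0"
proof -
 assume t: "t : {0..T}"
 have "internal_energy (\<rho> t x, m t x, E t x) > 0" using prs_pos[OF t, of x] g by (simp add: prs_def pressure_def zero_less_mult_iff)
 moreover have "(norm (m t x))^2 / \<rho> t x / 2 \<ge> 0" using rpos[OF t, of x] by simp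
 ultimately show ?thesis unfolding internal_energy_def dens_def mom_def ener_def fst_conv snd_conv by linarith
qed

text \<open>
  At vacuum the relative energy is \<open>E + p\<close> and the production a multiple of it; elsewhere
  \<open>production_bound\<close> applies. The lower bound on the entropy makes \<open>thermal_energy_quadratic\<close> uniform.
\<close>
lemma pointwise_control:
 assumes S: "!!t x. t : {0..T} ==> x : torus ==> \<bar>entr t x\<bar> <= S"
 obtains C where "C \<ge> 0" "!!t x U. [|t : {0<..<T}; x : torus; U : state_space; U : finite_entropy_states; dens U > 0 ==> - S <= spec_entropy \<gamma> U|]
   ==> \<bar>production (S + 1) t x U\<bar> <= C * RE (S + 1) t x U & 0 <= RE (S + 1) t x U
    & (RE (S + 1) t x U = 0 --> U = (\<rho> t x, m t x, E t x))"
proof -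
 have "EX B>0. ALL z:{0<..<T} \<times> torus. ALL i j. \<bar>par (Some j) (vel i) (fst z) (snd z)\<bar> <= B"
 proof -
  obtain B where B: "B > 0" "!!z. z : {0<..<T} \<times> torus ==> norm (jac (uvec (fst z)) (snd z)) <= B"
   using strip_cont_bound[OF C1_strip_cont_jac(1)[OF C1_uvec]] by blast
  have "\<bar>par (Some j) (vel i) (fst z) (snd z)\<bar> <= B" if z: "z : {0<..<T} \<times> torus" for z i j
  proof -
   have "par (Some j) (vel i) (fst z) (snd z) = jac (uvec (fst z)) (snd z) $ i $ j" using z by (intro uvec_derivs(2)[symmetric]) auto
   then show ?thesis using B(2)[OF z] component_le_norm_cart[of "jac (uvec (fst z)) (snd z) $ i" j]
    Finite_Cartesian_Product.norm_nth_le[of "jac (uvec (fst z)) (snd z)" i] by linarith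
  qed
  then show ?thesis using B(1) by blast
 qed
 then obtain B1 where B1: "B1 > 0" "!!t x i j. t : {0<..<T} ==> x : torus ==> \<bar>par (Some j) (vel i) t x\<bar> <= B1" by force
 obtain B2 where B2: "B2 > 0" "!!z. z : {0<..<T} \<times> torus ==> norm (divergence (uvec (fst z)) (snd z)) <= B2"
  using strip_cont_bound[OF C1_strip_cont_jac(2)[OF C1_uvec]] by blast
 obtain B3 where B3: "B3 > 0" "!!t x j. t : {0<..<T} ==> x : cbox 0 1 ==> \<bar>par (Some j) temp t x\<bar> <= B3"
  using par_bound_cbox[OF C1_derived(1)] by blast
 define B where "B = B1 + B2 + B3"
 have tp: "temp (fst z) (snd z) > 0" if "z : {0..T} \<times> cbox 0 1" for z using temp_pos that by auto
 have ct: "continuous_on ({0..T} \<times> cbox 0 1) (%z. temp (fst z) (snd z))"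
  by (rule continuous_on_subset[of "{0..T} \<times> UNIV"]) (use C1_on_continuous_on[OF C1_derived(1)] in \<open>auto simp: case_prod_beta'\<close>)
 from compact_pos_lower_bound[OF compact_Times[OF compact_Icc compact_cbox] ct tp]
 obtain \<theta> where th: "\<theta> > 0" "!!z. z : {0..T} \<times> cbox 0 1 ==> \<theta> <= temp (fst z) (snd z)" by blast
 define q where "q = \<theta> * ((\<gamma> - 1) / (2 * \<gamma>)) * exp (- (2 * S + 1))"
 have q: "q > 0" using th(1) g by (simp add: q_def)
 define L where "L = 1 / q"
 define C where "C = B * (2 * real CARD('n) + (\<gamma> - 1) + (real CARD('n) * L + 2)) + (\<gamma> - 1) * B"
 have BB: "B > 0" using B1 B2 B3 by (simp add: B_def)
 have L0: "L > 0" using q by (simp add: L_def)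
 have C1: "B * (2 * real CARD('n) + (\<gamma> - 1) + (real CARD('n) * L + 2)) \<ge> 0" "(\<gamma> - 1) * B \<ge> 0"
  using BB L0 g by (auto intro!: mult_nonneg_nonneg add_nonneg_nonneg)
 have main: "\<bar>production (S + 1) t x U\<bar> <= C * RE (S + 1) t x U & 0 <= RE (S + 1) t x U
    & (RE (S + 1) t x U = 0 --> U = (\<rho> t x, m t x, E t x))" if t: "t : {0<..<T}" and x: "x : torus" and U: "U : state_space" "U : finite_entropy_states"
   and lo: "dens U > 0 ==> - S <= spec_entropy \<gamma> U" for t x U
 proof -
  have t': "t : {0..T}" using t by simp
  have xc: "x : cbox 0 1" using x torus_subset_cbox by blast
  note r = rpos[OF t', of x] and p = prs_pos[OF t', of x]
  have D: "\<bar>divergence (uvec t) x\<bar> <= B" using B2(2)[of "(t, x)"] t x B1 B3 by (simp add: B_def)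
  show ?thesis
  proof (cases "dens U > 0")
   case False
   then have v: "dens U = 0" "mom U = 0" using U(2) by (auto simp: finite_entropy_states_def)
   have e0: "ener U \<ge> 0" using U(1) by (simp add: state_space_def)
   have re: "RE (S + 1) t x U = ener U + prs t x" by (simp add: RE_def v)
   have "production (S + 1) t x U = - ((\<gamma> - 1) * divergence (uvec t) x * (ener U + prs t x))"
    unfolding production_def work_vacuum[OF t] by (simp add: v convective_flux_def internal_energy_def algebra_simps)
   then have "\<bar>production (S + 1) t x U\<bar> = (\<gamma> - 1) * \<bar>divergence (uvec t) x\<bar> * (ener U + prs t x)"
    using g e0 p by (simp add: abs_mult)
   also have "... <= (\<gamma> - 1) * B * (ener U + prs t x)" using g e0 p D by (intro mult_right_mono mult_left_mono) auto
   also have "... <= C * (ener U + prs t x)" using e0 p C1 by (intro mult_right_mono) (auto simp: C_def)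
   finally show ?thesis using re e0 p by simp
  next
   case True
   define k where "k = min (spec_entropy \<gamma> U) (S + 1)"
   define w where "w = (%i. velocity U $ i - vel i t x)"
   define Rth where "Rth = internal_energy U + dens U * (prs t x / \<rho> t x) * (entr t x - k) - \<gamma> / (\<gamma> - 1) * (dens U * (prs t x / \<rho> t x)) + prs t x"
   note id = nonvacuum_identities[OF t True, where K="S + 1" and x=x, folded k_def w_def, folded Rth_def]
   have e: "internal_energy U > 0" using U(2) True by (auto simp: finite_entropy_states_def)
   have s0: "entr t x = (ln (prs t x) - \<gamma> * ln (\<rho> t x)) * (1 / (\<gamma> - 1))" by (simp add: entr_def)
   have k: "k <= 1 / (\<gamma> - 1) * ln ((\<gamma> - 1) * internal_energy U / dens U powr \<gamma>)" by (simp add: k_def spec_entropy_def)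
   have sb: "entr t x <= S" "- S <= entr t x" using S[OF t' x] unfolding abs_le_iff by linarith+
   have kb: "- S <= k" "k <= S + 1" using lo[OF True] sb by (auto simp: k_def)
   have M: "\<bar>k - entr t x\<bar> <= 2 * S + 1" unfolding abs_le_iff using sb kb by linarith
   have quad: "dens U * (prs t x / \<rho> t x) * ((\<gamma> - 1) / (2 * \<gamma>)) * exp (- (2 * S + 1)) * (entr t x - k)^2 <= Rth"
    unfolding Rth_def by (rule thermal_energy_quadratic[OF g True r p e k s0 M])
   have "dens U * \<theta> * ((\<gamma> - 1) / (2 * \<gamma>)) * exp (- (2 * S + 1)) * (entr t x - k)^2
     <= dens U * (prs t x / \<rho> t x) * ((\<gamma> - 1) / (2 * \<gamma>)) * exp (- (2 * S + 1)) * (entr t x - k)^2"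
    using th(2)[of "(t, x)"] t' xc True g by (intro mult_right_mono mult_left_mono) (auto simp: temp_def)
   then have qk: "q * (dens U * (entr t x - k)^2) <= Rth" using quad by (simp add: q_def mult_ac)
   moreover have "0 <= q * (dens U * (entr t x - k)^2)" using q True by simp
   ultimately have R0: "Rth \<ge> 0" by linarith
   have b1: "\<bar>par (Some j) (vel i) t x\<bar> <= B" for i j using B1(2)[OF t x, of j i] B1(1) B2(1) B3(1) unfolding B_def by linarith
   have b3: "\<bar>par (Some j) temp t x\<bar> <= B" for j using B3(2)[OF t xc, of j] B1(1) B2(1) B3(1) unfolding B_def by linarith
   have "dens U * (entr t x - k)^2 <= L * Rth" using qk q by (simp add: L_def pos_le_divide_eq mult.commute)
   from production_bound[where w=w and us="%j i. par (Some j) (vel i) t x" and \<theta>s="%j. par (Some j) temp t x" and D="divergence (uvec t) x" and B=B,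
     OF g less_imp_le[OF True] b1 D b3 R0 less_imp_le[OF L0] this]
   have "\<bar>production (S + 1) t x U\<bar> <= B * (2 * real CARD('n) + (\<gamma> - 1) + (real CARD('n) * L + 2)) * RE (S + 1) t x U" unfolding id w_def .
   moreover have re0: "RE (S + 1) t x U \<ge> 0" unfolding id using R0 True by (simp add: sum_nonneg)
   moreover have "B * (2 * real CARD('n) + (\<gamma> - 1) + (real CARD('n) * L + 2)) * RE (S + 1) t x U <= C * RE (S + 1) t x U"
    using re0 C1 by (intro mult_right_mono) (auto simp: C_def)
   moreover have "U = (\<rho> t x, m t x, E t x)" if z: "RE (S + 1) t x U = 0"
   proof -
    have ws: "dens U * (\<Sum>i. (w i)^2) / 2 \<ge> 0" using True by (simp add: sum_nonneg)
    have Rz: "Rth = 0" and wz: "dens U * (\<Sum>i. (w i)^2) / 2 = 0" using z R0 ws unfolding id w_def by linarith+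
    have "(\<Sum>i. (w i)^2) = 0" using wz True by simp
    then have w0: "w i = 0" for i by (simp add: sum_nonneg_eq_0_iff)
    have "spec_entropy \<gamma> U = 1 / (\<gamma> - 1) * ln ((\<gamma> - 1) * internal_energy U / dens U powr \<gamma>)" by (rule spec_entropy_def)
    from thermal_energy_zero[OF g True r p e this s0 k_def _ Rz[unfolded Rth_def]]
    have Re: "dens U = \<rho> t x" "internal_energy U = prs t x / (\<gamma> - 1)" using sb by auto
    have mm: "mom U = m t x"
    proof -
     have "mom U $ i = m t x $ i" for i using w0[of i] Re(1) r by (simp add: w_def velocity_def vel_def field_simps)
     then show ?thesis by (simp add: vec_eq_iff)
    qed
    have "internal_energy U = internal_energy (\<rho> t x, m t x, E t x)" unfolding Re(2) prs_def pressure_def using g by simp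
    then have "ener U = E t x" unfolding internal_energy_def using Re(1) mm by (simp add: dens_def mom_def ener_def)
    then show ?thesis using Re(1) mm by (simp add: dens_def mom_def ener_def prod_eq_iff)
   qed
   ultimately show ?thesis by linarith
  qed
 qed
 show ?thesis by (rule that[of C]) (use C1 main in \<open>auto simp: C_def\<close>)
qed

end

section \<open>Weak-strong uniqueness\<close>

lemma torus_integrable_continuous:
 fixes f :: "real^'n => real"
 assumes "continuous_on UNIV f" shows "integrable \<Omega> f"
proof -
 interpret finite_measure "lebesgue_on (torus :: (real^'n) set)" by (rule finite_measure_torus)
 obtain B where B: "!!x. x : cbox 0 1 ==> norm (f x) <= B" using compact_norm_bound[OF compact_cbox continuous_on_subset[OF assms]] by (metis subset_UNIV)
 show ?thesis
  by (rule integrable_const_bound[of _ B, OF _ measurable_torus_continuous[OF assms]]) (use B torus_subset_cbox in \<open>auto intro!: AE_I2\<close>)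
qed

lemma spacetime_integral_product:
 fixes f :: "real => real" and h :: "real^'n => real"
 assumes "continuous_on UNIV f" "continuous_on UNIV h" shows "integrable (spacetime T) (%z. f (fst z) * h (snd z))"
  and "(LINT z|spacetime T. f (fst z) * h (snd z)) = (LINT t|lebesgue_on {0<..<T}. f t) * (LINT x|\<Omega>. h x)"
proof -
 show i: "integrable (spacetime T) (%z. f (fst z) * h (snd z))"
  by (intro bounded_integrable_spacetime continuous_on_mult continuous_on_compose2[OF assms(1)] continuous_on_compose2[OF assms(2)] continuous_on_fst continuous_on_snd continuous_on_id) auto
 show "(LINT z|spacetime T. f (fst z) * h (snd z)) = (LINT t|lebesgue_on {0<..<T}. f t) * (LINT x|\<Omega>. h x)"
  unfolding spacetime_def using Fubini_lebesgue_on[OF torus_lebesgue_sets i[unfolded spacetime_def]] by simp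
qed

text \<open>
  Countably many \<open>\<tau>\<close> tending to \<open>T\<close> suffice.
\<close>
lemma AE_zero_of_weighted_integrals:
 fixes f :: "real \<times> (real^'n) => real"
 assumes f: "integrable (spacetime T) f" and f0: "AE z in spacetime T. 0 <= f z" and T: "T > 0"
  and le: "!!\<tau>. 0 < \<tau> ==> \<tau> < T ==> (LINT z|spacetime T. exp (- lam * fst z) * max 0 (1 - fst z / \<tau>) * f z) <= 0"
 shows "AE z in spacetime T. f z = 0"
proof -
 let ?w = "%\<tau> t. exp (- lam * t) * max 0 (1 - t / \<tau>)"
 define s where "s = (%n. T * (1 - 1 / (real n + 2)))"
 have s: "0 < s n" "s n < T" for n using T by (auto simp: s_def)
 have "AE z in spacetime T. ?w (s n) (fst z) * f z = 0" for n
 proof -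
  have c: "continuous_on UNIV (?w (s n))" using s(1)[of n] by (intro continuous_intros) auto
  have i: "integrable (spacetime T) (%z. ?w (s n) (fst z) * f z)" using strip_cont_integrable[OF f strip_cont_fst[OF c]] by (simp add: mult.commute)
  have n: "AE z in spacetime T. 0 <= ?w (s n) (fst z) * f z" using f0 by eventually_elim auto
  have "(LINT z|spacetime T. ?w (s n) (fst z) * f z) = 0" by (rule antisym[OF le[OF s] integral_nonneg_AE[OF n]])
  then show ?thesis using integral_nonneg_eq_0_iff_AE[OF i n] by simp
 qed
 then have "AE z in spacetime T. ALL n. ?w (s n) (fst z) * f z = 0" unfolding AE_all_countable by blast
 moreover have "AE z in spacetime T. z : {0<..<T} \<times> torus" by (rule AE_I2) (simp add: space_spacetime)
 ultimately show ?thesis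
 proof eventually_elim
  case (elim z)
  then have t: "0 < fst z" "fst z < T" by auto
  obtain n :: nat where "T / (T - fst z) < real n" using reals_Archimedean2 by blast
  then have "T < (T - fst z) * (real n + 2)" using t by (simp add: pos_divide_less_eq algebra_simps)
  then have "T / (real n + 2) < T - fst z" by (simp add: pos_divide_less_eq)
  then have "fst z < s n" unfolding s_def by (simp add: right_diff_distrib)
  then have "0 < exp (- lam * fst z) * max 0 (1 - fst z / s n)" using s(1)[of n] by (simp add: less_max_iff_disj)
  moreover have "exp (- lam * fst z) * max 0 (1 - fst z / s n) * f z = 0" using elim(1) by blast
  ultimately show ?case by (metis mult_eq_0_iff order_less_irrefl)
 qed
qed

locale dissipative_euler = strong_euler \<gamma> T \<rho>0 m0 E0 \<rho> E m
 for \<gamma> T :: real and \<rho>0 :: "real^'n => real" and m0 :: "real^'n => real^'n" and E0 :: "real^'n => real"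
  and \<rho> E :: "real => real^'n => real" and m :: "real => real^'n => real^'n" +
 fixes c :: "nat => real => real" and V :: "real => real^'n => 'n state measure"
 assumes dmv: "dmv_solution c \<gamma> T (%x. return (restrict_space borel state_space) (\<rho>0 x, m0 x, E0 x)) V"
begin

abbreviation "V0 x \<equiv> return (restrict_space borel state_space) (\<rho>0 x, m0 x, E0 x) :: 'n state measure"
definition "ex f z = expect (V (fst z) (snd z)) f"
abbreviation "trunc K \<equiv> S_eta \<gamma> (%s. min s K)"

lemma dmv_parts:
 "!!t x. t : {0<..<T} ==> x : torus ==> V t x : prob_on_states"
 "AE z in spacetime T. AE U in V (fst z) (snd z). U : finite_entropy_states"
 "integrable_expect T V dens" "integrable_expect T V mom" "integrable_expect T V ener"
 "integrable_expect T V convective_flux" "integrable_expect T V internal_energy"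
 "!!\<eta>. entropy_cutoff \<eta> ==> integrable_expect T V (%U. dens U * S_eta \<gamma> \<eta> U)"
 "!!\<eta>. entropy_cutoff \<eta> ==> integrable_expect T V (%U. S_eta \<gamma> \<eta> U *\<^sub>R mom U)"
 "!!\<phi>. test_fun T \<phi> ==> integral_st T (%t x. expect (V t x) dens * dt \<phi> t x + expect (V t x) mom \<bullet> grad (\<phi> t) x)
    = - (LINT x|\<Omega>. expect (V0 x) dens * \<phi> 0 x)"
 "AE \<tau> in lebesgue_on {0<..<T}. (LINT x|\<Omega>. expect (V \<tau> x) ener) <= (LINT x|\<Omega>. expect (V0 x) ener)"
 "!!\<eta> \<phi>. entropy_cutoff \<eta> ==> test_fun T \<phi> ==> (ALL t:{0..<T}. ALL x. 0 <= \<phi> t x) ==>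
    integral_st T (%t x. expect (V t x) (%U. dens U * S_eta \<gamma> \<eta> U) * dt \<phi> t x
              + expect (V t x) (%U. S_eta \<gamma> \<eta> U *\<^sub>R mom U) \<bullet> grad (\<phi> t) x)
    <= - (LINT x|\<Omega>. expect (V0 x) (%U. dens U * S_eta \<gamma> \<eta> U) * \<phi> 0 x)"
 "\<exists>\<mu>. is_matrix_measure (restrict_space borel ({0..T} \<times> torus)) \<mu> \<and>
    (\<forall>\<phi>. test_fun T \<phi> -->
     integral_st T (%t x. expect (V t x) mom \<bullet> dt \<phi> t x
               + expect (V t x) convective_flux \<bullet> jac (\<phi> t) x
               + (\<gamma> - 1) * expect (V t x) internal_energy * divergence (\<phi> t) x)
     = - (LINT x|\<Omega>. expect (V0 x) mom \<bullet> \<phi> 0 x)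
      + mm_integral \<mu> (%z. jac (\<phi> (fst z)) (snd z))) \<and>
    (\<forall>\<tau>. 0 <= \<tau> & \<tau> < T -->
     mm_variation (restrict_space borel ({0..T} \<times> torus)) \<mu> ({0..\<tau>} \<times> torus)
     <= c CARD('n) \<gamma> *
      integral_st \<tau> (%t x. expect (V0 x) ener - expect (V t x) ener))" using dmv unfolding dmv_solution_def Let_def by blast+

lemma expect_parts:
 "integrable (spacetime T) (ex dens)" "integrable (spacetime T) (ex mom)" "integrable (spacetime T) (ex ener)"
 "integrable (spacetime T) (ex convective_flux)" "integrable (spacetime T) (ex internal_energy)"
 "entropy_cutoff \<eta> ==> integrable (spacetime T) (ex (%U. dens U * S_eta \<gamma> \<eta> U))"
 "entropy_cutoff \<eta> ==> integrable (spacetime T) (ex (%U. S_eta \<gamma> \<eta> U *\<^sub>R mom U))"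
 using dmv_parts(3-9) unfolding integrable_expect_def L1_st_def ex_def by blast+

lemma V_prob:
 assumes "z : {0<..<T} \<times> torus" shows "prob_space (V (fst z) (snd z))" "space (V (fst z) (snd z)) = state_space"
  "sets (V (fst z) (snd z)) = sets (restrict_space borel state_space)"
proof -
 have "V (fst z) (snd z) : prob_on_states" using assms by (intro dmv_parts(1)) auto
 then show "prob_space (V (fst z) (snd z))" and s: "sets (V (fst z) (snd z)) = sets (restrict_space borel state_space)"
  by (simp_all add: prob_on_states_def space_prob_algebra)
 show "space (V (fst z) (snd z)) = state_space" using sets_eq_imp_space_eq[OF s] by (simp add: space_restrict_space)
qed

lemma initial_fields: "\<rho> 0 x = \<rho>0 x" "m 0 x = m0 x" "E 0 x = E0 x" using sol by (auto simp: strong_solution_def)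

lemma expect_V0:
 fixes f :: "'n state => 'b::{banach, second_countable_topology}"
 assumes "f : borel_measurable borel" shows "expect (V0 x) f = f (\<rho> 0 x, m 0 x, E 0 x)"
proof -
 have "(\<rho>0 x, m0 x, E0 x) : state_space" using rpos[of 0 x] E_pos[of 0 x] T by (simp add: initial_fields state_space_def dens_def ener_def less_imp_le)
 then show ?thesis unfolding expect_def initial_fields by (intro integral_return measurable_restrict_space1[OF assms]) (simp add: space_restrict_space)
qed

lemma measurable_observables:
 "dens : borel_measurable (borel :: 'n state measure)" "mom : borel_measurable (borel :: 'n state measure)"
 "ener : borel_measurable (borel :: 'n state measure)"
 "(%U. dens U * S_eta \<gamma> (%s. min (s + b) K) U) : borel_measurable (borel :: 'n state measure)"
proof -
 show [measurable]: "dens : borel_measurable (borel :: 'n state measure)" "mom : borel_measurable (borel :: 'n state measure)"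
  "ener : borel_measurable (borel :: 'n state measure)"
  unfolding dens_def[abs_def] mom_def[abs_def] ener_def[abs_def] by (auto intro!: borel_measurable_continuous_onI continuous_intros)
 show "(%U. dens U * S_eta \<gamma> (%s. min (s + b) K) U) : borel_measurable (borel :: 'n state measure)" unfolding S_eta_def internal_energy_def by measurable
qed

definition "F K z = ex ener z - ex mom z \<bullet> uvec (fst z) (snd z) + ex dens z * dens_mult (fst z) (snd z)
 - ex (%U. dens U * trunc K U) z * temp (fst z) (snd z) + prs (fst z) (snd z)"
definition "H K z = - (ex mom z \<bullet> dt uvec (fst z) (snd z)) - ex convective_flux z \<bullet> jac (uvec (fst z)) (snd z)
  - (\<gamma> - 1) * ex internal_energy z * divergence (uvec (fst z)) (snd z) + ex dens z * dt dens_mult (fst z) (snd z)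
  + ex mom z \<bullet> grad (dens_mult (fst z)) (snd z)
  - ex (%U. dens U * trunc K U) z * dt temp (fst z) (snd z)
  - ex (%U. trunc K U *\<^sub>R mom U) z \<bullet> grad (temp (fst z)) (snd z) + work (fst z) (snd z)"
definition "d z = expect (V0 (snd z)) ener - ex ener z"

lemma cutoffs: "entropy_cutoff (%s. min s K)" "entropy_cutoff (%s. min (s + b) K)" using entropy_cutoff_min[of 0 K] entropy_cutoff_min[of b K] by simp_all

lemma expect_combinations:
 assumes z: "z : {0<..<T} \<times> torus"
  and i: "integrable (V (fst z) (snd z)) dens" "integrable (V (fst z) (snd z)) mom" "integrable (V (fst z) (snd z)) ener"
   "integrable (V (fst z) (snd z)) convective_flux" "integrable (V (fst z) (snd z)) internal_energy"
   "integrable (V (fst z) (snd z)) (%U. dens U * trunc K U)" "integrable (V (fst z) (snd z)) (%U. trunc K U *\<^sub>R mom U)"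
 shows "has_bochner_integral (V (fst z) (snd z)) (RE K (fst z) (snd z)) (F K z)"
  and "has_bochner_integral (V (fst z) (snd z)) (production K (fst z) (snd z)) (H K z)"
proof -
 interpret prob_space "V (fst z) (snd z)" by (rule V_prob[OF z])
 note b = i[THEN has_bochner_integral_integrable]
 have c: "has_bochner_integral (V (fst z) (snd z)) (%U. a) (a :: real)" for a by (simp add: has_bochner_integral_iff prob_space)
 note rules = has_bochner_integral_add has_bochner_integral_diff has_bochner_integral_minus has_bochner_integral_mult_left has_bochner_integral_inner_left b c
 show "has_bochner_integral (V (fst z) (snd z)) (RE K (fst z) (snd z)) (F K z)" unfolding RE_def[abs_def] F_def ex_def expect_def by (intro rules)
 show "has_bochner_integral (V (fst z) (snd z)) (production K (fst z) (snd z)) (H K z)"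
  unfolding production_def[abs_def] H_def ex_def expect_def by (intro rules has_bochner_integral_mult_right)
qed

lemma AE_integrable_observables:
 "AE z in spacetime T. z : {0<..<T} \<times> torus & (AE U in V (fst z) (snd z). U : finite_entropy_states) \<and>
   integrable (V (fst z) (snd z)) dens & integrable (V (fst z) (snd z)) mom & integrable (V (fst z) (snd z)) ener \<and>
   integrable (V (fst z) (snd z)) convective_flux & integrable (V (fst z) (snd z)) internal_energy \<and>
   integrable (V (fst z) (snd z)) (%U. dens U * trunc K U) & integrable (V (fst z) (snd z)) (%U. trunc K U *\<^sub>R mom U)"
proof -
 have "AE z in spacetime T. z : {0<..<T} \<times> torus" by (rule AE_I2) (simp add: space_spacetime)
 then show ?thesis using dmv_parts(2) dmv_parts(3-7)[unfolded integrable_expect_def, THEN conjunct1]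
   dmv_parts(8,9)[OF cutoffs(1)[of K], unfolded integrable_expect_def, THEN conjunct1] by eventually_elim simp
qed

lemma strip_conts:
 "strip_cont T (%z. uvec (fst z) (snd z))" "strip_cont T (%z. dt uvec (fst z) (snd z))"
 "strip_cont T (%z. jac (uvec (fst z)) (snd z))" "strip_cont T (%z. divergence (uvec (fst z)) (snd z))"
 "strip_cont T (%z. dens_mult (fst z) (snd z))" "strip_cont T (%z. dt dens_mult (fst z) (snd z))" "strip_cont T (%z. grad (dens_mult (fst z)) (snd z))"
 "strip_cont T (%z. temp (fst z) (snd z))" "strip_cont T (%z. dt temp (fst z) (snd z))" "strip_cont T (%z. grad (temp (fst z)) (snd z))"
 "strip_cont T (%z. prs (fst z) (snd z))" "strip_cont T (%z. work (fst z) (snd z))"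
 using C1_strip_cont[OF C1_uvec] C1_strip_cont_jac[OF C1_uvec] C1_strip_cont[OF C1_derived(3)] C1_strip_cont_grad[OF C1_derived(3)]
  C1_strip_cont[OF C1_derived(1)] C1_strip_cont_grad[OF C1_derived(1)] C1_strip_cont[OF C1_prs] unfolding work_def par_def option.case
 by (auto intro!: strip_cont_add strip_cont_sum C1_strip_cont(3)[OF C1_strip_mult[OF C1_prs C1_vel]])

lemma strip_cont_integrable_mult:
 fixes f g :: "real \<times> (real^'n) => real"
 assumes "integrable (spacetime T) f" "strip_cont T g" shows "integrable (spacetime T) (%z. f z * g z)" using strip_cont_integrable[OF assms] by simp

lemma strip_cont_integrable1:
 fixes g :: "real \<times> (real^'n) => real"
 assumes "strip_cont T g" shows "integrable (spacetime T) g"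
proof -
 interpret finite_measure "spacetime T :: (real \<times> (real^'n)) measure" by (rule finite_measure_spacetime)
 show ?thesis using strip_cont_integrable_mult[OF _ assms, of "%z. 1"] by simp
qed

lemma V0_ener: "expect (V0 x) ener = E 0 x" using expect_V0[OF measurable_observables(3), of x] by (simp add: ener_def)

lemma cont0: "C1_strip T f ==> continuous_on UNIV (f 0)"
 using C1_strip_differentiable[of T f 0] T by (intro continuous_at_imp_continuous_on) (auto intro: differentiable_imp_continuous_within)

lemma FHd_integrable: "integrable (spacetime T) (F K)" "integrable (spacetime T) (H K)" "integrable (spacetime T) d"
proof -
 note I = strip_cont_integrable strip_cont_integrable_mult integrable_sum2 Bochner_Integration.integrable_diff Bochner_Integration.integrable_minus expect_parts cutoffs strip_conts(1-10) strip_conts(11,12)[THEN strip_cont_integrable1]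
 show "integrable (spacetime T) (F K)" unfolding F_def[abs_def] by (intro I)
 show "integrable (spacetime T) (H K)" unfolding H_def[abs_def] by (intro I Bochner_Integration.integrable_mult_right)
 have "integrable (spacetime T) (%z. 1 * E 0 (snd z))" using spacetime_integral_product(1)[of "%t. 1" "E 0" T] cont0[OF C1_basic(3)] by simp
 then show "integrable (spacetime T) d" unfolding d_def[abs_def] V0_ener by (intro I) simp
qed

text \<open>
  The energy inequality, integrated in time.
\<close>
lemma energy_defect_nonneg:
 assumes c: "continuous_on UNIV \<psi>" and \<psi>: "!!t. t : {0<..<T} ==> 0 <= \<psi> t" shows "0 <= (LINT z|spacetime T. \<psi> (fst z) * d z)"
proof -
 have i: "integrable (spacetime T) (%z. \<psi> (fst z) * d z)"
  using strip_cont_integrable_mult[OF FHd_integrable(3) strip_cont_fst[OF c]] by (simp add: mult.commute)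
 have sl: "AE t in lebesgue_on {0<..<T}. integrable \<Omega> (%x. ex ener (t, x))"
  by (rule AE_integrable_slice[OF torus_lebesgue_sets expect_parts(3)[unfolded spacetime_def]])
 have "AE t in lebesgue_on {0<..<T}. t : {0<..<T}" by (rule AE_I2) simp
 then have "AE t in lebesgue_on {0<..<T}. 0 <= (LINT x|\<Omega>. \<psi> t * d (t, x))" using dmv_parts(11) sl
 proof eventually_elim
  case (elim t)
  have "(LINT x|\<Omega>. d (t, x)) = (LINT x|\<Omega>. expect (V0 x) ener) - (LINT x|\<Omega>. expect (V t x) ener)"
   unfolding d_def using elim(3) torus_integrable_continuous[OF cont0[OF C1_basic(3)]] by (simp add: V0_ener ex_def Bochner_Integration.integral_diff)
  then have "0 <= (LINT x|\<Omega>. d (t, x))" using elim(2) by linarith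
  then show ?case using \<psi>[OF elim(1)] by simp
 qed
 from integral_nonneg_AE[OF this]
 show ?thesis unfolding spacetime_def using Fubini_lebesgue_on[OF torus_lebesgue_sets i[unfolded spacetime_def]] by simp
qed

end

lemma mm_integral_cong:
 assumes "is_matrix_measure X \<mu>" "!!z. z : space X ==> \<Phi> z = \<Psi> z" shows "mm_integral \<mu> \<Phi> = mm_integral \<mu> \<Psi>"
proof -
 have "space (fst (\<mu> i j)) = space X" "space (snd (\<mu> i j)) = space X" for i j
  using assms(1) unfolding is_matrix_measure_def by (meson sets_eq_imp_space_eq)+
 then show ?thesis using assms(2) unfolding mm_integral_def by (intro sum.cong refl arg_cong2[where f="(-)"] lint_cong) auto
qed

lemma bump_components:
 assumes tl: "0 < \<tau>" "lam \<ge> 0" and t: "t : {0..T}"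
 shows "C1_strip T w ==> grad (%x. bump lam \<tau> t *\<^sub>R w t x) x = bump lam \<tau> t *\<^sub>R grad (w t) x"
  and "C1_strip T v ==> jac (%x. bump lam \<tau> t *\<^sub>R v t x) x = bump lam \<tau> t *\<^sub>R jac (v t) x"
  and "C1_strip T v ==> divergence (%x. bump lam \<tau> t *\<^sub>R v t x) x = bump lam \<tau> t * divergence (v t) x"
proof -
 show "grad (%x. bump lam \<tau> t *\<^sub>R w t x) x = bump lam \<tau> t *\<^sub>R grad (w t) x" if "C1_strip T w"
  using bump_mult_strip(3)[OF tl that t] by (simp add: grad_def vec_eq_iff)
 have c: "pd j (%y. (bump lam \<tau> t *\<^sub>R v t y) $ i) x = bump lam \<tau> t * pd j (%y. v t y $ i) x" if "C1_strip T v" for i j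
  using bump_mult_strip(3)[OF tl C1_strip_vec_nth[OF that] t] by simp
 show "jac (%x. bump lam \<tau> t *\<^sub>R v t x) x = bump lam \<tau> t *\<^sub>R jac (v t) x" if "C1_strip T v"
  by (simp only: jac_def vec_eq_iff vec_lambda_beta vector_scaleR_component real_scaleR_def c[OF that, unfolded vector_scaleR_component real_scaleR_def] simp_thms)
 show "divergence (%x. bump lam \<tau> t *\<^sub>R v t x) x = bump lam \<tau> t * divergence (v t) x" if "C1_strip T v"
  unfolding divergence_def c[OF that] by (simp add: sum_distrib_left)
qed

lemma C1_strip_jac_closed:
 fixes f :: "real => real^'n => real^'n"
 assumes "C1_strip T f"
 obtains B where "B \<ge> 0" "!!t x. t : {0..T} ==> x : torus ==> norm (jac (f t) x) <= B"
  "!!i j. (%z. jac (f (fst z)) (snd z) $ i $ j) : borel_measurable (restrict_space borel ({0..T} \<times> torus))"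
proof -
 have "EX g. continuous_on (strip T) g & (ALL t:{0..T}. ALL x. pd j (%y. f t y $ i) x = g (t, x))" for i j
 proof (rule C1_strip_partials[OF C1_strip_vec_nth[OF assms, of i]])
  fix fx :: "'n => real \<times> (real^'n) => real"
  assume "!!j. continuous_on (strip T) (fx j)" and "!!t x j. t : {0..T} ==> pd j (%y. f t y $ i) x = fx j (t, x)"
  then show ?thesis by (intro exI[of _ "fx j"]) simp
 qed
 note ex = this
 define g where "g = (%i j. SOME g. continuous_on (strip T) g & (ALL t:{0..T}. ALL x. pd j (%y. f t y $ i) x = g (t, x)))"
 have "continuous_on (strip T) (g i j) & (ALL t:{0..T}. ALL x. pd j (%y. f t y $ i) x = g i j (t, x))" for i j unfolding g_def by (rule someI_ex[OF ex])
 then have g: "!!i j. continuous_on (strip T) (g i j)" "!!i j t x. t : {0..T} ==> pd j (%y. f t y $ i) x = g i j (t, x)" by blast+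
 have e: "jac (f t) x = (\<chi> i j. g i j (t, x))" if "t : {0..T}" for t x unfolding jac_def g(2)[OF that] ..
 have "continuous_on ({0..T} \<times> cbox 0 1) (%z. \<chi> i j. g i j z)" by (intro continuous_on_vec_lambda continuous_on_subset[OF g(1)]) auto
 then obtain B where B: "B > 0" "!!z. z : {0..T} \<times> cbox 0 1 ==> norm (\<chi> i j. g i j z) <= B"
  using compact_norm_bound[OF compact_Times[OF compact_Icc compact_cbox]] by blast
 show ?thesis
 proof (rule that[of B])
  show "norm (jac (f t) x) <= B" if "t : {0..T}" "x : torus" for t x using B(2)[of "(t, x)"] that torus_subset_cbox by (auto simp: e)
  show "(%z. jac (f (fst z)) (snd z) $ i $ j) : borel_measurable (restrict_space borel ({0..T} \<times> torus))" for i j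
  proof -
   have "g i j : borel_measurable (restrict_space borel ({0..T} \<times> torus))"
    by (intro borel_measurable_continuous_on_restrict continuous_on_subset[OF g(1)]) auto
   then show ?thesis by (rule measurable_cong[THEN iffD1, rotated]) (auto simp: space_restrict_space e)
  qed
 qed (use B in simp)
qed

context dissipative_euler begin

text \<open>
  The cut-off \<open>min (s + S) 0\<close> vanishes at the initial state, and the test function depends on time only. So
  the integral of a nonnegative function, with a positive weight, is at most zero.
\<close>
lemma dmv_min_entropy:
 assumes S: "!!x. x : torus ==> - S <= entr 0 x" shows "AE z in spacetime T. AE U in V (fst z) (snd z). dens U > 0 --> - S <= spec_entropy \<gamma> U"
proof -
 let ?\<eta> = "%s. min (s + S) 0"
 let ?f = "%U :: 'n state. dens U * S_eta \<gamma> ?\<eta> U"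
 have init: "expect (V0 x) ?f = 0" if x: "x : torus" for x
 proof -
  have "spec_entropy \<gamma> (\<rho> 0 x, m 0 x, E 0 x) = entr 0 x"
  proof -
   have "spec_entropy \<gamma> (\<rho> 0 x, m 0 x, E 0 x) = 1 / (\<gamma> - 1) * ln (prs 0 x / \<rho> 0 x powr \<gamma>)"
    by (simp add: spec_entropy_def prs_def pressure_def dens_def)
   then show ?thesis using prs_pos[of 0 x] rpos[of 0 x] T by (simp add: entr_def ln_div ln_powr)
  qed
  then have "S_eta \<gamma> ?\<eta> (\<rho> 0 x, m 0 x, E 0 x) = 0" using S[OF x] by (simp add: S_eta_def spec_entropy_def)
  then show ?thesis unfolding expect_V0[OF measurable_observables(4)] by simp
 qed
 have le: "(LINT z|spacetime T. exp (- 0 * fst z) * max 0 (1 - fst z / \<tau>) * - ex ?f z) <= 0" if tau: "0 < \<tau>" "\<tau> < T" for \<tau>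
 proof -
  have c1: "C1_strip T (%t x. 1 :: real)" by (rule C1_strip_const)
  let ?\<phi> = "%t (x :: real^'n). bump 0 \<tau> t *\<^sub>R (1 :: real)"
  have tf: "test_fun T ?\<phi>" by (rule bump_test_fun[OF tau order_refl c1]) (simp add: periodic_def)
  have "integral_st T (%t x. expect (V t x) ?f * dt ?\<phi> t x + expect (V t x) (%U. S_eta \<gamma> ?\<eta> U *\<^sub>R mom U) \<bullet> grad (?\<phi> t) x)
    <= - (LINT x|\<Omega>. expect (V0 x) ?f * ?\<phi> 0 x)" by (rule dmv_parts(12)[OF cutoffs(2) tf]) (use bump_props(3)[OF tau(1) order_refl] in simp)
  also have "(LINT x|\<Omega>. expect (V0 x) ?f * ?\<phi> 0 x) = (LINT x|lebesgue_on (torus :: (real^'n) set). 0)" by (intro lint_cong refl) (simp add: init)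
  also have "integral_st T (%t x. expect (V t x) ?f * dt ?\<phi> t x + expect (V t x) (%U. S_eta \<gamma> ?\<eta> U *\<^sub>R mom U) \<bullet> grad (?\<phi> t) x)
    = (LINT z|spacetime T. 2 / \<tau> * (exp (- 0 * fst z) * max 0 (1 - fst z / \<tau>) * - ex ?f z))" unfolding integral_st_def
  proof (intro lint_cong refl)
   fix z :: "real \<times> (real^'n)" assume "z : space (spacetime T)"
   then have t: "fst z : {0<..<T}" "fst z : {0..T}" by (auto simp: space_spacetime)
   have p: "pd s (%x::real^'n. 1::real) y = 0" "dt (%t (x::real^'n). 1::real) r y = 0" for s y r by (simp_all add: pd_def dt_def)
   have "grad (?\<phi> (fst z)) (snd z) = 0" unfolding bump_components(1)[OF tau(1) order_refl t(2) c1] by (simp add: grad_def p vec_eq_iff)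
   moreover have "dt ?\<phi> (fst z) (snd z) = - (2 / \<tau> * max 0 (1 - fst z / \<tau>))"
    unfolding bump_mult_strip(2)[OF tau(1) order_refl c1 t(1)] p by (simp add: bump'_def)
   ultimately show "expect (V (fst z) (snd z)) ?f * dt ?\<phi> (fst z) (snd z) + expect (V (fst z) (snd z)) (%U. S_eta \<gamma> ?\<eta> U *\<^sub>R mom U) \<bullet> grad (?\<phi> (fst z)) (snd z)
     = 2 / \<tau> * (exp (- 0 * fst z) * max 0 (1 - fst z / \<tau>) * - ex ?f z)" by (simp add: ex_def)
  qed
  also have "... = 2 / \<tau> * (LINT z|spacetime T. exp (- 0 * fst z) * max 0 (1 - fst z / \<tau>) * - ex ?f z)" by (rule integral_mult_right_zero)
  finally have "2 / \<tau> * (LINT z|spacetime T. exp (- 0 * fst z) * max 0 (1 - fst z / \<tau>) * - ex ?f z) <= 2 / \<tau> * 0" by (simp only: Bochner_Integration.integral_zero minus_zero mult_zero_right)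
  then show ?thesis by (rule mult_left_le_imp_le) (use tau in simp)
 qed
 have sp: "AE z in spacetime T. z : {0<..<T} \<times> torus" by (rule AE_I2) (simp add: space_spacetime)
 have fU: "?f U <= 0" if "U : state_space" for U :: "'n state" using that by (intro mult_nonneg_nonpos) (auto simp: state_space_def S_eta_def)
 have int: "AE z in spacetime T. integrable (V (fst z) (snd z)) ?f" using dmv_parts(8)[OF cutoffs(2)] unfolding integrable_expect_def by blast
 have nonneg: "AE z in spacetime T. 0 <= - ex ?f z" using sp
 proof eventually_elim
  case (elim z)
  have "0 <= (LINT U|V (fst z) (snd z). - ?f U)" by (rule Bochner_Integration.integral_nonneg) (use fU V_prob(2)[OF elim] in simp)
  then show ?case by (simp add: ex_def expect_def)
 qed
 have "AE z in spacetime T. - ex ?f z = 0" by (rule AE_zero_of_weighted_integrals[OF _ nonneg T le]) (use expect_parts(6)[OF cutoffs(2)] in simp_all)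
 then show ?thesis using sp int
 proof eventually_elim
  case (elim z)
  have n: "AE U in V (fst z) (snd z). 0 <= - ?f U" by (rule AE_I2) (use fU V_prob(2)[OF elim(2)] in simp)
  have i: "integrable (V (fst z) (snd z)) (%U. - ?f U)" using elim(3) by simp
  have "(LINT U|V (fst z) (snd z). - ?f U) = 0" using elim(1) by (simp add: ex_def expect_def)
  then have "AE U in V (fst z) (snd z). - ?f U = 0" using integral_nonneg_eq_0_iff_AE[OF i n] by simp
  then show ?case by eventually_elim (auto simp: S_eta_def spec_entropy_def min_def split: if_splits)
 qed
qed

text \<open>
  \<open>AM\<close>, \<open>AC\<close>, \<open>AS\<close> are the integrands of the momentum, continuity and entropy relations for the test
  functions \<open>\<psi> u\<close>, \<open>\<psi> a\<close>, \<open>\<psi> \<theta>\<close>. The contributions of \<open>p\<close> and of the initial energy are exact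
  integrals. The initial terms cancel, since the relative energy of the initial state is zero.
\<close>
lemma relative_energy_inequality:
 assumes K: "!!x. x : torus ==> entr 0 x <= K" and tau: "0 < \<tau>" "\<tau> < T" and lam: "lam \<ge> 0"
  and B: "B \<ge> 0" "!!t x. t : {0..T} ==> x : torus ==> norm (jac (uvec t) x) <= B"
  and Jm: "!!i j. (%z. jac (uvec (fst z)) (snd z) $ i $ j) : borel_measurable (restrict_space borel ({0..T} \<times> torus))"
 shows "(LINT z|spacetime T. - bump' lam \<tau> (fst z) * (F K z + d z))
   <= (LINT z|spacetime T. bump lam \<tau> (fst z) * H K z) + B * c CARD('n) \<gamma> * (LINT z|spacetime T. bump lam \<tau> (fst z) * d z)"
proof -
 note tl = tau(1) lam
 let ?\<psi> = "%z :: real \<times> (real^'n). bump lam \<tau> (fst z)"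
 let ?\<psi>' = "%z :: real \<times> (real^'n). bump' lam \<tau> (fst z)"
 let ?\<eta> = "%s. min s K"
 let ?DS = "%U :: 'n state. dens U * S_eta \<gamma> ?\<eta> U"
 let ?SM = "%U :: 'n state. S_eta \<gamma> ?\<eta> U *\<^sub>R mom U"
 have t0: "(0::real) : {0..T}" using T by simp
 have sc: "strip_cont T ?\<psi>" "strip_cont T ?\<psi>'" using bump_props(7,2)[OF tl] by (auto intro: strip_cont_fst)
 define AM where "AM = (%z. ex mom z \<bullet> (?\<psi>' z *\<^sub>R uvec (fst z) (snd z) + ?\<psi> z *\<^sub>R dt uvec (fst z) (snd z))
   + ex convective_flux z \<bullet> (?\<psi> z *\<^sub>R jac (uvec (fst z)) (snd z)) + ((\<gamma> - 1) * ex internal_energy z) * (?\<psi> z * divergence (uvec (fst z)) (snd z)))"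
 define AC where "AC = (%z. ex dens z * (?\<psi>' z * dens_mult (fst z) (snd z) + ?\<psi> z * dt dens_mult (fst z) (snd z)) + ex mom z \<bullet> (?\<psi> z *\<^sub>R grad (dens_mult (fst z)) (snd z)))"
 define AS where "AS = (%z. ex ?DS z * (?\<psi>' z * temp (fst z) (snd z) + ?\<psi> z * dt temp (fst z) (snd z)) + ex ?SM z \<bullet> (?\<psi> z *\<^sub>R grad (temp (fst z)) (snd z)))"
 define AP where "AP = (%z. ?\<psi>' z * prs (fst z) (snd z) + ?\<psi> z * par None prs (fst z) (snd z))"
 define AD where "AD = (%z. \<Sum>s. ?\<psi> z * par (Some s) (%t x. prs t x * vel s t x) (fst z) (snd z))"
 define AE0 where "AE0 = (%z. ?\<psi>' z * E 0 (snd z))"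
 have split: "- ?\<psi>' z * (F K z + d z) - ?\<psi> z * H K z = AM z - AC z + AS z - AP z - AD z - AE0 z" for z
  unfolding AM_def AC_def AS_def AP_def AD_def AE0_def F_def H_def d_def V0_ener work_def inner_add_right inner_scaleR_right sum_distrib_left[symmetric]
  by (simp add: par_def algebra_simps)
 note I = strip_cont_integrable strip_cont_integrable_mult integrable_sum2 expect_parts(1-5) expect_parts(6,7)[OF cutoffs(1)] Bochner_Integration.integrable_mult_right strip_cont_add strip_cont_mult strip_cont_scaleR sc strip_conts
 have iM: "integrable (spacetime T) AM" unfolding AM_def by (intro I)
 have iC: "integrable (spacetime T) AC" unfolding AC_def by (intro I)
 have iS: "integrable (spacetime T) AS" unfolding AS_def by (intro I)
 have iP: "integrable (spacetime T) AP" unfolding AP_def par_def option.case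
  by (intro strip_cont_integrable1 strip_cont_add strip_cont_mult sc strip_conts C1_strip_cont(2)[OF C1_prs])
 have per: "periodic (%x. prs t x * vel s t x)" if "t : {0..T}" for t s using periodic_fields(4,5)[OF that] by (simp add: periodic_def)
 note Z = spatial_derivative_integral_zero[OF bump_props(7)[OF tl] C1_strip_mult[OF C1_prs C1_vel] per]
 have iD: "integrable (spacetime T) AD" and D0: "integral\<^sup>L (spacetime T) AD = 0"
  unfolding AD_def using Z by (auto simp: lint_sum intro!: Bochner_Integration.integrable_sum)
 have cE: "continuous_on UNIV (E 0)" by (rule cont0[OF C1_basic(3)])
 have iE: "integrable (spacetime T) AE0" unfolding AE0_def by (rule spacetime_integral_product(1)[OF bump_props(2)[OF tl] cE])
 have E1: "integral\<^sup>L (spacetime T) AE0 = - (LINT x|\<Omega>. E 0 x)"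
 proof -
  have "(LINT z|spacetime T. ?\<psi>' z * 1) = (LINT t|lebesgue_on {0<..<T}. bump' lam \<tau> t) * (LINT x|lebesgue_on (torus :: (real^'n) set). 1)"
   by (rule spacetime_integral_product(2)[OF bump_props(2)[OF tl]]) simp
  moreover have "(LINT z|spacetime T. ?\<psi>' z * 1) = - 1"
   using bump_time_identity[OF tau lam C1_strip_const, where 'n='n, of 1] measure_torus[where 'n='n] by (simp add: par_def dt_def)
  ultimately have "(LINT t|lebesgue_on {0<..<T}. bump' lam \<tau> t) = - 1" using measure_torus[where 'n='n] by simp
  then show ?thesis unfolding AE0_def using spacetime_integral_product(2)[OF bump_props(2)[OF tl] cE] by simp
 qed
 have P1: "integral\<^sup>L (spacetime T) AP = - (LINT x|\<Omega>. prs 0 x)" unfolding AP_def by (rule bump_time_identity[OF tau lam C1_prs])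
 have st: "fst z : {0<..<T}" "fst z : {0..T}" if "z : space (spacetime T :: (real \<times> (real^'n)) measure)" for z using that by (auto simp: space_spacetime)
 have pu: "periodic (uvec t)" if "t : {0..T}" for t using periodic_fields(4)[OF that] by (simp add: periodic_def uvec_def)
 let ?a = "%t x. bump lam \<tau> t *\<^sub>R dens_mult t x"
 have C1: "integral\<^sup>L (spacetime T) AC = - (LINT x|\<Omega>. \<rho> 0 x * dens_mult 0 x)"
 proof -
  have "integral\<^sup>L (spacetime T) AC = integral_st T (%t x. expect (V t x) dens * dt ?a t x + expect (V t x) mom \<bullet> grad (?a t) x)"
   unfolding integral_st_def AC_def ex_def by (intro lint_cong refl)
    (simp only: bump_components(1)[OF tl st(2) C1_derived(3)] bump_mult_strip(2)[OF tl C1_derived(3) st(1)], simp)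
  also have "... = - (LINT x|\<Omega>. expect (V0 x) dens * ?a 0 x)" by (rule dmv_parts(10), rule bump_test_fun[OF tau lam C1_derived(3) periodic_derived(3)])
  finally show ?thesis by (simp add: expect_V0[OF measurable_observables(1)] bump_props(6)[OF tl] dens_def)
 qed
 let ?t = "%t x. bump lam \<tau> t *\<^sub>R temp t x"
 have DS0: "expect (V0 x) ?DS = \<rho> 0 x * entr 0 x" if x: "x : torus" for x
 proof -
  have "S_eta \<gamma> ?\<eta> (\<rho> 0 x, m 0 x, E 0 x) = min (1 / (\<gamma> - 1) * ln (prs 0 x / \<rho> 0 x powr \<gamma>)) K"
   by (simp add: S_eta_def prs_def pressure_def dens_def)
  also have "1 / (\<gamma> - 1) * ln (prs 0 x / \<rho> 0 x powr \<gamma>) = entr 0 x"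
   using prs_pos[OF t0, of x] rpos[OF t0, of x] by (simp add: entr_def ln_div ln_powr)
  finally have "S_eta \<gamma> ?\<eta> (\<rho> 0 x, m 0 x, E 0 x) = entr 0 x" using K[OF x] by simp
  then show ?thesis using expect_V0[OF measurable_observables(4)[of 0 K], of x] by (simp add: dens_def)
 qed
 have S1: "integral\<^sup>L (spacetime T) AS <= - (LINT x|\<Omega>. \<rho> 0 x * entr 0 x * temp 0 x)"
 proof -
  have "integral\<^sup>L (spacetime T) AS = integral_st T (%t x. expect (V t x) ?DS * dt ?t t x + expect (V t x) ?SM \<bullet> grad (?t t) x)"
   unfolding integral_st_def AS_def ex_def by (intro lint_cong refl)
    (simp only: bump_components(1)[OF tl st(2) C1_derived(1)] bump_mult_strip(2)[OF tl C1_derived(1) st(1)], simp)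
  also have "... <= - (LINT x|\<Omega>. expect (V0 x) ?DS * ?t 0 x)"
   by (rule dmv_parts(12)[OF cutoffs(1)], rule bump_test_fun[OF tau lam C1_derived(1) periodic_derived(1)])
    (auto intro!: mult_nonneg_nonneg bump_props(3)[OF tl] less_imp_le[OF temp_pos])
  also have "(LINT x|\<Omega>. expect (V0 x) ?DS * ?t 0 x) = (LINT x|\<Omega>. \<rho> 0 x * entr 0 x * temp 0 x)"
   by (intro lint_cong refl) (simp add: DS0 bump_props(6)[OF tl])
  finally show ?thesis .
 qed
 let ?u = "%t x. bump lam \<tau> t *\<^sub>R uvec t x"
 obtain \<mu> where mm: "is_matrix_measure (restrict_space borel ({0..T} \<times> torus)) \<mu>"
  and momeq: "!!\<phi>. test_fun T \<phi> ==> integral_st T (%t x. expect (V t x) mom \<bullet> dt \<phi> t x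
     + expect (V t x) convective_flux \<bullet> jac (\<phi> t) x + (\<gamma> - 1) * expect (V t x) internal_energy * divergence (\<phi> t) x)
     = - (LINT x|\<Omega>. expect (V0 x) mom \<bullet> \<phi> 0 x) + mm_integral \<mu> (%z. jac (\<phi> (fst z)) (snd z))"
  and var: "!!\<tau>. 0 <= \<tau> ==> \<tau> < T ==> mm_variation (restrict_space borel ({0..T} \<times> torus)) \<mu> ({0..\<tau>} \<times> torus)
     <= c CARD('n) \<gamma> * integral_st \<tau> (%t x. d (t, x))" using dmv_parts(13) unfolding d_def ex_def fst_conv snd_conv by blast
 have mmb: "\<bar>mm_integral \<mu> (%z. bump lam \<tau> (fst z) *\<^sub>R jac (uvec (fst z)) (snd z))\<bar> <= B * c CARD('n) \<gamma> * (LINT z|spacetime T. ?\<psi> z * d z)"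
 proof (rule weighted_concentration_bound[OF mm bump_props(7)[OF tl] _ _ tau Jm _ B(1) FHd_integrable(3) var])
  show "s <= t ==> bump lam \<tau> t <= bump lam \<tau> s" for s t by (rule bump_props(8)[OF tl])
  show "\<tau> <= t ==> bump lam \<tau> t = 0" for t by (rule bump_props(4)[OF tl])
  show "norm (jac (uvec (fst z)) (snd z)) <= B" if "z : space (restrict_space borel ({0..T} \<times> torus))" for z
   using that by (intro B(2)) (auto simp: space_restrict_space)
 qed
 have M1: "integral\<^sup>L (spacetime T) AM = - (LINT x|\<Omega>. m 0 x \<bullet> uvec 0 x) + mm_integral \<mu> (%z. bump lam \<tau> (fst z) *\<^sub>R jac (uvec (fst z)) (snd z))"
 proof -
  have "integral\<^sup>L (spacetime T) AM = integral_st T (%t x. expect (V t x) mom \<bullet> dt ?u t x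
     + expect (V t x) convective_flux \<bullet> jac (?u t) x + (\<gamma> - 1) * expect (V t x) internal_energy * divergence (?u t) x)"
   unfolding integral_st_def AM_def ex_def by (intro lint_cong refl)
    (simp only: bump_components(2,3)[OF tl st(2) C1_uvec] bump_mult_strip(2)[OF tl C1_uvec st(1)])
  also have "... = - (LINT x|\<Omega>. expect (V0 x) mom \<bullet> ?u 0 x) + mm_integral \<mu> (%z. jac (?u (fst z)) (snd z))"
   by (rule momeq, rule bump_test_fun[OF tau lam C1_uvec pu])
  also have "mm_integral \<mu> (%z. jac (?u (fst z)) (snd z)) = mm_integral \<mu> (%z. bump lam \<tau> (fst z) *\<^sub>R jac (uvec (fst z)) (snd z))"
   by (rule mm_integral_cong[OF mm]) (auto simp: space_restrict_space bump_components(2)[OF tl _ C1_uvec])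
  finally have "integral\<^sup>L (spacetime T) AM = - (LINT x|\<Omega>. expect (V0 x) mom \<bullet> ?u 0 x) + mm_integral \<mu> (%z. bump lam \<tau> (fst z) *\<^sub>R jac (uvec (fst z)) (snd z))" .
  moreover have "expect (V0 x) mom = m 0 x" for x unfolding expect_V0[OF measurable_observables(2)] by (simp add: mom_def)
  ultimately show ?thesis by (simp add: bump_props(6)[OF tl])
 qed
 have init: "(LINT x|\<Omega>. m 0 x \<bullet> uvec 0 x) - (LINT x|\<Omega>. \<rho> 0 x * dens_mult 0 x) + (LINT x|\<Omega>. \<rho> 0 x * entr 0 x * temp 0 x)
   - (LINT x|\<Omega>. prs 0 x) - (LINT x|\<Omega>. E 0 x) = 0"
 proof -
  note ci = cont0[OF C1_basic(1)] cont0[OF C1_basic(2)] cont0[OF C1_basic(3)] cont0[OF C1_uvec] cont0[OF C1_derived(1)] cont0[OF C1_derived(2)] cont0[OF C1_derived(3)] cont0[OF C1_prs]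
  have i: "integrable \<Omega> (%x. m 0 x \<bullet> uvec 0 x)" "integrable \<Omega> (%x. \<rho> 0 x * dens_mult 0 x)"
   "integrable \<Omega> (%x. \<rho> 0 x * entr 0 x * temp 0 x)" "integrable \<Omega> (prs 0)" "integrable \<Omega> (E 0)"
   by (intro torus_integrable_continuous continuous_on_mult continuous_on_inner ci)+
  have z: "m 0 x \<bullet> uvec 0 x - \<rho> 0 x * dens_mult 0 x + \<rho> 0 x * entr 0 x * temp 0 x - prs 0 x - E 0 x = 0" for x
  proof -
   have r: "\<rho> 0 x > 0" by (rule rpos[OF t0])
   have pr: "prs 0 x = \<rho> 0 x * temp 0 x" using r by (simp add: temp_def)
   have mu: "m 0 x \<bullet> uvec 0 x = \<rho> 0 x * (\<Sum>i. vel i 0 x * vel i 0 x)" using r by (simp add: inner_vec_def uvec_def vel_def sum_distrib_left)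
   have E: "E 0 x = prs 0 x / (\<gamma> - 1) + m 0 x \<bullet> uvec 0 x / 2" using g by (simp add: prs_eq inner_vec_def uvec_def)
   have gg: "\<gamma> / (\<gamma> - 1) * y = y + y / (\<gamma> - 1)" for y using g by (simp add: field_simps)
   have "\<rho> 0 x * dens_mult 0 x = m 0 x \<bullet> uvec 0 x / 2 - (prs 0 x + prs 0 x / (\<gamma> - 1)) + \<rho> 0 x * entr 0 x * temp 0 x"
    unfolding dens_mult_def gg mu pr by (simp add: algebra_simps)
   then show ?thesis unfolding E by linarith
  qed
  have "(LINT x|\<Omega>. m 0 x \<bullet> uvec 0 x - \<rho> 0 x * dens_mult 0 x + \<rho> 0 x * entr 0 x * temp 0 x - prs 0 x - E 0 x) = 0" unfolding z by simp
  then show ?thesis using i by simp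
 qed
 have iFd: "integrable (spacetime T) (%z. - ?\<psi>' z * (F K z + d z))"
  using strip_cont_integrable_mult[OF integrable_sum2[OF FHd_integrable(1,3)] sc(2)] by (simp add: mult.commute)
 have iH: "integrable (spacetime T) (%z. ?\<psi> z * H K z)" using strip_cont_integrable_mult[OF FHd_integrable(2) sc(1)] by (simp add: mult.commute)
 have "(LINT z|spacetime T. - ?\<psi>' z * (F K z + d z)) - (LINT z|spacetime T. ?\<psi> z * H K z)
   = (LINT z|spacetime T. AM z - AC z + AS z - AP z - AD z - AE0 z)"
  unfolding split[symmetric] by (rule Bochner_Integration.integral_diff[OF iFd iH, symmetric])
 also have "... = integral\<^sup>L (spacetime T) AM - integral\<^sup>L (spacetime T) AC + integral\<^sup>L (spacetime T) AS - integral\<^sup>L (spacetime T) AP - integral\<^sup>L (spacetime T) AD - integral\<^sup>L (spacetime T) AE0"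
  using iM iC iS iP iD iE by simp
 finally show ?thesis using M1 C1 S1 P1 D0 E1 init mmb unfolding abs_le_iff by linarith
qed

end

section \<open>The convergence theorem\<close>

context strong_euler begin

text \<open>
  Integrating the energy equation against \<open>T - t\<close> yields the time average of the energy directly.
\<close>
lemma energy_conserved: "integral_st T E = T * (LINT x|\<Omega>. E 0 x)"
proof -
 let ?w = "%t (x :: real^'n). T - t"
 let ?e = "%s t x. (E t x + prs t x) * vel s t x"
 have C: "C1_strip T ?w"
 proof -
  have "C1_on (strip T) (fst :: real \<times> (real^'n) => real)" unfolding C1_on_def
   by (rule exI[of _ "%z. Blinfun fst"]) (auto simp: bounded_linear_Blinfun_apply[OF bounded_linear_fst] intro: derivative_eq_intros)
  then show ?thesis by (intro C1_strip_diff C1_strip_const) (simp add: case_prod_beta')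
 qed
 have Ce: "C1_strip T (?e s)" for s by (intro C1_strip_mult C1_strip_add C1_basic C1_prs C1_vel)
 have per: "periodic (?e s t)" if "t : {0..T}" for s t using periodic_fields(3-5)[OF that] by (simp add: periodic_def)
 have cw: "continuous_on UNIV (%t. T - t)" by (intro continuous_intros)
 have dE: "dt (%t x. ?w t x * E t x) t x = - E t x - (\<Sum>s. (T - t) * par (Some s) (?e s) t x)" if t: "t : {0<..<T}" for t x
 proof -
  have "(along None ?w t x has_real_derivative - 1) (at 0)" unfolding along_def option.case by (auto intro!: derivative_eq_intros)
  from DERIV_mult[OF this has_par[OF C1_basic(3) t]]
  have "(along None (%t x. ?w t x * E t x) t x has_real_derivative - E t x + par None E t x * (T - t)) (at 0)" unfolding along_mult by simp
  from par_eqI[OF C1_strip_mult[OF C C1_basic(3)] t this]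
  have "dt (%t x. ?w t x * E t x) t x = - E t x + par None E t x * (T - t)" by (simp add: par_def)
  moreover have "par None E t x = - (\<Sum>s. par (Some s) (?e s) t x)"
  proof -
   have "divergence (%y. energy_flux \<gamma> (\<rho> t y, m t y, E t y)) x = (\<Sum>s. par (Some s) (?e s) t x)" unfolding divergence_def par_def
    by (simp add: energy_flux_def velocity_def ener_def dens_def mom_def prs_def vel_def divide_inverse mult_ac)
   then show ?thesis using conservation_laws(3)[OF t, of x] by (simp add: par_def)
  qed
  ultimately show ?thesis by (simp add: sum_distrib_left mult.commute)
 qed
 note Z = spatial_derivative_integral_zero[OF cw Ce per]
 have iE: "integrable (spacetime T) (%z. E (fst z) (snd z))"
  by (rule bounded_integrable_spacetime) (use C1_on_continuous_on[OF C1_basic(3)] in \<open>simp add: case_prod_beta'\<close>)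
 have iD: "integrable (spacetime T) (%z. \<Sum>s. (T - fst z) * par (Some s) (?e s) (fst z) (snd z))"
  and D0: "(LINT z|spacetime T. (\<Sum>s. (T - fst z) * par (Some s) (?e s) (fst z) (snd z))) = 0"
  using Z by (auto simp: lint_sum intro!: Bochner_Integration.integrable_sum)
 have "integral_st T (dt (%t x. ?w t x * E t x)) = (LINT z|spacetime T. - E (fst z) (snd z) - (\<Sum>s. (T - fst z) * par (Some s) (?e s) (fst z) (snd z)))"
  unfolding integral_st_def by (intro lint_cong refl) (use dE in \<open>auto simp: space_spacetime\<close>)
 also have "... = - integral_st T E" using iE iD D0 by (simp add: integral_st_def)
 finally have "integral_st T E = - integral_st T (dt (%t x. ?w t x * E t x))" by simp
 also have "... = T * (LINT x|\<Omega>. E 0 x)" unfolding spacetime_time_derivative[OF T C1_strip_mult[OF C C1_basic(3)]] by simp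
 finally show ?thesis .
qed

end

context dissipative_euler begin

text \<open>
  \<open>lam\<close> exceeds the constants in the bounds of the production and of the concentration term. Then only
  the part \<open>2/\<tau> exp (-lam t) (1 - t/\<tau>)\<close> of \<open>-\<psi>'\<close> is left, acting on two nonnegative quantities.
\<close>
theorem young_measure_is_Dirac:
 "AE z in spacetime T. AE U in V (fst z) (snd z). U = (\<rho> (fst z) (snd z), m (fst z) (snd z), E (fst z) (snd z))"
proof -
 have "continuous_on ({0..T} \<times> cbox 0 1) (%z. entr (fst z) (snd z))"
  by (rule continuous_on_subset[of "{0..T} \<times> UNIV"]) (use C1_on_continuous_on[OF C1_derived(2)] in \<open>auto simp: case_prod_beta'\<close>)
 from compact_norm_bound[OF compact_Times[OF compact_Icc compact_cbox] this]
 obtain S where S0: "!!z. z : {0..T} \<times> cbox 0 1 ==> norm (entr (fst z) (snd z)) <= S" by blast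
 have S: "\<bar>entr t x\<bar> <= S" if "t : {0..T}" "x : torus" for t x using S0[of "(t, x)"] that torus_subset_cbox by auto
 have t0: "(0::real) : {0..T}" using T by simp
 have Slo: "- S <= entr 0 x" and Shi: "entr 0 x <= S + 1" if "x : torus" for x using S[OF t0 that] unfolding abs_le_iff by linarith+
 obtain C where C: "C \<ge> 0" "!!t x U. [|t : {0<..<T}; x : torus; U : state_space; U : finite_entropy_states; dens U > 0 ==> - S <= spec_entropy \<gamma> U|]
   ==> \<bar>production (S + 1) t x U\<bar> <= C * RE (S + 1) t x U & 0 <= RE (S + 1) t x U
    & (RE (S + 1) t x U = 0 --> U = (\<rho> t x, m t x, E t x))" using pointwise_control[of S, OF S] by blast
 define K where "K = S + 1"
 have me: "AE z in spacetime T. AE U in V (fst z) (snd z). dens U > 0 --> - S <= spec_entropy \<gamma> U" by (rule dmv_min_entropy) (rule Slo)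
 have key: "AE z in spacetime T. \<bar>H K z\<bar> <= C * F K z & 0 <= F K z \<and>
   (F K z = 0 --> (AE U in V (fst z) (snd z). U = (\<rho> (fst z) (snd z), m (fst z) (snd z), E (fst z) (snd z))))" using AE_integrable_observables[of K] me
 proof eventually_elim
  case (elim z)
  then have z: "z : {0<..<T} \<times> torus" and z': "fst z : {0<..<T}" "snd z : torus" by auto
  let ?V = "V (fst z) (snd z)"
  have hb: "has_bochner_integral ?V (RE K (fst z) (snd z)) (F K z)" "has_bochner_integral ?V (production K (fst z) (snd z)) (H K z)"
   using expect_combinations[OF z, of K] elim(1) by blast+
  have sp: "AE U in ?V. U : state_space" by (rule AE_I2) (simp add: V_prob(2)[OF z])
  have fe: "AE U in ?V. U : finite_entropy_states" using elim(1) by blast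
  have pw: "AE U in ?V. \<bar>production K (fst z) (snd z) U\<bar> <= C * RE K (fst z) (snd z) U & 0 <= RE K (fst z) (snd z) U
    & (RE K (fst z) (snd z) U = 0 --> U = (\<rho> (fst z) (snd z), m (fst z) (snd z), E (fst z) (snd z)))" using sp fe elim(2)
  proof eventually_elim
   case (elim U)
   show ?case unfolding K_def by (rule C(2)[OF z']) (use elim in auto)
  qed
  have iR: "integrable ?V (RE K (fst z) (snd z))" "F K z = (LINT U|?V. RE K (fst z) (snd z) U)"
   and iP: "integrable ?V (production K (fst z) (snd z))" "H K z = (LINT U|?V. production K (fst z) (snd z) U)"
   using hb by (auto simp: has_bochner_integral_iff)
  have nn: "AE U in ?V. 0 <= RE K (fst z) (snd z) U" using pw by eventually_elim simp
  have "\<bar>H K z\<bar> <= (LINT U|?V. \<bar>production K (fst z) (snd z) U\<bar>)" unfolding iP(2) by (rule integral_abs_bound)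
  also have "... <= (LINT U|?V. C * RE K (fst z) (snd z) U)" by (rule integral_mono_AE) (use iP(1) iR(1) pw in \<open>auto elim!: eventually_mono\<close>)
  also have "... = C * F K z" unfolding iR(2) by simp
  finally have 1: "\<bar>H K z\<bar> <= C * F K z" .
  have 2: "0 <= F K z" unfolding iR(2) by (rule integral_nonneg_AE[OF nn])
  have 3: "AE U in ?V. U = (\<rho> (fst z) (snd z), m (fst z) (snd z), E (fst z) (snd z))" if "F K z = 0"
  proof -
   have "AE U in ?V. RE K (fst z) (snd z) U = 0" using integral_nonneg_eq_0_iff_AE[OF iR(1) nn] that unfolding iR(2) by blast
   then show ?thesis using pw by eventually_elim simp
  qed
  show ?case using 1 2 3 by blast
 qed
 obtain B where B: "B \<ge> 0" "!!t x. t : {0..T} ==> x : torus ==> norm (jac (uvec t) x) <= B"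
  "!!i j. (%z. jac (uvec (fst z)) (snd z) $ i $ j) : borel_measurable (restrict_space borel ({0..T} \<times> torus))"
  by (rule C1_strip_jac_closed[OF C1_uvec]) blast
 define lam where "lam = max C (B * c CARD('n) \<gamma>)"
 have lam: "lam \<ge> 0" "C <= lam" "B * c CARD('n) \<gamma> <= lam" using C(1) by (auto simp: lam_def max.coboundedI1)
 have "AE z in spacetime T. F K z = 0"
 proof (rule AE_zero_of_weighted_integrals[OF FHd_integrable(1) _ T])
  show "AE z in spacetime T. 0 <= F K z" using key by eventually_elim simp
  fix \<tau> :: real assume tau: "0 < \<tau>" "\<tau> < T"
  note tl = tau(1) lam(1)
  let ?w = "%t. exp (- lam * t) * max 0 (1 - t / \<tau>)"
  have cw: "continuous_on UNIV ?w" using tau by (intro continuous_intros) auto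
  note cs = cw bump_props(7)[OF tl] bump_props(2)[OF tl]
  have i: "integrable (spacetime T) (%z. \<psi> (fst z) * f z)" if "continuous_on UNIV \<psi>" "integrable (spacetime T) f" for \<psi> :: "real => real" and f :: "real \<times> (real^'n) => real"
   using strip_cont_integrable_mult[OF that(2) strip_cont_fst[OF that(1)]] by (simp add: mult.commute)
  note FHd = FHd_integrable(1,2)[of K] FHd_integrable(3)
  define a where "a = (LINT z|spacetime T. ?w (fst z) * F K z)"
  define a' where "a' = (LINT z|spacetime T. ?w (fst z) * d z)"
  define b where "b = (LINT z|spacetime T. bump lam \<tau> (fst z) * F K z)"
  define b' where "b' = (LINT z|spacetime T. bump lam \<tau> (fst z) * d z)"
  have "(LINT z|spacetime T. - bump' lam \<tau> (fst z) * (F K z + d z)) = lam * b + 2 / \<tau> * a + (lam * b' + 2 / \<tau> * a')"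
  proof -
   have "- bump' lam \<tau> t * (x + y) = (lam * (bump lam \<tau> t * x) + 2 / \<tau> * (?w t * x)) + (lam * (bump lam \<tau> t * y) + 2 / \<tau> * (?w t * y))" for t x y
    by (simp add: bump'_def algebra_simps add_divide_distrib)
   then have "(LINT z|spacetime T. - bump' lam \<tau> (fst z) * (F K z + d z)) = (LINT z|spacetime T. (lam * (bump lam \<tau> (fst z) * F K z) + 2 / \<tau> * (?w (fst z) * F K z)) + (lam * (bump lam \<tau> (fst z) * d z) + 2 / \<tau> * (?w (fst z) * d z)))"
    by (simp only:)
   also have "... = (lam * b + 2 / \<tau> * a) + (lam * b' + 2 / \<tau> * a')" unfolding a_def a'_def b_def b'_def
    using i[OF cs(1) FHd(1)] i[OF cs(1) FHd(3)] i[OF cs(2) FHd(1)] i[OF cs(2) FHd(3)] by simp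
   finally show ?thesis by simp
  qed
  moreover have "(LINT z|spacetime T. - bump' lam \<tau> (fst z) * (F K z + d z)) <= (LINT z|spacetime T. bump lam \<tau> (fst z) * H K z) + B * c CARD('n) \<gamma> * b'"
   unfolding b'_def by (rule relative_energy_inequality[OF _ tau lam(1) B]) (use Shi in \<open>simp add: K_def\<close>)
  moreover have "(LINT z|spacetime T. bump lam \<tau> (fst z) * H K z) <= lam * b"
  proof -
   have "(LINT z|spacetime T. bump lam \<tau> (fst z) * H K z) <= (LINT z|spacetime T. lam * (bump lam \<tau> (fst z) * F K z))"
   proof (rule integral_mono_AE)
    show "AE z in spacetime T. bump lam \<tau> (fst z) * H K z <= lam * (bump lam \<tau> (fst z) * F K z)" using key
    proof eventually_elim
     case (elim z)
     have "H K z <= C * F K z" using elim unfolding abs_le_iff by simp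
     also have "... <= lam * F K z" using elim lam by (intro mult_right_mono) auto
     finally have "bump lam \<tau> (fst z) * H K z <= bump lam \<tau> (fst z) * (lam * F K z)" by (rule mult_left_mono[OF _ bump_props(3)[OF tl]])
     then show ?case by (simp only: mult.left_commute)
    qed
   qed (auto intro!: i cs FHd)
   then show ?thesis unfolding b_def by simp
  qed
  moreover have "0 <= b'" unfolding b'_def by (rule energy_defect_nonneg[OF cs(2)]) (rule bump_props(3)[OF tl])
  moreover then have "B * c CARD('n) \<gamma> * b' <= lam * b'" by (rule mult_right_mono[OF lam(3)])
  moreover have "0 <= a'" unfolding a'_def by (rule energy_defect_nonneg[OF cw]) simp
  then have "0 <= 2 / \<tau> * a'" using tau by simp
  ultimately have "2 / \<tau> * a <= 2 / \<tau> * 0" by linarith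
  then have "a <= 0" by (rule mult_left_le_imp_le) (use tau in simp)
  then show "(LINT z|spacetime T. ?w (fst z) * F K z) <= 0" by (simp only: a_def)
 qed
 then show ?thesis using key by eventually_elim blast
qed

end

theorem theorem7p3:
  fixes \<gamma> T :: real and variant :: lf_variant and c :: "nat \<Rightarrow> real \<Rightarrow> real"
    and \<rho>0 E0 :: "real^'n \<Rightarrow> real" and m0 :: "real^'n \<Rightarrow> real^'n"
    and Uh :: "real \<Rightarrow> real \<Rightarrow> 'n cell \<Rightarrow> 'n state"
    and V :: "real \<Rightarrow> real^'n \<Rightarrow> 'n state measure"
    and \<rho> E :: "real \<Rightarrow> real^'n \<Rightarrow> real" and m :: "real \<Rightarrow> real^'n \<Rightarrow> real^'n"
  assumes "\<gamma> > 1" and "CARD('n) \<in> {1, 2, 3}" and "T > 0"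
    and "C1_torus \<rho>0" and "\<And>x. \<rho>0 x > 0" and "C1_torus m0" and "C1_torus E0"
    and "\<And>x. pressure \<gamma> (\<rho>0 x, m0 x, E0 x) > 0"
    and scheme: "\<And>h. h \<in> mesh_sizes \<Longrightarrow> lax_friedrichs_solution variant \<gamma> T h \<rho>0 m0 E0 (Uh h)"
    and young: "generates_young_measure T h_to_0 (approx Uh) V"
    and dmv: "dmv_solution c \<gamma> T
                (\<lambda>x. return (restrict_space borel state_space) (\<rho>0 x, m0 x, E0 x)) V"
    and strong: "strong_solution \<gamma> T \<rho>0 m0 E0 \<rho> m E"
    and unique: "\<And>\<rho>' m' E'. strong_solution \<gamma> T \<rho>0 m0 E0 \<rho>' m' E' \<Longrightarrow>
                   \<forall>t\<in>{0..T}. \<forall>x. \<rho>' t x = \<rho> t x \<and> m' t x = m t x \<and> E' t x = E t x"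
  shows "strongly_L1 T h_to_0 (approx Uh) (\<lambda>t x. (\<rho> t x, m t x, E t x)) \<and>
         weak_star_Linf_Lp T \<gamma> h_to_0 (\<lambda>h t x. dens (approx Uh h t x)) \<rho> \<and>
         strongly_L1 T h_to_0 (\<lambda>h t x. dens (approx Uh h t x)) \<rho> \<and>
         weak_star_Linf_Lp T (2 * \<gamma> / (\<gamma> + 1)) h_to_0 (\<lambda>h t x. mom (approx Uh h t x)) m \<and>
         strongly_L1 T h_to_0 (\<lambda>h t x. mom (approx Uh h t x)) m \<and>
         weak_star_Linf_L1 T h_to_0 (\<lambda>h t x. ener (approx Uh h t x)) E \<and>
         strongly_L1 T h_to_0 (\<lambda>h t x. ener (approx Uh h t x)) E"
proof -
 interpret dissipative_euler \<gamma> T \<rho>0 m0 E0 \<rho> E m c V by unfold_locales (fact assms)+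
 let ?W = "%t x. (\<rho> t x, m t x, E t x)"
 let ?Et = "LINT x|\<Omega>. E0 x"
 have c0: "continuous_on UNIV \<rho>0" "continuous_on UNIV m0" "continuous_on UNIV E0" using assms(4,6,7) by (auto intro: C1_torus_continuous)
 obtain \<kappa> \<delta> where k: "\<kappa> > 0" "\<delta> > 0" "!!x. x : torus ==> \<delta> <= \<rho>0 x"
  "!!x. x : torus ==> \<kappa> <= entropy_fun \<gamma> (\<rho>0 x, m0 x, E0 x)" using initial_entropy_bound[OF assms(1) c0 assms(5,8)] by blast
 note bounds = scheme_uniform_bounds[OF assms(1,3) c0 k _ _ scheme]
 have cW: "continuous_on (strip T) (%(t, x). \<rho> t x)" "continuous_on (strip T) (%(t, x). m t x)"
   "continuous_on (strip T) (%(t, x). E t x)" by (intro C1_on_continuous_on C1_basic)+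
 have weak: "weakly_L1 T h_to_0 (%h t x. g (approx Uh h t x)) (%t x. g (?W t x))" if g: "g : Cc_states" for g
 proof -
  have y: "weakly_L1 T h_to_0 (%h t x. g (approx Uh h t x)) (%t x. expect (V t x) g)" using young g by (simp add: generates_young_measure_def)
  have cg: "continuous_on state_space g" using g by (simp add: Cc_states_def)
  have "continuous_on (strip T) (%z. g (?W (fst z) (snd z)))"
  proof (rule continuous_on_compose2[OF cg])
   show "continuous_on (strip T) (%z. ?W (fst z) (snd z))" using cW by (intro continuous_on_Pair) (simp_all add: case_prod_beta')
   show "(%z. ?W (fst z) (snd z)) ` (strip T) \<subseteq> state_space" using rpos E_pos by (auto simp: state_space_def dens_def ener_def less_imp_le)
  qed
  then have iW: "integrable (spacetime T) (%z. g (?W (fst z) (snd z)))" by (rule bounded_integrable_spacetime)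
  have sp: "AE z in spacetime T. z : {0<..<T} \<times> (torus :: (real^'n) set)" by (rule AE_I2) (simp add: space_spacetime)
  have ae: "AE z in spacetime T. expect (V (fst z) (snd z)) g = g (?W (fst z) (snd z))" using young_measure_is_Dirac sp
  proof eventually_elim
   case (elim z)
   interpret prob_space "V (fst z) (snd z)" by (rule V_prob(1)[OF elim(2)])
   have "g : borel_measurable (restrict_space borel state_space)" by (rule borel_measurable_continuous_on_restrict[OF cg])
   then have gm: "g : borel_measurable (V (fst z) (snd z))" using V_prob(3)[OF elim(2)] by (simp cong: measurable_cong_sets)
   have "expect (V (fst z) (snd z)) g = (LINT U|V (fst z) (snd z). g (?W (fst z) (snd z)))"
    unfolding expect_def by (rule integral_cong_AE[OF gm]) (use elim(1) in \<open>auto elim!: eventually_mono\<close>)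
   then show ?case by (simp add: prob_space)
  qed
  have "integral_st T (%t x. expect (V t x) g * \<psi> t x) = integral_st T (%t x. g (?W t x) * \<psi> t x)" if "Linf_st T \<psi>" for \<psi>
   unfolding integral_st_def
  proof (rule integral_cong_AE)
   have p: "(%z. \<psi> (fst z) (snd z)) : borel_measurable (spacetime T)" using that by (simp add: Linf_st_def)
   have "(%z. expect (V (fst z) (snd z)) g) : borel_measurable (spacetime T)" using y by (auto simp: weakly_L1_def L1_st_def)
   then show "(%z. expect (V (fst z) (snd z)) g * \<psi> (fst z) (snd z)) : borel_measurable (spacetime T)" using p by simp
   show "(%z. g (?W (fst z) (snd z)) * \<psi> (fst z) (snd z)) : borel_measurable (spacetime T)"
    using p borel_measurable_integrable[OF iW] by (intro borel_measurable_times)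
   show "AE z in spacetime T. expect (V (fst z) (snd z)) g * \<psi> (fst z) (snd z) = g (?W (fst z) (snd z)) * \<psi> (fst z) (snd z)"
    using ae by eventually_elim simp
  qed
  then show ?thesis using y iW unfolding weakly_L1_def L1_st_def by simp
 qed
 have en: "integral_st T E = T * ?Et" using energy_conserved by (simp add: initial_fields)
 show ?thesis
 proof (rule strong_convergence_from_Dirac[OF assms(1,3) k(1) _ _ _ _ cW _ _ weak en])
  show "continuous_on {0..T} (%t. Uh h t K)" if "h : mesh_sizes" "K : cells h" for h K
   using scheme[OF that(1)] that(2) by (auto simp: lax_friedrichs_solution_def)
  show "0 < dens (Uh h t K)" "\<kappa> * dens (Uh h t K) powr \<gamma> <= internal_energy (Uh h t K)"
   if "h : mesh_sizes" "h <= 1 / 3" "t : {0..T}" "K : cells h" for h t K using bounds(1,2)[OF _ _ that(1,2,1,3,4)] k(3,4) by blast+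
  show "(LINT x|\<Omega>. ener (grid_fun h (Uh h t) x)) = ?Et" if "h : mesh_sizes" "h <= 1 / 3" "t : {0..T}" for h t
   using bounds(3)[OF _ _ that(1,2,1,3)] k(3,4) by blast
 qed (use rpos E_pos less_imp_le in blast)+
qed

end
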